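(* Let $n\geq 2$ and let $\mathcal F=(\mathbb D^n,\mathcal L,\{0\})$ be the singular holomorphic foliation on the unit polydisc $\mathbb D^n\subset\mathbb C^n$ whose leaves are the integral curves in $\mathbb D^n\setminus\{0\}$ of the linear vector field $$\Phi(z)=\sum_{j=1}^n\lambda_j z_j\frac{\partial}{\partial z_j},\qquad z=(z_1,\ldots,z_n),$$ where all $\lambda_j$ are nonzero complex numbers and there are some $1\leq l\neq k\leq n$ with $\lambda_k/\lambda_l\notin\mathbb R$. Let $T$ be a positive harmonic current directed by $\mathcal F$ which does not give mass to any of the $n$ coordinate invariant hyperplanes $\{z_j=0\}$, $1\leq j\leq n$. Then the Lelong number $\nu(T,0)$ of $T$ at the origin vanishes.
   Context: A singular holomorphic foliation by curves $\mathcal F=(X,\mathcal L,E)$ on a complex manifold $X$ of dimension $n$ consists of a closed set $E\subset X$ (the set of singularities) with $\overline{X\setminus E}=X$ and a holomorphic foliation of $X\setminus E$ by Riemann surfaces: it is given by flow boxes $\mathbb U\simeq\mathbb B\times\mathbb T$ (biholomorphically) with $\mathbb B\subset\mathbb C$, $\mathbb T\subset\mathbb C^{n-1}$ domains and with coordinate changes of the form $(y,t)\mapsto(\Psi(y,t),\Lambda(t))$. Plaques are the sets $\{t=\mathrm{const}\}$, and leaves are the minimal connected sets containing every plaque they meet. Let $\mathcal D^{p,q}(\mathcal F)$, $0\leq p,q\leq 1$, be the space of leafwise $(p,q)$-forms with compact support in $X\setminus E$ which are smooth on plaques and whose coefficients, together with all their leafwise derivatives, depend continuously on the plaque, with its natural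 topology. A directed current $T$ of bidimension $(1,1)$ is a continuous linear form on $\mathcal D^{1,1}(\mathcal F)$. It is positive if $T(f)\geq0$ for all $f$ that are positive on each plaque, and harmonic if $T(dd^cf)=0$ for all $f\in\mathcal D^{0,0}(\mathcal F)$. A positive harmonic current directed by $\mathcal F$ defines, by restricting smooth $(1,1)$-forms compactly supported in $X\setminus E$ to the leaves, a positive $dd^c$-closed current of bidimension $(1,1)$ on $X\setminus E$, still denoted $T$. The mass of $T$ on a measurable set $A$ is the mass on $A\setminus E$ of the positive measure $T\wedge\beta$, where $\beta$ is a Hermitian form on $X$ (here the standard one on $\mathbb C^n$). The Lelong number of $T$ at a point $x\in E$ (computed in local coordinates $z$ centered at $x$) is $$\nu(T,x):=\limsup_{r\to0+}\frac1{\pi r^2}\int_{\mathbb B(x,r)\setminus E}T\wedge dd^c\|z\|^2\in[0,\infty],$$ where $\mathbb B(x,r)$ is the Euclidean ball of center $x$ and radius $r$; $dd^c$ is a fixed positive multiple of $i\partial\bar\partial$ (the normalization is immaterial for vanishing). *)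

theory Defs
  imports "HOL-Analysis.Analysis"
begin

section \<open>Foliations by curves on open subsets of $C^n$\<close>

text \<open>
  The ambient space $C^n$ is \<^typ>\<open>complex ^ 'n\<close> and the model of a flow box is
  \<^typ>\<open>complex \<times> (complex ^ 'm)\<close>, where the index type \<open>'m\<close> has $n - 1$ elements.
  Holomorphy in several variables is Frechet differentiability with complex linear derivative.
\<close>

definition holomorphic_flow_map ::
    "(complex ^ 'n \<Rightarrow> complex \<times> (complex ^ 'm)) \<Rightarrow> (complex ^ 'n) set \<Rightarrow> bool" where
  "holomorphic_flow_map \<phi> U \<longleftrightarrow>
     (\<forall>p\<in>U. \<exists>\<phi>'. (\<phi> has_derivative \<phi>') (at p) \<and>
        (\<forall>c v. \<phi>' (c *s v) = (c * fst (\<phi>' v), c *s snd (\<phi>' v))))"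

definition holomorphic_flow_param ::
    "(complex \<times> (complex ^ 'm) \<Rightarrow> complex ^ 'n) \<Rightarrow> (complex \<times> (complex ^ 'm)) set \<Rightarrow> bool" where
  "holomorphic_flow_param \<psi> W \<longleftrightarrow>
     (\<forall>w\<in>W. \<exists>\<psi>'. (\<psi> has_derivative \<psi>') (at w) \<and>
        (\<forall>c y t. \<psi>' (c * y, c *s t) = c *s \<psi>' (y, t)))"

text \<open>A chart is a pair (domain, coordinate map); coordinates are written $(y,t)$.\<close>

type_synonym ('n, 'm) chart =
  "(complex, 'n) vec set \<times> ((complex, 'n) vec \<Rightarrow> complex \<times> (complex, 'm) vec)"

definition chart_inv :: "('n::finite, 'm::finite) chart \<Rightarrow> complex \<times> (complex ^ 'm) \<Rightarrow> complex ^ 'n" where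
  "chart_inv u = the_inv_into (fst u) (snd u)"

definition flow_box :: "('n::finite, 'm::finite) chart \<Rightarrow> bool" where
  "flow_box u \<longleftrightarrow> open (fst u) \<and> inj_on (snd u) (fst u) \<and>
     (\<exists>B S. open B \<and> connected B \<and> B \<noteq> {} \<and> open S \<and> connected S \<and> S \<noteq> {} \<and>
        snd u ` fst u = B \<times> S) \<and>
     holomorphic_flow_map (snd u) (fst u) \<and>
     holomorphic_flow_param (chart_inv u) (snd u ` fst u)"

text \<open>
  The coordinate changes have the form $(y,t) \mapsto (\Psi(y,t),\Lambda(t))$ near every point of
  the overlap; when the overlap is disconnected, $\Lambda$ may depend on the part considered.
\<close>

definition compatible_charts ::
    "('n::finite, 'm::finite) chart \<Rightarrow> ('n, 'm) chart \<Rightarrow> bool" where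
  "compatible_charts u v \<longleftrightarrow>
     (\<forall>p \<in> fst u \<inter> fst v. \<exists>W \<Lambda>. open W \<and> p \<in> W \<and> W \<subseteq> fst u \<inter> fst v \<and>
        (\<forall>q\<in>W. snd (snd v q) = \<Lambda> (snd (snd u q))))"

definition singular_foliation ::
    "(complex ^ 'n) set \<Rightarrow> ('n::finite, 'm::finite) chart set \<Rightarrow> (complex ^ 'n) set \<Rightarrow> bool" where
  "singular_foliation X L E \<longleftrightarrow>
     open X \<and> closedin (top_of_set X) E \<and> X \<subseteq> closure (X - E) \<and>
     (\<forall>u\<in>L. flow_box u) \<and> (\<Union>u\<in>L. fst u) = X - E \<and>
     (\<forall>u\<in>L. \<forall>v\<in>L. compatible_charts u v)"

definition plaques :: "('n::finite, 'm::finite) chart set \<Rightarrow> (complex ^ 'n) set set" where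
  "plaques L = {{p \<in> fst u. snd (snd u p) = t} | u t. u \<in> L \<and> t \<in> (snd \<circ> snd u) ` fst u}"

definition connected_saturated ::
    "(complex ^ 'n) set \<Rightarrow> ('n::finite, 'm::finite) chart set \<Rightarrow> (complex ^ 'n) set \<Rightarrow>
     (complex ^ 'n) set \<Rightarrow> bool" where
  "connected_saturated X L E A \<longleftrightarrow> A \<noteq> {} \<and> A \<subseteq> X - E \<and> connected A \<and>
     (\<forall>P \<in> plaques L. P \<inter> A \<noteq> {} \<longrightarrow> P \<subseteq> A)"

definition leaves ::
    "(complex ^ 'n) set \<Rightarrow> ('n::finite, 'm::finite) chart set \<Rightarrow> (complex ^ 'n) set \<Rightarrow>
     (complex ^ 'n) set set" where
  "leaves X L E = {A. connected_saturated X L E A \<and>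
     (\<forall>A'. connected_saturated X L E A' \<and> A' \<subseteq> A \<longrightarrow> A' = A)}"


section \<open>Integral curves of a holomorphic vector field\<close>

definition integral_curve_images ::
    "(complex ^ 'n \<Rightarrow> complex ^ 'n) \<Rightarrow> (complex ^ 'n) set \<Rightarrow> (complex ^ 'n) set set" where
  "integral_curve_images \<Phi> Y =
     {\<gamma> ` \<Omega> | \<gamma> \<Omega>. open \<Omega> \<and> connected \<Omega> \<and> \<Omega> \<noteq> {} \<and> \<gamma> ` \<Omega> \<subseteq> Y \<and>
        (\<forall>\<zeta>\<in>\<Omega>. \<forall>j. ((\<lambda>\<xi>. \<gamma> \<xi> $ j) has_field_derivative \<Phi> (\<gamma> \<zeta>) $ j) (at \<zeta>))}"

text \<open>Integral curves as subsets of \<open>Y\<close>, i.e. images of maximal complex-time solutions.\<close>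

definition integral_curves ::
    "(complex ^ 'n \<Rightarrow> complex ^ 'n) \<Rightarrow> (complex ^ 'n) set \<Rightarrow> (complex ^ 'n) set set" where
  "integral_curves \<Phi> Y = {C \<in> integral_curve_images \<Phi> Y.
     \<forall>C' \<in> integral_curve_images \<Phi> Y. C \<subseteq> C' \<longrightarrow> C' = C}"


section \<open>Leafwise forms\<close>

text \<open>
  \<open>plaque_param u p\<close> parametrises the plaque of \<open>u\<close> through \<open>p\<close> by the coordinate $y$;
  the point \<open>p\<close> itself is the value at \<open>fst (snd u p)\<close>.
\<close>

definition plaque_param ::
    "('n::finite, 'm::finite) chart \<Rightarrow> complex ^ 'n \<Rightarrow> complex \<Rightarrow> complex ^ 'n" where
  "plaque_param u p \<eta> = chart_inv u (\<eta>, snd (snd u p))"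

definition plaque_line ::
    "('n::finite, 'm::finite) chart \<Rightarrow> complex \<Rightarrow> complex ^ 'n \<Rightarrow> real \<Rightarrow> complex ^ 'n" where
  "plaque_line u d p s = plaque_param u p (fst (snd u p) + of_real s * d)"

text \<open>With \<open>d = 1\<close> and \<open>d = \<i>\<close> these are the partial derivatives in $Re\, y$ and $Im\, y$.\<close>

definition leaf_deriv ::
    "('n::finite, 'm::finite) chart \<Rightarrow> complex \<Rightarrow> (complex ^ 'n \<Rightarrow> complex) \<Rightarrow>
     complex ^ 'n \<Rightarrow> complex" where
  "leaf_deriv u d g p = vector_derivative (g \<circ> plaque_line u d p) (at 0)"

definition leaf_derivs ::
    "('n::finite, 'm::finite) chart \<Rightarrow> complex list \<Rightarrow> (complex ^ 'n \<Rightarrow> complex) \<Rightarrow>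
     complex ^ 'n \<Rightarrow> complex" where
  "leaf_derivs u ds g = fold (leaf_deriv u) ds g"

text \<open>
  Smooth on plaques, with all leafwise derivatives continuous in $(y,t)$.
\<close>

definition leafwise_smooth ::
    "('n::finite, 'm::finite) chart \<Rightarrow> (complex ^ 'n \<Rightarrow> complex) \<Rightarrow> bool" where
  "leafwise_smooth u g \<longleftrightarrow>
     (\<forall>ds. set ds \<subseteq> {1, \<i>} \<longrightarrow>
        continuous_on (fst u) (leaf_derivs u ds g) \<and>
        (\<forall>d\<in>{1, \<i>}. \<forall>p\<in>fst u. (leaf_derivs u ds g \<circ> plaque_line u d p) differentiable (at 0)))"

text \<open>
  Elements of $\mathcal D^{0,0}$ are functions, extended by zero. An element of
  $\mathcal D^{1,1}$ is the family of its coefficients \<open>h u\<close> with respect to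
  $i\,dy\wedge d\bar y$ in the charts \<open>u\<close>, extended by zero; the coefficients transform by
  $|\partial y_v/\partial y_u|^2$. The sets below consist of the forms supported in \<open>K\<close>.
\<close>

type_synonym ('n, 'm) leaf_form = "('n, 'm) chart \<Rightarrow> (complex, 'n) vec \<Rightarrow> complex"

definition test_functions_on ::
    "('n::finite, 'm::finite) chart set \<Rightarrow> (complex ^ 'n) set \<Rightarrow> (complex ^ 'n \<Rightarrow> complex) set" where
  "test_functions_on L K = {f. (\<forall>u\<in>L. leafwise_smooth u f) \<and> (\<forall>p. p \<notin> K \<longrightarrow> f p = 0)}"

definition transition_deriv ::
    "('n::finite, 'm::finite) chart \<Rightarrow> ('n, 'm) chart \<Rightarrow> complex ^ 'n \<Rightarrow> complex" where
  "transition_deriv u v p = deriv (\<lambda>\<eta>. fst (snd v (plaque_param u p \<eta>))) (fst (snd u p))"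

definition test_forms_on ::
    "('n::finite, 'm::finite) chart set \<Rightarrow> (complex ^ 'n) set \<Rightarrow> ('n, 'm) leaf_form set" where
  "test_forms_on L K = {h. (\<forall>u\<in>L. leafwise_smooth u (h u)) \<and>
     (\<forall>u\<in>L. \<forall>v\<in>L. \<forall>p \<in> fst u \<inter> fst v.
        h u p = of_real ((cmod (transition_deriv u v p))\<^sup>2) * h v p) \<and>
     (\<forall>u p. u \<notin> L \<or> p \<notin> fst u \<or> p \<notin> K \<longrightarrow> h u p = 0)}"

definition test_functions ::
    "(complex ^ 'n) set \<Rightarrow> ('n::finite, 'm::finite) chart set \<Rightarrow> (complex ^ 'n) set \<Rightarrow>
     (complex ^ 'n \<Rightarrow> complex) set" where
  "test_functions X L E = (\<Union>K\<in>{K. compact K \<and> K \<subseteq> X - E}. test_functions_on L K)"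

definition test_forms ::
    "(complex ^ 'n) set \<Rightarrow> ('n::finite, 'm::finite) chart set \<Rightarrow> (complex ^ 'n) set \<Rightarrow>
     ('n, 'm) leaf_form set" where
  "test_forms X L E = (\<Union>K\<in>{K. compact K \<and> K \<subseteq> X - E}. test_forms_on L K)"

text \<open>
  Normalisation: $dd^c = i\partial\bar\partial$, so the coefficient of $dd^c f$ is
  $\partial^2 f/\partial y\,\partial\bar y$, a quarter of the leafwise Laplacian.
\<close>

definition leaf_ddc ::
    "('n::finite, 'm::finite) chart set \<Rightarrow> (complex ^ 'n \<Rightarrow> complex) \<Rightarrow> ('n, 'm) leaf_form" where
  "leaf_ddc L f u p =
     (if u \<in> L \<and> p \<in> fst u
      then (leaf_derivs u [1, 1] f p + leaf_derivs u [\<i>, \<i>] f p) / 4 else 0)"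


section \<open>Directed currents\<close>

text \<open>
  The natural topology is the inductive limit, over the compact sets \<open>K\<close>, of the spaces of forms
  supported in \<open>K\<close>, each topologised by the seminorms $\sup_A |D h_u|$ with \<open>A\<close> a compact subset
  of the domain of a chart \<open>u\<close> and $D$ a leafwise derivative. A linear form is continuous iff on
  every such space it is bounded by a multiple of the maximum of finitely many seminorms.
\<close>

definition continuous_on_test_forms ::
    "(complex ^ 'n) set \<Rightarrow> ('n::finite, 'm::finite) chart set \<Rightarrow> (complex ^ 'n) set \<Rightarrow>
     (('n, 'm) leaf_form \<Rightarrow> complex) \<Rightarrow> bool" where
  "continuous_on_test_forms X L E T \<longleftrightarrow>
     (\<forall>K. compact K \<and> K \<subseteq> X - E \<longrightarrow>
        (\<exists>C I. finite I \<and>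
           (\<forall>(u, A, ds)\<in>I. u \<in> L \<and> compact A \<and> A \<subseteq> fst u \<and> set ds \<subseteq> {1, \<i>}) \<and>
           (\<forall>h \<in> test_forms_on L K. \<forall>M\<ge>0.
              (\<forall>(u, A, ds)\<in>I. \<forall>p\<in>A. cmod (leaf_derivs u ds (h u) p) \<le> M) \<longrightarrow>
              cmod (T h) \<le> C * M)))"

definition directed_current ::
    "(complex ^ 'n) set \<Rightarrow> ('n::finite, 'm::finite) chart set \<Rightarrow> (complex ^ 'n) set \<Rightarrow>
     (('n, 'm) leaf_form \<Rightarrow> complex) \<Rightarrow> bool" where
  "directed_current X L E T \<longleftrightarrow>
     (\<forall>g \<in> test_forms X L E. \<forall>h \<in> test_forms X L E. T (\<lambda>u p. g u p + h u p) = T g + T h) \<and>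
     (\<forall>c. \<forall>h \<in> test_forms X L E. T (\<lambda>u p. c * h u p) = c * T h) \<and>
     continuous_on_test_forms X L E T"

definition positive_current ::
    "(complex ^ 'n) set \<Rightarrow> ('n::finite, 'm::finite) chart set \<Rightarrow> (complex ^ 'n) set \<Rightarrow>
     (('n, 'm) leaf_form \<Rightarrow> complex) \<Rightarrow> bool" where
  "positive_current X L E T \<longleftrightarrow>
     (\<forall>h \<in> test_forms X L E.
        (\<forall>u\<in>L. \<forall>p\<in>fst u. h u p \<in> \<real>\<^sub>\<ge>\<^sub>0) \<longrightarrow> T h \<in> \<real>\<^sub>\<ge>\<^sub>0)"

definition harmonic_current ::
    "(complex ^ 'n) set \<Rightarrow> ('n::finite, 'm::finite) chart set \<Rightarrow> (complex ^ 'n) set \<Rightarrow>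
     (('n, 'm) leaf_form \<Rightarrow> complex) \<Rightarrow> bool" where
  "harmonic_current X L E T \<longleftrightarrow> (\<forall>f \<in> test_functions X L E. T (leaf_ddc L f) = 0)"

definition positive_harmonic_directed_current ::
    "(complex ^ 'n) set \<Rightarrow> ('n::finite, 'm::finite) chart set \<Rightarrow> (complex ^ 'n) set \<Rightarrow>
     (('n, 'm) leaf_form \<Rightarrow> complex) \<Rightarrow> bool" where
  "positive_harmonic_directed_current X L E T \<longleftrightarrow>
     directed_current X L E T \<and> positive_current X L E T \<and> harmonic_current X L E T"


section \<open>Mass and Lelong number\<close>

text \<open>
  A $(1,1)$-form $\sum_{j,k}\beta_{jk}\, i\,dz_j\wedge d\bar z_k$ on $C^n$ is given by its
  coefficient matrix; \<open>leaf_restrict L f \<beta>\<close> is the restriction of $f\beta$ to the leaves.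
\<close>

definition leaf_restrict ::
    "('n::finite, 'm::finite) chart set \<Rightarrow> (complex ^ 'n \<Rightarrow> complex) \<Rightarrow>
     (complex ^ 'n \<Rightarrow> complex ^ 'n ^ 'n) \<Rightarrow> ('n, 'm) leaf_form" where
  "leaf_restrict L f \<beta> u p =
     (if u \<in> L \<and> p \<in> fst u
      then let z' = (\<lambda>j. deriv (\<lambda>\<eta>. plaque_param u p \<eta> $ j) (fst (snd u p)))
           in f p * (\<Sum>j\<in>UNIV. \<Sum>k\<in>UNIV. \<beta> p $ j $ k * z' j * cnj (z' k))
      else 0)"

text \<open>
  $T\wedge\beta$ is the Radon measure on $X\setminus E$, extended by zero to $C^n$, that
  represents the positive functional $f\mapsto T(f\beta)$.
\<close>

definition wedge_measure ::
    "(complex ^ 'n) set \<Rightarrow> ('n::finite, 'm::finite) chart set \<Rightarrow> (complex ^ 'n) set \<Rightarrow>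
     (('n, 'm) leaf_form \<Rightarrow> complex) \<Rightarrow> (complex ^ 'n \<Rightarrow> complex ^ 'n ^ 'n) \<Rightarrow>
     (complex ^ 'n) measure" where
  "wedge_measure X L E T \<beta> = (THE \<mu>. sets \<mu> = sets borel \<and> emeasure \<mu> (- (X - E)) = 0 \<and>
     (\<forall>K. compact K \<and> K \<subseteq> X - E \<longrightarrow> emeasure \<mu> K < \<infinity>) \<and>
     (\<forall>f \<in> test_functions X L E. T (leaf_restrict L f \<beta>) = (\<integral>p. f p \<partial>\<mu>)))"

text \<open>The standard Hermitian form $i\sum_j dz_j\wedge d\bar z_j$.\<close>

definition std_hermitian :: "complex ^ 'n \<Rightarrow> complex ^ 'n ^ 'n" where
  "std_hermitian p = mat 1"

definition current_mass ::
    "(complex ^ 'n) set \<Rightarrow> ('n::finite, 'm::finite) chart set \<Rightarrow> (complex ^ 'n) set \<Rightarrow>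
     (('n, 'm) leaf_form \<Rightarrow> complex) \<Rightarrow> (complex ^ 'n) set \<Rightarrow> ennreal" where
  "current_mass X L E T A = emeasure (wedge_measure X L E T std_hermitian) (A - E)"

definition dir_deriv :: "complex ^ 'n \<Rightarrow> (complex ^ 'n \<Rightarrow> complex) \<Rightarrow> complex ^ 'n \<Rightarrow> complex" where
  "dir_deriv v g p = vector_derivative (\<lambda>s. g (p + s *\<^sub>R v)) (at 0)"

definition d_dz :: "'n \<Rightarrow> (complex ^ 'n \<Rightarrow> complex) \<Rightarrow> complex ^ 'n \<Rightarrow> complex" where
  "d_dz j g p = (dir_deriv (axis j 1) g p - \<i> * dir_deriv (axis j \<i>) g p) / 2"

definition d_dzbar :: "'n \<Rightarrow> (complex ^ 'n \<Rightarrow> complex) \<Rightarrow> complex ^ 'n \<Rightarrow> complex" where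
  "d_dzbar j g p = (dir_deriv (axis j 1) g p + \<i> * dir_deriv (axis j \<i>) g p) / 2"

text \<open>Coefficient matrix of $dd^c\rho = i\partial\bar\partial\rho$, as for \<open>leaf_ddc\<close>.\<close>

definition ddc :: "(complex ^ 'n \<Rightarrow> complex) \<Rightarrow> complex ^ 'n \<Rightarrow> complex ^ 'n ^ 'n" where
  "ddc \<rho> p = (\<chi> j k. d_dz j (d_dzbar k \<rho>) p)"

definition lelong_number ::
    "(complex ^ 'n) set \<Rightarrow> ('n::finite, 'm::finite) chart set \<Rightarrow> (complex ^ 'n) set \<Rightarrow>
     (('n, 'm) leaf_form \<Rightarrow> complex) \<Rightarrow> complex ^ 'n \<Rightarrow> ennreal" where
  "lelong_number X L E T x =
     Limsup (at_right 0)
       (\<lambda>r. emeasure (wedge_measure X L E T (ddc (\<lambda>z. of_real ((norm (z - x))\<^sup>2)))) (ball x r - E)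
            / ennreal (pi * r\<^sup>2))"


section \<open>The linear model\<close>

definition polydisc :: "(complex ^ 'n) set" where
  "polydisc = {z. \<forall>j. cmod (z $ j) < 1}"

definition linear_field :: "complex ^ 'n \<Rightarrow> complex ^ 'n \<Rightarrow> complex ^ 'n" where
  "linear_field lam z = (\<chi> j. lam $ j * z $ j)"

end

theory Submission
  imports Defs "HOL-Complex_Analysis.Cauchy_Integral_Formula"
begin

text \<open>
  Let $\zeta$ be the flow time of $\Phi$ on the leaves. By the Riesz representation theorem,
  $T\wedge i\,d\zeta\wedge d\bar\zeta$ is a positive measure on $D^n\setminus\{0\}$ (with
  $D^n$ the polydisc) which is annihilated by the leafwise Laplacians of test functions, and
  $T\wedge\beta$ is its product with $|\Phi|^2$, up to a constant.

  In the logarithmic coordinates $x=-\ln|z_k|$, $y=-\ln|z_l|$, which are real linear in $\zeta$ and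
  independent because $\lambda_k/\lambda_l\notin\mathbf{R}$, a leaf is part of a sector
  of angle less than $\pi$. Hence for some $a\in(1/2,1]$ the function $(xy)^{-a}$ and its Kelvin
  transform $(xy)^{-a}|\zeta|^{4a}$ are reciprocals of positive superharmonic functions. So is
  $1/F_0$ with $F_0=c-\frac12\ln(|z|^2+e^{-2R})$, and the class is stable under addition:
  \[ F=\Bigl(1/F_0+R^{2a-1}(xy)^{-a}\bigl(1+(|\zeta|/X)^{4a}\bigr)\Bigr)^{-1} \]
  is superharmonic, with Laplacian comparable to $-|\Phi|^2e^{2R}$ on $|z|\le e^{-R}$, $|\zeta|\le X$.
  Testing against cut-offs of $F$ bounds $e^{2R}$ times the mass of that set by the integral of
  $F\le\min(C,R^{1-2a}(xy)^a)$ over a shell near the boundary of the polydisc; the error from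
  large $x,y$ vanishes because $F=O((x+y)^{-2a})$ there and the measure of the part of the
  polydisc with $x,y\le S$ is $O(S^2)$. This integral tends to $0$ as $R\to\infty$ by
  dominated convergence.
\<close>

section \<open>A flat smooth function\<close>

text \<open>The natural potential is the minimum of three positive superharmonic functions, but test
  functions must be smooth. The reciprocal of the sum of the reciprocals is a smooth substitute,
  comparable to the minimum.

  Each function has its own task. F_0 creates the negative Laplacian near the origin and is O(R).
  The weight R^(2a-1) of the second reciprocal is the largest power of R that keeps it at most 1/R
  where x, y >= R, so it does not spoil this Laplacian; on the shell it forces F to 0. The Kelvin
  transform gives decay along the leaves: a cut-off at scale S has derivatives O(1/S), so a merely
  bounded F would leave an error O(S), while the decay leaves O(S^(1-2a)). The truncation X keeps
  the third reciprocal below the second for |zeta| <= X and disappears in the end by monotone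
  convergence.

  The exponent is a = 1/(1+rho), with rho the modulus of the cosine of the angle between the
  gradients of x and y. The nonreal ratio means rho < 1, that is a > 1/2, as both limits R ->
  infinity and S -> infinity require.

  Since x, y exist only off two hyperplanes, the mass hypothesis is what leads to full
  balls.\<close>

definition smooth_real_on :: "real set \<Rightarrow> (real \<Rightarrow> real) \<Rightarrow> bool" where
  "smooth_real_on I h \<longleftrightarrow>
     (\<exists>H. H 0 = h \<and> (\<forall>n. \<forall>x\<in>I. (H n has_real_derivative H (Suc n) x) (at x)))"

lemma smooth_real_on_derivE:
  assumes "smooth_real_on I h"
  obtains h' where "\<And>x. x \<in> I \<Longrightarrow> (h has_real_derivative h' x) (at x)" "smooth_real_on I h'"
proof -
  obtain H where H: "H 0 = h" "\<forall>n. \<forall>x\<in>I. (H n has_real_derivative H (Suc n) x) (at x)"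
    using assms unfolding smooth_real_on_def by blast
  show thesis
  proof (rule that[of "H 1"])
    show "(h has_real_derivative H 1 x) (at x)" if "x \<in> I" for x
      using H that by (metis One_nat_def)
    show "smooth_real_on I (H 1)"
      unfolding smooth_real_on_def by (rule exI[of _ "\<lambda>n. H (Suc n)"]) (use H in auto)
  qed
qed

lemma smooth_real_on_antideriv:
  assumes "smooth_real_on I h'" "\<And>x. x \<in> I \<Longrightarrow> (h has_real_derivative h' x) (at x)"
  shows "smooth_real_on I h"
proof -
  obtain H where H: "H 0 = h'" "\<forall>n. \<forall>x\<in>I. (H n has_real_derivative H (Suc n) x) (at x)"
    using assms(1) unfolding smooth_real_on_def by blast
  show ?thesis
    unfolding smooth_real_on_def
    by (rule exI[of _ "\<lambda>n. case n of 0 \<Rightarrow> h | Suc k \<Rightarrow> H k"])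
       (use H assms(2) in \<open>auto split: nat.split\<close>)
qed

lemma smooth_real_on_powr: "smooth_real_on {0<..} (\<lambda>x. c * x powr a)"
proof -
  define H where "H n x = c * (\<Prod>i<n. a - real i) * x powr (a - real n)" for n x
  have "(H n has_real_derivative H (Suc n) x) (at x)" if "x > 0" for n x
  proof -
    have "((\<lambda>x. c * (\<Prod>i<n. a - real i) * x powr (a - real n)) has_real_derivative
        (c * (\<Prod>i<n. a - real i) * ((a - real n) * x powr (a - real n - 1)))) (at x)"
      using that by (auto intro!: derivative_eq_intros)
    moreover have "a - real n - 1 = a - real (Suc n)" by simp
    ultimately show ?thesis
      unfolding H_def by (simp add: mult_ac H_def[abs_def])
  qed
  moreover have "H 0 = (\<lambda>x. c * x powr a)" by (auto simp: H_def)
  ultimately show ?thesis unfolding smooth_real_on_def by blast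
qed

lemma smooth_real_on_ln: "smooth_real_on {0<..} ln"
proof (rule smooth_real_on_antideriv)
  show "smooth_real_on {0<..} (\<lambda>x. 1 * x powr (-1))" by (rule smooth_real_on_powr)
  show "(ln has_real_derivative 1 * x powr (-1)) (at x)" if "x \<in> {0<..}" for x :: real
    using that by (auto intro!: derivative_eq_intros simp: powr_minus_divide)
qed

lemma smooth_real_on_cong:
  assumes "smooth_real_on I h" "open I" "\<And>x. x \<in> I \<Longrightarrow> h x = g x"
  shows "smooth_real_on I g"
proof -
  obtain h' where h': "\<And>x. x \<in> I \<Longrightarrow> (h has_real_derivative h' x) (at x)" "smooth_real_on I h'"
    using smooth_real_on_derivE[OF assms(1)] by metis
  show ?thesis
  proof (rule smooth_real_on_antideriv[OF h'(2)])
    fix x assume x: "x \<in> I"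
    show "(g has_real_derivative h' x) (at x)"
      using has_field_derivative_transform_within_open[OF h'(1)[OF x] assms(2) x] assms(3) by blast
  qed
qed

lemma smooth_real_on_inverse: "smooth_real_on {0<..} inverse"
  by (rule smooth_real_on_cong[OF smooth_real_on_powr[of 1 "-1"]])
     (auto simp: powr_minus_divide inverse_eq_divide)

definition flat_fun :: "real \<Rightarrow> real" where
  "flat_fun x = (if x \<le> 0 then 0 else exp (- 1 / x))"

text \<open>Differentiating p(1/x) exp(-1/x) gives q(1/x) exp(-1/x) with q(t) = t^2 (p(t) - p'(t)),
  which is the recursion.\<close>

fun flat_poly :: "nat \<Rightarrow> real poly" where
  "flat_poly 0 = 1"
| "flat_poly (Suc n) = [:0, 0, 1:] * (flat_poly n - pderiv (flat_poly n))"

definition flat_deriv :: "nat \<Rightarrow> real \<Rightarrow> real" where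
  "flat_deriv n x = (if x \<le> 0 then 0 else poly (flat_poly n) (1 / x) * exp (- 1 / x))"

lemma poly_exp_tendsto_0: "((\<lambda>y. poly p y * exp (- y)) \<longlongrightarrow> 0) at_top" for p :: "real poly"
proof -
  have "((\<lambda>y. \<Sum>i\<le>degree p. coeff p i * (y ^ i / exp y)) \<longlongrightarrow> (\<Sum>i\<le>degree p. coeff p i * 0)) at_top"
    by (intro tendsto_intros tendsto_power_div_exp_0)
  moreover have "(\<Sum>i\<le>degree p. coeff p i * (y ^ i / exp y)) = poly p y * exp (- y)" for y
    by (simp add: poly_altdef exp_minus sum_distrib_right sum_distrib_left divide_inverse mult_ac)
  ultimately show ?thesis by simp
qed

text \<open>Only the point 0 is delicate: the right difference quotient there is a polynomial in 1/h
  times exp(-1/h), which tends to 0.\<close>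

lemma flat_deriv_has_derivative: "(flat_deriv n has_real_derivative flat_deriv (Suc n) x) (at x)"
proof -
  consider "x < 0" | "x = 0" | "x > 0" by linarith
  then show ?thesis
  proof cases
    case 1
    have "((\<lambda>_. 0) has_real_derivative 0) (at x)" by simp
    then have "(flat_deriv n has_real_derivative 0) (at x)"
      by (rule has_field_derivative_transform_within_open[where S = "{..<0}"])
         (use 1 in \<open>auto simp: flat_deriv_def\<close>)
    with 1 show ?thesis by (simp add: flat_deriv_def)
  next
    case 3
    have "((\<lambda>x. poly (flat_poly n) (1 / x) * exp (- 1 / x)) has_real_derivative
       (poly (pderiv (flat_poly n)) (1/x) * (- 1 / x^2) * exp (- 1 / x)
        + poly (flat_poly n) (1 / x) * (exp (- 1 / x) * (1 / x^2)))) (at x)"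
      using 3 by (auto intro!: derivative_eq_intros simp: power2_eq_square field_simps)
    moreover have "(poly (pderiv (flat_poly n)) (1/x) * (- 1 / x^2) * exp (- 1 / x)
        + poly (flat_poly n) (1 / x) * (exp (- 1 / x) * (1 / x^2))) = flat_deriv (Suc n) x"
      using 3 by (simp add: flat_deriv_def power2_eq_square field_simps)
    ultimately have "((\<lambda>x. poly (flat_poly n) (1 / x) * exp (- 1 / x)) has_real_derivative
        flat_deriv (Suc n) x) (at x)" by simp
    then show ?thesis
      by (rule has_field_derivative_transform_within_open[where S = "{0<..}"])
         (use 3 in \<open>auto simp: flat_deriv_def\<close>)
  next
    case 2
    have lim: "((\<lambda>h. flat_deriv n h / h) \<longlongrightarrow> 0) (at 0)"
    proof (rule filterlim_split_at)
      show "((\<lambda>h. flat_deriv n h / h) \<longlongrightarrow> 0) (at_left 0)"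
      proof (rule tendsto_eventually)
        show "\<forall>\<^sub>F h in at_left 0. flat_deriv n h / h = 0"
          by (auto simp: eventually_at_filter flat_deriv_def intro: always_eventually)
      qed
      have "((\<lambda>y. poly ([:0, 1:] * flat_poly n) y * exp (- y)) \<longlongrightarrow> 0) at_top"
        by (rule poly_exp_tendsto_0)
      then have "((\<lambda>h. poly ([:0, 1:] * flat_poly n) (inverse h) * exp (- inverse h)) \<longlongrightarrow> 0) (at_right 0)"
        by (rule filterlim_compose[OF _ filterlim_inverse_at_top_right])
      then show "((\<lambda>h. flat_deriv n h / h) \<longlongrightarrow> 0) (at_right 0)"
      proof (rule Lim_transform_eventually)
        show "\<forall>\<^sub>F h in at_right 0. poly ([:0, 1:] * flat_poly n) (inverse h) * exp (- inverse h) = flat_deriv n h / h"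
          by (auto simp: eventually_at_filter flat_deriv_def field_simps intro!: always_eventually)
      qed
    qed
    then show ?thesis
      using 2 by (simp add: has_field_derivative_iff flat_deriv_def)
  qed
qed

lemma flat_fun_eq_flat_deriv: "flat_fun = flat_deriv 0"
  by (auto simp: flat_fun_def flat_deriv_def)

lemma smooth_real_on_flat_fun: "smooth_real_on UNIV flat_fun"
  unfolding smooth_real_on_def flat_fun_eq_flat_deriv
  by (rule exI[of _ flat_deriv]) (auto intro: flat_deriv_has_derivative)

lemma flat_fun_pos: "x > 0 \<Longrightarrow> flat_fun x > 0"
  and flat_fun_zero: "x \<le> 0 \<Longrightarrow> flat_fun x = 0"
  and flat_fun_nonneg: "flat_fun x \<ge> 0"
  and flat_fun_less_1: "flat_fun x < 1"
  by (auto simp: flat_fun_def)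

lemma flat_fun_mono: "x \<le> y \<Longrightarrow> flat_fun x \<le> flat_fun y"
  by (auto simp: flat_fun_def field_simps)

section \<open>Leafwise smooth functions\<close>

lemma flow_boxD:
  assumes "flow_box u"
  shows "open (fst u)" "inj_on (snd u) (fst u)"
  using assms unfolding flow_box_def by auto

lemma flow_boxE:
  assumes "flow_box u"
  obtains B S where "open B" "connected B" "open S" "connected S" "snd u ` fst u = B \<times> S"
    "continuous_on (fst u) (snd u)" "continuous_on (B \<times> S) (chart_inv u)"
    "\<And>w. w \<in> B \<times> S \<Longrightarrow> \<exists>\<psi>'. (chart_inv u has_derivative \<psi>') (at w) \<and>
        (\<forall>c y t. \<psi>' (c * y, c *s t) = c *s \<psi>' (y, t))"
proof -
  obtain B S where BS: "open B" "connected B" "open S" "connected S" "snd u ` fst u = B \<times> S"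
    and m: "holomorphic_flow_map (snd u) (fst u)"
    and p: "holomorphic_flow_param (chart_inv u) (snd u ` fst u)"
    using assms unfolding flow_box_def by metis
  show thesis
  proof (rule that[OF BS])
    show "continuous_on (fst u) (snd u)"
      using m unfolding holomorphic_flow_map_def
      by (meson continuous_at_imp_continuous_on has_derivative_continuous)
    show "continuous_on (B \<times> S) (chart_inv u)"
      using p unfolding holomorphic_flow_param_def BS(5)
      by (meson continuous_at_imp_continuous_on has_derivative_continuous)
    show "\<exists>\<psi>'. (chart_inv u has_derivative \<psi>') (at w) \<and>
        (\<forall>c y t. \<psi>' (c * y, c *s t) = c *s \<psi>' (y, t))" if "w \<in> B \<times> S" for w
      using p that unfolding holomorphic_flow_param_def BS(5) by auto
  qed
qed

lemma chart_inv_snd: "flow_box u \<Longrightarrow> p \<in> fst u \<Longrightarrow> chart_inv u (snd u p) = p"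
  unfolding chart_inv_def by (simp add: flow_boxD the_inv_into_f_f)

lemma snd_chart_inv: "flow_box u \<Longrightarrow> w \<in> snd u ` fst u \<Longrightarrow> snd u (chart_inv u w) = w"
  unfolding chart_inv_def by (simp add: flow_boxD f_the_inv_into_f)

lemma chart_inv_in: "flow_box u \<Longrightarrow> w \<in> snd u ` fst u \<Longrightarrow> chart_inv u w \<in> fst u"
  unfolding chart_inv_def by (simp add: flow_boxD the_inv_into_into)

lemma plaque_line_0: "flow_box u \<Longrightarrow> p \<in> fst u \<Longrightarrow> plaque_line u d p 0 = p"
  by (simp add: plaque_line_def plaque_param_def chart_inv_snd)

lemma isCont_plaque_param:
  assumes "flow_box u" "p \<in> fst u" 
  shows "isCont (plaque_param u p) (fst (snd u p))"
proof -
  obtain B S where BS: "open B" "open S" "snd u ` fst u = B \<times> S" "continuous_on (B \<times> S) (chart_inv u)"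
    using flow_boxE[OF assms(1)] by metis
  have "snd u p \<in> B \<times> S" using BS(3) assms(2) by blast
  then have "isCont (chart_inv u) (snd u p)"
    by (rule bspec[OF BS(4)[unfolded continuous_on_eq_continuous_at[OF open_Times[OF BS(1,2)]]]])
  then have "isCont (chart_inv u) (fst (snd u p), snd (snd u p))" by simp
  then show ?thesis
    unfolding plaque_param_def[abs_def]
    by (rule isCont_o2[where f = "\<lambda>\<eta>. (\<eta>, snd (snd u p))" and g = "chart_inv u", rotated])
       (intro continuous_intros)
qed

text \<open>Outside the image of the chart \<open>chart_inv\<close> is unspecified, so facts about
  the parametrization are available only for parameters near that of p; openness of the first factor
  of the image makes them hold on a neighbourhood.\<close>

lemma eventually_plaque_param:
  assumes "flow_box u" "p \<in> fst u" "open O'" "p \<in> O'"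
  shows "eventually (\<lambda>\<eta>. plaque_param u p \<eta> \<in> O' \<and> plaque_param u p \<eta> \<in> fst u \<and>
           snd u (plaque_param u p \<eta>) = (\<eta>, snd (snd u p))) (nhds (fst (snd u p)))"
proof -
  obtain B S where BS: "open B" "open S" "snd u ` fst u = B \<times> S"
    using flow_boxE[OF assms(1)] by metis
  have *: "fst (snd u p) \<in> B" "snd (snd u p) \<in> S" using BS(3) assms(2)
    by (metis imageI mem_Times_iff)+
  have p: "plaque_param u p (fst (snd u p)) = p" by (simp add: plaque_param_def chart_inv_snd assms)
  have "(plaque_param u p \<longlongrightarrow> p) (nhds (fst (snd u p)))"
    using isCont_plaque_param[OF assms(1,2)] unfolding continuous_at p
    using p tendsto_nhds_iff by metis
  then have "eventually (\<lambda>\<eta>. plaque_param u p \<eta> \<in> O') (nhds (fst (snd u p)))"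
    using assms by (simp add: topological_tendstoD)
  moreover have "eventually (\<lambda>\<eta>. \<eta> \<in> B) (nhds (fst (snd u p)))"
    using BS * by (simp add: eventually_nhds_in_open)
  ultimately show ?thesis
  proof eventually_elim
    case (elim \<eta>)
    then have "(\<eta>, snd (snd u p)) \<in> snd u ` fst u" using BS * by auto
    with elim show ?case
      by (simp add: plaque_param_def chart_inv_in[OF assms(1)] snd_chart_inv[OF assms(1)])
  qed
qed

lemma eventually_plaque_line:
  assumes "flow_box u" "p \<in> fst u" "open O'" "p \<in> O'"
  shows "eventually (\<lambda>s. plaque_line u d p s \<in> O' \<and> plaque_line u d p s \<in> fst u \<and>
           snd u (plaque_line u d p s) = (fst (snd u p) + of_real s * d, snd (snd u p))) (nhds 0)"
proof -
  have "filterlim (\<lambda>s::real. fst (snd u p) + of_real s * d) (nhds (fst (snd u p))) (nhds 0)"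
    by (rule tendsto_eq_rhs[OF tendsto_add[OF tendsto_const tendsto_mult[OF tendsto_of_real[OF filterlim_ident] tendsto_const]]]) simp
  from eventually_compose_filterlim[OF eventually_plaque_param[OF assms] this]
  show ?thesis unfolding plaque_line_def .
qed

lemma open_nhds_plaque_line:
  assumes "flow_box u" "p \<in> fst u" "open O'" "p \<in> O'"
  obtains S where "open S" "0 \<in> S" "\<And>s. s \<in> S \<Longrightarrow> plaque_line u d p s \<in> O'"
  using eventually_plaque_line[OF assms, of d] unfolding eventually_nhds by blast

lemma leaf_line_cong_vd:
  assumes "flow_box u" "p \<in> fst u" "open O'" "p \<in> O'" "\<And>q. q \<in> O' \<Longrightarrow> g q = h q"
    "(g \<circ> plaque_line u d p has_vector_derivative D) (at 0)"
  shows "(h \<circ> plaque_line u d p has_vector_derivative D) (at 0)"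
proof -
  obtain S where "open S" "0 \<in> S" "\<And>s. s \<in> S \<Longrightarrow> plaque_line u d p s \<in> O'"
    using open_nhds_plaque_line[OF assms(1-4), of d] by blast
  then show ?thesis
    using has_vector_derivative_transform_within_open[OF assms(6)] assms(5) by (metis comp_apply)
qed

text \<open>No differentiability is assumed: \<open>vector_derivative\<close> picks a value among
  the candidates D, and functions that agree near p have the same candidates.\<close>

lemma leaf_deriv_cong:
  assumes "flow_box u" "p \<in> fst u" "open O'" "p \<in> O'" "\<And>q. q \<in> O' \<Longrightarrow> g q = h q"
  shows "leaf_deriv u d g p = leaf_deriv u d h p"
proof -
  have "(g \<circ> plaque_line u d p has_vector_derivative D) (at 0) =
        (h \<circ> plaque_line u d p has_vector_derivative D) (at 0)" for D
    using leaf_line_cong_vd[OF assms(1-4)] assms(5) by metis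
  then show ?thesis unfolding leaf_deriv_def vector_derivative_def by simp
qed

section \<open>Leafwise smoothness graded by the order of differentiation\<close>

text \<open>The regularity of \<open>leafwise_smooth\<close>, but counted by order and relative to
  an open subset of the chart. Closure under products and compositions becomes an induction on the
  order, and functions defined only off the hyperplanes can be treated.\<close>

primrec leaf_smooth_upto ::
    "('n::finite, 'm::finite) chart \<Rightarrow> nat \<Rightarrow> (complex ^ 'n) set \<Rightarrow> (complex ^ 'n \<Rightarrow> complex) \<Rightarrow> bool" where
  "leaf_smooth_upto u 0 O' g = continuous_on O' g"
| "leaf_smooth_upto u (Suc k) O' g = (continuous_on O' g \<and>
     (\<forall>d\<in>{1, \<i>}. (\<forall>p\<in>O'. (g \<circ> plaque_line u d p) differentiable (at 0)) \<and>
        leaf_smooth_upto u k O' (leaf_deriv u d g)))"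

definition leaf_smooth_on ::
    "('n::finite, 'm::finite) chart \<Rightarrow> (complex ^ 'n) set \<Rightarrow> (complex ^ 'n \<Rightarrow> complex) \<Rightarrow> bool" where
  "leaf_smooth_on u O' g \<longleftrightarrow> (\<forall>k. leaf_smooth_upto u k O' g)"

lemma leaf_smooth_uptoI_deriv:
  assumes "continuous_on O' g"
    "\<And>p d. p \<in> O' \<Longrightarrow> d \<in> {1, \<i>} \<Longrightarrow> (g \<circ> plaque_line u d p has_vector_derivative D d p) (at 0)"
    "\<And>d. d \<in> {1, \<i>} \<Longrightarrow> leaf_smooth_upto u k O' (leaf_deriv u d g)"
  shows "leaf_smooth_upto u (Suc k) O' g"
  using assms by (auto simp: differentiable_def has_vector_derivative_def)

lemma leaf_smooth_on_iff:
  "leaf_smooth_on u O' g \<longleftrightarrow> continuous_on O' g \<and>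
     (\<forall>d\<in>{1, \<i>}. (\<forall>p\<in>O'. (g \<circ> plaque_line u d p) differentiable (at 0)) \<and>
        leaf_smooth_on u O' (leaf_deriv u d g))" (is "_ = ?R")
proof
  assume "leaf_smooth_on u O' g"
  then have "leaf_smooth_upto u (Suc k) O' g" for k unfolding leaf_smooth_on_def by blast
  then show ?R unfolding leaf_smooth_on_def by auto
next
  assume R: ?R
  have "leaf_smooth_upto u k O' g" for k
    using R by (cases k) (auto simp: leaf_smooth_on_def)
  then show "leaf_smooth_on u O' g" unfolding leaf_smooth_on_def by blast
qed

text \<open>\<open>leaf_derivs\<close> folds from the left, so differentiating once more appends a
  direction at the end of the list, while removing the head replaces \<open>g\<close> by its first
  derivative. The two directions of the proof use one view each.\<close>

lemma leafwise_smooth_iff: "leafwise_smooth u g \<longleftrightarrow> leaf_smooth_on u (fst u) g"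
proof
  assume g: "leafwise_smooth u g"
  have "leaf_smooth_upto u k (fst u) (leaf_derivs u ds g)" if "set ds \<subseteq> {1, \<i>}" for k ds
    using that
  proof (induction k arbitrary: ds)
    case 0
    then show ?case using g unfolding leafwise_smooth_def by simp
  next
    case (Suc k)
    have "leaf_deriv u d (leaf_derivs u ds g) = leaf_derivs u (ds @ [d]) g" for d
      by (simp add: leaf_derivs_def)
    moreover have "leaf_smooth_upto u k (fst u) (leaf_derivs u (ds @ [d]) g)" if "d \<in> {1, \<i>}" for d
      using Suc.IH[of "ds @ [d]"] Suc.prems that by simp
    ultimately show ?case
      using Suc.prems g unfolding leafwise_smooth_def by (metis leaf_smooth_upto.simps(2))
  qed
  from this[of "[]"] show "leaf_smooth_on u (fst u) g"
    by (simp add: leaf_smooth_on_def leaf_derivs_def)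
next
  assume "leaf_smooth_on u (fst u) g"
  then have *: "leaf_smooth_on u (fst u) (leaf_derivs u ds g)" if "set ds \<subseteq> {1, \<i>}" for ds
    using that
  proof (induction ds arbitrary: g)
    case Nil
    then show ?case by (simp add: leaf_derivs_def)
  next
    case (Cons d ds)
    then have "leaf_smooth_on u (fst u) (leaf_deriv u d g)"
      using leaf_smooth_on_iff[of u "fst u" g] by auto
    then show ?case using Cons by (simp add: leaf_derivs_def)
  qed
  show "leafwise_smooth u g"
    unfolding leafwise_smooth_def
  proof (intro allI impI)
    fix ds :: "complex list" assume "set ds \<subseteq> {1, \<i>}"
    from *[OF this, unfolded leaf_smooth_on_iff[of u "fst u" "leaf_derivs u ds g"]]
    show "continuous_on (fst u) (leaf_derivs u ds g) \<and>
        (\<forall>d\<in>{1, \<i>}. \<forall>p\<in>fst u. (leaf_derivs u ds g \<circ> plaque_line u d p) differentiable (at 0))"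
      by blast
  qed
qed

context
  fixes u :: "('n::finite, 'm::finite) chart" and O' :: "(complex ^ 'n) set"
  assumes u: "flow_box u" and O': "open O'" "O' \<subseteq> fst u"
begin

lemma leaf_smooth_upto_cong:
  assumes "leaf_smooth_upto u k O' g" "\<And>q. q \<in> O' \<Longrightarrow> g q = h q"
  shows "leaf_smooth_upto u k O' h"
  using assms
proof (induction k arbitrary: g h)
  case 0
  then show ?case by (metis continuous_on_cong leaf_smooth_upto.simps(1))
next
  case (Suc k)
  have c: "continuous_on O' h" using Suc.prems by (metis continuous_on_cong leaf_smooth_upto.simps(2))
  have "(h \<circ> plaque_line u d p) differentiable (at 0)" if "d \<in> {1, \<i>}" "p \<in> O'" for d p
  proof -
    have "(g \<circ> plaque_line u d p) differentiable (at 0)" using Suc.prems that by auto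
    then obtain D where "(g \<circ> plaque_line u d p has_vector_derivative D) (at 0)"
      using vector_derivative_works by blast
    then have "(h \<circ> plaque_line u d p has_vector_derivative D) (at 0)"
      using leaf_line_cong_vd[OF u _ O'(1) that(2)] that O' Suc.prems(2) by blast
    then show ?thesis using differentiableI_vector by blast
  qed
  moreover have "leaf_smooth_upto u k O' (leaf_deriv u d h)" if "d \<in> {1, \<i>}" for d
  proof (rule Suc.IH)
    show "leaf_smooth_upto u k O' (leaf_deriv u d g)" using Suc.prems that by auto
    show "leaf_deriv u d g q = leaf_deriv u d h q" if "q \<in> O'" for q
      using leaf_deriv_cong[OF u _ O'(1) that] Suc.prems(2) O' that by blast
  qed
  ultimately show ?case using c by auto
qed

lemma leaf_smooth_upto_mono:
  "leaf_smooth_upto u (Suc k) O' g \<Longrightarrow> leaf_smooth_upto u k O' g"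
proof (induction k arbitrary: g)
  case (Suc k)
  have "leaf_smooth_upto u k O' (leaf_deriv u d g)" if "d \<in> {1, \<i>}" for d
    using Suc.IH Suc.prems that unfolding leaf_smooth_upto.simps(2)[of u "Suc k"] by blast
  then show ?case using Suc.prems by simp
qed simp

lemma leaf_smooth_upto_vd:
  assumes "leaf_smooth_upto u (Suc k) O' g" "p \<in> O'" "d \<in> {1, \<i>}"
  shows "(g \<circ> plaque_line u d p has_vector_derivative leaf_deriv u d g p) (at 0)"
  unfolding leaf_deriv_def by (rule vector_derivative_works[THEN iffD1]) (use assms in auto)

lemma leaf_smooth_on_vd:
  assumes "leaf_smooth_on u O' g" "p \<in> O'" "d \<in> {1, \<i>}"
  shows "(g \<circ> plaque_line u d p has_vector_derivative leaf_deriv u d g p) (at 0)"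
  using assms leaf_smooth_upto_vd unfolding leaf_smooth_on_def by blast

text \<open>Lets an explicit derivative formula \<open>D\<close> stand in for
  \<open>leaf_deriv\<close>, so that the inductions below can be applied to that formula.\<close>

lemma leaf_smooth_upto_SucI:
  assumes "continuous_on O' g"
    "\<And>p d. p \<in> O' \<Longrightarrow> d \<in> {1, \<i>} \<Longrightarrow> (g \<circ> plaque_line u d p has_vector_derivative D d p) (at 0)"
    "\<And>d. d \<in> {1, \<i>} \<Longrightarrow> leaf_smooth_upto u k O' (D d)"
  shows "leaf_smooth_upto u (Suc k) O' g"
proof (rule leaf_smooth_uptoI_deriv[OF assms(1,2)])
  fix d :: complex assume d: "d \<in> {1, \<i>}"
  have "leaf_deriv u d g p = D d p" if "p \<in> O'" for p
    unfolding leaf_deriv_def using vector_derivative_at[OF assms(2)[OF that d]] .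
  then show "leaf_smooth_upto u k O' (leaf_deriv u d g)"
    using leaf_smooth_upto_cong[OF assms(3)[OF d]] by metis
qed

lemma leaf_smooth_upto_const: "leaf_smooth_upto u k O' (\<lambda>_. c)"
proof (induction k arbitrary: c)
  case (Suc k)
  show ?case by (rule leaf_smooth_upto_SucI[where D = "\<lambda>_ _. 0"]) (auto simp: Suc o_def)
qed auto

lemma leaf_smooth_upto_add:
  assumes "leaf_smooth_upto u k O' g" "leaf_smooth_upto u k O' h"
  shows "leaf_smooth_upto u k O' (\<lambda>p. g p + h p)"
  using assms
proof (induction k arbitrary: g h)
  case (Suc k)
  show ?case
  proof (rule leaf_smooth_upto_SucI[where D = "\<lambda>d p. leaf_deriv u d g p + leaf_deriv u d h p"])
    show "continuous_on O' (\<lambda>p. g p + h p)" using Suc.prems by (auto intro: continuous_intros)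
    show "((\<lambda>p. g p + h p) \<circ> plaque_line u d p has_vector_derivative
        leaf_deriv u d g p + leaf_deriv u d h p) (at 0)" if "p \<in> O'" "d \<in> {1, \<i>}" for p d
      using has_vector_derivative_add[OF leaf_smooth_upto_vd[OF Suc.prems(1) that] leaf_smooth_upto_vd[OF Suc.prems(2) that]]
      by (simp add: o_def)
    show "leaf_smooth_upto u k O' (\<lambda>p. leaf_deriv u d g p + leaf_deriv u d h p)" if "d \<in> {1, \<i>}" for d
      using Suc.IH Suc.prems that by auto
  qed
qed (auto intro: continuous_intros)

lemma leaf_mult_vd:
  fixes g h :: "complex ^ 'n \<Rightarrow> complex"
  assumes "p \<in> O'"
   "(g \<circ> plaque_line u d p has_vector_derivative D) (at 0)"
   "(h \<circ> plaque_line u d p has_vector_derivative E) (at 0)"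
  shows "((\<lambda>p. g p * h p) \<circ> plaque_line u d p has_vector_derivative D * h p + g p * E) (at 0)"
proof -
  have "plaque_line u d p 0 = p" using plaque_line_0[OF u] assms(1) O' by blast
  then show ?thesis
    using has_vector_derivative_mult[OF assms(2,3)] by (simp add: o_def add.commute)
qed

lemma leaf_smooth_upto_mult:
  assumes "leaf_smooth_upto u k O' g" "leaf_smooth_upto u k O' h"
  shows "leaf_smooth_upto u k O' (\<lambda>p. g p * h p)"
  using assms
proof (induction k arbitrary: g h)
  case (Suc k)
  show ?case
  proof (rule leaf_smooth_upto_SucI[where D = "\<lambda>d p. leaf_deriv u d g p * h p + g p * leaf_deriv u d h p"])
    show "continuous_on O' (\<lambda>p. g p * h p)" using Suc.prems by (auto intro: continuous_intros)
    show "((\<lambda>p. g p * h p) \<circ> plaque_line u d p has_vector_derivative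
        leaf_deriv u d g p * h p + g p * leaf_deriv u d h p) (at 0)" if "p \<in> O'" "d \<in> {1, \<i>}" for p d
      using leaf_mult_vd[OF that(1) leaf_smooth_upto_vd[OF Suc.prems(1) that] leaf_smooth_upto_vd[OF Suc.prems(2) that]] .
    show "leaf_smooth_upto u k O' (\<lambda>p. leaf_deriv u d g p * h p + g p * leaf_deriv u d h p)" if "d \<in> {1, \<i>}" for d
      by (intro leaf_smooth_upto_add Suc.IH leaf_smooth_upto_mono[OF Suc.prems(1)]
            leaf_smooth_upto_mono[OF Suc.prems(2)])
         (use Suc.prems that in auto)
  qed
qed (auto intro: continuous_intros)

lemma leaf_smooth_upto_linear:
  fixes l :: "complex \<Rightarrow> complex"
  assumes l: "bounded_linear l" and "leaf_smooth_upto u k O' g"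
  shows "leaf_smooth_upto u k O' (\<lambda>p. l (g p))"
  using assms(2)
proof (induction k arbitrary: g)
  case 0
  then show ?case by (simp add: bounded_linear.continuous_on[OF l])
next
  case (Suc k)
  show ?case
  proof (rule leaf_smooth_upto_SucI[where D = "\<lambda>d p. l (leaf_deriv u d g p)"])
    show "continuous_on O' (\<lambda>p. l (g p))" using Suc.prems by (auto intro: bounded_linear.continuous_on[OF l])
    show "((\<lambda>p. l (g p)) \<circ> plaque_line u d p has_vector_derivative l (leaf_deriv u d g p)) (at 0)"
      if "p \<in> O'" "d \<in> {1, \<i>}" for p d
      using bounded_linear.has_vector_derivative[OF l leaf_smooth_upto_vd[OF Suc.prems(1) that]] 
      by (simp add: o_def)
    show "leaf_smooth_upto u k O' (\<lambda>p. l (leaf_deriv u d g p))" if "d \<in> {1, \<i>}" for d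
      using Suc.IH Suc.prems that by auto
  qed
qed

lemma leaf_compose_vd:
  fixes a :: "complex ^ 'n \<Rightarrow> real"
  assumes "p \<in> O'" "((\<lambda>p. complex_of_real (a p)) \<circ> plaque_line u d p has_vector_derivative D) (at 0)"
    "(h has_real_derivative h') (at (a p))"
  shows "((\<lambda>p. complex_of_real (h (a p))) \<circ> plaque_line u d p has_vector_derivative of_real h' * D) (at 0)"
    "D = of_real (Re D)"
proof -
  have p0: "plaque_line u d p 0 = p" using plaque_line_0[OF u] assms(1) O' by blast
  have re: "((\<lambda>s. a (plaque_line u d p s)) has_real_derivative Re D) (at 0)"
    using bounded_linear.has_vector_derivative[OF bounded_linear_Re assms(2)]
    by (simp add: o_def has_real_derivative_iff_has_vector_derivative)
  \<comment> \<open>A real-valued function has imaginary part 0 along the plaque line, so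
    \<open>D\<close> is real and the chain rule in one real variable applies.\<close>
  have im: "((\<lambda>s. 0) has_vector_derivative Im D) (at (0::real))"
    using bounded_linear.has_vector_derivative[OF bounded_linear_Im assms(2)]
    by (simp add: o_def)
  then have "Im D = 0" 
    using vector_derivative_unique_at has_vector_derivative_const by metis
  then show D: "D = of_real (Re D)" by (simp add: complex_eq_iff)
  have "((\<lambda>s. h (a (plaque_line u d p s))) has_real_derivative h' * Re D) (at 0)"
    using DERIV_chain2[OF _ re, of h h'] assms(3) p0 by simp
  then have "((\<lambda>s. of_real (h (a (plaque_line u d p s)))) has_vector_derivative
     (of_real (h' * Re D) :: complex)) (at 0)"
    unfolding has_real_derivative_iff_has_vector_derivative
    by (rule bounded_linear.has_vector_derivative[OF bounded_linear_of_real])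
  moreover have "of_real (h' * Re D) = of_real h' * D" using D by (metis of_real_mult)
  ultimately show "((\<lambda>p. of_real (h (a p))) \<circ> plaque_line u d p has_vector_derivative of_real h' * D) (at 0)"
    by (simp only: o_def)
qed

lemma leaf_smooth_upto_compose:
  fixes a :: "complex ^ 'n \<Rightarrow> real"
  assumes "smooth_real_on I h" "leaf_smooth_upto u k O' (\<lambda>p. of_real (a p))" "a ` O' \<subseteq> I"
  shows "leaf_smooth_upto u k O' (\<lambda>p. of_real (h (a p)))"
  using assms
proof (induction k arbitrary: h)
  case 0
  obtain h' where h': "\<And>x. x \<in> I \<Longrightarrow> (h has_real_derivative h' x) (at x)"
    using smooth_real_on_derivE[OF 0(1)] by metis
  have "continuous_on I h" using h' by (meson DERIV_continuous continuous_at_imp_continuous_on)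
  moreover have "continuous_on O' (\<lambda>p. Re (of_real (a p)))" using 0 by (intro continuous_intros) auto
  then have "continuous_on O' a" by simp
  ultimately show ?case
    using 0(3) by (auto intro!: continuous_on_of_real continuous_on_compose2[of I h])
next
  case (Suc k)
  obtain h' where h': "\<And>x. x \<in> I \<Longrightarrow> (h has_real_derivative h' x) (at x)" "smooth_real_on I h'"
    using smooth_real_on_derivE[OF Suc(2)] by metis
  have "continuous_on I h" using h' by (meson DERIV_continuous continuous_at_imp_continuous_on)
  moreover have "continuous_on O' (\<lambda>p. Re (of_real (a p)))" using Suc by (intro continuous_intros) auto
  then have "continuous_on O' a" by simp
  ultimately have c: "continuous_on O' (\<lambda>p. complex_of_real (h (a p)))"
    using Suc.prems(3) by (auto intro!: continuous_on_of_real continuous_on_compose2[of I h])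
  show ?case
  proof (rule leaf_smooth_upto_SucI[where D = "\<lambda>d p. of_real (h' (a p)) * leaf_deriv u d (\<lambda>p. of_real (a p)) p", OF c])
    show "((\<lambda>p. of_real (h (a p))) \<circ> plaque_line u d p has_vector_derivative
         of_real (h' (a p)) * leaf_deriv u d (\<lambda>p. of_real (a p)) p) (at 0)"
      if "p \<in> O'" "d \<in> {1, \<i>}" for p d
      using leaf_compose_vd(1)[OF that(1) leaf_smooth_upto_vd[OF Suc.prems(2) that]] h'(1) Suc.prems(3) that
      by blast
    show "leaf_smooth_upto u k O' (\<lambda>p. of_real (h' (a p)) * leaf_deriv u d (\<lambda>p. of_real (a p)) p)"
      if "d \<in> {1, \<i>}" for d
      by (intro leaf_smooth_upto_mult Suc.IH[OF h'(2) leaf_smooth_upto_mono[OF Suc.prems(2)] Suc.prems(3)])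
         (use Suc.prems that in auto)
  qed
qed

lemma leaf_smooth_on_const: "leaf_smooth_on u O' (\<lambda>_. c)"
  and leaf_smooth_on_add: "leaf_smooth_on u O' g \<Longrightarrow> leaf_smooth_on u O' h \<Longrightarrow> leaf_smooth_on u O' (\<lambda>p. g p + h p)"
  and leaf_smooth_on_mult: "leaf_smooth_on u O' g \<Longrightarrow> leaf_smooth_on u O' h \<Longrightarrow> leaf_smooth_on u O' (\<lambda>p. g p * h p)"
  and leaf_smooth_on_linear: "bounded_linear l \<Longrightarrow> leaf_smooth_on u O' g \<Longrightarrow> leaf_smooth_on u O' (\<lambda>p. l (g p))"
  and leaf_smooth_on_compose: "smooth_real_on I r \<Longrightarrow> leaf_smooth_on u O' (\<lambda>p. of_real (a p)) \<Longrightarrow> a ` O' \<subseteq> I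
     \<Longrightarrow> leaf_smooth_on u O' (\<lambda>p. of_real (r (a p)))"
  and leaf_smooth_on_cong: "leaf_smooth_on u O' g \<Longrightarrow> (\<And>q. q \<in> O' \<Longrightarrow> g q = h q) \<Longrightarrow> leaf_smooth_on u O' h"
  unfolding leaf_smooth_on_def
  by (simp add: leaf_smooth_upto_const)
     (simp add: leaf_smooth_upto_add, simp add: leaf_smooth_upto_mult, simp add: leaf_smooth_upto_linear,
      metis leaf_smooth_upto_compose, metis leaf_smooth_upto_cong)

lemma leaf_smooth_on_sum:
  "finite A \<Longrightarrow> (\<And>i. i \<in> A \<Longrightarrow> leaf_smooth_on u O' (g i)) \<Longrightarrow> leaf_smooth_on u O' (\<lambda>p. \<Sum>i\<in>A. g i p)"
  by (induction A rule: finite_induct) (auto intro: leaf_smooth_on_const leaf_smooth_on_add)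

lemma leaf_smooth_on_leaf_deriv:
  "leaf_smooth_on u O' g \<Longrightarrow> d \<in> {1, \<i>} \<Longrightarrow> leaf_smooth_on u O' (leaf_deriv u d g)"
  unfolding leaf_smooth_on_iff[of u O' g] by blast

lemma leaf_smooth_on_continuous: "leaf_smooth_on u O' g \<Longrightarrow> continuous_on O' g"
  unfolding leaf_smooth_on_iff[of u O' g] by blast

end

lemma leaf_smooth_on_subset:
  assumes "leaf_smooth_on u O' g" "O'' \<subseteq> O'"
  shows "leaf_smooth_on u O'' g"
proof -
  have "leaf_smooth_upto u k O'' g" if "leaf_smooth_upto u k O' g" for k g
    using that assms(2)
    by (induction k arbitrary: g) (auto intro: continuous_on_subset)
  then show ?thesis using assms(1) unfolding leaf_smooth_on_def by blast
qed

lemma leaf_smooth_on_Un: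
  assumes "leaf_smooth_on u O1 g" "leaf_smooth_on u O2 g" "open O1" "open O2"
  shows "leaf_smooth_on u (O1 \<union> O2) g"
proof -
  have "leaf_smooth_upto u k (O1 \<union> O2) g" if "leaf_smooth_upto u k O1 g" "leaf_smooth_upto u k O2 g" for k g
    using that assms(3,4)
    by (induction k arbitrary: g) (auto intro: continuous_on_open_Un)
  then show ?thesis using assms(1,2) unfolding leaf_smooth_on_def by blast
qed

section \<open>Charts and plaques\<close>

text \<open>Cauchy's inequality for the difference of G at parameters t and t0, which is uniformly
  small on a disc, controls the difference of the two derivatives. Continuity of the derivative in y
  at the fixed parameter t0 does the rest.\<close>

lemma continuous_on_deriv_parametric:
  fixes G :: "complex \<times> 'b::euclidean_space \<Rightarrow> complex"
  assumes B: "open B" and S: "open S" and G: "continuous_on (B \<times> S) G"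
    and hol: "\<And>t. t \<in> S \<Longrightarrow> (\<lambda>y. G (y, t)) holomorphic_on B"
  shows "continuous_on (B \<times> S) (\<lambda>w. deriv (\<lambda>y. G (y, snd w)) (fst w))"
  unfolding continuous_on_iff
proof (intro ballI allI impI)
  fix w0 :: "complex \<times> 'b" and e :: real
  assume w0: "w0 \<in> B \<times> S" and e: "e > 0"
  obtain y0 t0 where w0_eq: "w0 = (y0, t0)" by fastforce
  have y0: "y0 \<in> B" and t0: "t0 \<in> S" using w0 w0_eq by auto
  obtain r where r: "r > 0" "cball y0 r \<subseteq> B" using B y0 open_contains_cball by blast
  obtain r' where r': "r' > 0" "cball t0 r' \<subseteq> S" using S t0 open_contains_cball by blast
  let ?K = "cball y0 r \<times> cball t0 r'"
  have "uniformly_continuous_on ?K G"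
    by (intro compact_uniformly_continuous continuous_on_subset[OF G] compact_Times compact_cball)
       (use r r' in auto)
  \<comment> \<open>Divided by the radius r / 2 in Cauchy's inequality this becomes e / 4, which
    leaves room for the e / 2 from the variation in y.\<close>
  moreover have "e * r / 8 > 0" using e r by simp
  ultimately obtain d2 where d2: "d2 > 0"
    "\<And>w w'. w \<in> ?K \<Longrightarrow> w' \<in> ?K \<Longrightarrow> dist w' w < d2 \<Longrightarrow> dist (G w') (G w) < e * r / 8"
    unfolding uniformly_continuous_on_def by metis
  have "continuous_on B (deriv (\<lambda>y. G (y, t0)))"
    using holomorphic_deriv[OF hol[OF t0] B] holomorphic_on_imp_continuous_on by blast
  then obtain d1 where d1: "d1 > 0"
    "\<And>y. y \<in> B \<Longrightarrow> dist y y0 < d1 \<Longrightarrow> dist (deriv (\<lambda>y. G (y, t0)) y) (deriv (\<lambda>y. G (y, t0)) y0) < e / 2"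
    using y0 e unfolding continuous_on_iff by (metis half_gt_zero)
  define d where "d = Min {r / 2, r', d1, d2}"
  have d: "d > 0" "d \<le> r / 2" "d \<le> r'" "d \<le> d1" "d \<le> d2"
    using r r' d1 d2 by (auto simp: d_def)
  show "\<exists>d>0. \<forall>w\<in>B \<times> S. dist w w0 < d \<longrightarrow>
      dist (deriv (\<lambda>y. G (y, snd w)) (fst w)) (deriv (\<lambda>y. G (y, snd w0)) (fst w0)) < e"
  proof (intro exI conjI ballI impI)
    fix w assume w: "w \<in> B \<times> S" "dist w w0 < d"
    obtain y t where w_eq: "w = (y, t)" by fastforce
    have dy: "dist y y0 < d" and dt: "dist t t0 < d"
      using w(2) dist_fst_le[of w w0] dist_snd_le[of w w0] unfolding w_eq w0_eq by auto
    have sub: "cball y (r / 2) \<subseteq> cball y0 r"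
    proof
      fix x assume "x \<in> cball y (r / 2)"
      then have "dist y x \<le> r / 2" by simp
      moreover have "dist y0 x \<le> dist y0 y + dist y x" by (rule dist_triangle)
      ultimately show "x \<in> cball y0 r" using dy d by (simp add: dist_commute)
    qed
    have tS: "t \<in> S" using w w_eq by auto
    have yB: "y \<in> B" using w w_eq by auto
    define f where "f = (\<lambda>x. G (x, t) - G (x, t0))"
    have fh: "f holomorphic_on B" unfolding f_def using hol tS t0 by (intro holomorphic_intros)
    have "norm ((deriv ^^ 1) f y) \<le> fact 1 * (e * r / 8) / (r / 2) ^ 1"
    proof (rule Cauchy_inequality)
      show "f holomorphic_on ball y (r / 2)"
        using holomorphic_on_subset[OF fh] sub r by (meson ball_subset_cball subset_trans)
      show "continuous_on (cball y (r / 2)) f"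
        using holomorphic_on_imp_continuous_on[OF holomorphic_on_subset[OF fh]] sub r by blast
      show "0 < r / 2" using r by simp
      fix x assume "norm (y - x) = r / 2"
      then have "x \<in> cball y (r / 2)" by (simp add: dist_norm)
      then have x: "x \<in> cball y0 r" using sub by blast
      have "dist (x, t) (x, t0) < d2" using dt d by (simp add: dist_Pair_Pair)
      then have "dist (G (x, t)) (G (x, t0)) < e * r / 8"
        using d2(2)[of "(x, t0)" "(x, t)"] x dt d r' by (auto simp: dist_commute)
      then show "norm (f x) \<le> e * r / 8" by (simp add: f_def dist_norm)
    qed
    then have 1: "norm (deriv f y) \<le> e / 4" using r by simp
    have fd: "(\<lambda>x. G (x, s)) field_differentiable (at y)" if "s \<in> S" for s
      using hol[OF that] B yB holomorphic_on_imp_differentiable_at by blast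
    have "deriv f y = deriv (\<lambda>x. G (x, t)) y - deriv (\<lambda>x. G (x, t0)) y"
      unfolding f_def using fd tS t0 by simp
    then have "dist (deriv (\<lambda>x. G (x, t)) y) (deriv (\<lambda>x. G (x, t0)) y) \<le> e / 4"
      using 1 by (simp add: dist_norm)
    moreover have "dist (deriv (\<lambda>y. G (y, t0)) y) (deriv (\<lambda>y. G (y, t0)) y0) < e / 2"
      using d1(2)[OF yB] dy d by simp
    ultimately have "dist (deriv (\<lambda>x. G (x, t)) y) (deriv (\<lambda>y. G (y, t0)) y0) < e"
      using dist_triangle[of "deriv (\<lambda>x. G (x, t)) y" "deriv (\<lambda>y. G (y, t0)) y0" "deriv (\<lambda>x. G (x, t0)) y"] e
      by linarith
    then show "dist (deriv (\<lambda>y. G (y, snd w)) (fst w)) (deriv (\<lambda>y. G (y, snd w0)) (fst w0)) < e"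
      by (simp add: w_eq w0_eq)
  qed (use d in auto)
qed

lemma chart_holomorphic_vd:
  fixes u :: "('n::finite, 'm::finite) chart"
  assumes u: "flow_box u" and im: "snd u ` fst u = B \<times> S" and B: "open B"
    and hol: "\<And>t. t \<in> S \<Longrightarrow> (\<lambda>y. G (y, t)) holomorphic_on B" and p: "p \<in> fst u"
  shows "((\<lambda>p. G (snd u p)) \<circ> plaque_line u d p has_vector_derivative
     d * deriv (\<lambda>y. G (y, snd (snd u p))) (fst (snd u p))) (at 0)"
proof -
  let ?y = "fst (snd u p)" and ?t = "snd (snd u p)"
  have yt: "?y \<in> B" "?t \<in> S" using im p by (metis imageI mem_Times_iff)+
  have "((\<lambda>y. G (y, ?t)) has_field_derivative deriv (\<lambda>y. G (y, ?t)) ?y) (at ?y)"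
    using hol[OF yt(2)] B yt(1) holomorphic_derivI by blast
  then have D: "((\<lambda>y. G (y, ?t)) has_derivative (\<lambda>v. v * deriv (\<lambda>y. G (y, ?t)) ?y)) (at (?y + of_real 0 * d))"
    by (simp add: has_field_derivative_def mult_commute_abs)
  have "((\<lambda>s::real. ?y + of_real s * d) has_derivative (\<lambda>s. of_real s * d)) (at 0)"
    by (auto intro!: derivative_eq_intros)
  from has_derivative_compose[OF this D]
  have G: "((\<lambda>s::real. G (?y + of_real s * d, ?t)) has_vector_derivative d * deriv (\<lambda>y. G (y, ?t)) ?y) (at 0)"
    by (simp add: has_vector_derivative_def scaleR_conv_of_real mult_ac)
  have "eventually (\<lambda>s. snd u (plaque_line u d p s) = (?y + of_real s * d, ?t)) (nhds 0)"
    using eventually_plaque_line[OF u p flow_boxD(1)[OF u] p, of d] by eventually_elim simp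
  then obtain T where T: "open T" "0 \<in> T" "\<And>s. s \<in> T \<Longrightarrow> snd u (plaque_line u d p s) = (?y + of_real s * d, ?t)"
    unfolding eventually_nhds by blast
  show ?thesis
    by (rule has_vector_derivative_transform_within_open[OF G T(1,2)]) (simp add: T(3))
qed

text \<open>Functions continuous in (y,t) and holomorphic in y form a class stable under the
  derivative in y, so the induction on the order stays inside it.\<close>

lemma leaf_smooth_chart_holomorphic:
  fixes u :: "('n::finite, 'm::finite) chart"
  assumes u: "flow_box u" and im: "snd u ` fst u = B \<times> S" and B: "open B" and S: "open S"
    and cu: "continuous_on (fst u) (snd u)"
    and "continuous_on (B \<times> S) G" "\<And>t. t \<in> S \<Longrightarrow> (\<lambda>y. G (y, t)) holomorphic_on B"
  shows "leaf_smooth_on u (fst u) (\<lambda>p. G (snd u p))"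
proof -
  have "leaf_smooth_upto u k (fst u) (\<lambda>p. G (snd u p))" for k
    using assms(6,7)
  proof (induction k arbitrary: G)
    case 0
    then show ?case using im by (auto intro: continuous_on_compose2[OF _ cu])
  next
    case (Suc k)
    define G' where "G' d w = d * deriv (\<lambda>y. G (y, snd w)) (fst w)" for d w
    show ?case
    proof (rule leaf_smooth_upto_SucI[OF u flow_boxD(1)[OF u] order_refl, where D = "\<lambda>d p. G' d (snd u p)"])
      show "continuous_on (fst u) (\<lambda>p. G (snd u p))"
        using im Suc.prems(1) by (auto intro: continuous_on_compose2[OF _ cu])
      show "((\<lambda>p. G (snd u p)) \<circ> plaque_line u d p has_vector_derivative G' d (snd u p)) (at 0)"
        if "p \<in> fst u" for p d
        unfolding G'_def by (rule chart_holomorphic_vd[OF u im B Suc.prems(2) that])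
      show "leaf_smooth_upto u k (fst u) (\<lambda>p. G' d (snd u p))" for d
      proof (rule Suc.IH)
        show "continuous_on (B \<times> S) (G' d)"
          unfolding G'_def[abs_def] using continuous_on_deriv_parametric[OF B S Suc.prems]
          by (intro continuous_intros)
        show "(\<lambda>y. G' d (y, t)) holomorphic_on B" if "t \<in> S" for t
          unfolding G'_def using Suc.prems(2)[OF that] B
          by (auto intro!: holomorphic_intros holomorphic_deriv)
      qed
    qed
  qed
  then show ?thesis unfolding leaf_smooth_on_def by blast
qed

section \<open>Tangent vectors of the plaques and their change under charts\<close>

definition plaque_tangent ::
    "('n::finite, 'm::finite) chart \<Rightarrow> 'n \<Rightarrow> complex ^ 'n \<Rightarrow> complex" where
  "plaque_tangent u j p = deriv (\<lambda>\<eta>. plaque_param u p \<eta> $ j) (fst (snd u p))"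

lemma plaque_param_has_derivative:
  fixes u :: "('n::finite, 'm::finite) chart"
  assumes u: "flow_box u" and im: "snd u ` fst u = B \<times> S" and y: "y \<in> B" "t \<in> S"
  obtains a where "((\<lambda>\<eta>. chart_inv u (\<eta>, t)) has_derivative (\<lambda>v. v *s a)) (at y)"
    "\<And>j. ((\<lambda>\<eta>. chart_inv u (\<eta>, t) $ j) has_field_derivative a $ j) (at y)"
proof -
  have "holomorphic_flow_param (chart_inv u) (snd u ` fst u)"
    using u unfolding flow_box_def by blast
  then obtain \<psi>' where psi: "(chart_inv u has_derivative \<psi>') (at (y, t))"
      "\<And>c y t. \<psi>' (c * y, c *s t) = c *s \<psi>' (y, t)"
    using y unfolding holomorphic_flow_param_def im by blast
  have "((\<lambda>\<eta>. (\<eta>, t)) has_derivative (\<lambda>v. (v, 0))) (at y)"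
    by (auto intro!: derivative_eq_intros)
  from has_derivative_compose[OF this psi(1)]
  have "((\<lambda>\<eta>. chart_inv u (\<eta>, t)) has_derivative (\<lambda>v. \<psi>' (v, 0))) (at y)" .
  moreover have eq: "(\<lambda>v. \<psi>' (v, 0)) = (\<lambda>v. v *s \<psi>' (1, 0))"
  proof
    show "\<psi>' (v, 0) = v *s \<psi>' (1, 0)" for v
      using psi(2)[of v 1 0] by simp
  qed
  ultimately have 1: "((\<lambda>\<eta>. chart_inv u (\<eta>, t)) has_derivative (\<lambda>v. v *s \<psi>' (1, 0))) (at y)"
    by metis
  show thesis
  proof (rule that[OF 1])
    fix j
    have "((\<lambda>\<eta>. chart_inv u (\<eta>, t) $ j) has_derivative (\<lambda>v. (v *s \<psi>' (1, 0)) $ j)) (at y)"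
      by (rule bounded_linear.has_derivative[OF bounded_linear_vec_nth 1])
    then show "((\<lambda>\<eta>. chart_inv u (\<eta>, t) $ j) has_field_derivative \<psi>' (1, 0) $ j) (at y)"
      by (simp add: has_field_derivative_def mult_commute_abs)
  qed
qed

lemma plaque_tangent_has_derivative:
  fixes u :: "('n::finite, 'm::finite) chart"
  assumes u: "flow_box u" and p: "p \<in> fst u"
  shows "(plaque_param u p has_derivative (\<lambda>v. v *s (\<chi> j. plaque_tangent u j p))) (at (fst (snd u p)))"
    "((\<lambda>\<eta>. plaque_param u p \<eta> $ j) has_field_derivative plaque_tangent u j p) (at (fst (snd u p)))"
proof -
  obtain B S where BS: "snd u ` fst u = B \<times> S" using flow_boxE[OF u] by metis
  have "fst (snd u p) \<in> B" "snd (snd u p) \<in> S" using BS p by (metis imageI mem_Times_iff)+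
  from plaque_param_has_derivative[OF u BS this]
  obtain a where a: "((\<lambda>\<eta>. chart_inv u (\<eta>, snd (snd u p))) has_derivative (\<lambda>v. v *s a)) (at (fst (snd u p)))"
    "\<And>j. ((\<lambda>\<eta>. chart_inv u (\<eta>, snd (snd u p)) $ j) has_field_derivative a $ j) (at (fst (snd u p)))"
    by blast
  have "plaque_tangent u j p = a $ j" for j
    unfolding plaque_tangent_def plaque_param_def using a(2) DERIV_imp_deriv by blast
  moreover from this have "(\<chi> j. plaque_tangent u j p) = a" by (simp add: vec_eq_iff)
  ultimately show "(plaque_param u p has_derivative (\<lambda>v. v *s (\<chi> j. plaque_tangent u j p))) (at (fst (snd u p)))"
    "((\<lambda>\<eta>. plaque_param u p \<eta> $ j) has_field_derivative plaque_tangent u j p) (at (fst (snd u p)))"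
    using a unfolding plaque_param_def[abs_def] by simp_all
qed

lemma leaf_smooth_plaque_tangent_coord:
  fixes u :: "('n::finite, 'm::finite) chart"
  assumes u: "flow_box u"
  shows "leaf_smooth_on u (fst u) (\<lambda>p. p $ j)"
    and "leaf_smooth_on u (fst u) (plaque_tangent u j)"
    and "p \<in> fst u \<Longrightarrow> ((\<lambda>p. p $ j) \<circ> plaque_line u d p has_vector_derivative d * plaque_tangent u j p) (at 0)"
    and "p \<in> fst u \<Longrightarrow> (plaque_tangent u j \<circ> plaque_line u d p has_vector_derivative
       d * deriv (deriv (\<lambda>\<eta>. plaque_param u p \<eta> $ j)) (fst (snd u p))) (at 0)"
proof -
  obtain B S where BS: "open B" "open S" "snd u ` fst u = B \<times> S" "continuous_on (fst u) (snd u)"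
    "continuous_on (B \<times> S) (chart_inv u)"
    using flow_boxE[OF u] by metis
  let ?G = "\<lambda>w. chart_inv u w $ j"
  have cG: "continuous_on (B \<times> S) ?G" using BS(5) by (intro continuous_intros)
  have hG: "(\<lambda>y. ?G (y, t)) holomorphic_on B" if "t \<in> S" for t
    unfolding holomorphic_on_def
    using plaque_param_has_derivative[OF u BS(3) _ that]
    by (metis field_differentiable_at_within field_differentiable_def)
  have eq: "?G (snd u p) = p $ j" if "p \<in> fst u" for p using chart_inv_snd[OF u that] by simp
  show 1: "leaf_smooth_on u (fst u) (\<lambda>p. p $ j)"
    using leaf_smooth_on_cong[OF u flow_boxD(1)[OF u] order_refl
        leaf_smooth_chart_holomorphic[OF u BS(3,1,2,4) cG hG], of "\<lambda>p. p $ j"] eq by blast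
  let ?H = "\<lambda>w. deriv (\<lambda>y. ?G (y, snd w)) (fst w)"
  have cH: "continuous_on (B \<times> S) ?H" by (rule continuous_on_deriv_parametric[OF BS(1,2) cG hG])
  have hH: "(\<lambda>y. ?H (y, t)) holomorphic_on B" if "t \<in> S" for t
    using holomorphic_deriv[OF hG[OF that] BS(1)] by simp
  have eqH: "?H (snd u p) = plaque_tangent u j p" for p
    by (simp add: plaque_tangent_def plaque_param_def)
  show "leaf_smooth_on u (fst u) (plaque_tangent u j)"
    using leaf_smooth_chart_holomorphic[OF u BS(3,1,2,4) cH hH] unfolding eqH .
  show "((\<lambda>p. p $ j) \<circ> plaque_line u d p has_vector_derivative d * plaque_tangent u j p) (at 0)"
    if p: "p \<in> fst u"
  proof (rule leaf_line_cong_vd[OF u p flow_boxD(1)[OF u] p eq])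
    show "((\<lambda>p. ?G (snd u p)) \<circ> plaque_line u d p has_vector_derivative d * plaque_tangent u j p) (at 0)"
      using chart_holomorphic_vd[OF u BS(3,1) hG p, of d] unfolding plaque_tangent_def plaque_param_def .
  qed
  show "(plaque_tangent u j \<circ> plaque_line u d p has_vector_derivative
       d * deriv (deriv (\<lambda>\<eta>. plaque_param u p \<eta> $ j)) (fst (snd u p))) (at 0)" if p: "p \<in> fst u"
    using chart_holomorphic_vd[OF u BS(3,1) hH p, of d] unfolding eqH 
    by (simp add: plaque_param_def[abs_def] eta_contract_eq)
qed

lemma holomorphic_flow_mapE:
  fixes u :: "('n::finite, 'm::finite) chart"
  assumes u: "flow_box u" and p: "p \<in> fst u"
  obtains \<phi>' where "(snd u has_derivative \<phi>') (at p)"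
    "\<And>c v. \<phi>' (c *s v) = (c * fst (\<phi>' v), c *s snd (\<phi>' v))"
  using assms unfolding flow_box_def holomorphic_flow_map_def by blast

text \<open>The chart undoes the parametrization, so the derivative of the parametrization is
  injective and cannot vanish.\<close>

lemma plaque_tangent_nonzero:
  fixes u :: "('n::finite, 'm::finite) chart"
  assumes u: "flow_box u" and p: "p \<in> fst u"
  shows "\<exists>j. plaque_tangent u j p \<noteq> 0"
proof (rule ccontr)
  assume "\<nexists>j. plaque_tangent u j p \<noteq> 0"
  then have z: "(\<chi> j. plaque_tangent u j p) = 0" by (simp add: vec_eq_iff)
  let ?y = "fst (snd u p)"
  have pp: "plaque_param u p ?y = p" by (simp add: plaque_param_def chart_inv_snd[OF u p])
  obtain \<phi>' where phi: "(snd u has_derivative \<phi>') (at p)" using holomorphic_flow_mapE[OF u p] by metis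
  have "(plaque_param u p has_derivative (\<lambda>v. 0)) (at ?y)"
    using plaque_tangent_has_derivative(1)[OF u p] unfolding z by simp
  from has_derivative_compose[OF this, of "snd u" \<phi>']
  have "((\<lambda>\<eta>. snd u (plaque_param u p \<eta>)) has_derivative (\<lambda>v. 0)) (at ?y)"
    using phi pp has_derivative_linear[OF phi] by (simp add: linear_0)
  then have 1: "((\<lambda>\<eta>. fst (snd u (plaque_param u p \<eta>))) has_derivative (\<lambda>v. 0)) (at ?y)"
    using has_derivative_fst by fastforce
  have "eventually (\<lambda>\<eta>. fst (snd u (plaque_param u p \<eta>)) = \<eta>) (nhds ?y)"
    using eventually_plaque_param[OF u p flow_boxD(1)[OF u] p] by eventually_elim simp
  then obtain T where T: "open T" "?y \<in> T" "\<And>\<eta>. \<eta> \<in> T \<Longrightarrow> fst (snd u (plaque_param u p \<eta>)) = \<eta>"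
    unfolding eventually_nhds by blast
  have "((\<lambda>\<eta>. \<eta>) has_derivative (\<lambda>v. 0)) (at ?y)"
    by (rule has_derivative_transform_within_open[OF 1 T(1,2)]) (rule T(3))
  then have "(\<lambda>v::complex. v) = (\<lambda>v. 0)"
    using has_derivative_unique[OF has_derivative_ident] by blast
  then show False by (metis one_neq_zero)
qed

text \<open>Compatible charts share their plaques locally. The parametrization by u is therefore
  that by v after a holomorphic change \<open>?\<tau>\<close> of the plaque coordinate, and the
  chain rule applies.\<close>

lemma plaque_tangent_transition:
  fixes u v :: "('n::finite, 'm::finite) chart"
  assumes u: "flow_box u" and v: "flow_box v" and c: "compatible_charts u v"
    and p: "p \<in> fst u" "p \<in> fst v"
  shows "plaque_tangent u j p = transition_deriv u v p * plaque_tangent v j p"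
proof -
  let ?y = "fst (snd u p)" and ?t = "snd (snd u p)"
  obtain W \<Lambda> where W: "open W" "p \<in> W" "W \<subseteq> fst u \<inter> fst v"
    "\<And>q. q \<in> W \<Longrightarrow> snd (snd v q) = \<Lambda> (snd (snd u q))"
    using bspec[OF c[unfolded compatible_charts_def], of p] p by auto
  let ?\<tau> = "\<lambda>\<eta>. fst (snd v (plaque_param u p \<eta>))"
  have pp: "plaque_param u p ?y = p" by (simp add: plaque_param_def chart_inv_snd[OF u p(1)])
  have "eventually (\<lambda>\<eta>. plaque_param v p (?\<tau> \<eta>) = plaque_param u p \<eta>) (nhds ?y)"
    using eventually_plaque_param[OF u p(1) W(1,2)]
  proof eventually_elim
    case (elim \<eta>)
    then have q: "plaque_param u p \<eta> \<in> W" "snd (snd u (plaque_param u p \<eta>)) = ?t" by auto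
    have "snd (snd v (plaque_param u p \<eta>)) = snd (snd v p)"
      using W(4)[OF q(1)] W(4)[OF W(2)] q(2) by simp
    then have "(?\<tau> \<eta>, snd (snd v p)) = snd v (plaque_param u p \<eta>)" by (metis prod.collapse)
    then show ?case
      using chart_inv_snd[OF v, of "plaque_param u p \<eta>"] q W(3) unfolding plaque_param_def by auto
  qed
  then obtain T where T: "open T" "?y \<in> T" "\<And>\<eta>. \<eta> \<in> T \<Longrightarrow> plaque_param v p (?\<tau> \<eta>) = plaque_param u p \<eta>"
    unfolding eventually_nhds by blast
  obtain \<phi>' where phi: "(snd v has_derivative \<phi>') (at p)"
    "\<And>c w. \<phi>' (c *s w) = (c * fst (\<phi>' w), c *s snd (\<phi>' w))"
    using holomorphic_flow_mapE[OF v p(2)] by metis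
  let ?a = "\<chi> j. plaque_tangent u j p"
  have "((\<lambda>\<eta>. snd v (plaque_param u p \<eta>)) has_derivative (\<lambda>w. \<phi>' (w *s ?a))) (at ?y)"
    using has_derivative_compose[OF plaque_tangent_has_derivative(1)[OF u p(1)], of "snd v" \<phi>'] phi(1)
    unfolding pp .
  from has_derivative_fst[OF this]
  have "(?\<tau> has_derivative (\<lambda>w. w * fst (\<phi>' ?a))) (at ?y)" by (simp add: phi(2))
  then have tau: "(?\<tau> has_field_derivative fst (\<phi>' ?a)) (at ?y)"
    by (simp add: has_field_derivative_def mult_commute_abs)
  then have td: "transition_deriv u v p = fst (\<phi>' ?a)"
    unfolding transition_deriv_def by (rule DERIV_imp_deriv)
  have "?\<tau> ?y = fst (snd v p)" using pp by simp
  then have "((\<lambda>\<eta>. plaque_param v p \<eta> $ j) has_field_derivative plaque_tangent v j p) (at (?\<tau> ?y))"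
    using plaque_tangent_has_derivative(2)[OF v p(2)] by simp
  from DERIV_chain2[OF this tau]
  have "((\<lambda>\<eta>. plaque_param v p (?\<tau> \<eta>) $ j) has_field_derivative
      plaque_tangent v j p * transition_deriv u v p) (at ?y)" unfolding td .
  then have "((\<lambda>\<eta>. plaque_param u p \<eta> $ j) has_field_derivative
      plaque_tangent v j p * transition_deriv u v p) (at ?y)"
    by (rule has_field_derivative_transform_within_open[OF _ T(1,2)]) (simp add: T(3))
  then show ?thesis
    using plaque_tangent_has_derivative(2)[OF u p(1)] DERIV_unique by (metis mult.commute)
qed

section \<open>Riesz representation of positive functionals\<close>

text \<open>Smooth functions form no lattice, so the Stone-Daniell construction does not apply
  directly. Its role is taken by \<open>V_box\<close>: V is stable under multiplication by functions
  whose set of positivity is a prescribed open box. \<open>V_dom\<close> supplies majorants of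
  compact sets.\<close>

locale positive_functional =
  fixes V :: "('a::euclidean_space \<Rightarrow> real) set" and l :: "('a \<Rightarrow> real) \<Rightarrow> real" and Y :: "'a set"
  assumes V_add: "f \<in> V \<Longrightarrow> g \<in> V \<Longrightarrow> (\<lambda>x. f x + g x) \<in> V"
    and V_scale: "f \<in> V \<Longrightarrow> (\<lambda>x. c * f x) \<in> V"
    and l_add: "f \<in> V \<Longrightarrow> g \<in> V \<Longrightarrow> l (\<lambda>x. f x + g x) = l f + l g"
    and l_scale: "f \<in> V \<Longrightarrow> l (\<lambda>x. c * f x) = c * l f"
    and l_pos: "f \<in> V \<Longrightarrow> (\<And>x. 0 \<le> f x) \<Longrightarrow> 0 \<le> l f"
    and V_cont: "f \<in> V \<Longrightarrow> continuous_on UNIV f"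
    and V_supp: "f \<in> V \<Longrightarrow> \<exists>K. compact K \<and> K \<subseteq> Y \<and> (\<forall>x. x \<notin> K \<longrightarrow> f x = 0)"
    and V_dom: "compact K \<Longrightarrow> K \<subseteq> Y \<Longrightarrow> \<exists>e\<in>V. (\<forall>x. 0 \<le> e x) \<and> (\<forall>x\<in>K. 1 \<le> e x)"
    and V_box: "\<exists>\<phi>. {x. 0 < \<phi> x} = box a b \<and> (\<forall>x. 0 \<le> \<phi> x \<and> \<phi> x \<le> 1) \<and>
          (\<forall>f\<in>V. (\<lambda>x. \<phi> x * f x) \<in> V)"
    and Y_open: "open Y"
begin

definition P :: "('a \<Rightarrow> real) set" where "P = {f \<in> V. \<forall>x. 0 \<le> f x}"

lemma PD: "f \<in> P \<Longrightarrow> f \<in> V" "f \<in> P \<Longrightarrow> 0 \<le> f x" "f \<in> P \<Longrightarrow> 0 \<le> l f"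
  unfolding P_def using l_pos by auto

lemma V_diff: "f \<in> V \<Longrightarrow> g \<in> V \<Longrightarrow> (\<lambda>x. f x - g x) \<in> V"
  and l_diff: "f \<in> V \<Longrightarrow> g \<in> V \<Longrightarrow> l (\<lambda>x. f x - g x) = l f - l g"
  using V_add[of f "\<lambda>x. (-1) * g x"] V_scale[of g "-1"] l_add[of f "\<lambda>x. (-1) * g x"] l_scale[of g "-1"]
  by simp_all

lemma l_mono: "f \<in> V \<Longrightarrow> g \<in> V \<Longrightarrow> (\<And>x. f x \<le> g x) \<Longrightarrow> l f \<le> l g"
  using V_diff[of g f] l_diff[of g f] l_pos[of "\<lambda>x. g x - f x"] by simp

lemma zero_V: "(\<lambda>_. 0) \<in> V"
  using V_dom[of "{}"] V_scale[of _ 0] by auto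

lemma zero_P: "(\<lambda>_. 0) \<in> P" using zero_V by (simp add: P_def)

lemma l_zero: "l (\<lambda>_. 0) = 0" using l_scale[OF zero_V, of 0] by simp

lemma sum_P: "finite A \<Longrightarrow> (\<And>i. i \<in> A \<Longrightarrow> F i \<in> P) \<Longrightarrow> (\<lambda>x. \<Sum>i\<in>A. F i x) \<in> P \<and> l (\<lambda>x. \<Sum>i\<in>A. F i x) = (\<Sum>i\<in>A. l (F i))"
proof (induction A rule: finite_induct)
  case empty
  then show ?case by (simp add: zero_P l_zero)
next
  case (insert i A)
  then show ?case using V_add l_add by (auto simp: P_def)
qed

text \<open>The Daniell outer integral; only the values on \<open>Y\<close> count.\<close>

definition covers :: "('a \<Rightarrow> ennreal) \<Rightarrow> (nat \<Rightarrow> 'a \<Rightarrow> real) set" where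
  "covers h = {F. (\<forall>i. F i \<in> P) \<and> (\<forall>x\<in>Y. h x \<le> (\<Sum>i. ennreal (F i x)))}"

definition outer_int :: "('a \<Rightarrow> ennreal) \<Rightarrow> ennreal" where
  "outer_int h = (INF F\<in>covers h. \<Sum>i. ennreal (l (F i)))"

lemma outer_int_le: "(\<And>i. F i \<in> P) \<Longrightarrow> (\<And>x. x \<in> Y \<Longrightarrow> h x \<le> (\<Sum>i. ennreal (F i x)))
    \<Longrightarrow> outer_int h \<le> (\<Sum>i. ennreal (l (F i)))"
  unfolding outer_int_def covers_def by (intro INF_lower) auto

text \<open>A countable family of countable covers is merged into a single cover by the pairing
  bijection.\<close>

lemma outer_int_le_double:
  assumes "\<And>m i. G m i \<in> P" "\<And>x. x \<in> Y \<Longrightarrow> h x \<le> (\<Sum>m. \<Sum>i. ennreal (G m i x))"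
  shows "outer_int h \<le> (\<Sum>m. \<Sum>i. ennreal (l (G m i)))"
proof -
  have "outer_int h \<le> (\<Sum>j. ennreal (l (case prod_decode j of (m, i) \<Rightarrow> G m i)))"
  proof (rule outer_int_le)
    show "(case prod_decode j of (m, i) \<Rightarrow> G m i) \<in> P" for j
      using assms(1) by (auto split: prod.split)
    fix x assume "x \<in> Y"
    have "(\<Sum>j. ennreal ((case prod_decode j of (m, i) \<Rightarrow> G m i) x)) = (\<Sum>m. \<Sum>i. ennreal (G m i x))"
      using suminf_ennreal_2dimen[of "\<lambda>m. \<Sum>i. ennreal (G m i x)" "\<lambda>(m, i). ennreal (G m i x)"]
      by (simp add: case_prod_unfold)
    then show "h x \<le> (\<Sum>j. ennreal ((case prod_decode j of (m, i) \<Rightarrow> G m i) x))"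
      using assms(2)[OF \<open>x \<in> Y\<close>] by simp
  qed
  also have "\<dots> = (\<Sum>m. \<Sum>i. ennreal (l (G m i)))"
    using suminf_ennreal_2dimen[of "\<lambda>m. \<Sum>i. ennreal (l (G m i))" "\<lambda>(m, i). ennreal (l (G m i))"]
    by (simp add: case_prod_unfold)
  finally show ?thesis .
qed

lemma outer_int_mono: "(\<And>x. x \<in> Y \<Longrightarrow> h x \<le> g x) \<Longrightarrow> outer_int h \<le> outer_int g"
  unfolding outer_int_def by (intro INF_superset_mono) (auto simp: covers_def intro: order_trans)

lemma outer_int_zero: "outer_int (\<lambda>_. 0) = 0"
  using outer_int_le[of "\<lambda>_ _. 0" "\<lambda>_. 0"] zero_P l_zero by simp

lemma outer_int_countably_subadditive: "outer_int (\<lambda>x. \<Sum>n. h n x) \<le> (\<Sum>n. outer_int (h n))"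
proof (cases "\<exists>n. outer_int (h n) = top")
  case True
  then obtain n where "outer_int (h n) = top" by blast
  moreover have "outer_int (h n) \<le> (\<Sum>n. outer_int (h n))"
    using sum_le_suminf[of "\<lambda>n. outer_int (h n)" "{n}"] by (simp add: summableI)
  ultimately show ?thesis by (simp add: top_unique)
next
  case False
  show ?thesis
  proof (rule ennreal_le_epsilon)
    fix e :: real assume e: "e > 0"
    have "\<exists>F\<in>covers (h n). (\<Sum>i. ennreal (l (F i))) < outer_int (h n) + ennreal (e * (1/2) ^ Suc n)" for n
    proof -
      have "outer_int (h n) < outer_int (h n) + ennreal (e * (1/2) ^ Suc n)"
      proof (cases "outer_int (h n)")
        case (real r)
        have "r < r + e * (1/2) ^ Suc n" using e by simp
        then have "ennreal r < ennreal (r + e * (1/2) ^ Suc n)" using real by (subst ennreal_less_iff) auto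
        then show ?thesis using real e by (subst (asm) ennreal_plus) auto
      qed (use False in auto)
      then show ?thesis unfolding outer_int_def INF_less_iff .
    qed
    then obtain F where F: "\<And>n. F n \<in> covers (h n)"
      "\<And>n. (\<Sum>i. ennreal (l (F n i))) < outer_int (h n) + ennreal (e * (1/2) ^ Suc n)" by metis
    have "outer_int (\<lambda>x. \<Sum>n. h n x) \<le> (\<Sum>n. \<Sum>i. ennreal (l (F n i)))"
    proof (rule outer_int_le_double)
      show "F n i \<in> P" for n i using F(1) by (auto simp: covers_def)
      show "(\<Sum>n. h n x) \<le> (\<Sum>n. \<Sum>i. ennreal (F n i x))" if "x \<in> Y" for x
        using F(1) that by (intro suminf_le summableI) (auto simp: covers_def)
    qed
    also have "\<dots> \<le> (\<Sum>n. outer_int (h n) + ennreal (e * (1/2) ^ Suc n))"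
      by (intro suminf_le summableI) (use F(2) less_imp_le in blast)
    also have "\<dots> = (\<Sum>n. outer_int (h n)) + (\<Sum>n. ennreal (e * (1/2) ^ Suc n))"
      by (intro suminf_add[symmetric] summableI)
    also have "(\<Sum>n. ennreal (e * (1/2) ^ Suc n)) = ennreal e"
      using sums_mult[OF power_half_series, of e] e by (intro suminf_ennreal_eq) auto
    finally show "outer_int (\<lambda>x. \<Sum>n. h n x) \<le> (\<Sum>n. outer_int (h n)) + ennreal e" .
  qed
qed

section \<open>Borel measures from the outer integral\<close>

text \<open>The weight h is carried along for a later comparison: h = 1 yields the representing
  measure, and h = f a second measure, of total mass \<open>l f\<close>, which should be f times the
  first.\<close>

definition outer_on :: "('a \<Rightarrow> ennreal) \<Rightarrow> 'a set \<Rightarrow> ennreal" where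
  "outer_on h A = outer_int (\<lambda>x. h x * indicator A x)"

lemma outer_on_measure_space_outer: "outer_measure_space (Pow UNIV) (outer_on h)"
  unfolding outer_measure_space_def
proof (intro conjI)
  show "positive (Pow UNIV) (outer_on h)" by (simp add: positive_def outer_on_def outer_int_zero)
  show "increasing (Pow UNIV) (outer_on h)"
    by (auto simp: increasing_def outer_on_def intro!: outer_int_mono mult_left_mono split: split_indicator)
  show "countably_subadditive (Pow UNIV) (outer_on h)"
    unfolding countably_subadditive_def
  proof (intro allI impI)
    fix A :: "nat \<Rightarrow> 'a set" assume d: "disjoint_family A"
    have "(\<lambda>x. h x * indicator (\<Union>i. A i) x) = (\<lambda>x. \<Sum>i. h x * indicator (A i) x)"
      by (subst suminf_indicator[OF d, symmetric]) simp
    then show "outer_on h (\<Union>i. A i) \<le> (\<Sum>i. outer_on h (A i))"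
      unfolding outer_on_def using outer_int_countably_subadditive[of "\<lambda>i x. h x * indicator (A i) x"]
      by (simp del: ennreal_suminf_cmult)
  qed
qed

lemma outer_int_add_le: "outer_int (\<lambda>x. g x + h x) \<le> outer_int g + outer_int h"
proof -
  define H where "H n = (if n = 0 then g else if n = 1 then h else (\<lambda>_. 0))" for n :: nat
  have s: "(\<Sum>n. f n) = f 0 + f 1" if "\<And>n. n \<ge> 2 \<Longrightarrow> f n = 0" for f :: "nat \<Rightarrow> ennreal"
  proof -
    have "(\<Sum>n. f n) = (\<Sum>n<2. f n)"
      by (rule suminf_finite) (use that in auto)
    then show ?thesis by (simp add: numeral_2_eq_2)
  qed
  have "(\<Sum>n. H n x) = g x + h x" for x by (subst s) (auto simp: H_def)
  moreover have "(\<Sum>n. outer_int (H n)) = outer_int g + outer_int h"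
    by (subst s) (auto simp: H_def outer_int_zero)
  ultimately show ?thesis using outer_int_countably_subadditive[of H] by simp
qed

text \<open>Caratheodory's condition for a box. With {\<phi> > 0} the box, the sum over m of \<phi>
  (1-\<phi>)^m is its indicator, so the functions \<open>G m i\<close> cover the part of h inside
  the box, while (1-\<phi>)^n \<open>F i\<close> still covers the part outside. Both costs together
  are the cost of F, for every n and hence in the limit.\<close>

lemma outer_int_box_split:
  "outer_int (\<lambda>x. h x * indicator (box a b) x) + outer_int (\<lambda>x. h x * indicator (- box a b) x) \<le> outer_int h"
proof -
  obtain \<phi> where phi: "{x. 0 < \<phi> x} = box a b" "\<And>x. 0 \<le> \<phi> x" "\<And>x. \<phi> x \<le> 1"
    "\<And>f. f \<in> V \<Longrightarrow> (\<lambda>x. \<phi> x * f x) \<in> V"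
    using V_box[of a b] by blast
  have PhiP: "(\<lambda>x. \<phi> x * f x) \<in> P" "(\<lambda>x. (1 - \<phi> x) * f x) \<in> P" if "f \<in> P" for f
  proof -
    show "(\<lambda>x. \<phi> x * f x) \<in> P" using that phi by (auto simp: P_def)
    have "(\<lambda>x. f x - \<phi> x * f x) \<in> V" using that phi(4) V_diff by (auto simp: P_def)
    then show "(\<lambda>x. (1 - \<phi> x) * f x) \<in> P"
      using that phi by (auto simp: P_def algebra_simps mult_left_le_one_le)
  qed
  have pow: "(\<lambda>x. (1 - \<phi> x) ^ n * f x) \<in> P" if "f \<in> P" for f n
  proof (induction n)
    case (Suc n)
    then show ?case using PhiP(2)[OF Suc] by (simp add: mult_ac)
  qed (use that in simp)
  show ?thesis
    unfolding outer_int_def[of h]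
  proof (rule INF_greatest)
    fix F assume F: "F \<in> covers h"
    then have FP: "F i \<in> P" for i by (auto simp: covers_def)
    define G where "G m i x = \<phi> x * ((1 - \<phi> x) ^ m * F i x)" for m i x
    have GP: "G m i \<in> P" for m i
      unfolding G_def[abs_def] by (rule PhiP(1)[OF pow[OF FP]])
    \<comment> \<open>Telescoping, since \<phi> (1-\<phi>)^m = (1-\<phi>)^m -
      (1-\<phi>)^(m+1).\<close>
    have split: "l (F i) = (\<Sum>m<n. l (G m i)) + l (\<lambda>x. (1 - \<phi> x) ^ n * F i x)" for i n
    proof (induction n)
      case (Suc n)
      have "(\<lambda>x. (1 - \<phi> x) ^ n * F i x) = (\<lambda>x. G n i x + (1 - \<phi> x) ^ Suc n * F i x)"
        by (auto simp: G_def algebra_simps)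
      then show ?case
        using Suc l_add[OF PD(1)[OF GP] PD(1)[OF pow[OF FP]], of n i "Suc n" i] by simp
    qed simp
    have 1: "outer_int (\<lambda>x. h x * indicator (box a b) x) \<le> (\<Sum>m. \<Sum>i. ennreal (l (G m i)))"
    proof (rule outer_int_le_double[OF GP])
      fix x assume x: "x \<in> Y"
      show "h x * indicator (box a b) x \<le> (\<Sum>m. \<Sum>i. ennreal (G m i x))"
      proof (cases "x \<in> box a b")
        case True
        then have p: "0 < \<phi> x" using phi(1) by blast
        have "(\<lambda>m. (1 - \<phi> x) ^ m) sums (1 / (1 - (1 - \<phi> x)))"
          using p phi(3)[of x] by (intro geometric_sums) auto
        from sums_mult[OF this, of "\<phi> x"] have "(\<lambda>m. \<phi> x * (1 - \<phi> x) ^ m) sums 1" using p by simp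
        then have geo: "(\<Sum>m. ennreal (\<phi> x * (1 - \<phi> x) ^ m)) = 1"
          using phi(2,3) by (subst suminf_ennreal_eq[of _ 1]) auto
        have "(\<Sum>m. \<Sum>i. ennreal (G m i x)) = (\<Sum>m. \<Sum>i. ennreal (\<phi> x * (1 - \<phi> x) ^ m) * ennreal (F i x))"
          using phi(2,3) PD(2)[OF FP] by (simp add: G_def ennreal_mult'[symmetric] mult_ac)
        also have "\<dots> = (\<Sum>i. ennreal (F i x))" using geo by simp
        finally show ?thesis using F x True by (simp add: covers_def)
      qed simp
    qed
    have 2: "outer_int (\<lambda>x. h x * indicator (- box a b) x) \<le> (\<Sum>i. ennreal (l (\<lambda>x. (1 - \<phi> x) ^ n * F i x)))" for n
    proof (rule outer_int_le[OF pow[OF FP]])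
      fix x assume x: "x \<in> Y"
      show "h x * indicator (- box a b) x \<le> (\<Sum>i. ennreal ((1 - \<phi> x) ^ n * F i x))"
      proof (cases "x \<in> box a b")
        case False
        then have "\<phi> x = 0" using phi(1) phi(2)[of x] by (metis mem_Collect_eq order_le_less)
        then show ?thesis using F x False by (simp add: covers_def)
      qed simp
    qed
    have 3: "(\<Sum>m<n. \<Sum>i. ennreal (l (G m i))) + outer_int (\<lambda>x. h x * indicator (- box a b) x)
        \<le> (\<Sum>i. ennreal (l (F i)))" for n
    proof -
      have "(\<Sum>m<n. \<Sum>i. ennreal (l (G m i))) = (\<Sum>i. \<Sum>m<n. ennreal (l (G m i)))"
        by (rule suminf_sum[symmetric]) (rule summableI)
      then have "(\<Sum>m<n. \<Sum>i. ennreal (l (G m i))) + outer_int (\<lambda>x. h x * indicator (- box a b) x)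
         \<le> (\<Sum>i. \<Sum>m<n. ennreal (l (G m i))) + (\<Sum>i. ennreal (l (\<lambda>x. (1 - \<phi> x) ^ n * F i x)))"
        using 2[of n] by (simp add: add_left_mono)
      also have "\<dots> = (\<Sum>i. (\<Sum>m<n. ennreal (l (G m i))) + ennreal (l (\<lambda>x. (1 - \<phi> x) ^ n * F i x)))"
        by (rule suminf_add) (rule summableI)+
      also have "\<dots> = (\<Sum>i. ennreal (l (F i)))"
      proof -
        have "(\<Sum>m<n. ennreal (l (G m i))) + ennreal (l (\<lambda>x. (1 - \<phi> x) ^ n * F i x)) = ennreal (l (F i))" for i
          unfolding split[of i n]
          by (subst sum_ennreal) (auto simp: PD(3)[OF GP] PD(3)[OF pow[OF FP]] sum_nonneg ennreal_plus)
        then show ?thesis by simp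
      qed
      finally show ?thesis .
    qed
    have "(\<Sum>m. \<Sum>i. ennreal (l (G m i))) + outer_int (\<lambda>x. h x * indicator (- box a b) x)
        \<le> (\<Sum>i. ennreal (l (F i)))"
      unfolding suminf_eq_SUP[of "\<lambda>m. \<Sum>i. ennreal (l (G m i))"]
      by (subst ennreal_SUP_add_left[symmetric]) (auto intro: SUP_least 3)
    then show "outer_int (\<lambda>x. h x * indicator (box a b) x) + outer_int (\<lambda>x. h x * indicator (- box a b) x)
        \<le> (\<Sum>i. ennreal (l (F i)))"
      using 1 by (meson add_right_mono order_trans)
  qed
qed

lemma measure_space_outer_on: "measure_space UNIV (sets borel) (outer_on h)"
proof -
  interpret Pw: sigma_algebra UNIV "Pow UNIV :: 'a set set" by (rule sigma_algebra_Pow)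
  let ?L = "lambda_system UNIV (Pow UNIV) (outer_on h)"
  have ms: "measure_space UNIV ?L (outer_on h)"
    by (rule Pw.caratheodory_lemma[OF outer_on_measure_space_outer])
  then have sa: "sigma_algebra UNIV ?L" by (simp add: measure_space_def)
  have "box a b \<in> ?L" for a b :: 'a
  proof -
    have "outer_on h (box a b \<inter> A) + outer_on h ((UNIV - box a b) \<inter> A) = outer_on h A" for A
    proof (rule antisym)
      have "(\<lambda>x. h x * indicator A x * indicator (box a b) x) = (\<lambda>x. h x * indicator (box a b \<inter> A) x)"
        "(\<lambda>x. h x * indicator A x * indicator (- box a b) x) = (\<lambda>x. h x * indicator ((UNIV - box a b) \<inter> A) x)"
        by (auto split: split_indicator)
      then show "outer_on h (box a b \<inter> A) + outer_on h ((UNIV - box a b) \<inter> A) \<le> outer_on h A"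
        using outer_int_box_split[of "\<lambda>x. h x * indicator A x" a b] by (simp add: outer_on_def)
      have "(\<lambda>x. h x * indicator A x) = (\<lambda>x. h x * indicator (box a b \<inter> A) x + h x * indicator ((UNIV - box a b) \<inter> A) x)"
        by (auto split: split_indicator)
      then show "outer_on h A \<le> outer_on h (box a b \<inter> A) + outer_on h ((UNIV - box a b) \<inter> A)"
        unfolding outer_on_def using outer_int_add_le by simp
    qed
    then show ?thesis by (simp add: lambda_system_def)
  qed
  then have "sigma_sets UNIV (range (\<lambda>(a, b). box a b)) \<subseteq> ?L"
    by (intro sigma_algebra.sigma_sets_subset[OF sa]) auto
  then have "sets (borel :: 'a measure) \<subseteq> ?L" by (simp add: borel_eq_box)
  then show ?thesis
    using measure_down[OF ms] sets.sigma_algebra_axioms[of "borel :: 'a measure"] by simp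
qed

definition weighted :: "('a \<Rightarrow> ennreal) \<Rightarrow> 'a measure" where
  "weighted h = measure_of UNIV (sets borel) (outer_on h)"

lemma sets_weighted [simp, measurable_cong]: "sets (weighted h) = sets borel"
  using sets.sigma_sets_eq[of "borel :: 'a measure"] by (simp add: weighted_def)

lemma emeasure_weighted: "A \<in> sets borel \<Longrightarrow> emeasure (weighted h) A = outer_on h A"
  using measure_space_outer_on[of h] unfolding weighted_def measure_space_def
  by (metis emeasure_measure_of_sigma sets.sigma_algebra_axioms space_borel)

text \<open>The nontrivial inequality is a compactness argument: the open sets where a partial sum
  plus d exceeds f increase and cover the compact support K of f, so one partial sum suffices up to
  d. The majorant e of the indicator of K turns the error d into d times \<open>l e\<close>.\<close>

lemma outer_int_P:
  assumes f: "f \<in> P"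
  shows "outer_int (\<lambda>x. ennreal (f x)) = ennreal (l f)"
proof (rule antisym)
  have "outer_int (\<lambda>x. ennreal (f x)) \<le> (\<Sum>i. ennreal (l ((\<lambda>i. if i = 0 then f else (\<lambda>_. 0)) i)))"
  proof (rule outer_int_le)
    show "(if i = 0 then f else (\<lambda>_. 0)) \<in> P" for i :: nat using f zero_P by simp
    show "ennreal (f x) \<le> (\<Sum>i. ennreal ((if i = 0 then f else (\<lambda>_. 0)) x))" for x
      using sum_le_suminf[of "\<lambda>i. ennreal ((if i = 0 then f else (\<lambda>_. 0)) x)" "{0::nat}"] by (simp add: summableI)
  qed
  also have "\<dots> = (\<Sum>i\<in>{0::nat}. ennreal (l ((\<lambda>i. if i = 0 then f else (\<lambda>_. 0)) i)))"
    by (rule suminf_finite) (auto simp: l_zero)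
  finally show "outer_int (\<lambda>x. ennreal (f x)) \<le> ennreal (l f)" by simp
next
  obtain K where K: "compact K" "K \<subseteq> Y" "\<And>x. x \<notin> K \<Longrightarrow> f x = 0" using V_supp[OF PD(1)[OF f]] by blast
  obtain e where e: "e \<in> P" "\<And>x. x \<in> K \<Longrightarrow> 1 \<le> e x" using V_dom[OF K(1,2)] by (auto simp: P_def)
  show "ennreal (l f) \<le> outer_int (\<lambda>x. ennreal (f x))"
    unfolding outer_int_def
  proof (rule INF_greatest)
    fix F assume F: "F \<in> covers (\<lambda>x. ennreal (f x))"
    then have FP: "F i \<in> P" for i by (auto simp: covers_def)
    have main: "ennreal (l f) \<le> (\<Sum>i. ennreal (l (F i))) + ennreal (d * l e)" if d: "d > 0" for d
    proof -
      define O' where "O' N = {x. f x < (\<Sum>i<N. F i x) + d}" for N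
      have cF: "continuous_on UNIV (\<lambda>x. \<Sum>i<N. F i x)" for N
        using V_cont[OF PD(1)[OF FP]] by (intro continuous_intros) auto
      have op: "open (O' N)" for N
        unfolding O'_def using V_cont[OF PD(1)[OF f]] cF[of N]
        by (intro open_Collect_less continuous_on_add continuous_on_const)
      have mono: "O' N \<subseteq> O' M" if "N \<le> M" for N M
      proof -
        have "(\<Sum>i<N. F i x) \<le> (\<Sum>i<M. F i x)" for x
          by (rule sum_mono2) (use that PD(2)[OF FP] in auto)
        then show ?thesis unfolding O'_def by (smt (verit) Collect_mono)
      qed
      have "K \<subseteq> (\<Union>N. O' N)"
      proof
        fix x assume "x \<in> K"
        then have le: "ennreal (f x) \<le> (\<Sum>i. ennreal (F i x))" using F K(2) by (auto simp: covers_def)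
        show "x \<in> (\<Union>N. O' N)"
        proof (cases "f x < d")
          case True
          then have "x \<in> O' 0" by (simp add: O'_def)
          then show ?thesis by blast
        next
          case False
          then have "ennreal (f x - d) < ennreal (f x)" using d by (simp add: ennreal_lessI)
          then have "ennreal (f x - d) < (SUP N. \<Sum>i<N. ennreal (F i x))"
            using le by (simp add: suminf_eq_SUP)
          then obtain N where "ennreal (f x - d) < (\<Sum>i<N. ennreal (F i x))"
            unfolding less_SUP_iff by blast
          then have "ennreal (f x - d) < ennreal (\<Sum>i<N. F i x)"
            using PD(2)[OF FP] by simp
          then have "f x - d < (\<Sum>i<N. F i x)"
            using False by (subst (asm) ennreal_less_iff) auto
          then have "x \<in> O' N" by (simp add: O'_def)
          then show ?thesis by blast
        qed
      qed
      then obtain C where C: "finite C" "K \<subseteq> (\<Union>N\<in>C. O' N)"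
        using compactE_image[OF K(1), of UNIV O'] op by auto
      define N where "N = Max (insert 0 C)"
      have "K \<subseteq> O' N"
      proof
        fix x assume "x \<in> K"
        then obtain M where "M \<in> C" "x \<in> O' M" using C by blast
        then show "x \<in> O' N" using mono[of M N] C(1) by (auto simp: N_def)
      qed
      let ?S = "\<lambda>x. \<Sum>i<N. F i x"
      have S: "?S \<in> P" "l ?S = (\<Sum>i<N. l (F i))" using sum_P[of "{..<N}" F] FP by auto
      have "l f \<le> l (\<lambda>x. ?S x + d * e x)"
      proof (rule l_mono[OF PD(1)[OF f] V_add[OF PD(1)[OF S(1)] V_scale[OF PD(1)[OF e(1)]]]])
        fix x
        show "f x \<le> ?S x + d * e x"
        proof (cases "x \<in> K")
          case True
          then have "f x < ?S x + d" using \<open>K \<subseteq> O' N\<close> by (auto simp: O'_def)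
          moreover have "d * 1 \<le> d * e x" using e(2)[OF True] d by (intro mult_left_mono) auto
          ultimately show ?thesis by simp
        next
          case False
          then show ?thesis using K(3) PD(2)[OF S(1), of x] PD(2)[OF e(1), of x] d by simp
        qed
      qed
      also have "\<dots> = (\<Sum>i<N. l (F i)) + d * l e"
        using S l_add[OF PD(1)[OF S(1)] V_scale[OF PD(1)[OF e(1)]]] l_scale[OF PD(1)[OF e(1)]] by simp
      finally have "ennreal (l f) \<le> ennreal ((\<Sum>i<N. l (F i)) + d * l e)" by (rule ennreal_leI)
      also have "\<dots> = (\<Sum>i<N. ennreal (l (F i))) + ennreal (d * l e)"
        using PD(3)[OF FP] PD(3)[OF e(1)] d by (subst ennreal_plus) (auto intro: sum_nonneg)
      also have "\<dots> \<le> (\<Sum>i. ennreal (l (F i))) + ennreal (d * l e)"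
        by (intro add_right_mono sum_le_suminf summableI) auto
      finally show ?thesis .
    qed
    show "ennreal (l f) \<le> (\<Sum>i. ennreal (l (F i)))"
    proof (rule ennreal_le_epsilon)
      fix d :: real assume d: "d > 0"
      have le: "0 \<le> l e" using PD(3)[OF e(1)] .
      have "d / (l e + 1) * l e \<le> d" using d le by (simp add: field_simps)
      then have "ennreal (d / (l e + 1) * l e) \<le> ennreal d" by (rule ennreal_leI)
      then show "ennreal (l f) \<le> (\<Sum>i. ennreal (l (F i))) + ennreal d"
        using main[of "d / (l e + 1)"] d le by (meson add_left_mono order_trans divide_pos_pos add_nonneg_pos zero_less_one)
    qed
  qed
qed

lemma outer_int_scale:
  assumes c: "0 \<le> c"
  shows "outer_int (\<lambda>x. ennreal c * h x) \<le> ennreal c * outer_int h"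
proof (cases "c = 0")
  case False
  then have c: "c > 0" using assms by simp
  have "outer_int (\<lambda>x. ennreal c * h x) \<le> ennreal c * (\<Sum>i. ennreal (l (F i)))" if F: "F \<in> covers h" for F
  proof -
    have FP: "F i \<in> P" for i using F by (auto simp: covers_def)
    have "outer_int (\<lambda>x. ennreal c * h x) \<le> (\<Sum>i. ennreal (l (\<lambda>x. c * F i x)))"
    proof (rule outer_int_le)
      show "(\<lambda>x. c * F i x) \<in> P" for i using FP V_scale c by (auto simp: P_def)
      show "ennreal c * h x \<le> (\<Sum>i. ennreal (c * F i x))" if "x \<in> Y" for x
      proof -
        have "(\<Sum>i. ennreal (c * F i x)) = ennreal c * (\<Sum>i. ennreal (F i x))"
          using c PD(2)[OF FP] by (simp add: ennreal_mult)
        then show ?thesis using F that by (auto simp: covers_def intro: mult_left_mono)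
      qed
    qed
    also have "\<dots> = ennreal c * (\<Sum>i. ennreal (l (F i)))"
      using c PD(3)[OF FP] l_scale[OF PD(1)[OF FP]] by (simp add: ennreal_mult)
    finally show ?thesis .
  qed
  then have *: "outer_int (\<lambda>x. ennreal c * h x) / ennreal c \<le> (\<Sum>i. ennreal (l (F i)))" if "F \<in> covers h" for F
    using that c by (simp add: divide_le_posI_ennreal)
  have "outer_int (\<lambda>x. ennreal c * h x) / ennreal c \<le> outer_int h"
    unfolding outer_int_def[of h] by (rule INF_greatest) (rule *)
  then have "ennreal c * (outer_int (\<lambda>x. ennreal c * h x) / ennreal c) \<le> ennreal c * outer_int h"
    by (rule mult_left_mono) simp
  moreover have "ennreal c * (x / ennreal c) = x" for x
    using c by (simp add: ennreal_times_divide mult.commute[of "ennreal c"] ennreal_mult_divide_eq)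
  ultimately show ?thesis by simp
qed (simp add: outer_int_zero)

section \<open>The representing measure\<close>

definition rep_measure :: "'a measure" where "rep_measure = weighted (\<lambda>_. 1)"

lemma sets_rep_measure [simp, measurable_cong]: "sets rep_measure = sets borel"
  by (simp add: rep_measure_def)

lemma space_rep_measure [simp]: "space rep_measure = UNIV"
  using sets_eq_imp_space_eq[OF sets_rep_measure] by simp

lemma rep_measure_compl: "emeasure rep_measure (- Y) = 0"
proof -
  have "- Y \<in> sets borel" using Y_open by simp
  moreover have "outer_int (indicator (- Y)) \<le> outer_int (\<lambda>_. 0)"
    by (rule outer_int_mono) auto
  ultimately show ?thesis
    by (simp add: rep_measure_def emeasure_weighted outer_on_def outer_int_zero)
qed

lemma rep_measure_compact:
  assumes "compact K" "K \<subseteq> Y"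
  shows "emeasure rep_measure K < \<infinity>"
proof -
  obtain e where e: "e \<in> P" "\<And>x. x \<in> K \<Longrightarrow> 1 \<le> e x" using V_dom[OF assms] by (auto simp: P_def)
  have "emeasure rep_measure K = outer_int (indicator K)"
    using assms by (simp add: rep_measure_def emeasure_weighted outer_on_def compact_imp_closed)
  also have "\<dots> \<le> outer_int (\<lambda>x. ennreal (e x))"
    by (rule outer_int_mono) (use e(2) in \<open>auto split: split_indicator simp: ennreal_1[symmetric] simp del: ennreal_1 intro: ennreal_leI\<close>)
  also have "\<dots> = ennreal (l e)" by (rule outer_int_P[OF e(1)])
  finally show ?thesis by (simp add: le_less_trans)
qed

lemma P_bounded:
  assumes f: "f \<in> V"
  obtains M where "M > 0" "\<And>x. \<bar>f x\<bar> \<le> M"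
proof -
  obtain K where K: "compact K" "\<And>x. x \<notin> K \<Longrightarrow> f x = 0" using V_supp[OF f] by blast
  have "compact (f ` K)"
    using continuous_on_subset[OF V_cont[OF f]] K(1) by (intro compact_continuous_image) auto
  then have "bounded (f ` K)" by (rule compact_imp_bounded)
  then obtain M where M: "\<And>x. x \<in> K \<Longrightarrow> \<bar>f x\<bar> \<le> M"
    unfolding bounded_iff by auto
  have "\<bar>f x\<bar> \<le> max M 1" for x
  proof (cases "x \<in> K")
    case True
    then show ?thesis using M[OF True] by linarith
  qed (use K(2) in simp)
  then show thesis using that[of "max M 1"] by auto
qed

text \<open>Compares f times the representing measure with the weighted measure \<open>?D\<close>,
  whose total mass is \<open>l f\<close>. On the slice \<open>S k\<close>, where f lies between k d
  and (k+1) d, the two differ by at most d times the mass of the slice inside the support K. Summed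
  over k, the error is d times the finite mass of K.\<close>

lemma nn_integral_rep_measure:
  assumes f: "f \<in> P"
  shows "(\<integral>\<^sup>+x. ennreal (f x) \<partial>rep_measure) = ennreal (l f)"
proof -
  obtain K where K: "compact K" "K \<subseteq> Y" "\<And>x. x \<notin> K \<Longrightarrow> f x = 0" using V_supp[OF PD(1)[OF f]] by blast
  have f_meas [measurable]: "f \<in> borel_measurable borel"
    using V_cont[OF PD(1)[OF f]] by (rule borel_measurable_continuous_onI)
  have K_meas [measurable]: "K \<in> sets borel" using K(1) by (simp add: compact_imp_closed)
  have K_fin: "emeasure rep_measure K < \<infinity>" by (rule rep_measure_compact[OF K(1,2)])
  let ?m = "emeasure rep_measure K" and ?I = "\<integral>\<^sup>+x. ennreal (f x) \<partial>rep_measure"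
  let ?D = "weighted (\<lambda>x. ennreal (f x))"
  have D_UNIV: "emeasure ?D UNIV = ennreal (l f)"
    by (simp add: emeasure_weighted outer_on_def outer_int_P[OF f])
  have key: "?I \<le> ennreal (l f) + ennreal d * ?m \<and> ennreal (l f) \<le> ?I + ennreal d * ?m" if d: "d > 0" for d
  proof -
    define S where "S k = {x. real k * d \<le> f x \<and> f x < real (Suc k) * d}" for k :: nat
    have S_meas [measurable]: "S k \<in> sets borel" for k unfolding S_def by measurable
    have inS: "x \<in> S k \<longleftrightarrow> k = nat \<lfloor>f x / d\<rfloor>" for x k
    proof -
      have "x \<in> S k \<longleftrightarrow> real k \<le> f x / d \<and> f x / d < real k + 1"
        using d by (simp add: S_def field_simps)
      also have "\<dots> \<longleftrightarrow> \<lfloor>f x / d\<rfloor> = int k" by (simp add: floor_eq_iff)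
      also have "\<dots> \<longleftrightarrow> k = nat \<lfloor>f x / d\<rfloor>"
        using PD(2)[OF f, of x] d by auto
      finally show ?thesis .
    qed
    have dS: "disjoint_family S" by (auto simp: disjoint_family_on_def inS)
    have US: "(\<Union>k. S k) = UNIV" by (auto simp: inS)
    have split: "(\<integral>\<^sup>+x. g x \<partial>rep_measure) = (\<Sum>k. \<integral>\<^sup>+x. g x * indicator (S k) x \<partial>rep_measure)"
      if [measurable]: "g \<in> borel_measurable borel" for g :: "'a \<Rightarrow> ennreal"
    proof -
      have "(\<integral>\<^sup>+x. g x \<partial>rep_measure) = (\<integral>\<^sup>+x. (\<Sum>k. g x * indicator (S k) x) \<partial>rep_measure)"
        using suminf_indicator[OF dS] by (simp add: US)
      also have "\<dots> = (\<Sum>k. \<integral>\<^sup>+x. g x * indicator (S k) x \<partial>rep_measure)"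
        by (rule nn_integral_suminf) measurable
      finally show ?thesis .
    qed
    have D_split: "ennreal (l f) = (\<Sum>k. emeasure ?D (S k))"
      using suminf_emeasure[of S ?D] dS D_UNIV by (simp add: US image_subset_iff)
    have mK: "?m = (\<Sum>k. emeasure rep_measure (S k \<inter> K))"
      using split[of "indicator K"] by (simp add: indicator_inter_arith[symmetric] Int_commute)
    have mk: "outer_int (indicator (S k \<inter> K)) = emeasure rep_measure (S k \<inter> K)" for k
      by (simp add: rep_measure_def emeasure_weighted outer_on_def)
    have Dk: "emeasure ?D (S k) = outer_int (\<lambda>x. ennreal (f x) * indicator (S k) x)" for k
      by (simp add: emeasure_weighted outer_on_def)
    have fS_le: "ennreal (f x) * indicator (S k) x \<le> ennreal (real (Suc k) * d) * indicator (S k \<inter> K) x" for k x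
    proof (cases "x \<in> S k")
      case True
      then have "ennreal (f x) \<le> ennreal (real (Suc k) * d)" by (intro ennreal_leI) (simp add: S_def)
      then show ?thesis using True K(3)[of x] by (cases "x \<in> K") (simp_all del: of_nat_Suc)
    qed simp
    have fS_ge: "ennreal (real k * d) * indicator (S k \<inter> K) x \<le> ennreal (f x) * indicator (S k) x" for k x
    proof (cases "x \<in> S k")
      case True
      then have "ennreal (real k * d) \<le> ennreal (f x)" by (intro ennreal_leI) (simp add: S_def)
      then show ?thesis using True by (cases "x \<in> K") simp_all
    qed simp
    have up: "emeasure ?D (S k) \<le> (\<integral>\<^sup>+x. ennreal (f x) * indicator (S k) x \<partial>rep_measure)
        + ennreal d * emeasure rep_measure (S k \<inter> K)" for k
    proof -
      have "emeasure ?D (S k) \<le> outer_int (\<lambda>x. ennreal (real (Suc k) * d) * indicator (S k \<inter> K) x)"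
        unfolding Dk by (rule outer_int_mono) (rule fS_le)
      also have "\<dots> \<le> ennreal (real (Suc k) * d) * emeasure rep_measure (S k \<inter> K)"
        using outer_int_scale[of "real (Suc k) * d" "indicator (S k \<inter> K)"] d by (simp add: mk)
      also have "\<dots> = ennreal (real k * d) * emeasure rep_measure (S k \<inter> K) + ennreal d * emeasure rep_measure (S k \<inter> K)"
        using d by (simp add: distrib_right[symmetric] ennreal_plus[symmetric] algebra_simps del: ennreal_plus)
      also have "ennreal (real k * d) * emeasure rep_measure (S k \<inter> K)
          = (\<integral>\<^sup>+x. ennreal (real k * d) * indicator (S k \<inter> K) x \<partial>rep_measure)"
        by (simp add: nn_integral_cmult_indicator)
      also have "\<dots> \<le> (\<integral>\<^sup>+x. ennreal (f x) * indicator (S k) x \<partial>rep_measure)"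
        by (rule nn_integral_mono) (rule fS_ge)
      finally show ?thesis by (simp add: add_right_mono)
    qed
    have low: "(\<integral>\<^sup>+x. ennreal (f x) * indicator (S k) x \<partial>rep_measure)
        \<le> emeasure ?D (S k) + ennreal d * emeasure rep_measure (S k \<inter> K)" for k
    proof -
      have "(\<integral>\<^sup>+x. ennreal (f x) * indicator (S k) x \<partial>rep_measure)
          \<le> (\<integral>\<^sup>+x. ennreal (real (Suc k) * d) * indicator (S k \<inter> K) x \<partial>rep_measure)"
        by (rule nn_integral_mono) (rule fS_le)
      also have "\<dots> = ennreal (real (Suc k) * d) * emeasure rep_measure (S k \<inter> K)"
        by (simp add: nn_integral_cmult_indicator)
      also have "\<dots> = ennreal (real k * d) * emeasure rep_measure (S k \<inter> K) + ennreal d * emeasure rep_measure (S k \<inter> K)"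
        using d by (simp add: distrib_right[symmetric] ennreal_plus[symmetric] algebra_simps del: ennreal_plus)
      also have "ennreal (real k * d) * emeasure rep_measure (S k \<inter> K) \<le> emeasure ?D (S k)"
      \<comment> \<open>The outer integral is known only to be subhomogeneous, so this lower bound
        for \<open>?D\<close> is obtained by scaling with 1/(k d); the slice k = 0 is trivial and
        treated apart.\<close>
      proof (cases "k = 0")
        case False
        let ?c = "real k * d"
        have c: "?c > 0" using False d by simp
        have "outer_int (indicator (S k \<inter> K)) \<le> outer_int (\<lambda>x. ennreal (1 / ?c) * (ennreal (f x) * indicator (S k) x))"
        proof (rule outer_int_mono)
          fix x
          show "indicator (S k \<inter> K) x \<le> ennreal (1 / ?c) * (ennreal (f x) * indicator (S k) x)"
          proof (cases "x \<in> S k \<inter> K")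
            case True
            then have "1 \<le> 1 / ?c * f x" using c by (simp add: S_def field_simps)
            then have "ennreal 1 \<le> ennreal (1 / ?c * f x)" by (rule ennreal_leI)
            then have "1 \<le> ennreal (1 / ?c) * ennreal (f x)"
              using c PD(2)[OF f, of x] by (metis ennreal_1 ennreal_mult' divide_nonneg_pos zero_le_one)
            then show ?thesis using True by simp
          qed simp
        qed
        also have "\<dots> \<le> ennreal (1 / ?c) * emeasure ?D (S k)"
          unfolding Dk using c by (intro outer_int_scale) simp
        finally have "ennreal ?c * emeasure rep_measure (S k \<inter> K) \<le> ennreal ?c * (ennreal (1 / ?c) * emeasure ?D (S k))"
          unfolding mk by (rule mult_left_mono) simp
        also have "\<dots> = emeasure ?D (S k)"
          using False d by (simp add: mult.assoc[symmetric] ennreal_mult[symmetric])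
        finally show ?thesis .
      qed simp
      finally show ?thesis by (simp add: add_right_mono)
    qed
    have I: "?I = (\<Sum>k. \<integral>\<^sup>+x. ennreal (f x) * indicator (S k) x \<partial>rep_measure)" by (rule split) measurable
    have "?I \<le> (\<Sum>k. emeasure ?D (S k) + ennreal d * emeasure rep_measure (S k \<inter> K))"
      unfolding I by (intro suminf_le summableI low)
    also have "\<dots> = ennreal (l f) + ennreal d * ?m"
      unfolding D_split mK by (subst suminf_add[symmetric]) (auto intro: summableI)
    finally have 1: "?I \<le> ennreal (l f) + ennreal d * ?m" .
    have "ennreal (l f) \<le> (\<Sum>k. (\<integral>\<^sup>+x. ennreal (f x) * indicator (S k) x \<partial>rep_measure)
        + ennreal d * emeasure rep_measure (S k \<inter> K))"
      unfolding D_split by (intro suminf_le summableI up)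
    also have "\<dots> = ?I + ennreal d * ?m"
      unfolding I mK by (subst suminf_add[symmetric]) (auto intro: summableI)
    finally show ?thesis using 1 by blast
  qed
  obtain m where m: "?m = ennreal m" "m \<ge> 0" using K_fin by (cases ?m) auto
  have small: "ennreal (e / (m + 1)) * ?m \<le> ennreal e" if "e > 0" for e
  proof -
    have "ennreal (e / (m + 1)) * ?m = ennreal (e / (m + 1) * m)"
      unfolding m(1) using m(2) that by (intro ennreal_mult[symmetric]) auto
    also have "\<dots> \<le> ennreal e" using m that by (intro ennreal_leI) (simp add: field_simps)
    finally show ?thesis .
  qed
  show ?thesis
  proof (rule antisym; rule ennreal_le_epsilon)
    fix e :: real assume e: "e > 0"
    have p: "e / (m + 1) > 0" using e m by simp
    show "?I \<le> ennreal (l f) + ennreal e" using key[OF p] small[OF e] by (meson add_left_mono order_trans)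
    show "ennreal (l f) \<le> ?I + ennreal e" using key[OF p] small[OF e] by (meson add_left_mono order_trans)
  qed
qed

text \<open>The positive and negative parts of f need not lie in V. Instead f is the difference of f
  + M e and M e, both nonnegative members of V, with e a majorant of the support of f.\<close>

lemma integral_rep_measure:
  assumes f: "f \<in> V"
  shows "integrable rep_measure f" "integral\<^sup>L rep_measure f = l f"
proof -
  have P: "integrable rep_measure g \<and> integral\<^sup>L rep_measure g = l g" if g: "g \<in> P" for g
  proof -
    have [measurable]: "g \<in> borel_measurable borel"
      using V_cont[OF PD(1)[OF g]] by (rule borel_measurable_continuous_onI)
    have i: "integrable rep_measure g"
      using nn_integral_rep_measure[OF g] PD(2)[OF g] by (intro integrableI_nonneg) auto
    have "ennreal (integral\<^sup>L rep_measure g) = ennreal (l g)"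
      using nn_integral_eq_integral[OF i] PD(2)[OF g] nn_integral_rep_measure[OF g] by simp
    then show ?thesis using i PD(2,3)[OF g] by (simp add: integral_nonneg_AE)
  qed
  obtain K where K: "compact K" "K \<subseteq> Y" "\<And>x. x \<notin> K \<Longrightarrow> f x = 0" using V_supp[OF f] by blast
  obtain e where e: "e \<in> P" "\<And>x. x \<in> K \<Longrightarrow> 1 \<le> e x" using V_dom[OF K(1,2)] by (auto simp: P_def)
  obtain M where M: "M > 0" "\<And>x. \<bar>f x\<bar> \<le> M" using P_bounded[OF f] by blast
  have MeV: "(\<lambda>x. M * e x) \<in> V" using V_scale[OF PD(1)[OF e(1)]] .
  have Me: "(\<lambda>x. M * e x) \<in> P" using MeV PD(2)[OF e(1)] M(1) by (simp add: P_def)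
  have "0 \<le> f x + M * e x" for x
  proof (cases "x \<in> K")
    case True
    then have "M * 1 \<le> M * e x" using M e(2) by (intro mult_left_mono) auto
    then show ?thesis using M(2)[of x] by linarith
  next
    case False
    then show ?thesis using K(3) M PD(2)[OF e(1), of x] by simp
  qed
  then have fMe: "(\<lambda>x. f x + M * e x) \<in> P" using V_add[OF f MeV] by (simp add: P_def)
  have eq: "f = (\<lambda>x. (f x + M * e x) - M * e x)" by simp
  show "integrable rep_measure f"
    by (subst eq) (intro Bochner_Integration.integrable_diff conjunct1[OF P[OF fMe]] conjunct1[OF P[OF Me]])
  have "integral\<^sup>L rep_measure f = l (\<lambda>x. f x + M * e x) - l (\<lambda>x. M * e x)"
    by (subst eq, subst Bochner_Integration.integral_diff) (use P[OF fMe] P[OF Me] in auto)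
  then show "integral\<^sup>L rep_measure f = l f" using l_add[OF f MeV] by simp
qed

text \<open>For e in P the measures e M1 and e M2 are finite and agree on boxes, because e -
  (1-\<phi>)^n e increases to e times the indicator of a box. Dividing by e on compact sets where e
  >= 1 and exhausting Y gives equality of M1 and M2.\<close>

lemma representing_measure_unique:
  assumes sets: "sets M1 = sets borel" "sets M2 = sets borel"
    and null: "emeasure M1 (- Y) = 0" "emeasure M2 (- Y) = 0"
    and int1: "\<And>f. f \<in> V \<Longrightarrow> integrable M1 f \<and> integral\<^sup>L M1 f = l f"
    and int2: "\<And>f. f \<in> V \<Longrightarrow> integrable M2 f \<and> integral\<^sup>L M2 f = l f"
  shows "M1 = M2"
proof -
  note [measurable_cong] = sets
  have meas: "f \<in> borel_measurable borel" if "f \<in> V" for f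
    using V_cont[OF that] by (rule borel_measurable_continuous_onI)
  have boxes: "(\<integral>\<^sup>+x. ennreal (e x) * indicator (box a b) x \<partial>M) = (SUP n. ennreal (l (e' n)))"
    if e: "e \<in> P" and e': "\<And>n. e' n = (\<lambda>x. e x - (1 - \<phi> x) ^ n * e x)"
      and phi: "{x. 0 < \<phi> x} = box a b" "\<And>x. 0 \<le> \<phi> x" "\<And>x. \<phi> x \<le> 1"
      and eV: "\<And>n. e' n \<in> P"
      and M: "sets M = sets borel" "\<And>f. f \<in> V \<Longrightarrow> integrable M f \<and> integral\<^sup>L M f = l f"
    for e a b \<phi> e' and M :: "'a measure"
  proof -
    note [measurable_cong] = M(1)
    have inc: "incseq (\<lambda>n x. ennreal (e' n x))"
    proof (intro incseq_SucI le_funI ennreal_leI)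
      fix n x
      have "(1 - \<phi> x) ^ Suc n * e x \<le> (1 - \<phi> x) ^ n * e x"
        using phi(2,3)[of x] PD(2)[OF e, of x] by (intro mult_right_mono power_decreasing) auto
      then show "e' n x \<le> e' (Suc n) x" by (simp add: e')
    qed
    have lim: "(SUP n. ennreal (e' n x)) = ennreal (e x) * indicator (box a b) x" for x
    proof (rule LIMSEQ_unique[OF LIMSEQ_SUP])
      show "incseq (\<lambda>n. ennreal (e' n x))" using inc by (auto simp: incseq_def le_fun_def)
      show "(\<lambda>n. ennreal (e' n x)) \<longlonglongrightarrow> ennreal (e x) * indicator (box a b) x"
      proof (cases "x \<in> box a b")
        case True
        then have "0 < \<phi> x" using phi(1) by blast
        then have "(\<lambda>n. (1 - \<phi> x) ^ n) \<longlonglongrightarrow> 0" using phi(3)[of x] by (intro LIMSEQ_power_zero) (auto simp: abs_if)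
        then have "(\<lambda>n. e' n x) \<longlonglongrightarrow> e x - 0 * e x" unfolding e' by (intro tendsto_diff tendsto_mult tendsto_const)
        then show ?thesis using True by (simp add: tendsto_ennrealI)
      next
        case False
        then have "\<phi> x = 0" using phi(1) phi(2)[of x] by (metis mem_Collect_eq order_le_less)
        then show ?thesis using False by (simp add: e')
      qed
    qed
    have [measurable]: "e' n \<in> borel_measurable borel" for n using meas eV PD(1) by blast
    have "(\<integral>\<^sup>+x. ennreal (e x) * indicator (box a b) x \<partial>M) = (\<integral>\<^sup>+x. (SUP n. ennreal (e' n x)) \<partial>M)"
      by (simp add: lim)
    also have "\<dots> = (SUP n. \<integral>\<^sup>+x. ennreal (e' n x) \<partial>M)"
      by (rule nn_integral_monotone_convergence_SUP[OF inc]) measurable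
    also have "\<dots> = (SUP n. ennreal (l (e' n)))"
      using M(2)[OF PD(1)[OF eV]] PD(2)[OF eV] by (simp add: nn_integral_eq_integral)
    finally show ?thesis .
  qed
  have dens: "density M1 (\<lambda>x. ennreal (e x)) = density M2 (\<lambda>x. ennreal (e x))" if e: "e \<in> P" for e
  proof (rule measure_eqI_generator_eq[where E = "range (\<lambda>(a, b). box a b)" and \<Omega> = UNIV
        and A = "\<lambda>i. box (- (real i *\<^sub>R One)) (real i *\<^sub>R One)"])
    have [measurable]: "e \<in> borel_measurable borel" using meas e PD(1) by blast
    show "Int_stable (range (\<lambda>(a, b). box a b :: 'a set))"
      by (auto simp: Int_stable_def box_Int_box)
    show "emeasure (density M1 (\<lambda>x. ennreal (e x))) X = emeasure (density M2 (\<lambda>x. ennreal (e x))) X"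
      if X_box: "X \<in> range (\<lambda>(a, b). box a b)" for X
    proof -
      obtain a b where X: "X = box a b" using X_box by auto
      obtain \<phi> where phi: "{x. 0 < \<phi> x} = box a b" "\<And>x. 0 \<le> \<phi> x" "\<And>x. \<phi> x \<le> 1"
        "\<And>f. f \<in> V \<Longrightarrow> (\<lambda>x. \<phi> x * f x) \<in> V"
        using V_box[of a b] by blast
      have pow: "(\<lambda>x. (1 - \<phi> x) ^ n * e x) \<in> V" for n
      proof (induction n)
        case (Suc n)
        then show ?case using V_diff[OF Suc phi(4)[OF Suc]] by (simp add: algebra_simps)
      qed (use e PD(1) in simp)
      define e' where "e' n = (\<lambda>x. e x - (1 - \<phi> x) ^ n * e x)" for n
      have e'P: "e' n \<in> P" for n
      proof -
        have "(1 - \<phi> x) ^ n * e x \<le> e x" for x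
          using phi(2,3)[of x] PD(2)[OF e, of x] by (simp add: mult_left_le_one_le power_le_one)
        then show ?thesis using V_diff[OF PD(1)[OF e] pow] by (simp add: P_def e'_def)
      qed
      show ?thesis
        using boxes[OF e e'_def phi(1-3) e'P sets(1) int1] boxes[OF e e'_def phi(1-3) e'P sets(2) int2]
        by (simp add: emeasure_density X)
    qed
    show "emeasure (density M1 (\<lambda>x. ennreal (e x))) (box (- (real i *\<^sub>R One)) (real i *\<^sub>R One)) \<noteq> \<infinity>" for i
    proof -
      have "emeasure (density M1 (\<lambda>x. ennreal (e x))) (box (- (real i *\<^sub>R One)) (real i *\<^sub>R One))
         \<le> (\<integral>\<^sup>+x. ennreal (e x) \<partial>M1)"
        by (subst emeasure_density) (auto intro!: nn_integral_mono split: split_indicator)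
      also have "\<dots> = ennreal (l e)"
        using int1[OF PD(1)[OF e]] PD(2)[OF e] by (simp add: nn_integral_eq_integral)
      finally show ?thesis by (auto simp: top_unique)
    qed
  qed (auto simp: sets borel_eq_box UN_box_eq_UNIV image_subset_iff)
  obtain C where C: "\<And>n. compact (C n)" "\<And>n. C n \<subseteq> Y" "\<And>n. C n \<subseteq> interior (C (Suc n))" "\<Union> (range C) = Y"
    using open_Union_compact_subsets[OF Y_open] by metis
  have incC: "C n \<subseteq> C (Suc n)" for n using C(3) interior_subset by blast
  show ?thesis
  proof (rule measure_eqI)
    fix A assume "A \<in> sets M1"
    then have [measurable]: "A \<in> sets borel" using sets by simp
    have [measurable]: "C n \<in> sets borel" for n using C(1) by (simp add: compact_imp_closed)
    have [measurable]: "Y \<in> sets borel" using Y_open by simp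
    have AC: "emeasure M (A \<inter> C n) = (\<integral>\<^sup>+x. ennreal (1 / e x) * indicator (A \<inter> C n) x \<partial>density M (\<lambda>x. ennreal (e x)))"
      if e: "e \<in> P" "\<And>x. x \<in> C n \<Longrightarrow> 1 \<le> e x" and M: "sets M = sets borel" for e n and M :: "'a measure"
    proof -
      note [measurable_cong] = M
      have [measurable]: "e \<in> borel_measurable borel" using meas e PD(1) by blast
      have "(\<integral>\<^sup>+x. ennreal (1 / e x) * indicator (A \<inter> C n) x \<partial>density M (\<lambda>x. ennreal (e x)))
         = (\<integral>\<^sup>+x. ennreal (e x) * (ennreal (1 / e x) * indicator (A \<inter> C n) x) \<partial>M)"
        by (rule nn_integral_density) measurable
      also have "\<dots> = (\<integral>\<^sup>+x. indicator (A \<inter> C n) x \<partial>M)"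
      proof (rule nn_integral_cong)
        fix x
        have "ennreal (e x) * ennreal (1 / e x) = 1" if "x \<in> C n"
          using e(2)[OF that] by (simp add: ennreal_mult[symmetric])
        then show "ennreal (e x) * (ennreal (1 / e x) * indicator (A \<inter> C n) x) = indicator (A \<inter> C n) x"
          by (auto split: split_indicator)
      qed
      also have "\<dots> = emeasure M (A \<inter> C n)" by simp
      finally show ?thesis by simp
    qed
    have eqn: "emeasure M1 (A \<inter> C n) = emeasure M2 (A \<inter> C n)" for n
    proof -
      obtain e where e: "e \<in> P" "\<And>x. x \<in> C n \<Longrightarrow> 1 \<le> e x"
        using V_dom[OF C(1,2), of n] by (auto simp: P_def)
      show ?thesis using AC[OF e sets(1)] AC[OF e sets(2)] dens[OF e(1)] by simp
    qed
    have lim: "emeasure M A = (SUP n. emeasure M (A \<inter> C n))"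
      if M: "sets M = sets borel" "emeasure M (- Y) = 0" for M :: "'a measure"
    proof -
      note [measurable_cong] = M(1)
      have "emeasure M A = emeasure M (A \<inter> Y)"
      proof (rule emeasure_eq_AE)
        have "- Y \<in> null_sets M" using M Y_open by (simp add: null_sets_def)
        then have "AE x in M. x \<in> Y" by (rule AE_I') auto
        then show "AE x in M. (x \<in> A) = (x \<in> A \<inter> Y)" by eventually_elim simp
      qed (simp_all add: M)
      also have "A \<inter> Y = (\<Union>n. A \<inter> C n)" using C(4) by auto
      also have "emeasure M \<dots> = (SUP n. emeasure M (A \<inter> C n))"
        by (rule SUP_emeasure_incseq[symmetric]) (use M incC in \<open>auto intro!: incseq_SucI\<close>)
      finally show ?thesis .
    qed
    show "emeasure M1 A = emeasure M2 A"
      using lim[OF sets(1) null(1)] lim[OF sets(2) null(2)] eqn by simp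
  qed (simp add: sets)
qed

end

section \<open>Foliations by the orbits of a linear flow\<close>

definition lin_flow :: "complex ^ 'n \<Rightarrow> complex ^ 'n \<Rightarrow> complex \<Rightarrow> complex ^ 'n" where
  "lin_flow lam p \<zeta> = (\<chi> j. p $ j * exp (lam $ j * \<zeta>))"

lemma lin_flow_nth [simp]: "lin_flow lam p \<zeta> $ j = p $ j * exp (lam $ j * \<zeta>)"
  by (simp add: lin_flow_def)

lemma open_polydisc: "open (polydisc :: (complex ^ 'n::finite) set)"
proof -
  have "open (\<Inter>j. {z :: complex ^ 'n. cmod (z $ j) < 1})"
    by (intro open_INT finite ballI open_Collect_less continuous_intros)
  moreover have "polydisc = (\<Inter>j. {z :: complex ^ 'n. cmod (z $ j) < 1})" by (auto simp: polydisc_def)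
  ultimately show ?thesis by simp
qed

text \<open>In the flow time, |z_j| < 1 is a half plane, or no condition if p_j = 0; the domain is
  an intersection of convex sets.\<close>

lemma lin_flow_domain:
  fixes p :: "complex ^ 'n::finite"
  shows "open {\<zeta>. lin_flow lam p \<zeta> \<in> polydisc}" "connected {\<zeta>. lin_flow lam p \<zeta> \<in> polydisc}"
proof -
  show "open {\<zeta>. lin_flow lam p \<zeta> \<in> polydisc}"
  proof -
    have "open (\<Inter>j. {\<zeta>. cmod (p $ j * exp (lam $ j * \<zeta>)) < 1})"
      by (intro open_INT finite ballI open_Collect_less continuous_intros)
    moreover have "{\<zeta>. lin_flow lam p \<zeta> \<in> polydisc} = (\<Inter>j. {\<zeta>. cmod (p $ j * exp (lam $ j * \<zeta>)) < 1})"
      by (auto simp: polydisc_def)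
    ultimately show ?thesis by simp
  qed
  have "convex {\<zeta>. cmod (p $ j * exp (lam $ j * \<zeta>)) < 1}" for j
  proof (cases "p $ j = 0")
    case False
    have "cmod (p $ j * exp (lam $ j * \<zeta>)) < 1 \<longleftrightarrow> inner (cnj (lam $ j)) \<zeta> < - ln (cmod (p $ j))" for \<zeta>
    proof -
      have "cmod (p $ j * exp (lam $ j * \<zeta>)) = exp (ln (cmod (p $ j)) + inner (cnj (lam $ j)) \<zeta>)"
        using False by (simp add: norm_mult exp_add inner_complex_def)
      then show ?thesis by (simp add: exp_less_one_iff) linarith
    qed
    then show ?thesis by (simp add: convex_halfspace_lt)
  qed simp
  then have "convex (\<Inter>j. {\<zeta>. cmod (p $ j * exp (lam $ j * \<zeta>)) < 1})" by (intro convex_INT) auto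
  moreover have "{\<zeta>. lin_flow lam p \<zeta> \<in> polydisc} = (\<Inter>j. {\<zeta>. cmod (p $ j * exp (lam $ j * \<zeta>)) < 1})"
    by (auto simp: polydisc_def)
  ultimately show "connected {\<zeta>. lin_flow lam p \<zeta> \<in> polydisc}" by (simp add: convex_connected)
qed

text \<open>Maximality is uniqueness for the linear system: along any integral curve z_j
  exp(-\<lambda>_j \<zeta>) is constant, so a competing curve through p is a time shift of
  \<open>lin_flow lam p\<close>.\<close>

lemma lin_flow_integral_curve:
  fixes p :: "complex ^ 'n::finite"
  assumes p: "p \<in> polydisc - {0}"
  shows "lin_flow lam p ` {\<zeta>. lin_flow lam p \<zeta> \<in> polydisc} \<in> integral_curves (linear_field lam) (polydisc - {0})"
proof -
  let ?\<Omega> = "{\<zeta>. lin_flow lam p \<zeta> \<in> polydisc}"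
  have p0: "lin_flow lam p 0 = p" by (simp add: vec_eq_iff)
  obtain i where i: "p $ i \<noteq> 0" using p by (auto simp: vec_eq_iff)
  then have nz: "lin_flow lam p \<zeta> \<noteq> 0" for \<zeta> by (auto simp: vec_eq_iff)
  have 1: "lin_flow lam p ` ?\<Omega> \<in> integral_curve_images (linear_field lam) (polydisc - {0})"
    unfolding integral_curve_images_def mem_Collect_eq
  proof (intro exI conjI ballI allI)
    show "open ?\<Omega>" "connected ?\<Omega>" by (rule lin_flow_domain)+
    have "0 \<in> ?\<Omega>" using p p0 by simp
    then show "?\<Omega> \<noteq> {}" by blast
    show "lin_flow lam p ` ?\<Omega> \<subseteq> polydisc - {0}" using nz by auto
    show "((\<lambda>\<xi>. lin_flow lam p \<xi> $ j) has_field_derivative linear_field lam (lin_flow lam p \<zeta>) $ j) (at \<zeta>)" for j \<zeta>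
      by (auto simp: linear_field_def intro!: derivative_eq_intros)
  qed simp
  moreover have "C' = lin_flow lam p ` ?\<Omega>"
    if C': "C' \<in> integral_curve_images (linear_field lam) (polydisc - {0})" and sub: "lin_flow lam p ` ?\<Omega> \<subseteq> C'" for C'
  proof (rule antisym[OF _ sub])
    obtain \<gamma> \<Omega>' where g: "C' = \<gamma> ` \<Omega>'" "open \<Omega>'" "connected \<Omega>'" "\<gamma> ` \<Omega>' \<subseteq> polydisc - {0}"
      "\<And>\<zeta> j. \<zeta> \<in> \<Omega>' \<Longrightarrow> ((\<lambda>\<xi>. \<gamma> \<xi> $ j) has_field_derivative linear_field lam (\<gamma> \<zeta>) $ j) (at \<zeta>)"
      using C' unfolding integral_curve_images_def by blast
    have "p \<in> C'" using sub p p0 by (metis DiffD1 image_eqI mem_Collect_eq subsetD)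
    then obtain \<zeta>0 where z0: "\<zeta>0 \<in> \<Omega>'" "\<gamma> \<zeta>0 = p" using g(1) by blast
    have "\<gamma> \<zeta> = lin_flow lam p (\<zeta> - \<zeta>0)" if z: "\<zeta> \<in> \<Omega>'" for \<zeta>
    proof -
      have "\<gamma> \<zeta> $ j = p $ j * exp (lam $ j * (\<zeta> - \<zeta>0))" for j
      proof -
        let ?h = "\<lambda>\<xi>. \<gamma> \<xi> $ j * exp (- lam $ j * \<xi>)"
        have d: "(?h has_field_derivative 0) (at \<xi>)" if "\<xi> \<in> \<Omega>'" for \<xi>
          using g(5)[OF that, of j] by (auto intro!: derivative_eq_intros simp: linear_field_def)
        have "continuous_on \<Omega>' ?h"
          using d by (meson DERIV_continuous continuous_at_imp_continuous_on)
        then obtain c where c: "\<And>\<xi>. \<xi> \<in> \<Omega>' \<Longrightarrow> ?h \<xi> = c"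
          using DERIV_zero_connected_constant[of \<Omega>' "{}" ?h] g(2,3) d by auto
        then have "?h \<zeta> = ?h \<zeta>0" using z z0(1) by simp
        then have "?h \<zeta> * exp (lam $ j * \<zeta>) = p $ j * exp (- lam $ j * \<zeta>0) * exp (lam $ j * \<zeta>)" using z0(2) by simp
        then show ?thesis by (simp add: exp_diff exp_minus field_simps)
      qed
      then show ?thesis by (simp add: vec_eq_iff)
    qed
    then show "C' \<subseteq> lin_flow lam p ` ?\<Omega>" using g(1,4) by auto
  qed
  ultimately show ?thesis unfolding integral_curves_def by blast
qed

locale linear_foliation =
  fixes lam :: "complex ^ 'n::finite" and L :: "('n, 'm::finite) chart set" and k l :: 'n
  assumes lam_nz: "lam $ j \<noteq> 0"
    and nonreal: "lam $ k / lam $ l \<notin> \<real>"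
    and foliation: "singular_foliation polydisc L {0}"
    and leaves_eq: "leaves polydisc L {0} = integral_curves (linear_field lam) (polydisc - {0})"
begin

lemma flow_boxL: "u \<in> L \<Longrightarrow> flow_box u"
  and charts_cover: "(\<Union>u\<in>L. fst u) = polydisc - {0}"
  and charts_compatible: "u \<in> L \<Longrightarrow> v \<in> L \<Longrightarrow> compatible_charts u v"
  using foliation unfolding singular_foliation_def by blast+

lemma chart_open: "u \<in> L \<Longrightarrow> open (fst u)" using flow_boxL flow_boxD(1) by blast

lemma chart_subset: "u \<in> L \<Longrightarrow> fst u \<subseteq> polydisc - {0}" using charts_cover by blast

text \<open>The maximal integral curve through p is a leaf, hence contains every plaque it meets.
  Nothing is asserted here about the dependence of the flow time on q.\<close>

lemma plaque_in_flow:
  assumes u: "u \<in> L" and p: "p \<in> fst u" and q: "q \<in> fst u" "snd (snd u q) = snd (snd u p)"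
  shows "\<exists>\<zeta>. q = lin_flow lam p \<zeta>"
proof -
  have pY: "p \<in> polydisc - {0}" using chart_subset[OF u] p by blast
  let ?C = "lin_flow lam p ` {\<zeta>. lin_flow lam p \<zeta> \<in> polydisc}"
  have "?C \<in> leaves polydisc L {0}" using lin_flow_integral_curve[OF pY] leaves_eq by simp
  then have sat: "\<And>P. P \<in> plaques L \<Longrightarrow> P \<inter> ?C \<noteq> {} \<Longrightarrow> P \<subseteq> ?C"
    unfolding leaves_def connected_saturated_def by blast
  let ?P = "{q \<in> fst u. snd (snd u q) = snd (snd u p)}"
  have "?P \<in> plaques L" unfolding plaques_def using u p by force
  moreover have "p \<in> ?C"
  proof
    show "p = lin_flow lam p 0" by (simp add: vec_eq_iff)
    then show "0 \<in> {\<zeta>. lin_flow lam p \<zeta> \<in> polydisc}" using pY by simp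
  qed
  ultimately have "?P \<subseteq> ?C" using sat p by blast
  then show ?thesis using q by blast
qed

section \<open>Plaque tangents as multiples of the vector field\<close>

text \<open>Up to a constant factor, the determinant of the real linear system that recovers \<zeta>
  from the real parts of \<lambda>_k \<zeta> and \<lambda>_l \<zeta>.\<close>

lemma det_nz: "lam $ k * cnj (lam $ l) - lam $ l * cnj (lam $ k) \<noteq> 0"
proof
  assume "lam $ k * cnj (lam $ l) - lam $ l * cnj (lam $ k) = 0"
  then have "lam $ k / lam $ l = cnj (lam $ k / lam $ l)"
    using lam_nz[of l] by (simp add: field_simps)
  then have "lam $ k / lam $ l \<in> \<real>" by (metis Reals_cnj_iff)
  then show False using nonreal by simp
qed

text \<open>For a nearby point q of the plaque the flow time is only known to exist. As \<lambda>_k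
  / \<lambda>_l is not real, it is determined by ln |q_k/p_k| and ln |q_l/p_l|, which are real parts
  of logarithms. This gives a formula \<open>Z\<close> that is differentiable in the plaque
  coordinate without following a branch.\<close>

lemma tangent_generic:
  assumes u: "u \<in> L" and p: "p \<in> fst u" "p $ k \<noteq> 0" "p $ l \<noteq> 0"
  shows "\<exists>\<kappa>. \<forall>j. plaque_tangent u j p = \<kappa> * (lam $ j * p $ j)"
proof -
  note fb = flow_boxL[OF u]
  let ?y = "fst (snd u p)" and ?q = "plaque_param u p"
  let ?\<Delta> = "lam $ k * cnj (lam $ l) - lam $ l * cnj (lam $ k)"
  have qy: "?q ?y = p" by (simp add: plaque_param_def chart_inv_snd[OF fb p(1)])
  define A where "A i \<eta> = Ln (?q \<eta> $ i / p $ i)" for i \<eta>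
  \<comment> \<open>Coefficients from Cramer's rule: \<open>Z\<close> solves Re(\<lambda>_i Z) =
    Re(\<open>A i\<close>) for i = k, l.\<close>
  define c1 where "c1 = 2 * cnj (lam $ l) / ?\<Delta>"
  define c2 where "c2 = 2 * cnj (lam $ k) / ?\<Delta>"
  define Z where "Z \<eta> = c1 * of_real (Re (A k \<eta>)) - c2 * of_real (Re (A l \<eta>))" for \<eta>
  have dA: "(A i has_field_derivative plaque_tangent u i p / p $ i) (at ?y)" if "p $ i \<noteq> 0" for i
  proof -
    have "((\<lambda>\<eta>. ?q \<eta> $ i / p $ i) has_field_derivative plaque_tangent u i p / p $ i) (at ?y)"
      by (rule DERIV_cdivide[OF plaque_tangent_has_derivative(2)[OF fb p(1)]])
    moreover have "(Ln has_field_derivative 1) (at (?q ?y $ i / p $ i))"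
      using has_field_derivative_Ln[of 1] qy that by simp
    ultimately show ?thesis
      unfolding A_def[abs_def] using DERIV_chain2[of Ln 1 "\<lambda>\<eta>. ?q \<eta> $ i / p $ i" ?y] by simp
  qed
  define D where "D v = c1 * of_real (Re (v * (plaque_tangent u k p / p $ k)))
      - c2 * of_real (Re (v * (plaque_tangent u l p / p $ l)))" for v
  have dA': "(A i has_derivative (\<lambda>v. v * (plaque_tangent u i p / p $ i))) (at ?y)" if "p $ i \<noteq> 0" for i
    using dA[OF that] by (simp only: has_field_derivative_def mult_commute_abs)
  have dRe: "((\<lambda>\<eta>. complex_of_real (Re (A i \<eta>))) has_derivative (\<lambda>v. of_real (Re (v * (plaque_tangent u i p / p $ i))))) (at ?y)"
    if "p $ i \<noteq> 0" for i
    by (rule bounded_linear.has_derivative[OF bounded_linear_of_real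
          bounded_linear.has_derivative[OF bounded_linear_Re dA'[OF that]]])
  have dZ: "(Z has_derivative D) (at ?y)"
    unfolding Z_def[abs_def] D_def[abs_def]
    by (intro has_derivative_diff has_derivative_mult_right dRe p)
  have "eventually (\<lambda>\<eta>. ?q \<eta> = lin_flow lam p (Z \<eta>)) (nhds ?y)"
    using eventually_plaque_param[OF fb p(1) chart_open[OF u] p(1)]
  proof eventually_elim
    case (elim \<eta>)
    then obtain \<zeta> where z: "?q \<eta> = lin_flow lam p \<zeta>" using plaque_in_flow[OF u p(1), of "?q \<eta>"] elim by auto
    have Re: "of_real (Re (A i \<eta>)) = (lam $ i * \<zeta> + cnj (lam $ i * \<zeta>)) / 2" if "p $ i \<noteq> 0" for i
    proof -
      have "?q \<eta> $ i / p $ i = exp (lam $ i * \<zeta>)" using z that by simp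
      then have "Re (A i \<eta>) = Re (lam $ i * \<zeta>)" unfolding A_def by (simp add: Re_Ln)
      then show ?thesis by (simp add: complex_eq_iff)
    qed
    have "2 * cnj (lam $ l) * of_real (Re (A k \<eta>)) - 2 * cnj (lam $ k) * of_real (Re (A l \<eta>)) = ?\<Delta> * \<zeta>"
      unfolding Re[OF p(2)] Re[OF p(3)] by (simp add: field_simps)
    then have "(2 * cnj (lam $ l) * of_real (Re (A k \<eta>)) - 2 * cnj (lam $ k) * of_real (Re (A l \<eta>))) / ?\<Delta> = \<zeta>"
      using det_nz by simp
    then have "Z \<eta> = \<zeta>" by (simp only: Z_def c1_def c2_def times_divide_eq_left diff_divide_distrib)
    then show ?case using z by simp
  qed
  then obtain T where T: "open T" "?y \<in> T" "\<And>\<eta>. \<eta> \<in> T \<Longrightarrow> ?q \<eta> = lin_flow lam p (Z \<eta>)"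
    unfolding eventually_nhds by blast
  have Zy: "Z ?y = 0" by (simp add: Z_def A_def qy p)
  have key: "v * plaque_tangent u j p = p $ j * lam $ j * D v" for v j
  proof -
    have "((\<lambda>\<eta>. p $ j * exp (lam $ j * Z \<eta>)) has_derivative (\<lambda>v. p $ j * (exp (lam $ j * Z ?y) * (lam $ j * D v)))) (at ?y)"
    proof -
      have e: "(exp has_derivative (\<lambda>h. h * exp (lam $ j * Z ?y))) (at (lam $ j * Z ?y))"
        using DERIV_exp[of "lam $ j * Z ?y"] by (simp add: has_field_derivative_def mult_commute_abs)
      show ?thesis
        using has_derivative_mult_right[OF has_derivative_compose[OF has_derivative_mult_right[OF dZ, of "lam $ j"] e], of "p $ j"]
        by (simp add: mult_ac)
    qed
    then have "((\<lambda>\<eta>. p $ j * exp (lam $ j * Z \<eta>)) has_derivative (\<lambda>v. p $ j * lam $ j * D v)) (at ?y)"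
      by (simp add: Zy mult.assoc)
    then have "((\<lambda>\<eta>. ?q \<eta> $ j) has_derivative (\<lambda>v. p $ j * lam $ j * D v)) (at ?y)"
      by (rule has_derivative_transform_within_open[OF _ T(1,2)]) (simp add: T(3))
    moreover have "((\<lambda>\<eta>. ?q \<eta> $ j) has_derivative (\<lambda>v. v * plaque_tangent u j p)) (at ?y)"
      using plaque_tangent_has_derivative(2)[OF fb p(1), of j] by (simp add: has_field_derivative_def mult_commute_abs)
    ultimately have "(\<lambda>v. p $ j * lam $ j * D v) = (\<lambda>v. v * plaque_tangent u j p)"
      by (rule has_derivative_unique)
    then show ?thesis by metis
  qed
  show ?thesis
    by (intro exI[of _ "D 1"] allI) (use key[of 1] in \<open>simp add: mult_ac\<close>)
qed

lemma dense_generic: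
  fixes p :: "complex ^ 'n"
  assumes "open N" "p \<in> N"
  obtains q where "q \<in> N" "q $ k \<noteq> 0" "q $ l \<noteq> 0"
proof -
  define w where "w = (axis k 1 + axis l 1 :: complex ^ 'n)"
  have kl: "k \<noteq> l" using nonreal lam_nz[of l] by auto
  then have w: "w $ k = 1" "w $ l = 1" by (simp_all add: w_def axis_def)
  obtain e where e: "e > 0" "ball p e \<subseteq> N" using assms openE by blast
  have d: "e / (norm w + 1) > 0" using e by (simp add: add_nonneg_pos)
  have "infinite ({0<..<e / (norm w + 1)} - {- Re (p $ k), - Re (p $ l)})"
    using d by (intro Diff_infinite_finite infinite_Ioo) auto
  then obtain s where "s \<in> {0<..<e / (norm w + 1)} - {- Re (p $ k), - Re (p $ l)}"
    using infinite_imp_nonempty by blast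
  then have s: "0 < s" "s < e / (norm w + 1)" "s \<noteq> - Re (p $ k)" "s \<noteq> - Re (p $ l)" by auto
  let ?q = "p + s *\<^sub>R w"
  have "norm w + 1 > 0" by (simp add: add_nonneg_pos)
  then have "s * (norm w + 1) < e" using s(2) by (simp add: pos_less_divide_eq)
  then have "s * norm w < e" using s(1) by (simp add: algebra_simps)
  then have "?q \<in> ball p e" using s(1) by (simp add: dist_norm)
  then have "?q \<in> N" using e(2) by blast
  moreover have "Re (?q $ k) = Re (p $ k) + s" "Re (?q $ l) = Re (p $ l) + s"
    using w by simp_all
  then have "Re (?q $ k) \<noteq> 0" "Re (?q $ l) \<noteq> 0" using s by linarith+
  then have "?q $ k \<noteq> 0" "?q $ l \<noteq> 0" by (metis zero_complex.sel(1))+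
  ultimately show thesis using that by blast
qed

text \<open>Being parallel to the vector field is the vanishing of the 2x2 minors, a closed
  condition. It holds on the dense set where z_k and z_l are nonzero, hence also on these
  hyperplanes.\<close>

lemma tangent_minors:
  assumes u: "u \<in> L" and p: "p \<in> fst u"
  shows "plaque_tangent u i p * (lam $ j * p $ j) = plaque_tangent u j p * (lam $ i * p $ i)"
proof (rule ccontr)
  let ?h = "\<lambda>p. plaque_tangent u i p * (lam $ j * p $ j) - plaque_tangent u j p * (lam $ i * p $ i)"
  assume "plaque_tangent u i p * (lam $ j * p $ j) \<noteq> plaque_tangent u j p * (lam $ i * p $ i)"
  then have hp: "?h p \<noteq> 0" by simp
  note fb = flow_boxL[OF u]
  have "continuous_on (fst u) (plaque_tangent u j)" for j
    using leaf_smooth_on_continuous[OF fb chart_open[OF u] order_refl leaf_smooth_plaque_tangent_coord(2)[OF fb]] .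
  then have "continuous_on (fst u) ?h" by (intro continuous_intros) auto
  then have "open (?h -` (- {0}) \<inter> fst u)"
    using continuous_on_open_vimage[OF chart_open[OF u]] open_Compl closed_singleton by blast
  then obtain q where q: "q \<in> ?h -` (- {0}) \<inter> fst u" "q $ k \<noteq> 0" "q $ l \<noteq> 0"
    using dense_generic[of _ p] hp p by blast
  then obtain \<kappa> where "\<And>j. plaque_tangent u j q = \<kappa> * (lam $ j * q $ j)"
    using tangent_generic[OF u] by blast
  then have "?h q = 0" by simp
  then show False using q by simp
qed

definition speed2 :: "complex ^ 'n \<Rightarrow> real" where
  "speed2 p = (\<Sum>j\<in>UNIV. (cmod (lam $ j * p $ j))\<^sup>2)"

text \<open>The factor between tangent and vector field, that is d\<zeta>/dy, as a quotient of
  Hermitian products: unlike the quotient of two components, this makes sense at every point of the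
  punctured polydisc.\<close>

definition time_deriv :: "('n, 'm) chart \<Rightarrow> complex ^ 'n \<Rightarrow> complex" where
  "time_deriv u p = (\<Sum>j\<in>UNIV. cnj (lam $ j * p $ j) * plaque_tangent u j p) / of_real (speed2 p)"

lemma speed2_pos: "p \<noteq> 0 \<Longrightarrow> 0 < speed2 p"
proof -
  assume "p \<noteq> 0"
  then obtain j where "p $ j \<noteq> 0" by (auto simp: vec_eq_iff)
  then have "0 < (cmod (lam $ j * p $ j))\<^sup>2" using lam_nz by simp
  also have "\<dots> \<le> speed2 p" unfolding speed2_def by (rule member_le_sum) auto
  finally show ?thesis .
qed

lemma plaque_tangent_eq:
  assumes u: "u \<in> L" and p: "p \<in> fst u"
  shows "plaque_tangent u i p = time_deriv u p * (lam $ i * p $ i)"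
proof -
  have "p \<noteq> 0" using chart_subset[OF u] p by blast
  then have s: "complex_of_real (speed2 p) \<noteq> 0" using speed2_pos[of p] by simp
  have "(\<Sum>j\<in>UNIV. cnj (lam $ j * p $ j) * plaque_tangent u j p) * (lam $ i * p $ i)
     = (\<Sum>j\<in>UNIV. cnj (lam $ j * p $ j) * (plaque_tangent u i p * (lam $ j * p $ j)))"
    unfolding sum_distrib_right
    by (intro sum.cong refl) (simp only: mult.assoc tangent_minors[OF u p, of _ i])
  also have "\<dots> = plaque_tangent u i p * of_real (speed2 p)"
    unfolding speed2_def of_real_sum sum_distrib_left
    by (intro sum.cong refl) (simp only: complex_norm_square, simp add: mult_ac)
  finally show ?thesis unfolding time_deriv_def using s by (simp add: field_simps)
qed

lemma time_deriv_nz: "u \<in> L \<Longrightarrow> p \<in> fst u \<Longrightarrow> time_deriv u p \<noteq> 0"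
  using plaque_tangent_nonzero[OF flow_boxL] plaque_tangent_eq by fastforce

end

section \<open>The trace measure of a current\<close>

lemma leaf_smooth_on_prod:
  assumes "flow_box u" "open O'" "O' \<subseteq> fst u"
  shows "finite A \<Longrightarrow> (\<And>i. i \<in> A \<Longrightarrow> leaf_smooth_on u O' (g i)) \<Longrightarrow> leaf_smooth_on u O' (\<lambda>p. \<Prod>i\<in>A. g i p)"
  by (induction A rule: finite_induct)
     (auto intro: leaf_smooth_on_const[OF assms] leaf_smooth_on_mult[OF assms])

definition vsq :: "'n \<Rightarrow> complex ^ 'n \<Rightarrow> real" where "vsq j p = (cmod (p $ j))\<^sup>2"

definition tangent_norm2 :: "('n::finite, 'm::finite) chart \<Rightarrow> complex ^ 'n \<Rightarrow> real" where
  "tangent_norm2 u p = (\<Sum>j\<in>UNIV. (cmod (plaque_tangent u j p))\<^sup>2)"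

lemma leaf_restrict_std_hermitian:
  "leaf_restrict L f std_hermitian u p =
     (if u \<in> L \<and> p \<in> fst u then f p * of_real (tangent_norm2 u p) else 0)"
proof -
  have "(\<Sum>j\<in>UNIV. \<Sum>k\<in>UNIV. std_hermitian p $ j $ k * plaque_tangent u j p * cnj (plaque_tangent u k p))
      = of_real (tangent_norm2 u p)"
  proof -
    have "(\<Sum>k\<in>UNIV. std_hermitian p $ j $ k * plaque_tangent u j p * cnj (plaque_tangent u k p))
       = of_real ((cmod (plaque_tangent u j p))\<^sup>2)" for j
    proof -
      have "(\<Sum>k\<in>UNIV. std_hermitian p $ j $ k * plaque_tangent u j p * cnj (plaque_tangent u k p))
        = (\<Sum>k\<in>UNIV. if j = k then plaque_tangent u j p * cnj (plaque_tangent u k p) else 0)"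
        by (intro sum.cong) (auto simp: std_hermitian_def mat_def)
      also have "\<dots> = of_real ((cmod (plaque_tangent u j p))\<^sup>2)"
        by (simp add: complex_norm_square del: of_real_power)
      finally show ?thesis .
    qed
    then show ?thesis by (simp add: tangent_norm2_def)
  qed
  then show ?thesis by (simp add: leaf_restrict_def Let_def plaque_tangent_def)
qed

lemma leaf_smooth_tangent_norm2:
  assumes u: "flow_box u"
  shows "leaf_smooth_on u (fst u) (\<lambda>p. of_real (tangent_norm2 u p))"
proof -
  note o = u flow_boxD(1)[OF u] order_refl
  note t = leaf_smooth_plaque_tangent_coord(2)[OF u]
  have "leaf_smooth_on u (fst u) (\<lambda>p. \<Sum>j\<in>UNIV. plaque_tangent u j p * cnj (plaque_tangent u j p))"
    by (intro leaf_smooth_on_sum[OF o] leaf_smooth_on_mult[OF o] t leaf_smooth_on_linear[OF o bounded_linear_cnj]) auto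
  then show ?thesis by (simp add: tangent_norm2_def complex_norm_square[symmetric])
qed

lemma tangent_norm2_pos: "flow_box u \<Longrightarrow> p \<in> fst u \<Longrightarrow> 0 < tangent_norm2 u p"
proof -
  assume "flow_box u" "p \<in> fst u"
  then obtain j where "plaque_tangent u j p \<noteq> 0" using plaque_tangent_nonzero by blast
  then have "0 < (cmod (plaque_tangent u j p))\<^sup>2" by simp
  also have "\<dots> \<le> tangent_norm2 u p" unfolding tangent_norm2_def by (rule member_le_sum) auto
  finally show ?thesis .
qed

section \<open>The trace functional on test functions\<close>

locale linear_current = linear_foliation lam L k l
  for lam :: "complex ^ 'n::finite" and L :: "('n, 'm::finite) chart set" and k l +
  fixes T :: "('n, 'm) leaf_form \<Rightarrow> complex"
  assumes current: "positive_harmonic_directed_current polydisc L {0} T"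
begin

abbreviation "Y \<equiv> polydisc - {0 :: complex ^ 'n}"
abbreviation "tfuns \<equiv> test_functions polydisc L {0}"
abbreviation "tform f \<equiv> leaf_restrict L f std_hermitian"

lemma open_Y: "open Y" by (simp add: open_polydisc open_Diff)

lemma tfuns_iff: "f \<in> tfuns \<longleftrightarrow> (\<forall>u\<in>L. leaf_smooth_on u (fst u) f) \<and>
   (\<exists>K. compact K \<and> K \<subseteq> Y \<and> (\<forall>p. p \<notin> K \<longrightarrow> f p = 0))"
  unfolding test_functions_def test_functions_on_def leafwise_smooth_iff by blast

lemma tfunsE:
  assumes "f \<in> tfuns"
  obtains K where "compact K" "K \<subseteq> Y" "\<And>p. p \<notin> K \<Longrightarrow> f p = 0"
  using assms tfuns_iff by blast

lemma tfuns_add: "f \<in> tfuns \<Longrightarrow> g \<in> tfuns \<Longrightarrow> (\<lambda>p. f p + g p) \<in> tfuns"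
proof -
  assume f: "f \<in> tfuns" and g: "g \<in> tfuns"
  obtain K where K: "compact K" "K \<subseteq> Y" "\<And>p. p \<notin> K \<Longrightarrow> f p = 0" using tfunsE[OF f] by metis
  obtain K' where K': "compact K'" "K' \<subseteq> Y" "\<And>p. p \<notin> K' \<Longrightarrow> g p = 0" using tfunsE[OF g] by metis
  show ?thesis
    unfolding tfuns_iff
  proof (intro conjI ballI exI)
    show "leaf_smooth_on u (fst u) (\<lambda>p. f p + g p)" if "u \<in> L" for u
      using f g that leaf_smooth_on_add[OF flow_boxL[OF that] chart_open[OF that] order_refl] by (simp add: tfuns_iff)
    show "compact (K \<union> K')" using K K' by (simp add: compact_Un)
    show "K \<union> K' \<subseteq> Y" using K K' by blast
    show "\<forall>p. p \<notin> K \<union> K' \<longrightarrow> f p + g p = 0" using K K' by simp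
  qed
qed

lemma tfuns_mult:
  assumes f: "f \<in> tfuns" and m: "\<And>u. u \<in> L \<Longrightarrow> leaf_smooth_on u (fst u) m"
  shows "(\<lambda>p. m p * f p) \<in> tfuns"
proof -
  obtain K where K: "compact K" "K \<subseteq> Y" "\<And>p. p \<notin> K \<Longrightarrow> f p = 0" using tfunsE[OF f] by metis
  show ?thesis
    unfolding tfuns_iff
  proof (intro conjI ballI exI)
    show "leaf_smooth_on u (fst u) (\<lambda>p. m p * f p)" if "u \<in> L" for u
      using f m that leaf_smooth_on_mult[OF flow_boxL[OF that] chart_open[OF that] order_refl] by (simp add: tfuns_iff)
    show "compact K" "K \<subseteq> Y" "\<forall>p. p \<notin> K \<longrightarrow> m p * f p = 0" using K by simp_all
  qed
qed

lemma tfuns_linear: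
  assumes f: "f \<in> tfuns" and r: "bounded_linear r"
  shows "(\<lambda>p. r (f p)) \<in> tfuns"
proof -
  obtain K where K: "compact K" "K \<subseteq> Y" "\<And>p. p \<notin> K \<Longrightarrow> f p = 0" using tfunsE[OF f] by metis
  show ?thesis
    unfolding tfuns_iff
  proof (intro conjI ballI exI)
    show "leaf_smooth_on u (fst u) (\<lambda>p. r (f p))" if "u \<in> L" for u
      using f r that leaf_smooth_on_linear[OF flow_boxL[OF that] chart_open[OF that] order_refl] by (simp add: tfuns_iff)
    show "compact K" "K \<subseteq> Y" "\<forall>p. p \<notin> K \<longrightarrow> r (f p) = 0"
      using K linear_0[OF bounded_linear.linear[OF r]] by simp_all
  qed
qed

lemma tfuns_continuous: "f \<in> tfuns \<Longrightarrow> continuous_on UNIV f"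
proof -
  assume f: "f \<in> tfuns"
  obtain K where K: "compact K" "K \<subseteq> Y" "\<And>p. p \<notin> K \<Longrightarrow> f p = 0" using tfunsE[OF f] by metis
  have "continuous_on (\<Union>u\<in>L. fst u) f"
    using f chart_open leaf_smooth_on_continuous[OF flow_boxL chart_open order_refl]
    by (intro continuous_on_open_UN) (auto simp: tfuns_iff)
  then have "continuous_on Y f" using charts_cover by simp
  moreover have "continuous_on (- K) f"
    using K(3) by (subst continuous_on_cong[of _ _ _ "\<lambda>_. 0"]) auto
  ultimately have "continuous_on (Y \<union> - K) f"
    using open_Y K(1) by (intro continuous_on_open_Un) (auto simp: compact_imp_closed open_Compl)
  moreover have "Y \<union> - K = UNIV" using K(2) by blast
  ultimately show ?thesis by simp
qed

lemma tform_test_form: "f \<in> tfuns \<Longrightarrow> tform f \<in> test_forms polydisc L {0}"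
proof -
  assume f: "f \<in> tfuns"
  obtain K where K: "compact K" "K \<subseteq> Y" "\<And>p. p \<notin> K \<Longrightarrow> f p = 0" using tfunsE[OF f] by metis
  have "tform f \<in> test_forms_on L K"
    unfolding test_forms_on_def mem_Collect_eq
  proof (intro conjI ballI allI impI)
    fix u assume u: "u \<in> L"
    note o = flow_boxL[OF u] chart_open[OF u] order_refl
    have "leaf_smooth_on u (fst u) (\<lambda>p. f p * of_real (tangent_norm2 u p))"
      using f u leaf_smooth_on_mult[OF o] leaf_smooth_tangent_norm2[OF o(1)] by (simp add: tfuns_iff)
    then show "leafwise_smooth u (tform f u)"
      unfolding leafwise_smooth_iff
      by (rule leaf_smooth_on_cong[OF o]) (simp add: leaf_restrict_std_hermitian u)
  next
    fix u v p assume uv: "u \<in> L" "v \<in> L" and p: "p \<in> fst u \<inter> fst v"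
    have "tangent_norm2 u p = (cmod (transition_deriv u v p))\<^sup>2 * tangent_norm2 v p"
      using plaque_tangent_transition[OF flow_boxL[OF uv(1)] flow_boxL[OF uv(2)] charts_compatible[OF uv], of p] p
      by (simp add: tangent_norm2_def sum_distrib_left norm_mult power_mult_distrib)
    then show "tform f u p = of_real ((cmod (transition_deriv u v p))\<^sup>2) * tform f v p"
      using uv p by (simp add: leaf_restrict_std_hermitian)
  next
    fix u p assume "u \<notin> L \<or> p \<notin> fst u \<or> p \<notin> K"
    then show "tform f u p = 0" using K(3) by (auto simp: leaf_restrict_std_hermitian)
  qed
  then show ?thesis unfolding test_forms_def using K by blast
qed

lemma T_add: "f \<in> tfuns \<Longrightarrow> g \<in> tfuns \<Longrightarrow> T (tform (\<lambda>p. f p + g p)) = T (tform f) + T (tform g)"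
proof -
  assume fg: "f \<in> tfuns" "g \<in> tfuns"
  have "T (\<lambda>u p. tform f u p + tform g u p) = T (tform f) + T (tform g)"
    using current tform_test_form[OF fg(1)] tform_test_form[OF fg(2)]
    unfolding positive_harmonic_directed_current_def directed_current_def by blast
  moreover have "(\<lambda>u p. tform f u p + tform g u p) = tform (\<lambda>p. f p + g p)"
    by (intro ext) (simp add: leaf_restrict_std_hermitian algebra_simps)
  ultimately show ?thesis by simp
qed

lemma T_scale: "f \<in> tfuns \<Longrightarrow> T (tform (\<lambda>p. c * f p)) = c * T (tform f)"
proof -
  assume f: "f \<in> tfuns"
  have "T (\<lambda>u p. c * tform f u p) = c * T (tform f)"
    using current tform_test_form[OF f]
    unfolding positive_harmonic_directed_current_def directed_current_def by blast
  moreover have "(\<lambda>u p. c * tform f u p) = tform (\<lambda>p. c * f p)"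
    by (intro ext) (simp add: leaf_restrict_std_hermitian algebra_simps)
  ultimately show ?thesis by simp
qed

text \<open>Real test functions, because the representation argument rests on order; the complex
  ones are recovered from real and imaginary parts.\<close>

definition rfuns :: "(complex ^ 'n \<Rightarrow> real) set" where
  "rfuns = {f. (\<lambda>p. complex_of_real (f p)) \<in> tfuns}"

definition T_real :: "(complex ^ 'n \<Rightarrow> real) \<Rightarrow> real" where
  "T_real f = Re (T (tform (\<lambda>p. complex_of_real (f p))))"

lemma T_nonneg:
  assumes "f \<in> rfuns" "\<And>p. 0 \<le> f p"
  shows "T (tform (\<lambda>p. complex_of_real (f p))) \<in> \<real>\<^sub>\<ge>\<^sub>0"
proof -
  have "tform (\<lambda>p. complex_of_real (f p)) \<in> test_forms polydisc L {0}"
    using tform_test_form assms(1) by (simp add: rfuns_def)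
  moreover have "tform (\<lambda>p. complex_of_real (f p)) u p \<in> \<real>\<^sub>\<ge>\<^sub>0" for u p
    using assms(2)[of p] by (auto simp: leaf_restrict_std_hermitian tangent_norm2_def of_real_mult[symmetric] sum_nonneg
        simp del: of_real_mult of_real_sum)
  ultimately show ?thesis
    using current unfolding positive_harmonic_directed_current_def positive_current_def by blast
qed

lemma leaf_smooth_coord_real:
  assumes u: "u \<in> L"
  shows "leaf_smooth_on u (fst u) (\<lambda>p. complex_of_real (vsq j p))"
    "leaf_smooth_on u (fst u) (\<lambda>p. complex_of_real (p \<bullet> i))"
proof -
  note o = flow_boxL[OF u] chart_open[OF u] order_refl
  note z = leaf_smooth_plaque_tangent_coord(1)[OF o(1)]
  have "leaf_smooth_on u (fst u) (\<lambda>p. p $ j * cnj (p $ j))"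
    by (intro leaf_smooth_on_mult[OF o] z leaf_smooth_on_linear[OF o bounded_linear_cnj])
  then show "leaf_smooth_on u (fst u) (\<lambda>p. complex_of_real (vsq j p))"
    unfolding vsq_def complex_norm_square .
  have bl: "bounded_linear (\<lambda>z. complex_of_real (z \<bullet> (i $ j)))" for j
    by (rule bounded_linear_compose[OF bounded_linear_of_real bounded_linear_inner_left])
  have "leaf_smooth_on u (fst u) (\<lambda>p. \<Sum>j\<in>UNIV. complex_of_real ((p $ j) \<bullet> (i $ j)))"
    by (intro leaf_smooth_on_sum[OF o] leaf_smooth_on_linear[OF o bl] z) auto
  then show "leaf_smooth_on u (fst u) (\<lambda>p. complex_of_real (p \<bullet> i))"
    by (simp add: inner_vec_def)
qed

lemma leaf_smooth_flat:
  assumes u: "u \<in> L" and a: "leaf_smooth_on u (fst u) (\<lambda>p. complex_of_real (a p))"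
  shows "leaf_smooth_on u (fst u) (\<lambda>p. complex_of_real (flat_fun (c * a p + b)))"
proof -
  note o = flow_boxL[OF u] chart_open[OF u] order_refl
  have "leaf_smooth_on u (fst u) (\<lambda>p. complex_of_real c * complex_of_real (a p) + complex_of_real b)"
    by (intro leaf_smooth_on_add[OF o] leaf_smooth_on_mult[OF o] leaf_smooth_on_const[OF o] a)
  then have "leaf_smooth_on u (fst u) (\<lambda>p. complex_of_real (c * a p + b))" by simp
  then show ?thesis
    by (rule leaf_smooth_on_compose[OF o smooth_real_on_flat_fun]) simp
qed

text \<open>On K all |z_j|^2 stay below 1 - d and |z|^2 stays above d. The sum \<open>g\<close>
  vanishes there and reaches \<open>c\<close> as soon as some |z_j|^2 exceeds 1 - d/2, so applying
  \<open>flat_fun\<close> to c - g cuts off near the boundary of the polydisc; the factor with N -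
  d/2 cuts off near the origin. Division by the lower bound \<open>C\<close> on K
  normalizes.\<close>

lemma rfuns_bump:
  assumes K: "compact K" "K \<subseteq> Y"
  shows "\<exists>e\<in>rfuns. (\<forall>x. 0 \<le> e x) \<and> (\<forall>x\<in>K. 1 \<le> e x)"
proof -
  define N where "N p = (\<Sum>j\<in>UNIV. vsq j p)" for p :: "complex ^ 'n"
  have contv: "continuous_on A (vsq j)" for A :: "(complex ^ 'n) set" and j unfolding vsq_def[abs_def] by (intro continuous_intros)
  have contN: "continuous_on A N" for A unfolding N_def[abs_def] by (intro continuous_intros contv)
  have "\<exists>d>0. \<forall>p\<in>K. (\<forall>j. vsq j p \<le> 1 - d) \<and> d \<le> N p"
  proof (cases "K = {}")
    case True
    then show ?thesis by (auto intro: exI[of _ 1])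
  next
    case False
    have "\<exists>d>0. \<forall>p\<in>K. vsq j p \<le> 1 - d" for j
    proof -
      obtain p where p: "p \<in> K" "\<And>q. q \<in> K \<Longrightarrow> vsq j q \<le> vsq j p"
        using continuous_attains_sup[OF K(1) False contv] by blast
      have "cmod (p $ j) < 1" using p(1) K(2) by (auto simp: polydisc_def)
      then have "vsq j p < 1" by (simp add: vsq_def power_less_one_iff abs_square_less_1)
      then show ?thesis using p by (intro exI[of _ "1 - vsq j p"]) auto
    qed
    then obtain d where d: "\<And>j. d j > 0" "\<And>j p. p \<in> K \<Longrightarrow> vsq j p \<le> 1 - d j" by metis
    obtain p where p: "p \<in> K" "\<And>q. q \<in> K \<Longrightarrow> N p \<le> N q"
      using continuous_attains_inf[OF K(1) False contN] by blast
    have "p \<noteq> 0" using p(1) K(2) by blast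
    then obtain i where "p $ i \<noteq> 0" by (auto simp: vec_eq_iff)
    then have "0 < vsq i p" by (simp add: vsq_def)
    also have "\<dots> \<le> N p" unfolding N_def by (rule member_le_sum) (auto simp: vsq_def)
    finally have Np: "0 < N p" .
    define e where "e = Min (insert (N p) (range d))"
    have e: "e > 0" "e \<le> N p" using d(1) Np by (auto simp: e_def)
    have ed: "e \<le> d j" for j unfolding e_def by (rule Min_le) auto
    show ?thesis
    proof (intro exI conjI ballI allI)
      show "vsq j q \<le> 1 - e" if "q \<in> K" for q j using d(2)[OF that, of j] ed[of j] by linarith
      show "e \<le> N q" if "q \<in> K" for q using p(2)[OF that] e(2) by linarith
    qed (rule e(1))
  qed
  then obtain d where d: "d > 0" "\<And>p j. p \<in> K \<Longrightarrow> vsq j p \<le> 1 - d" "\<And>p. p \<in> K \<Longrightarrow> d \<le> N p" by blast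
  define c where "c = flat_fun (d / 2)"
  have c: "c > 0" using d by (simp add: c_def flat_fun_pos)
  define g where "g p = (\<Sum>j\<in>UNIV. flat_fun (1 * vsq j p + (d - 1)))" for p :: "complex ^ 'n"
  define e where "e p = flat_fun ((-1) * g p + c) * flat_fun (1 * N p + (- d / 2))" for p
  let ?K = "{p. (\<forall>j. vsq j p \<le> 1 - d / 2) \<and> d / 2 \<le> N p}"
  have K_eq: "?K = (\<Inter>j. {p. vsq j p \<le> 1 - d / 2}) \<inter> {p. d / 2 \<le> N p}" by auto
  have "closed ?K"
    unfolding K_eq by (intro closed_Int closed_INT ballI closed_Collect_le contv contN continuous_on_const)
  moreover have "bounded ?K"
  proof -
    have "norm p \<le> real CARD('n)" if "p \<in> ?K" for p
    proof -
      have "norm p \<le> (\<Sum>j\<in>UNIV. cmod (p $ j))" unfolding norm_vec_def by (rule L2_set_le_sum) auto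
      also have "\<dots> \<le> (\<Sum>j\<in>(UNIV :: 'n set). 1)"
      proof (rule sum_mono)
        fix j
        have "vsq j p \<le> 1" using that d(1) by (smt (verit) mem_Collect_eq half_gt_zero)
        then show "cmod (p $ j) \<le> 1" by (simp add: vsq_def abs_square_le_1)
      qed
      finally show ?thesis by simp
    qed
    then show ?thesis unfolding bounded_iff by blast
  qed
  ultimately have cK: "compact ?K" by (simp add: compact_eq_bounded_closed)
  have KY: "?K \<subseteq> Y"
  proof
    fix p assume p: "p \<in> ?K"
    have "vsq j p < 1" for j using p d(1) by (smt (verit) mem_Collect_eq half_gt_zero)
    then have "cmod (p $ j) < 1" for j by (simp add: vsq_def abs_square_less_1)
    moreover have "p \<noteq> 0" using p d(1) by (auto simp: N_def vsq_def)
    ultimately show "p \<in> Y" by (simp add: polydisc_def)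
  qed
  have g0: "g p \<ge> 0" for p unfolding g_def by (intro sum_nonneg) (simp add: flat_fun_nonneg)
  have out: "e p = 0" if "p \<notin> ?K" for p
  proof (cases "d / 2 \<le> N p")
    case True
    then obtain j where j: "vsq j p > 1 - d / 2" using \<open>p \<notin> ?K\<close> by (auto simp: not_le)
    have "c \<le> flat_fun (1 * vsq j p + (d - 1))" unfolding c_def using j by (intro flat_fun_mono) simp
    also have "\<dots> \<le> g p" unfolding g_def by (rule member_le_sum) (auto simp: flat_fun_nonneg)
    finally show ?thesis by (simp add: e_def flat_fun_zero)
  qed (simp add: e_def flat_fun_zero)
  define C where "C = flat_fun c * c"
  have C: "C > 0" using c by (simp add: C_def flat_fun_pos)
  have low: "C \<le> e p" if "p \<in> K" for p
  proof -
    have "g p = 0" unfolding g_def using d(2)[OF that] by (intro sum.neutral ballI flat_fun_zero) (simp add: algebra_simps)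
    then have "flat_fun ((-1) * g p + c) = flat_fun c" by simp
    moreover have "flat_fun (1 * N p + (- d / 2)) \<ge> c" unfolding c_def using d(3)[OF that] by (intro flat_fun_mono) simp
    ultimately show ?thesis
      unfolding e_def C_def using flat_fun_nonneg[of c] by (simp add: mult_left_mono)
  qed
  have smooth: "leaf_smooth_on u (fst u) (\<lambda>p. complex_of_real (inverse C * e p))" if u: "u \<in> L" for u
  proof -
    note o = flow_boxL[OF u] chart_open[OF u] order_refl
    have "leaf_smooth_on u (fst u) (\<lambda>p. \<Sum>j\<in>UNIV. complex_of_real (flat_fun (1 * vsq j p + (d - 1))))"
      by (intro leaf_smooth_on_sum[OF o] leaf_smooth_flat[OF u] leaf_smooth_coord_real[OF u]) auto
    then have g: "leaf_smooth_on u (fst u) (\<lambda>p. complex_of_real (g p))" by (simp add: g_def)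
    have "leaf_smooth_on u (fst u) (\<lambda>p. \<Sum>j\<in>UNIV. complex_of_real (vsq j p))"
      by (intro leaf_smooth_on_sum[OF o] leaf_smooth_coord_real[OF u]) auto
    then have N: "leaf_smooth_on u (fst u) (\<lambda>p. complex_of_real (N p))" by (simp add: N_def)
    have "leaf_smooth_on u (fst u) (\<lambda>p. complex_of_real (inverse C) * (complex_of_real (flat_fun ((-1) * g p + c))
        * complex_of_real (flat_fun (1 * N p + (- d / 2)))))"
      by (intro leaf_smooth_on_mult[OF o] leaf_smooth_on_const[OF o] leaf_smooth_flat[OF u] g N)
    then show ?thesis by (simp add: e_def)
  qed
  show ?thesis
  proof (intro bexI conjI ballI allI)
    show "(\<lambda>p. inverse C * e p) \<in> rfuns"
      unfolding rfuns_def mem_Collect_eq tfuns_iff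
      using smooth cK KY out by (intro conjI ballI exI[of _ ?K]) auto
    show "0 \<le> inverse C * e x" for x using C by (simp add: e_def flat_fun_nonneg)
    show "1 \<le> inverse C * e x" if "x \<in> K" for x
      using low[OF that] C by (simp add: field_simps)
  qed
qed

text \<open>The product over the real coordinates of the flat functions of x_i - a_i and b_i - x_i
  is positive exactly on the box, bounded by 1, and leafwise smooth.\<close>

lemma rfuns_box: "\<exists>\<phi>. {x. 0 < \<phi> x} = box a b \<and> (\<forall>x. 0 \<le> \<phi> x \<and> \<phi> x \<le> 1) \<and>
    (\<forall>f\<in>rfuns. (\<lambda>x. \<phi> x * f x) \<in> rfuns)"
proof (intro exI conjI ballI allI)
  let ?f = "\<lambda>i x. flat_fun (1 * (x \<bullet> i) + (- (a \<bullet> i))) * flat_fun ((-1) * (x \<bullet> i) + b \<bullet> i)"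
  let ?\<phi> = "\<lambda>x :: complex ^ 'n. \<Prod>i\<in>Basis. ?f i x"
  have f0: "0 \<le> ?f i x" "?f i x \<le> 1" for i x
    by (rule mult_nonneg_nonneg[OF flat_fun_nonneg flat_fun_nonneg])
       (rule mult_le_one[OF less_imp_le[OF flat_fun_less_1] flat_fun_nonneg less_imp_le[OF flat_fun_less_1]])
  have pos: "0 < ?f i x \<longleftrightarrow> a \<bullet> i < x \<bullet> i \<and> x \<bullet> i < b \<bullet> i" for i x
  proof
    assume h: "0 < ?f i x"
    then have "flat_fun (1 * (x \<bullet> i) + (- (a \<bullet> i))) \<noteq> 0" "flat_fun ((-1) * (x \<bullet> i) + b \<bullet> i) \<noteq> 0" by auto
    then show "a \<bullet> i < x \<bullet> i \<and> x \<bullet> i < b \<bullet> i" unfolding flat_fun_def by (auto split: if_splits)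
  next
    assume "a \<bullet> i < x \<bullet> i \<and> x \<bullet> i < b \<bullet> i"
    then show "0 < ?f i x" by (intro mult_pos_pos flat_fun_pos) auto
  qed
  show "{x. 0 < ?\<phi> x} = box a b"
  proof (intro set_eqI iffI)
    fix x assume "x \<in> {x. 0 < ?\<phi> x}"
    then have "?f i x \<noteq> 0" if "i \<in> Basis" for i using that by (metis (no_types, lifting) finite_Basis less_irrefl mem_Collect_eq prod_zero)
    then have "0 < ?f i x" if "i \<in> Basis" for i using that f0(1)[of x i] by (metis order_le_less)
    then show "x \<in> box a b" using pos by (simp add: mem_box)
  next
    fix x assume "x \<in> box a b"
    then have "0 < ?f i x" if "i \<in> Basis" for i using that pos[of x i] by (simp add: mem_box)
    then show "x \<in> {x. 0 < ?\<phi> x}" by (simp add: prod_pos)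
  qed
  show "0 \<le> ?\<phi> x" "?\<phi> x \<le> 1" for x
    using f0 by (auto intro!: prod_nonneg prod_le_1)
  show "(\<lambda>x. ?\<phi> x * f x) \<in> rfuns" if f: "f \<in> rfuns" for f
  proof -
    have "(\<lambda>p. complex_of_real (?\<phi> p) * complex_of_real (f p)) \<in> tfuns"
    proof (rule tfuns_mult)
      show "(\<lambda>p. complex_of_real (f p)) \<in> tfuns" using f by (simp add: rfuns_def)
      fix u assume u: "u \<in> L"
      note o = flow_boxL[OF u] chart_open[OF u] order_refl
      have "leaf_smooth_on u (fst u) (\<lambda>x. \<Prod>i\<in>Basis. complex_of_real (flat_fun (1 * (x \<bullet> i) + (- (a \<bullet> i)))) * complex_of_real (flat_fun ((-1) * (x \<bullet> i) + b \<bullet> i)))"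
        by (intro leaf_smooth_on_prod[OF o] leaf_smooth_on_mult[OF o] leaf_smooth_flat[OF u] leaf_smooth_coord_real[OF u]) auto
      then show "leaf_smooth_on u (fst u) (\<lambda>p. complex_of_real (?\<phi> p))" by simp
    qed
    then show ?thesis by (simp add: rfuns_def)
  qed
qed

lemma positive_functional_T: "positive_functional rfuns T_real Y"
proof
  fix f g :: "complex ^ 'n \<Rightarrow> real" and c :: real
  assume f: "f \<in> rfuns"
  then have fc: "(\<lambda>p. complex_of_real (f p)) \<in> tfuns" by (simp add: rfuns_def)
  show "(\<lambda>x. c * f x) \<in> rfuns"
    using tfuns_linear[OF fc bounded_linear_mult_right, of "of_real c"] by (simp add: rfuns_def)
  show "T_real (\<lambda>x. c * f x) = c * T_real f"
    using T_scale[OF fc, of "of_real c"] by (simp add: T_real_def)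
  show "continuous_on UNIV f"
    using continuous_on_Re[OF tfuns_continuous[OF fc]] by simp
  show "\<exists>K. compact K \<and> K \<subseteq> Y \<and> (\<forall>x. x \<notin> K \<longrightarrow> f x = 0)"
    using tfunsE[OF fc] by (metis of_real_eq_0_iff)
  show "0 \<le> T_real f" if "\<And>x. 0 \<le> f x"
    using T_nonneg[OF f that] by (simp add: T_real_def complex_nonneg_Reals_iff)
  assume g: "g \<in> rfuns"
  then have gc: "(\<lambda>p. complex_of_real (g p)) \<in> tfuns" by (simp add: rfuns_def)
  show "(\<lambda>x. f x + g x) \<in> rfuns" using tfuns_add[OF fc gc] by (simp add: rfuns_def)
  show "T_real (\<lambda>x. f x + g x) = T_real f + T_real g"
    using T_add[OF fc gc] by (simp add: T_real_def)
next
  show "open Y" by (rule open_Y)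
qed (fact rfuns_bump rfuns_box)+

sublocale pf: positive_functional rfuns T_real Y by (rule positive_functional_T)

text \<open>Positivity gives real values on nonnegative functions, and f is the difference of the
  nonnegative functions f + M e and M e.\<close>

lemma T_real_eq:
  assumes f: "f \<in> rfuns"
  shows "T (tform (\<lambda>p. complex_of_real (f p))) = of_real (T_real f)"
proof -
  obtain K where K: "compact K" "K \<subseteq> Y" "\<And>x. x \<notin> K \<Longrightarrow> f x = 0" using pf.V_supp[OF f] by blast
  obtain e where e: "e \<in> rfuns" "\<And>x. 0 \<le> e x" "\<And>x. x \<in> K \<Longrightarrow> 1 \<le> e x" using rfuns_bump[OF K(1,2)] by blast
  obtain M where M: "M > 0" "\<And>x. \<bar>f x\<bar> \<le> M" using pf.P_bounded[OF f] by blast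
  have Me: "(\<lambda>x. M * e x) \<in> rfuns" using pf.V_scale[OF e(1)] .
  have real: "Im (T (tform (\<lambda>p. complex_of_real (g p)))) = 0" if "g \<in> rfuns" "\<And>x. 0 \<le> g x" for g
    using T_nonneg[OF that] by (simp add: complex_nonneg_Reals_iff)
  have "0 \<le> f x + M * e x" for x
  proof (cases "x \<in> K")
    case True
    then have "M * 1 \<le> M * e x" using M e(3) by (intro mult_left_mono) auto
    then show ?thesis using M(2)[of x] by linarith
  qed (use K(3) M e(2) in simp)
  then have "Im (T (tform (\<lambda>p. complex_of_real (f p + M * e p)))) = 0"
    by (intro real pf.V_add f Me)
  moreover have "Im (T (tform (\<lambda>p. complex_of_real (M * e p)))) = 0"
    using Me M(1) e(2) by (intro real) auto
  moreover have "T (tform (\<lambda>p. complex_of_real (f p + M * e p))) =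
     T (tform (\<lambda>p. complex_of_real (f p))) + T (tform (\<lambda>p. complex_of_real (M * e p)))"
    unfolding of_real_add using f Me by (intro T_add) (auto simp: rfuns_def)
  ultimately have "Im (T (tform (\<lambda>p. complex_of_real (f p)))) = 0" by simp
  then show ?thesis by (simp add: T_real_def complex_eq_iff)
qed

lemma tfuns_Re_Im: "f \<in> tfuns \<Longrightarrow> (\<lambda>p. Re (f p)) \<in> rfuns \<and> (\<lambda>p. Im (f p)) \<in> rfuns"
  using tfuns_linear[of f "\<lambda>z. complex_of_real (Re z)", OF _ bounded_linear_compose[OF bounded_linear_of_real bounded_linear_Re]]
    tfuns_linear[of f "\<lambda>z. complex_of_real (Im z)", OF _ bounded_linear_compose[OF bounded_linear_of_real bounded_linear_Im]]
  by (simp add: rfuns_def)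

lemma T_complex: "f \<in> tfuns \<Longrightarrow> T (tform f) = of_real (T_real (\<lambda>p. Re (f p))) + \<i> * of_real (T_real (\<lambda>p. Im (f p)))"
proof -
  assume f: "f \<in> tfuns"
  have r: "(\<lambda>p. complex_of_real (Re (f p))) \<in> tfuns" "(\<lambda>p. complex_of_real (Im (f p))) \<in> tfuns"
    using tfuns_Re_Im[OF f] by (simp_all add: rfuns_def)
  have "T (tform f) = T (tform (\<lambda>p. complex_of_real (Re (f p)) + \<i> * complex_of_real (Im (f p))))"
    by (simp add: complex_eq[symmetric])
  also have "\<dots> = T (tform (\<lambda>p. complex_of_real (Re (f p)))) + \<i> * T (tform (\<lambda>p. complex_of_real (Im (f p))))"
    using T_add[OF r(1) tfuns_linear[OF r(2) bounded_linear_mult_right, of "\<i>"]] T_scale[OF r(2)] by simp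
  finally show ?thesis using T_real_eq tfuns_Re_Im[OF f] by simp
qed

text \<open>\<open>wedge_measure\<close> is a definite description, so uniqueness counts as much as
  existence. Test functions are integrable for any competitor because it is finite on their compact
  supports.\<close>

lemma wedge_measure_eq: "wedge_measure polydisc L {0} T std_hermitian = pf.rep_measure"
  unfolding wedge_measure_def
proof (rule the_equality)
  let ?\<sigma> = pf.rep_measure
  show "sets ?\<sigma> = sets borel \<and> emeasure ?\<sigma> (- Y) = 0 \<and>
     (\<forall>K. compact K \<and> K \<subseteq> Y \<longrightarrow> emeasure ?\<sigma> K < \<infinity>) \<and>
     (\<forall>f\<in>tfuns. T (tform f) = (\<integral>p. f p \<partial>?\<sigma>))"
  proof (intro conjI ballI allI impI)
    fix f assume f: "f \<in> tfuns"
    note r = pf.integral_rep_measure[OF conjunct1[OF tfuns_Re_Im[OF f]]]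
    note i = pf.integral_rep_measure[OF conjunct2[OF tfuns_Re_Im[OF f]]]
    have "(\<integral>p. f p \<partial>?\<sigma>) = (\<integral>p. complex_of_real (Re (f p)) + \<i> * complex_of_real (Im (f p)) \<partial>?\<sigma>)"
      by (simp add: complex_eq[symmetric])
    also have "\<dots> = of_real (T_real (\<lambda>p. Re (f p))) + \<i> * of_real (T_real (\<lambda>p. Im (f p)))"
      using r i by (subst Bochner_Integration.integral_add) (auto simp: integral_complex_of_real)
    finally show "T (tform f) = (\<integral>p. f p \<partial>?\<sigma>)" using T_complex[OF f] by simp
  next
    show "emeasure ?\<sigma> (- Y) = 0" by (rule pf.rep_measure_compl)
    show "emeasure ?\<sigma> K < \<infinity>" if "compact K \<and> K \<subseteq> Y" for K using pf.rep_measure_compact that by blast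
  qed simp
next
  fix \<mu> assume mu: "sets \<mu> = sets borel \<and> emeasure \<mu> (- Y) = 0 \<and>
     (\<forall>K. compact K \<and> K \<subseteq> Y \<longrightarrow> emeasure \<mu> K < \<infinity>) \<and>
     (\<forall>f\<in>tfuns. T (tform f) = (\<integral>p. f p \<partial>\<mu>))"
  note [measurable_cong] = conjunct1[OF mu]
  have int: "integrable \<mu> f \<and> integral\<^sup>L \<mu> f = T_real f" if f: "f \<in> rfuns" for f
  proof -
    obtain K where K: "compact K" "K \<subseteq> Y" "\<And>x. x \<notin> K \<Longrightarrow> f x = 0" using pf.V_supp[OF f] by blast
    obtain M where M: "M > 0" "\<And>x. \<bar>f x\<bar> \<le> M" using pf.P_bounded[OF f] by blast
    have [measurable]: "f \<in> borel_measurable borel"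
      using pf.V_cont[OF f] by (rule borel_measurable_continuous_onI)
    have [measurable]: "K \<in> sets borel" using K(1) by (simp add: compact_imp_closed)
    have "integrable \<mu> (\<lambda>x. M * indicator K x)"
      using mu K by (intro integrable_mult_right integrable_real_indicator) auto
    then have "integrable \<mu> f"
    proof (rule Bochner_Integration.integrable_bound)
      show "f \<in> borel_measurable \<mu>" by measurable
      show "AE x in \<mu>. norm (f x) \<le> norm (M * indicator K x)"
        using M K(3) by (intro always_eventually) (auto split: split_indicator)
    qed
    moreover have "complex_of_real (T_real f) = complex_of_real (integral\<^sup>L \<mu> f)"
      using mu T_real_eq[OF f] f integral_complex_of_real[of \<mu> f] by (simp add: rfuns_def)
    ultimately show ?thesis by (simp only: of_real_eq_iff)
  qed
  show "\<mu> = pf.rep_measure"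
    by (rule pf.representing_measure_unique) (use mu int pf.rep_measure_compl pf.integral_rep_measure in auto)
qed

end

section \<open>Leafwise calculus in the flow time\<close>

lemma leaf_deriv_eqI:
  "(g \<circ> plaque_line u d p has_vector_derivative D) (at 0) \<Longrightarrow> leaf_deriv u d g p = D"
  unfolding leaf_deriv_def by (rule vector_derivative_at)

lemma leaf_deriv_const: "leaf_deriv u d (\<lambda>_. c) p = 0"
  by (rule leaf_deriv_eqI) (simp add: o_def)

context
  fixes u :: "('n::finite, 'm::finite) chart" and O' :: "(complex ^ 'n) set"
  assumes u: "flow_box u" and O': "open O'" "O' \<subseteq> fst u"
begin

lemma leaf_deriv_add:
  assumes "leaf_smooth_on u O' g" "leaf_smooth_on u O' h" "p \<in> O'" "d \<in> {1, \<i>}"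
  shows "leaf_deriv u d (\<lambda>p. g p + h p) p = leaf_deriv u d g p + leaf_deriv u d h p"
  using has_vector_derivative_add[OF leaf_smooth_on_vd[OF u O' assms(1,3,4)] leaf_smooth_on_vd[OF u O' assms(2,3,4)]]
  by (intro leaf_deriv_eqI) (simp add: o_def)

lemma leaf_deriv_mult:
  assumes "leaf_smooth_on u O' g" "leaf_smooth_on u O' h" "p \<in> O'" "d \<in> {1, \<i>}"
  shows "leaf_deriv u d (\<lambda>p. g p * h p) p = leaf_deriv u d g p * h p + g p * leaf_deriv u d h p"
  by (rule leaf_deriv_eqI[OF leaf_mult_vd[OF u O' assms(3) leaf_smooth_on_vd[OF u O' assms(1,3,4)]
        leaf_smooth_on_vd[OF u O' assms(2,3,4)]]])

lemma leaf_deriv_compose: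
  assumes "leaf_smooth_on u O' (\<lambda>p. complex_of_real (a p))" "p \<in> O'" "d \<in> {1, \<i>}"
    "(h has_real_derivative h') (at (a p))"
  shows "leaf_deriv u d (\<lambda>p. complex_of_real (h (a p))) p = of_real h' * leaf_deriv u d (\<lambda>p. complex_of_real (a p)) p"
  by (rule leaf_deriv_eqI[OF leaf_compose_vd(1)[OF u O' assms(2) leaf_smooth_on_vd[OF u O' assms(1,2,3)] assms(4)]])

lemma leaf_deriv2_add:
  assumes "leaf_smooth_on u O' g" "leaf_smooth_on u O' h" "p \<in> O'" "d \<in> {1, \<i>}"
  shows "leaf_deriv u d (leaf_deriv u d (\<lambda>p. g p + h p)) p
    = leaf_deriv u d (leaf_deriv u d g) p + leaf_deriv u d (leaf_deriv u d h) p"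
proof -
  have "leaf_deriv u d (leaf_deriv u d (\<lambda>p. g p + h p)) p
      = leaf_deriv u d (\<lambda>p. leaf_deriv u d g p + leaf_deriv u d h p) p"
    using assms O' leaf_deriv_add by (intro leaf_deriv_cong[OF u _ O'(1)]) auto
  also have "\<dots> = leaf_deriv u d (leaf_deriv u d g) p + leaf_deriv u d (leaf_deriv u d h) p"
    using leaf_deriv_add[OF leaf_smooth_on_leaf_deriv[OF u O' assms(1,4)] leaf_smooth_on_leaf_deriv[OF u O' assms(2,4)] assms(3,4)] .
  finally show ?thesis .
qed

lemma leaf_deriv2_mult:
  assumes "leaf_smooth_on u O' g" "leaf_smooth_on u O' h" "p \<in> O'" "d \<in> {1, \<i>}"
  shows "leaf_deriv u d (leaf_deriv u d (\<lambda>p. g p * h p)) p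
    = leaf_deriv u d (leaf_deriv u d g) p * h p + 2 * leaf_deriv u d g p * leaf_deriv u d h p
      + g p * leaf_deriv u d (leaf_deriv u d h) p"
proof -
  note G = leaf_smooth_on_leaf_deriv[OF u O' assms(1,4)]
  note H = leaf_smooth_on_leaf_deriv[OF u O' assms(2,4)]
  have "leaf_deriv u d (leaf_deriv u d (\<lambda>p. g p * h p)) p
      = leaf_deriv u d (\<lambda>p. leaf_deriv u d g p * h p + g p * leaf_deriv u d h p) p"
    using assms O' leaf_deriv_mult by (intro leaf_deriv_cong[OF u _ O'(1)]) auto
  also have "\<dots> = leaf_deriv u d (\<lambda>p. leaf_deriv u d g p * h p) p + leaf_deriv u d (\<lambda>p. g p * leaf_deriv u d h p) p"
    by (rule leaf_deriv_add[OF leaf_smooth_on_mult[OF u O' G assms(2)] leaf_smooth_on_mult[OF u O' assms(1) H] assms(3,4)])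
  finally show ?thesis
    using leaf_deriv_mult[OF G assms(2-4)] leaf_deriv_mult[OF assms(1) H assms(3,4)] by simp
qed

lemma leaf_deriv2_compose:
  assumes "leaf_smooth_on u O' (\<lambda>p. complex_of_real (a p))" "p \<in> O'" "d \<in> {1, \<i>}" "a ` O' \<subseteq> I"
    "smooth_real_on I h" "\<And>x. x \<in> I \<Longrightarrow> (h has_real_derivative h' x) (at x)" "smooth_real_on I h'"
    "(h' has_real_derivative h'') (at (a p))"
  shows "leaf_deriv u d (leaf_deriv u d (\<lambda>p. complex_of_real (h (a p)))) p
    = of_real h'' * (leaf_deriv u d (\<lambda>p. complex_of_real (a p)) p)\<^sup>2
      + of_real (h' (a p)) * leaf_deriv u d (leaf_deriv u d (\<lambda>p. complex_of_real (a p))) p"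
proof -
  note A = leaf_smooth_on_leaf_deriv[OF u O' assms(1,3)]
  have "leaf_deriv u d (leaf_deriv u d (\<lambda>p. complex_of_real (h (a p)))) p
      = leaf_deriv u d (\<lambda>p. of_real (h' (a p)) * leaf_deriv u d (\<lambda>p. complex_of_real (a p)) p) p"
    using assms O' leaf_deriv_compose[OF assms(1)] by (intro leaf_deriv_cong[OF u _ O'(1)]) auto
  also have "\<dots> = leaf_deriv u d (\<lambda>p. complex_of_real (h' (a p))) p * leaf_deriv u d (\<lambda>p. complex_of_real (a p)) p
     + of_real (h' (a p)) * leaf_deriv u d (leaf_deriv u d (\<lambda>p. complex_of_real (a p))) p"
    by (rule leaf_deriv_mult[OF leaf_smooth_on_compose[OF u O' assms(7,1,4)] A assms(2,3)])
  finally show ?thesis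
    using leaf_deriv_compose[OF assms(1-3,8)] by (simp add: power2_eq_square)
qed

end

context linear_foliation
begin

text \<open>
  On \<open>U\<close>, the functions \<open>f1\<close> and \<open>f2\<close> are $\partial f/\partial\zeta$ and
  $\partial^2 f/\partial\zeta\,\partial\bar\zeta$ in the flow time $\zeta$, a leafwise coordinate
  whose derivative $d\zeta/dy$ is \<open>time_deriv u\<close>.
\<close>

definition leaf_jet ::
    "(complex ^ 'n) set \<Rightarrow> (complex ^ 'n \<Rightarrow> real) \<Rightarrow> (complex ^ 'n \<Rightarrow> complex) \<Rightarrow> (complex ^ 'n \<Rightarrow> real) \<Rightarrow> bool" where
  "leaf_jet U f f1 f2 \<longleftrightarrow> (\<forall>u\<in>L. leaf_smooth_on u (fst u \<inter> U) (\<lambda>p. complex_of_real (f p)) \<and>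
     (\<forall>p\<in>fst u \<inter> U.
        (\<forall>d\<in>{1, \<i>}. leaf_deriv u d (\<lambda>p. complex_of_real (f p)) p = of_real (2 * Re (f1 p * time_deriv u p * d))) \<and>
        leaf_deriv u 1 (leaf_deriv u 1 (\<lambda>p. complex_of_real (f p))) p +
        leaf_deriv u \<i> (leaf_deriv u \<i> (\<lambda>p. complex_of_real (f p))) p
          = of_real (4 * (cmod (time_deriv u p))\<^sup>2 * f2 p)))"

lemma leaf_jetD:
  assumes "leaf_jet U f f1 f2" "u \<in> L"
  shows "leaf_smooth_on u (fst u \<inter> U) (\<lambda>p. complex_of_real (f p))"
    "p \<in> fst u \<inter> U \<Longrightarrow> d \<in> {1, \<i>} \<Longrightarrow>
       leaf_deriv u d (\<lambda>p. complex_of_real (f p)) p = of_real (2 * Re (f1 p * time_deriv u p * d))"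
    "p \<in> fst u \<inter> U \<Longrightarrow> leaf_deriv u 1 (leaf_deriv u 1 (\<lambda>p. complex_of_real (f p))) p +
        leaf_deriv u \<i> (leaf_deriv u \<i> (\<lambda>p. complex_of_real (f p))) p
          = of_real (4 * (cmod (time_deriv u p))\<^sup>2 * f2 p)"
  using assms unfolding leaf_jet_def by blast+

lemma leaf_jetI:
  assumes "\<And>u. u \<in> L \<Longrightarrow> leaf_smooth_on u (fst u \<inter> U) (\<lambda>p. complex_of_real (f p))"
    "\<And>u p d. u \<in> L \<Longrightarrow> p \<in> fst u \<inter> U \<Longrightarrow> d \<in> {1, \<i>} \<Longrightarrow>
       leaf_deriv u d (\<lambda>p. complex_of_real (f p)) p = of_real (2 * Re (f1 p * time_deriv u p * d))"
    "\<And>u p. u \<in> L \<Longrightarrow> p \<in> fst u \<inter> U \<Longrightarrow> leaf_deriv u 1 (leaf_deriv u 1 (\<lambda>p. complex_of_real (f p))) p +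
        leaf_deriv u \<i> (leaf_deriv u \<i> (\<lambda>p. complex_of_real (f p))) p
          = of_real (4 * (cmod (time_deriv u p))\<^sup>2 * f2 p)"
  shows "leaf_jet U f f1 f2"
  using assms unfolding leaf_jet_def by blast

lemma chart_Int:
  assumes "u \<in> L" "open U"
  shows "flow_box u" "open (fst u \<inter> U)" "fst u \<inter> U \<subseteq> fst u"
  using flow_boxL[OF assms(1)] chart_open[OF assms(1)] assms(2) by auto

lemma leaf_jet_cong:
  assumes j: "leaf_jet U f f1 f2" and U: "open U"
    and eq: "\<And>p. p \<in> U \<Longrightarrow> f p = g p" "\<And>p. p \<in> U \<Longrightarrow> f1 p = g1 p" "\<And>p. p \<in> U \<Longrightarrow> f2 p = g2 p"
  shows "leaf_jet U g g1 g2"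
proof (rule leaf_jetI)
  fix u assume u: "u \<in> L"
  note o = chart_Int[OF u U]
  show "leaf_smooth_on u (fst u \<inter> U) (\<lambda>p. complex_of_real (g p))"
    by (rule leaf_smooth_on_cong[OF o leaf_jetD(1)[OF j u]]) (simp add: eq)
  fix p assume p: "p \<in> fst u \<inter> U"
  then have pu: "p \<in> fst u" and pU: "p \<in> U" by auto
  have c: "leaf_deriv u d (\<lambda>p. complex_of_real (g p)) q = leaf_deriv u d (\<lambda>p. complex_of_real (f p)) q"
    if "q \<in> fst u \<inter> U" for d q
    using that by (intro leaf_deriv_cong[OF o(1) _ o(2) that]) (auto simp: eq)
  show "leaf_deriv u d (\<lambda>p. complex_of_real (g p)) p = of_real (2 * Re (g1 p * time_deriv u p * d))"
    if "d \<in> {1, \<i>}" for d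
    using c[OF p] leaf_jetD(2)[OF j u p that] eq(2)[OF pU] by simp
  have c2: "leaf_deriv u d (leaf_deriv u d (\<lambda>p. complex_of_real (g p))) p
      = leaf_deriv u d (leaf_deriv u d (\<lambda>p. complex_of_real (f p))) p" for d
    by (intro leaf_deriv_cong[OF o(1) pu o(2) p]) (rule c)
  show "leaf_deriv u 1 (leaf_deriv u 1 (\<lambda>p. complex_of_real (g p))) p +
        leaf_deriv u \<i> (leaf_deriv u \<i> (\<lambda>p. complex_of_real (g p))) p
          = of_real (4 * (cmod (time_deriv u p))\<^sup>2 * g2 p)"
    unfolding c2 using leaf_jetD(3)[OF j u p] eq(3)[OF pU] by simp
qed

lemma leaf_jet_subset:
  assumes "leaf_jet U f f1 f2" "U' \<subseteq> U"
  shows "leaf_jet U' f f1 f2"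
proof (rule leaf_jetI)
  fix u assume u: "u \<in> L"
  show "leaf_smooth_on u (fst u \<inter> U') (\<lambda>p. complex_of_real (f p))"
    using leaf_smooth_on_subset[OF leaf_jetD(1)[OF assms(1) u]] assms(2) by blast
qed (use leaf_jetD(2,3)[OF assms(1)] assms(2) in blast)+

lemma leaf_jet_Un:
  assumes "leaf_jet U f f1 f2" "leaf_jet V f f1 f2" "open U" "open V"
  shows "leaf_jet (U \<union> V) f f1 f2"
proof (rule leaf_jetI)
  fix u assume u: "u \<in> L"
  have "leaf_smooth_on u ((fst u \<inter> U) \<union> (fst u \<inter> V)) (\<lambda>p. complex_of_real (f p))"
    using leaf_smooth_on_Un[OF leaf_jetD(1)[OF assms(1) u] leaf_jetD(1)[OF assms(2) u]] chart_Int(2)[OF u] assms(3,4) by blast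
  then show "leaf_smooth_on u (fst u \<inter> (U \<union> V)) (\<lambda>p. complex_of_real (f p))"
    by (simp add: Int_Un_distrib)
qed (use leaf_jetD(2,3)[OF assms(1)] leaf_jetD(2,3)[OF assms(2)] in blast)+

lemma leaf_jet_const:
  assumes "open U"
  shows "leaf_jet U (\<lambda>_. c) (\<lambda>_. 0) (\<lambda>_. 0)"
proof (rule leaf_jetI)
  fix u p assume u: "u \<in> L" "p \<in> fst u \<inter> U"
  note o = chart_Int[OF u(1) assms]
  have "leaf_deriv u d (\<lambda>p. complex_of_real c) = (\<lambda>_. 0)" for d
    by (rule ext) (rule leaf_deriv_const)
  then show "leaf_deriv u 1 (leaf_deriv u 1 (\<lambda>p. complex_of_real c)) p +
        leaf_deriv u \<i> (leaf_deriv u \<i> (\<lambda>p. complex_of_real c)) p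
          = of_real (4 * (cmod (time_deriv u p))\<^sup>2 * 0)"
    using leaf_deriv_const[of u _ 0] by simp
next
  fix u assume u: "u \<in> L"
  show "leaf_smooth_on u (fst u \<inter> U) (\<lambda>p. complex_of_real c)"
    by (rule leaf_smooth_on_const[OF chart_Int[OF u assms]])
qed (simp add: leaf_deriv_const)

lemma leaf_jet_add:
  assumes f: "leaf_jet U f f1 f2" and g: "leaf_jet U g g1 g2" and U: "open U"
  shows "leaf_jet U (\<lambda>p. f p + g p) (\<lambda>p. f1 p + g1 p) (\<lambda>p. f2 p + g2 p)"
proof (rule leaf_jetI)
  fix u assume u: "u \<in> L"
  note o = chart_Int[OF u U]
  note F = leaf_jetD[OF f u] and G = leaf_jetD[OF g u]
  show "leaf_smooth_on u (fst u \<inter> U) (\<lambda>p. complex_of_real (f p + g p))"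
    using leaf_smooth_on_add[OF o F(1) G(1)] by simp
  fix p assume p: "p \<in> fst u \<inter> U"
  show "leaf_deriv u d (\<lambda>p. complex_of_real (f p + g p)) p = of_real (2 * Re ((f1 p + g1 p) * time_deriv u p * d))"
    if "d \<in> {1, \<i>}" for d
    using leaf_deriv_add[OF o F(1) G(1) p that] F(2)[OF p that] G(2)[OF p that]
    by (simp add: algebra_simps)
  show "leaf_deriv u 1 (leaf_deriv u 1 (\<lambda>p. complex_of_real (f p + g p))) p +
        leaf_deriv u \<i> (leaf_deriv u \<i> (\<lambda>p. complex_of_real (f p + g p))) p
          = of_real (4 * (cmod (time_deriv u p))\<^sup>2 * (f2 p + g2 p))"
  proof -
    have "leaf_deriv u 1 (leaf_deriv u 1 (\<lambda>p. complex_of_real (f p + g p))) p +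
        leaf_deriv u \<i> (leaf_deriv u \<i> (\<lambda>p. complex_of_real (f p + g p))) p =
        (leaf_deriv u 1 (leaf_deriv u 1 (\<lambda>p. complex_of_real (f p))) p +
        leaf_deriv u \<i> (leaf_deriv u \<i> (\<lambda>p. complex_of_real (f p))) p) +
        (leaf_deriv u 1 (leaf_deriv u 1 (\<lambda>p. complex_of_real (g p))) p +
        leaf_deriv u \<i> (leaf_deriv u \<i> (\<lambda>p. complex_of_real (g p))) p)"
      using leaf_deriv2_add[OF o F(1) G(1) p] by simp
    then show ?thesis unfolding F(3)[OF p] G(3)[OF p] by (simp add: algebra_simps)
  qed
qed

text \<open>The inner product of two gradients in terms of the complex derivatives a and b; here c
  will be d\<zeta>/dy.\<close>

lemma Re_grad_mult: "Re (a * c) * Re (b * c) + Re (a * c * \<i>) * Re (b * c * \<i>) = (cmod c)\<^sup>2 * Re (a * cnj b)"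
  by (simp only: cmod_power2) (simp add: power2_eq_square algebra_simps)

lemma of_real_sum_prod:
  "complex_of_real (2 * a) * of_real (2 * b) + of_real (2 * a') * of_real (2 * b') = of_real (4 * (a * b + a' * b'))"
  by simp

lemma leaf_jet_mult:
  assumes f: "leaf_jet U f f1 f2" and g: "leaf_jet U g g1 g2" and U: "open U"
  shows "leaf_jet U (\<lambda>p. f p * g p) (\<lambda>p. f1 p * of_real (g p) + of_real (f p) * g1 p)
    (\<lambda>p. f2 p * g p + f p * g2 p + 2 * Re (f1 p * cnj (g1 p)))"
proof (rule leaf_jetI)
  fix u assume u: "u \<in> L"
  note o = chart_Int[OF u U]
  note F = leaf_jetD[OF f u] and G = leaf_jetD[OF g u]
  show "leaf_smooth_on u (fst u \<inter> U) (\<lambda>p. complex_of_real (f p * g p))"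
    using leaf_smooth_on_mult[OF o F(1) G(1)] by simp
  fix p assume p: "p \<in> fst u \<inter> U"
  show "leaf_deriv u d (\<lambda>p. complex_of_real (f p * g p)) p
      = of_real (2 * Re ((f1 p * of_real (g p) + of_real (f p) * g1 p) * time_deriv u p * d))"
    if "d \<in> {1, \<i>}" for d
    using leaf_deriv_mult[OF o F(1) G(1) p that] F(2)[OF p that] G(2)[OF p that]
    by (simp add: algebra_simps)
  let ?c = "time_deriv u p"
  let ?D = "\<lambda>h d. leaf_deriv u d (\<lambda>p. complex_of_real (h p)) p"
  let ?D2 = "\<lambda>h d. leaf_deriv u d (leaf_deriv u d (\<lambda>p. complex_of_real (h p))) p"
  have "?D2 (\<lambda>p. f p * g p) 1 + ?D2 (\<lambda>p. f p * g p) \<i> = (?D2 f 1 + ?D2 f \<i>) * of_real (g p)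
      + of_real (f p) * (?D2 g 1 + ?D2 g \<i>) + 2 * (?D f 1 * ?D g 1 + ?D f \<i> * ?D g \<i>)"
    using leaf_deriv2_mult[OF o F(1) G(1) p] by (simp add: algebra_simps)
  also have "?D f 1 * ?D g 1 + ?D f \<i> * ?D g \<i> = of_real (4 * ((cmod ?c)\<^sup>2 * Re (f1 p * cnj (g1 p))))"
    unfolding F(2)[OF p insertI1] F(2)[OF p insertI2[OF singletonI]] G(2)[OF p insertI1]
      G(2)[OF p insertI2[OF singletonI]] of_real_sum_prod mult_1_right Re_grad_mult ..
  finally show "?D2 (\<lambda>p. f p * g p) 1 + ?D2 (\<lambda>p. f p * g p) \<i>
      = of_real (4 * (cmod ?c)\<^sup>2 * (f2 p * g p + f p * g2 p + 2 * Re (f1 p * cnj (g1 p))))"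
    unfolding F(3)[OF p] G(3)[OF p]
    by (simp add: of_real_mult[symmetric] of_real_add[symmetric] del: of_real_mult of_real_add of_real_power) (simp add: algebra_simps)
qed

lemma leaf_jet_compose:
  assumes h: "smooth_real_on I h" "smooth_real_on I h'"
    "\<And>x. x \<in> I \<Longrightarrow> (h has_real_derivative h' x) (at x)"
    "\<And>x. x \<in> I \<Longrightarrow> (h' has_real_derivative h'' x) (at x)"
    and a: "leaf_jet U a a1 a2" and U: "open U" and I: "\<And>p. p \<in> U \<Longrightarrow> a p \<in> I"
  shows "leaf_jet U (\<lambda>p. h (a p)) (\<lambda>p. of_real (h' (a p)) * a1 p)
     (\<lambda>p. h' (a p) * a2 p + h'' (a p) * (cmod (a1 p))\<^sup>2)"
proof (rule leaf_jetI)
  fix u assume u: "u \<in> L"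
  note o = chart_Int[OF u U]
  note A = leaf_jetD[OF a u]
  have aI: "a ` (fst u \<inter> U) \<subseteq> I" using I by blast
  show "leaf_smooth_on u (fst u \<inter> U) (\<lambda>p. complex_of_real (h (a p)))"
    by (rule leaf_smooth_on_compose[OF o h(1) A(1) aI])
  fix p assume p: "p \<in> fst u \<inter> U"
  then have ap: "a p \<in> I" using I by blast
  show "leaf_deriv u d (\<lambda>p. complex_of_real (h (a p))) p
      = of_real (2 * Re (of_real (h' (a p)) * a1 p * time_deriv u p * d))"
    if "d \<in> {1, \<i>}" for d
    using leaf_deriv_compose[OF o A(1) p that h(3)[OF ap]] A(2)[OF p that]
    by (simp add: mult.assoc)
  let ?c = "time_deriv u p"
  let ?D = "\<lambda>h d. leaf_deriv u d (\<lambda>p. complex_of_real (h p)) p"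
  let ?D2 = "\<lambda>h d. leaf_deriv u d (leaf_deriv u d (\<lambda>p. complex_of_real (h p))) p"
  have "?D2 (\<lambda>p. h (a p)) 1 + ?D2 (\<lambda>p. h (a p)) \<i>
      = of_real (h'' (a p)) * (?D a 1 * ?D a 1 + ?D a \<i> * ?D a \<i>) + of_real (h' (a p)) * (?D2 a 1 + ?D2 a \<i>)"
    using leaf_deriv2_compose[OF o A(1) p _ aI h(1,3,2) h(4)[OF ap]]
    by (simp add: power2_eq_square algebra_simps)
  also have "?D a 1 * ?D a 1 + ?D a \<i> * ?D a \<i> = of_real (4 * ((cmod ?c)\<^sup>2 * Re (a1 p * cnj (a1 p))))"
    unfolding A(2)[OF p insertI1] A(2)[OF p insertI2[OF singletonI]] of_real_sum_prod mult_1_right Re_grad_mult ..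
  also have "Re (a1 p * cnj (a1 p)) = (cmod (a1 p))\<^sup>2"
    by (simp add: complex_norm_square[symmetric] del: of_real_power)
  finally show "?D2 (\<lambda>p. h (a p)) 1 + ?D2 (\<lambda>p. h (a p)) \<i>
      = of_real (4 * (cmod ?c)\<^sup>2 * (h' (a p) * a2 p + h'' (a p) * (cmod (a1 p))\<^sup>2))"
    unfolding A(3)[OF p]
    by (simp add: of_real_mult[symmetric] of_real_add[symmetric] del: of_real_mult of_real_add of_real_power) (simp add: algebra_simps)
qed

text \<open>Along a plaque z_j is holomorphic, so the terms of its second derivative, which carry
  the factor d^2 or its conjugate, cancel between d = 1 and d = \<i>. Only the product of the two
  first derivatives remains in the Laplacian.\<close>

lemma leaf_jet_vsq:
  assumes U: "open U"
  shows "leaf_jet U (vsq j) (\<lambda>p. lam $ j * of_real (vsq j p)) (\<lambda>p. (cmod (lam $ j))\<^sup>2 * vsq j p)"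
proof (rule leaf_jetI)
  fix u assume u: "u \<in> L"
  note o = chart_Int[OF u U]
  let ?z = "\<lambda>p. p $ j" and ?t = "plaque_tangent u j"
  note sub = leaf_smooth_on_subset[OF _ o(3)]
  have z: "leaf_smooth_on u (fst u \<inter> U) ?z" and t: "leaf_smooth_on u (fst u \<inter> U) ?t"
    using leaf_smooth_plaque_tangent_coord(1,2)[OF o(1)] sub by blast+
  have zc: "leaf_smooth_on u (fst u \<inter> U) (\<lambda>p. cnj (?z p))"
    by (rule leaf_smooth_on_linear[OF o bounded_linear_cnj z])
  have eq: "complex_of_real (vsq j p) = ?z p * cnj (?z p)" for p
    unfolding vsq_def complex_norm_square ..
  show "leaf_smooth_on u (fst u \<inter> U) (\<lambda>p. complex_of_real (vsq j p))"
    unfolding eq by (rule leaf_smooth_on_mult[OF o z zc])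
  fix p assume p: "p \<in> fst u \<inter> U"
  have pu: "p \<in> fst u" using p by blast
  let ?s = "deriv (deriv (\<lambda>\<eta>. plaque_param u p \<eta> $ j)) (fst (snd u p))"
  have dz: "leaf_deriv u d ?z q = d * ?t q" if "q \<in> fst u" for d q
    by (rule leaf_deriv_eqI[OF leaf_smooth_plaque_tangent_coord(3)[OF o(1) that]])
  have dzc: "leaf_deriv u d (\<lambda>p. cnj (?z p)) q = cnj (d * ?t q)" if "q \<in> fst u" for d q
    using bounded_linear.has_vector_derivative[OF bounded_linear_cnj leaf_smooth_plaque_tangent_coord(3)[OF o(1) that]]
    by (intro leaf_deriv_eqI) (simp add: o_def)
  have dt: "leaf_deriv u d (leaf_deriv u d ?z) p = d * d * ?s" for d
  proof -
    have "leaf_deriv u d (leaf_deriv u d ?z) p = leaf_deriv u d (\<lambda>q. d * ?t q) p"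
      using p by (intro leaf_deriv_cong[OF o(1) _ o(2)]) (auto simp: dz)
    also have "\<dots> = d * (d * ?s)"
      using has_vector_derivative_mult_right[OF leaf_smooth_plaque_tangent_coord(4)[OF o(1) pu]] p
      by (intro leaf_deriv_eqI) (simp add: o_def)
    finally show ?thesis by simp
  qed
  have dtc: "leaf_deriv u d (leaf_deriv u d (\<lambda>p. cnj (?z p))) p = cnj (d * d * ?s)" for d
  proof -
    have "leaf_deriv u d (leaf_deriv u d (\<lambda>p. cnj (?z p))) p = leaf_deriv u d (\<lambda>q. cnj (d * ?t q)) p"
      using p by (intro leaf_deriv_cong[OF o(1) _ o(2)]) (auto simp: dzc)
    also have "\<dots> = cnj (d * (d * ?s))"
      using bounded_linear.has_vector_derivative[OF bounded_linear_cnj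
          has_vector_derivative_mult_right[OF leaf_smooth_plaque_tangent_coord(4)[OF o(1) pu]]] p
      by (intro leaf_deriv_eqI) (simp add: o_def)
    finally show ?thesis by simp
  qed
  have tp: "?t p = time_deriv u p * (lam $ j * p $ j)" by (rule plaque_tangent_eq[OF u pu])
  show "leaf_deriv u d (\<lambda>p. complex_of_real (vsq j p)) p
      = of_real (2 * Re (lam $ j * of_real (vsq j p) * time_deriv u p * d))" if d: "d \<in> {1, \<i>}" for d
  proof -
    have "leaf_deriv u d (\<lambda>p. complex_of_real (vsq j p)) p = d * ?t p * cnj (?z p) + ?z p * cnj (d * ?t p)"
      unfolding eq leaf_deriv_mult[OF o z zc p d] dz[OF pu] dzc[OF pu] ..
    also have "\<dots> = of_real (2 * Re (d * ?t p * cnj (?z p)))"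
      by (simp add: complex_eq_iff algebra_simps)
    also have "d * ?t p * cnj (?z p) = lam $ j * of_real (vsq j p) * time_deriv u p * d"
      unfolding tp eq by simp
    finally show ?thesis .
  qed
  have "leaf_deriv u d (leaf_deriv u d (\<lambda>p. complex_of_real (vsq j p))) p
      = d * d * ?s * cnj (?z p) + 2 * (d * ?t p) * cnj (d * ?t p) + ?z p * cnj (d * d * ?s)" if d: "d \<in> {1, \<i>}" for d
    unfolding eq leaf_deriv2_mult[OF o z zc p d] dt dtc dz[OF pu] dzc[OF pu] ..
  from this[of 1] this[of \<i>]
  have "leaf_deriv u 1 (leaf_deriv u 1 (\<lambda>p. complex_of_real (vsq j p))) p +
      leaf_deriv u \<i> (leaf_deriv u \<i> (\<lambda>p. complex_of_real (vsq j p))) p = 4 * (?t p * cnj (?t p))"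
    by simp
  also have "?t p * cnj (?t p) = of_real ((cmod (time_deriv u p))\<^sup>2 * ((cmod (lam $ j))\<^sup>2 * vsq j p))"
    unfolding tp by (simp only: of_real_mult complex_norm_square eq complex_cnj_mult mult_ac)
  finally show "leaf_deriv u 1 (leaf_deriv u 1 (\<lambda>p. complex_of_real (vsq j p))) p +
      leaf_deriv u \<i> (leaf_deriv u \<i> (\<lambda>p. complex_of_real (vsq j p))) p
      = of_real (4 * (cmod (time_deriv u p))\<^sup>2 * ((cmod (lam $ j))\<^sup>2 * vsq j p))"
    by simp
qed

lemma leaf_jet_sum:
  assumes "finite A" "\<And>i. i \<in> A \<Longrightarrow> leaf_jet U (f i) (f1 i) (f2 i)" "open U"
  shows "leaf_jet U (\<lambda>p. \<Sum>i\<in>A. f i p) (\<lambda>p. \<Sum>i\<in>A. f1 i p) (\<lambda>p. \<Sum>i\<in>A. f2 i p)"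
  using assms(1,2)
proof (induction A rule: finite_induct)
  case empty
  then show ?case using leaf_jet_const[OF assms(3), of 0] by simp
next
  case (insert i A)
  then show ?case using leaf_jet_add[OF _ _ assms(3), of "f i" "f1 i" "f2 i"] by simp
qed

lemma leaf_jet_cmult:
  assumes "leaf_jet U f f1 f2" "open U"
  shows "leaf_jet U (\<lambda>p. c * f p) (\<lambda>p. of_real c * f1 p) (\<lambda>p. c * f2 p)"
  using leaf_jet_mult[OF leaf_jet_const[OF assms(2), of c] assms(1,2)] by simp

end

context linear_current
begin

section \<open>Harmonicity as an integral identity in the flow time\<close>

lemma tangent_norm2_eq:
  assumes "u \<in> L" "p \<in> fst u"
  shows "tangent_norm2 u p = (cmod (time_deriv u p))\<^sup>2 * speed2 p"
  unfolding tangent_norm2_def speed2_def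
  by (simp add: plaque_tangent_eq[OF assms] norm_mult power_mult_distrib sum_distrib_left)

text \<open>By \<open>tangent_norm2_eq\<close> the factor |d\<zeta>/dy|^2 is common to dd^c f and to
  the restricted Hermitian form, so dd^c f is H times that form, with H independent of the chart.
  The current vanishes on the left side and integrates H on the right.\<close>

lemma leaf_jet_integral:
  assumes j: "leaf_jet Y f f1 f2" and K: "compact K" "K \<subseteq> Y" "\<And>p. p \<in> Y - K \<Longrightarrow> f p = 0"
  defines "H \<equiv> \<lambda>p. if p \<in> Y then f2 p / speed2 p else 0"
  shows "H \<in> rfuns" "integrable pf.rep_measure H" "integral\<^sup>L pf.rep_measure H = 0"
proof -
  let ?G = "\<lambda>p. if p \<in> Y then f p else 0"
  have jG: "leaf_jet Y ?G f1 f2" by (rule leaf_jet_cong[OF j open_Y]) auto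
  have sub: "fst u \<inter> Y = fst u" if "u \<in> L" for u using chart_subset[OF that] by blast
  note GD = leaf_jetD[OF jG, unfolded Int_absorb2]
  have Gt: "(\<lambda>p. complex_of_real (?G p)) \<in> tfuns"
    unfolding tfuns_iff
  proof (intro conjI ballI exI)
    show "leaf_smooth_on u (fst u) (\<lambda>p. complex_of_real (?G p))" if "u \<in> L" for u
      using leaf_jetD(1)[OF jG that] unfolding sub[OF that] .
    show "compact K" "K \<subseteq> Y" "\<forall>p. p \<notin> K \<longrightarrow> complex_of_real (?G p) = 0" using K by auto
  qed
  \<comment> \<open>On the open set Y - K the jet of f is also a jet of the zero function, and the
    second component of a jet is determined by the function.\<close>
  have f2: "f2 p = 0" if p: "p \<in> Y - K" for p
  proof -
    obtain u where u: "u \<in> L" "p \<in> fst u" using charts_cover p by blast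
    have op: "open (Y - K)" using open_Y K(1) by (simp add: compact_imp_closed open_Diff)
    have "leaf_jet (Y - K) (\<lambda>_. 0) f1 f2"
      by (rule leaf_jet_cong[OF leaf_jet_subset[OF j] op]) (use K(3) in auto)
    from leaf_jetD(3)[OF this u(1), of p] leaf_jetD(3)[OF leaf_jet_const[OF op] u(1), of p 0] u p
    have "complex_of_real (4 * (cmod (time_deriv u p))\<^sup>2 * f2 p) = 0" by auto
    then show ?thesis using time_deriv_nz[OF u] by simp
  qed
  have lap: "leaf_ddc L (\<lambda>p. complex_of_real (?G p)) u p = complex_of_real ((cmod (time_deriv u p))\<^sup>2 * f2 p)"
    if u: "u \<in> L" "p \<in> fst u" for u p
    using leaf_jetD(3)[OF jG u(1), of p] u sub[OF u(1)]
    by (simp add: leaf_ddc_def leaf_derivs_def)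
  have Hu: "complex_of_real (H p) = leaf_ddc L (\<lambda>p. complex_of_real (?G p)) u p * of_real (inverse (tangent_norm2 u p))"
    if u: "u \<in> L" "p \<in> fst u" for u p
    using lap[OF u] tangent_norm2_eq[OF u] time_deriv_nz[OF u] chart_subset[OF u(1)] u(2)
    by (auto simp: H_def field_simps)
  have "(\<lambda>p. complex_of_real (H p)) \<in> tfuns"
    unfolding tfuns_iff
  proof (intro conjI ballI exI)
    fix u assume u: "u \<in> L"
    note o = flow_boxL[OF u] chart_open[OF u] order_refl
    note G = leaf_jetD(1)[OF jG u, unfolded sub[OF u]]
    let ?D = "\<lambda>d. leaf_deriv u d (leaf_deriv u d (\<lambda>p. complex_of_real (?G p)))"
    have D: "leaf_smooth_on u (fst u) (?D d)" if "d \<in> {1, \<i>}" for d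
      using leaf_smooth_on_leaf_deriv[OF o leaf_smooth_on_leaf_deriv[OF o G that] that] .
    have "leaf_smooth_on u (fst u) (\<lambda>p. complex_of_real (inverse (tangent_norm2 u p)))"
      by (rule leaf_smooth_on_compose[OF o smooth_real_on_inverse leaf_smooth_tangent_norm2[OF o(1)]])
         (use tangent_norm2_pos[OF o(1)] in auto)
    then have "leaf_smooth_on u (fst u) (\<lambda>p. ((?D 1 p + ?D \<i> p) * (1 / 4)) * complex_of_real (inverse (tangent_norm2 u p)))"
      using D by (intro leaf_smooth_on_mult[OF o] leaf_smooth_on_add[OF o] leaf_smooth_on_const[OF o]) auto
    then show "leaf_smooth_on u (fst u) (\<lambda>p. complex_of_real (H p))"
    proof (rule leaf_smooth_on_cong[OF o])
      fix q assume q: "q \<in> fst u"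
      show "((?D 1 q + ?D \<i> q) * (1 / 4)) * complex_of_real (inverse (tangent_norm2 u q)) = complex_of_real (H q)"
        unfolding Hu[OF u q] using u q by (simp add: leaf_ddc_def leaf_derivs_def)
    qed
  next
    show "compact K" "K \<subseteq> Y" "\<forall>p. p \<notin> K \<longrightarrow> complex_of_real (H p) = 0" using K f2 by (auto simp: H_def)
  qed
  then show H: "H \<in> rfuns" by (simp add: rfuns_def)
  show "integrable pf.rep_measure H" by (rule pf.integral_rep_measure(1)[OF H])
  have "tform (\<lambda>p. complex_of_real (H p)) = leaf_ddc L (\<lambda>p. complex_of_real (?G p))"
  proof (intro ext)
    fix u p
    show "tform (\<lambda>p. complex_of_real (H p)) u p = leaf_ddc L (\<lambda>p. complex_of_real (?G p)) u p"
    proof (cases "u \<in> L \<and> p \<in> fst u")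
      case True
      then show ?thesis
        using Hu[of u p] tangent_norm2_pos[of u p] flow_boxL[of u] by (simp add: leaf_restrict_std_hermitian)
    qed (auto simp: leaf_restrict_std_hermitian leaf_ddc_def)
  qed
  moreover have "T (leaf_ddc L (\<lambda>p. complex_of_real (?G p))) = 0"
    using current Gt unfolding positive_harmonic_directed_current_def harmonic_current_def by blast
  ultimately have "T_real H = 0" by (simp add: T_real_def)
  then show "integral\<^sup>L pf.rep_measure H = 0" using pf.integral_rep_measure(2)[OF H] by simp
qed

lemma speed2_measurable [measurable]: "speed2 \<in> borel_measurable borel"
  unfolding speed2_def[abs_def] by (intro borel_measurable_continuous_onI continuous_intros)

text \<open>The measure $T\wedge i\,d\zeta\wedge d\bar\zeta$ in the flow time $\zeta$.\<close>

definition flow_measure :: "(complex ^ 'n) measure" where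
  "flow_measure = density pf.rep_measure (\<lambda>p. ennreal (1 / speed2 p))"

lemma sets_flow_measure [simp, measurable_cong]: "sets flow_measure = sets borel"
  by (simp add: flow_measure_def)

lemma AE_Y: "AE p in pf.rep_measure. p \<in> Y"
proof (rule AE_I')
  have "- Y \<in> sets borel" by (rule borel_closed[OF closed_Compl[OF open_Y]])
  then show "- Y \<in> null_sets pf.rep_measure"
    using pf.rep_measure_compl unfolding null_sets_def mem_Collect_eq pf.sets_rep_measure by blast
qed auto

text \<open>The second derivative \<open>f2\<close> has flow integral 0, so it may be subtracted
  from \<open>h\<close> before integrating. In the applications f is a potential times a cut-off, g
  is the gain where its Laplacian has a sign and h the cost where the cut-off varies.\<close>

lemma flow_measure_le:
  assumes j: "leaf_jet Y f f1 f2" and K: "compact K" "K \<subseteq> Y" "\<And>p. p \<in> Y - K \<Longrightarrow> f p = 0"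
    and [measurable]: "g \<in> borel_measurable borel" "h \<in> borel_measurable borel"
    and nonneg: "\<And>p. 0 \<le> g p" "\<And>p. 0 \<le> h p"
    and le: "\<And>p. p \<in> Y \<Longrightarrow> g p \<le> h p - f2 p"
  shows "(\<integral>\<^sup>+p. ennreal (g p) \<partial>flow_measure) \<le> (\<integral>\<^sup>+p. ennreal (h p) \<partial>flow_measure)"
proof -
  define H where "H = (\<lambda>p. if p \<in> Y then f2 p / speed2 p else 0)"
  have H: "integrable pf.rep_measure H" "integral\<^sup>L pf.rep_measure H = 0"
    using leaf_jet_integral(2,3)[OF j K] by (simp_all only: H_def)
  have s0: "0 \<le> speed2 p" for p unfolding speed2_def by (intro sum_nonneg) auto
  have dens: "(\<integral>\<^sup>+p. ennreal (a p) \<partial>flow_measure) = (\<integral>\<^sup>+p. ennreal (a p / speed2 p) \<partial>pf.rep_measure)"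
    if [measurable]: "a \<in> borel_measurable borel" and "\<And>p. 0 \<le> a p" for a
    unfolding flow_measure_def
    by (subst nn_integral_density) (use that s0 in \<open>auto simp: ennreal_mult[symmetric] intro!: nn_integral_cong\<close>)
  show ?thesis
  proof (cases "(\<integral>\<^sup>+p. ennreal (h p / speed2 p) \<partial>pf.rep_measure) = \<infinity>")
    case True
    then show ?thesis using dens[of h] nonneg by simp
  next
    case False
    have ih: "integrable pf.rep_measure (\<lambda>p. h p / speed2 p)"
      using False nonneg s0 by (intro integrableI_nonneg) (auto simp: less_top)
    have "(\<integral>\<^sup>+p. ennreal (g p / speed2 p) \<partial>pf.rep_measure) \<le> (\<integral>\<^sup>+p. ennreal (h p / speed2 p - H p) \<partial>pf.rep_measure)"
    proof (rule nn_integral_mono_AE)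
      show "AE p in pf.rep_measure. ennreal (g p / speed2 p) \<le> ennreal (h p / speed2 p - H p)"
        using AE_Y
      proof eventually_elim
        case (elim p)
        have "g p / speed2 p \<le> (h p - f2 p) / speed2 p" using le[OF elim] s0 by (intro divide_right_mono)
        then show ?case using elim by (intro ennreal_leI) (simp add: H_def diff_divide_distrib)
      qed
    qed
    also have "\<dots> = ennreal (\<integral>p. h p / speed2 p - H p \<partial>pf.rep_measure)"
    proof (rule nn_integral_eq_integral)
      show "integrable pf.rep_measure (\<lambda>p. h p / speed2 p - H p)" using ih H(1) by simp
      show "AE p in pf.rep_measure. 0 \<le> h p / speed2 p - H p"
        using AE_Y
      proof eventually_elim
        case (elim p)
        have "0 / speed2 p \<le> (h p - f2 p) / speed2 p"
          using le[OF elim] nonneg(1)[of p] s0 by (intro divide_right_mono) auto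
        then show ?case using elim by (simp add: H_def diff_divide_distrib)
      qed
    qed
    also have "\<dots> = ennreal (\<integral>p. h p / speed2 p \<partial>pf.rep_measure)" using ih H by simp
    also have "\<dots> = (\<integral>\<^sup>+p. ennreal (h p / speed2 p) \<partial>pf.rep_measure)"
      using ih nonneg s0 by (intro nn_integral_eq_integral[symmetric]) auto
    finally show ?thesis using dens[of g] dens[of h] nonneg by simp
  qed
qed

end

text \<open>Identifies the measure in the Lelong number with the one that defines the mass.\<close>

lemma ddc_norm_square: "ddc (\<lambda>z :: complex ^ 'n::finite. complex_of_real ((norm (z - 0))\<^sup>2)) = std_hermitian"
proof
  fix p :: "complex ^ 'n"
  have d: "dir_deriv v (\<lambda>z. complex_of_real ((norm (z - 0))\<^sup>2)) q = of_real (2 * (q \<bullet> v))" for v q :: "complex ^ 'n"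
  proof -
    have "((\<lambda>s. (q + s *\<^sub>R v) \<bullet> (q + s *\<^sub>R v)) has_real_derivative 2 * (q \<bullet> v)) (at 0)"
      by (auto simp: inner_add_left inner_add_right inner_commute[of v q] intro!: derivative_eq_intros)
    then have "((\<lambda>s. complex_of_real ((q + s *\<^sub>R v) \<bullet> (q + s *\<^sub>R v))) has_vector_derivative of_real (2 * (q \<bullet> v))) (at 0)"
      unfolding has_real_derivative_iff_has_vector_derivative
      by (rule bounded_linear.has_vector_derivative[OF bounded_linear_of_real])
    then show ?thesis unfolding dir_deriv_def diff_zero power2_norm_eq_inner by (rule vector_derivative_at)
  qed
  have inner_axis_c: "q \<bullet> axis k c = (q $ k) \<bullet> c" for q :: "complex ^ 'n" and k c by (rule inner_axis)
  have zb: "d_dzbar k (\<lambda>z. complex_of_real ((norm (z - 0))\<^sup>2)) = (\<lambda>q :: complex ^ 'n. q $ k)" for k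
  proof
    show "d_dzbar k (\<lambda>z. complex_of_real ((norm (z - 0))\<^sup>2)) q = q $ k" for q :: "complex ^ 'n"
      unfolding d_dzbar_def d inner_axis_c by (simp add: inner_complex_def complex_eq_iff)
  qed
  have lin: "dir_deriv v (\<lambda>q :: complex ^ 'n. q $ k) p = v $ k" for v k
  proof -
    have "((\<lambda>s. p $ k + s *\<^sub>R (v $ k)) has_vector_derivative v $ k) (at 0)"
      by (auto intro!: derivative_eq_intros)
    then show ?thesis unfolding dir_deriv_def by (simp add: vector_derivative_at)
  qed
  show "ddc (\<lambda>z. complex_of_real ((norm (z - 0))\<^sup>2)) p = std_hermitian p"
    unfolding ddc_def zb by (auto simp: vec_eq_iff d_dz_def lin std_hermitian_def mat_def axis_def)
qed

section \<open>Barriers in logarithmic coordinates\<close>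

lemma cmod2_divide_add_le:
  assumes "e > 0" "f > 0"
  shows "(cmod (g + h))\<^sup>2 / (e + f) \<le> (cmod g)\<^sup>2 / e + (cmod h)\<^sup>2 / f"
proof -
  have "(cmod (g + h))\<^sup>2 \<le> (cmod g + cmod h)\<^sup>2" by (intro power_mono norm_triangle_ineq) auto
  also have "\<dots> \<le> ((cmod g)\<^sup>2 / e + (cmod h)\<^sup>2 / f) * (e + f)"
  proof -
    have "((cmod g)\<^sup>2 / e + (cmod h)\<^sup>2 / f) * (e + f) - (cmod g + cmod h)\<^sup>2 = (cmod g * f - cmod h * e)\<^sup>2 / (e * f)"
      using assms by (simp add: field_simps power2_eq_square)
    also have "\<dots> \<ge> 0" using assms by simp
    finally show ?thesis by linarith
  qed
  finally show ?thesis using assms by (simp add: divide_le_eq)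
qed

text \<open>
  \<open>f2 \<ge> 2 |f1|\<^sup>2 / f\<close> says that the reciprocal of \<open>f\<close> is superharmonic; the condition is
  stable under addition because $|z|^2/t$ is subadditive.
\<close>

lemma reciprocal_superharmonic_sum:
  fixes l0 l1 l2 d :: real
  assumes "e0 > 0" "e1 > 0" "e2 > 0"
    and "l0 \<ge> d + 2 * (cmod g0)\<^sup>2 / e0" "l1 \<ge> 2 * (cmod g1)\<^sup>2 / e1" "l2 \<ge> 2 * (cmod g2)\<^sup>2 / e2"
  defines "E \<equiv> e0 + e1 + e2"
  shows "(l0 + l1 + l2) / E\<^sup>2 - 2 * (cmod (g0 + g1 + g2))\<^sup>2 / E ^ 3 \<ge> d / E\<^sup>2"
proof -
  have E: "E > 0" using assms by simp
  have "(cmod (g0 + g1 + g2))\<^sup>2 / E \<le> (cmod (g0 + g1))\<^sup>2 / (e0 + e1) + (cmod g2)\<^sup>2 / e2"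
    unfolding E_def using assms by (intro cmod2_divide_add_le) auto
  also have "(cmod (g0 + g1))\<^sup>2 / (e0 + e1) \<le> (cmod g0)\<^sup>2 / e0 + (cmod g1)\<^sup>2 / e1"
    using assms by (intro cmod2_divide_add_le) auto
  finally have "d \<le> l0 + l1 + l2 - 2 * ((cmod (g0 + g1 + g2))\<^sup>2 / E)" using assms by simp
  then have "d / E\<^sup>2 \<le> (l0 + l1 + l2 - 2 * ((cmod (g0 + g1 + g2))\<^sup>2 / E)) / E\<^sup>2"
    by (rule divide_right_mono) simp
  also have "\<dots> = (l0 + l1 + l2) / E\<^sup>2 - 2 * (cmod (g0 + g1 + g2))\<^sup>2 / E ^ 3"
    using E by (simp add: field_simps power2_eq_square power3_eq_cube)
  finally show ?thesis .
qed

lemma of_real_twice_Re: "complex_of_real (2 * Re z) = z + cnj z"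
  by (simp add: complex_eq_iff)

lemma cmod_add_square: "(cmod (u + v))\<^sup>2 = (cmod u)\<^sup>2 + (cmod v)\<^sup>2 + 2 * Re (u * cnj v)"
  by (simp only: cmod_power2) (simp add: power2_eq_square algebra_simps)

lemma cmod_diff_square: "(cmod (u - v))\<^sup>2 = (cmod u)\<^sup>2 + (cmod v)\<^sup>2 - 2 * Re (u * cnj v)"
  by (simp only: cmod_power2) (simp add: power2_eq_square algebra_simps)

lemma smooth_real_on_exp: "smooth_real_on UNIV exp"
  unfolding smooth_real_on_def by (rule exI[of _ "\<lambda>_. exp"]) auto

context linear_foliation
begin

section \<open>Jets of logarithms, exponentials and reciprocals\<close>

lemma leaf_jet_ln:
  assumes "leaf_jet U a a1 a2" "open U" "\<And>p. p \<in> U \<Longrightarrow> 0 < a p"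
  shows "leaf_jet U (\<lambda>p. ln (a p)) (\<lambda>p. a1 p / of_real (a p))
    (\<lambda>p. a2 p / a p - (cmod (a1 p))\<^sup>2 / (a p)\<^sup>2)"
proof -
  have "leaf_jet U (\<lambda>p. ln (a p)) (\<lambda>p. of_real (inverse (a p)) * a1 p)
      (\<lambda>p. inverse (a p) * a2 p + (- (inverse (a p) ^ Suc (Suc 0))) * (cmod (a1 p))\<^sup>2)"
  proof (rule leaf_jet_compose[OF smooth_real_on_ln smooth_real_on_inverse _ _ assms(1,2)])
    show "(ln has_real_derivative inverse x) (at x)" "(inverse has_real_derivative - (inverse x ^ Suc (Suc 0))) (at x)"
      if "x \<in> {0<..}" for x :: real
      using that DERIV_inverse[of x UNIV] by (auto intro!: derivative_eq_intros simp: inverse_eq_divide)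
    show "a p \<in> {0<..}" if "p \<in> U" for p using assms(3)[OF that] by simp
  qed
  then show ?thesis
    by (rule leaf_jet_cong[OF _ assms(2)]) (auto simp: divide_inverse power2_eq_square mult_ac)
qed

lemma leaf_jet_exp:
  assumes "leaf_jet U a a1 a2" "open U"
  shows "leaf_jet U (\<lambda>p. exp (a p)) (\<lambda>p. of_real (exp (a p)) * a1 p)
    (\<lambda>p. exp (a p) * (a2 p + (cmod (a1 p))\<^sup>2))"
  by (rule leaf_jet_cong[OF leaf_jet_compose[OF smooth_real_on_exp smooth_real_on_exp _ _ assms] assms(2)])
     (auto intro!: derivative_eq_intros simp: algebra_simps)

lemma leaf_jet_inverse:
  assumes "leaf_jet U a a1 a2" "open U" "\<And>p. p \<in> U \<Longrightarrow> 0 < a p"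
  shows "leaf_jet U (\<lambda>p. inverse (a p)) (\<lambda>p. - a1 p / of_real ((a p)\<^sup>2))
    (\<lambda>p. - (a2 p / (a p)\<^sup>2 - 2 * (cmod (a1 p))\<^sup>2 / a p ^ 3))"
proof -
  have eq: "x powr (-2) = inverse x ^ 2" if "x > 0" for x :: real
    using powr_minus[of x 2] that by (simp add: power_inverse)
  have "leaf_jet U (\<lambda>p. inverse (a p)) (\<lambda>p. of_real (- (inverse (a p) ^ 2)) * a1 p)
      (\<lambda>p. - (inverse (a p) ^ 2) * a2 p + (2 * inverse (a p) ^ 3) * (cmod (a1 p))\<^sup>2)"
  proof (rule leaf_jet_compose[OF smooth_real_on_inverse _ _ _ assms(1,2)])
    show "smooth_real_on {0<..} (\<lambda>x. - (inverse x ^ 2))"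
      by (rule smooth_real_on_cong[OF smooth_real_on_powr[of "-1" "-2"]]) (auto simp: eq)
    show "(inverse has_real_derivative - (inverse x ^ 2)) (at x)" if "x \<in> {0<..}" for x :: real
      using that DERIV_inverse[of x UNIV] by (simp add: numeral_2_eq_2)
    show "((\<lambda>x. - (inverse x ^ 2)) has_real_derivative 2 * inverse x ^ 3) (at x)" if "x \<in> {0<..}" for x :: real
      using that by (auto intro!: derivative_eq_intros simp: power2_eq_square power3_eq_cube)
    show "a p \<in> {0<..}" if "p \<in> U" for p using assms(3)[OF that] by simp
  qed
  then show ?thesis
    by (rule leaf_jet_cong[OF _ assms(2)])
       (auto simp: divide_inverse power_inverse algebra_simps)
qed

section \<open>The squared norm and the speed of the flow\<close>

definition nsq :: "complex ^ 'n \<Rightarrow> real" where "nsq p = (\<Sum>j\<in>UNIV. vsq j p)"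
text \<open>The derivative of |z|^2 in the flow time; the mixed second derivative is
  \<open>speed2\<close>.\<close>

definition nsq1 :: "complex ^ 'n \<Rightarrow> complex" where "nsq1 p = (\<Sum>j\<in>UNIV. lam $ j * of_real (vsq j p))"

lemma vsq_nonneg: "0 \<le> vsq j p" by (simp add: vsq_def)

lemma vsq_le_nsq: "vsq j p \<le> nsq p"
  unfolding nsq_def by (rule member_le_sum) (auto simp: vsq_nonneg)

lemma nsq_nonneg: "0 \<le> nsq p" unfolding nsq_def by (intro sum_nonneg) (simp add: vsq_nonneg)

lemma nsq_eq_norm: "nsq p = (norm p)\<^sup>2"
  unfolding nsq_def vsq_def by (simp add: norm_vec_def L2_set_def sum_nonneg)

lemma nsq_pos: "p \<noteq> 0 \<Longrightarrow> 0 < nsq p" by (simp add: nsq_eq_norm)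

lemma speed2_eq: "speed2 p = (\<Sum>j\<in>UNIV. (cmod (lam $ j))\<^sup>2 * vsq j p)"
  by (simp add: speed2_def vsq_def norm_mult power_mult_distrib)

lemma speed2_nonneg: "0 \<le> speed2 p" unfolding speed2_def by (intro sum_nonneg) auto

lemma nsq1_le: "(cmod (nsq1 p))\<^sup>2 \<le> nsq p * speed2 p"
proof -
  have "cmod (nsq1 p) \<le> (\<Sum>j\<in>UNIV. cmod (lam $ j) * vsq j p)"
    unfolding nsq1_def by (rule sum_norm_le) (simp add: norm_mult vsq_nonneg)
  then have "(cmod (nsq1 p))\<^sup>2 \<le> (\<Sum>j\<in>UNIV. cmod (p $ j) * (cmod (lam $ j) * cmod (p $ j)))\<^sup>2"
    by (intro power_mono) (auto simp: vsq_def power2_eq_square mult_ac)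
  also have "\<dots> \<le> (\<Sum>j\<in>UNIV. (cmod (p $ j))\<^sup>2) * (\<Sum>j\<in>UNIV. (cmod (lam $ j) * cmod (p $ j))\<^sup>2)"
    by (rule Cauchy_Schwarz_ineq_sum)
  also have "\<dots> = nsq p * speed2 p"
    by (simp add: nsq_def vsq_def speed2_def norm_mult)
  finally show ?thesis .
qed

lemma leaf_jet_nsq: "open U \<Longrightarrow> leaf_jet U nsq nsq1 speed2"
  unfolding nsq_def[abs_def] nsq1_def[abs_def] speed2_eq[abs_def]
  by (rule leaf_jet_sum[OF _ leaf_jet_vsq]) auto

definition lam_max :: real where "lam_max = Max (range (\<lambda>j. cmod (lam $ j)))"
definition lam_min :: real where "lam_min = Min (range (\<lambda>j. cmod (lam $ j)))"

lemma lam_min_pos: "lam_min > 0" using lam_nz by (simp add: lam_min_def)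

lemma lam_max_pos: "lam_max > 0"
proof -
  have "0 < cmod (lam $ k)" using lam_nz by simp
  also have "\<dots> \<le> lam_max" by (simp add: lam_max_def)
  finally show ?thesis .
qed

lemma speed2_le: "speed2 p \<le> lam_max\<^sup>2 * nsq p"
  unfolding speed2_eq nsq_def sum_distrib_left
  by (intro sum_mono mult_right_mono power_mono) (auto simp: lam_max_def vsq_nonneg)

lemma speed2_ge: "lam_min\<^sup>2 * nsq p \<le> speed2 p"
  unfolding speed2_eq nsq_def sum_distrib_left
  using lam_min_pos by (intro sum_mono mult_right_mono power_mono) (auto simp: lam_min_def vsq_nonneg)

lemma nsq1_le': "cmod (nsq1 p) \<le> lam_max * nsq p"
proof (rule power2_le_imp_le)
  have "(cmod (nsq1 p))\<^sup>2 \<le> nsq p * (lam_max\<^sup>2 * nsq p)"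
    using nsq1_le[of p] mult_left_mono[OF speed2_le[of p] nsq_nonneg[of p]] by linarith
  then show "(cmod (nsq1 p))\<^sup>2 \<le> (lam_max * nsq p)\<^sup>2" by (simp add: power2_eq_square mult_ac)
qed (use lam_max_pos nsq_nonneg in auto)

section \<open>Logarithmic coordinates and the flow time\<close>

definition generic :: "(complex ^ 'n) set" where
  "generic = {p \<in> polydisc - {0}. p $ k \<noteq> 0 \<and> p $ l \<noteq> 0}"

lemma open_generic: "open generic"
proof -
  have "generic = polydisc \<inter> {p. p $ k \<noteq> 0} \<inter> {p. p $ l \<noteq> 0}" by (auto simp: generic_def)
  moreover have "open {p :: complex ^ 'n. p $ i \<noteq> 0}" for i
    by (intro open_Collect_neq continuous_intros)
  ultimately show ?thesis using open_polydisc by auto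
qed

definition xk :: "complex ^ 'n \<Rightarrow> real" where "xk p = - (1 / 2) * ln (vsq k p)"
definition yl :: "complex ^ 'n \<Rightarrow> real" where "yl p = - (1 / 2) * ln (vsq l p)"
text \<open>\<open>alpha\<close> and \<open>beta\<close> are the derivatives of \<open>xk\<close>
  and \<open>yl\<close> in the flow time. They are constant, so both coordinates are harmonic along
  the leaves.\<close>

definition alpha :: complex where "alpha = - lam $ k / 2"
definition beta :: complex where "beta = - lam $ l / 2"

lemma generic_vsq: "p \<in> generic \<Longrightarrow> 0 < vsq k p \<and> vsq k p < 1 \<and> 0 < vsq l p \<and> vsq l p < 1"
  by (auto simp: generic_def vsq_def polydisc_def abs_square_less_1)

lemma xk_pos: "p \<in> generic \<Longrightarrow> 0 < xk p" and yl_pos: "p \<in> generic \<Longrightarrow> 0 < yl p"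
  using generic_vsq[of p] by (auto simp: xk_def yl_def)

lemma leaf_jet_minus_half_ln:
  assumes "open U" "\<And>p. p \<in> U \<Longrightarrow> 0 < vsq j p"
  shows "leaf_jet U (\<lambda>p. - (1 / 2) * ln (vsq j p)) (\<lambda>_. - lam $ j / 2) (\<lambda>_. 0)"
  by (rule leaf_jet_cong[OF leaf_jet_cmult[OF leaf_jet_ln[OF leaf_jet_vsq[OF assms(1)] assms] assms(1), of "- (1 / 2)"] assms(1)])
     (use assms(2) in \<open>force simp: norm_mult power2_eq_square field_simps\<close>)+

lemma leaf_jet_xk: "leaf_jet generic xk (\<lambda>_. alpha) (\<lambda>_. 0)"
  unfolding xk_def[abs_def] alpha_def by (rule leaf_jet_minus_half_ln[OF open_generic]) (simp add: generic_vsq)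

lemma leaf_jet_yl: "leaf_jet generic yl (\<lambda>_. beta) (\<lambda>_. 0)"
  unfolding yl_def[abs_def] beta_def by (rule leaf_jet_minus_half_ln[OF open_generic]) (simp add: generic_vsq)

definition wdet :: complex where "wdet = alpha * cnj beta - cnj alpha * beta"

lemma wdet_nz: "wdet \<noteq> 0"
proof -
  have "wdet = (lam $ k * cnj (lam $ l) - lam $ l * cnj (lam $ k)) / 4"
    by (simp add: wdet_def alpha_def beta_def field_simps)
  then show ?thesis using det_nz by (metis divide_eq_0_iff zero_neq_numeral)
qed

lemma cnj_wdet: "cnj wdet = - wdet" by (simp add: wdet_def)

text \<open>The flow time as a function of the logarithmic coordinates \<open>xk\<close> and \<open>yl\<close>.\<close>

definition wtime :: "complex ^ 'n \<Rightarrow> complex" where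
  "wtime p = (cnj beta * of_real (xk p) - cnj alpha * of_real (yl p)) / wdet"

definition wsq :: "complex ^ 'n \<Rightarrow> real" where "wsq p = (cmod (wtime p))\<^sup>2"

lemma Re_alpha_wtime: "2 * Re (alpha * wtime p) = xk p"
proof -
  have "of_real (2 * Re (alpha * wtime p)) = alpha * wtime p + cnj (alpha * wtime p)"
    by (rule of_real_twice_Re)
  also have "\<dots> = of_real (xk p) * (alpha * cnj beta - cnj alpha * beta) / wdet"
    using wdet_nz by (simp add: wtime_def cnj_wdet field_simps)
  also have "\<dots> = of_real (xk p)" using wdet_nz by (simp add: wdet_def[symmetric])
  finally show ?thesis by (simp only: of_real_eq_iff)
qed

lemma Re_beta_wtime: "2 * Re (beta * wtime p) = yl p"
proof -
  have "of_real (2 * Re (beta * wtime p)) = beta * wtime p + cnj (beta * wtime p)"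
    by (rule of_real_twice_Re)
  also have "\<dots> = of_real (yl p) * (alpha * cnj beta - cnj alpha * beta) / wdet"
    using wdet_nz by (simp add: wtime_def cnj_wdet field_simps)
  also have "\<dots> = of_real (yl p)" using wdet_nz by (simp add: wdet_def[symmetric])
  finally show ?thesis by (simp only: of_real_eq_iff)
qed

lemma xk_sq_le: "(xk p)\<^sup>2 \<le> 4 * (cmod alpha)\<^sup>2 * wsq p"
  and yl_sq_le: "(yl p)\<^sup>2 \<le> 4 * (cmod beta)\<^sup>2 * wsq p"
proof -
  have *: "(2 * Re (c * w))\<^sup>2 \<le> 4 * (cmod c)\<^sup>2 * (cmod w)\<^sup>2" for c w :: complex
  proof -
    have "(2 * Re (c * w))\<^sup>2 = 4 * \<bar>Re (c * w)\<bar>\<^sup>2" by (simp only: power_mult_distrib power2_abs) simp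
    also have "\<dots> \<le> 4 * (cmod (c * w))\<^sup>2" by (intro mult_left_mono power_mono abs_Re_le_cmod) auto
    finally show ?thesis by (simp add: norm_mult power_mult_distrib)
  qed
  show "(xk p)\<^sup>2 \<le> 4 * (cmod alpha)\<^sup>2 * wsq p" using *[of alpha "wtime p"] by (simp only: Re_alpha_wtime wsq_def)
  show "(yl p)\<^sup>2 \<le> 4 * (cmod beta)\<^sup>2 * wsq p" using *[of beta "wtime p"] by (simp only: Re_beta_wtime wsq_def)
qed

lemma wsq_pos: "p \<in> generic \<Longrightarrow> 0 < wsq p"
proof -
  assume p: "p \<in> generic"
  have "wtime p \<noteq> 0"
  proof
    assume "wtime p = 0"
    then show False using Re_alpha_wtime[of p] xk_pos[OF p] by simp
  qed
  then show ?thesis by (simp add: wsq_def)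
qed

text \<open>On a leaf \<open>wtime\<close> is the flow time up to an additive constant, so |w|^2 has
  derivative cnj w and mixed derivative 1. Jets are defined for real functions only, which is why
  |w|^2 is expanded as a quadratic form in \<open>xk\<close> and \<open>yl\<close>.\<close>

lemma leaf_jet_wsq: "leaf_jet generic wsq (\<lambda>p. cnj (wtime p)) (\<lambda>_. 1)"
proof -
  define m1 where "m1 = cnj beta / wdet"
  define m2 where "m2 = - cnj alpha / wdet"
  have w: "wtime p = m1 * of_real (xk p) + m2 * of_real (yl p)" for p
    by (simp add: wtime_def m1_def m2_def diff_divide_distrib)
  \<comment> \<open>\<open>n1\<close> says that w has derivative 1 in \<zeta>, and \<open>n2\<close>
    that its conjugate has derivative 0, i.e. that w is holomorphic in the flow time.\<close>
  have n1: "m1 * alpha + m2 * beta = 1"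
    using wdet_nz by (simp add: m1_def m2_def field_simps) (simp add: wdet_def mult_ac)
  have n2: "cnj m1 * alpha + cnj m2 * beta = 0"
    using wdet_nz by (simp add: m1_def m2_def cnj_wdet field_simps)
  define A where "A = (cmod m1)\<^sup>2"
  define B where "B = 2 * Re (m1 * cnj m2)"
  define C where "C = (cmod m2)\<^sup>2"
  have cA: "complex_of_real A = m1 * cnj m1" and cC: "complex_of_real C = m2 * cnj m2"
    by (simp_all only: complex_norm_square A_def C_def)
  have cB: "complex_of_real B = m1 * cnj m2 + cnj m1 * m2"
    unfolding B_def of_real_twice_Re by simp
  define S where "S = 2 * Re (alpha * cnj alpha)"
  define U where "U = 2 * Re (alpha * cnj beta)"
  define V where "V = 2 * Re (beta * cnj beta)"
  have cS: "complex_of_real S = 2 * (alpha * cnj alpha)" and cV: "complex_of_real V = 2 * (beta * cnj beta)"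
    and cU: "complex_of_real U = alpha * cnj beta + cnj alpha * beta"
    unfolding S_def U_def V_def of_real_twice_Re by simp_all
  have jx: "leaf_jet generic (\<lambda>p. xk p * xk p) (\<lambda>p. alpha * of_real (xk p) + of_real (xk p) * alpha)
      (\<lambda>p. 0 * xk p + xk p * 0 + 2 * Re (alpha * cnj alpha))"
    by (rule leaf_jet_mult[OF leaf_jet_xk leaf_jet_xk open_generic])
  have jy: "leaf_jet generic (\<lambda>p. yl p * yl p) (\<lambda>p. beta * of_real (yl p) + of_real (yl p) * beta)
      (\<lambda>p. 0 * yl p + yl p * 0 + 2 * Re (beta * cnj beta))"
    by (rule leaf_jet_mult[OF leaf_jet_yl leaf_jet_yl open_generic])
  have jxy: "leaf_jet generic (\<lambda>p. xk p * yl p) (\<lambda>p. alpha * of_real (yl p) + of_real (xk p) * beta)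
      (\<lambda>p. 0 * yl p + xk p * 0 + 2 * Re (alpha * cnj beta))"
    by (rule leaf_jet_mult[OF leaf_jet_xk leaf_jet_yl open_generic])
  note j = leaf_jet_add[OF leaf_jet_add[OF leaf_jet_cmult[OF jx open_generic, of A]
      leaf_jet_cmult[OF jxy open_generic, of B] open_generic] leaf_jet_cmult[OF jy open_generic, of C] open_generic]
  show ?thesis
  proof (rule leaf_jet_cong[OF j open_generic])
    fix p
    have "complex_of_real (A * (xk p * xk p) + B * (xk p * yl p) + C * (yl p * yl p)) = wtime p * cnj (wtime p)"
      unfolding of_real_add of_real_mult[of A] of_real_mult[of B] of_real_mult[of C] cA cB cC w
      by (simp add: algebra_simps)
    also have "\<dots> = complex_of_real (wsq p)" by (simp only: wsq_def complex_norm_square)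
    finally show "A * (xk p * xk p) + B * (xk p * yl p) + C * (yl p * yl p) = wsq p"
      by (simp only: of_real_eq_iff)
    have "of_real A * (alpha * of_real (xk p) + of_real (xk p) * alpha) + of_real B * (alpha * of_real (yl p) + of_real (xk p) * beta)
       + of_real C * (beta * of_real (yl p) + of_real (yl p) * beta)
      = cnj (wtime p) * (m1 * alpha + m2 * beta) + wtime p * (cnj m1 * alpha + cnj m2 * beta)"
      unfolding cA cB cC w by (simp add: algebra_simps)
    then show "of_real A * (alpha * of_real (xk p) + of_real (xk p) * alpha) + of_real B * (alpha * of_real (yl p) + of_real (xk p) * beta)
       + of_real C * (beta * of_real (yl p) + of_real (yl p) * beta) = cnj (wtime p)"
      by (simp add: n1 n2)
    have "complex_of_real (A * S + B * U + C * V)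
       = m1 * cnj m1 * (2 * (alpha * cnj alpha)) + (m1 * cnj m2 + cnj m1 * m2) * (alpha * cnj beta + cnj alpha * beta)
         + m2 * cnj m2 * (2 * (beta * cnj beta))"
      by (simp only: of_real_add of_real_mult cA cB cC cS cU cV)
    also have "\<dots> = (m1 * alpha + m2 * beta) * cnj (m1 * alpha + m2 * beta)
        + (cnj m1 * alpha + cnj m2 * beta) * cnj (cnj m1 * alpha + cnj m2 * beta)"
      by (simp add: algebra_simps)
    also have "\<dots> = complex_of_real 1" by (simp only: n1 n2) simp
    finally have "A * S + B * U + C * V = 1" by (simp only: of_real_eq_iff)
    then show "A * (0 * xk p + xk p * 0 + 2 * Re (alpha * cnj alpha)) + B * (0 * yl p + xk p * 0 + 2 * Re (alpha * cnj beta))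
      + C * (0 * yl p + yl p * 0 + 2 * Re (beta * cnj beta)) = 1" by (simp only: S_def U_def V_def) simp
  qed
qed

section \<open>The barriers and their exponent\<close>

text \<open>\<open>rho\<close> is the modulus of the cosine of the angle between the gradients of
  \<open>xk\<close> and \<open>yl\<close>. The exponent \<open>aexp\<close> is chosen with aexp (1 +
  rho) = 1, the identity that balances gradient and Laplacian in
  \<open>barrier_superharmonic\<close>.\<close>

definition rho :: real where "rho = \<bar>Re (alpha * cnj beta)\<bar> / (cmod alpha * cmod beta)"
definition aexp :: real where "aexp = 1 / (1 + rho)"

lemma alpha_nz: "alpha \<noteq> 0" and beta_nz: "beta \<noteq> 0" using lam_nz by (simp_all add: alpha_def beta_def)

lemma rho_bounds: "0 \<le> rho" "rho < 1"
proof -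
  show "0 \<le> rho" by (simp add: rho_def)
  have "Im (alpha * cnj beta) \<noteq> 0"
  proof
    assume "Im (alpha * cnj beta) = 0"
    then have "wdet = 0" by (simp add: wdet_def complex_eq_iff algebra_simps)
    then show False using wdet_nz by simp
  qed
  then have "(Re (alpha * cnj beta))\<^sup>2 < (cmod (alpha * cnj beta))\<^sup>2"
    unfolding cmod_power2 by (metis less_add_same_cancel1 zero_less_power2)
  then have "\<bar>Re (alpha * cnj beta)\<bar> < cmod (alpha * cnj beta)"
    by (metis abs_norm_cancel power2_abs power2_less_imp_less norm_ge_zero)
  then show "rho < 1" using alpha_nz beta_nz by (simp add: rho_def norm_mult divide_less_eq)
qed

lemma aexp_bounds: "1 / 2 < aexp" "aexp \<le> 1" "aexp * (1 + rho) = 1"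
  using rho_bounds by (auto simp: aexp_def field_simps)

text \<open>With u = |alpha|/x and v = |beta|/y, the cross term of the square is at most 2 rho u v,
  and 2 u v <= u^2 + v^2.\<close>

lemma log_gradient_le:
  assumes "x > 0" "y > 0"
  shows "(cmod (alpha / of_real x + beta / of_real y))\<^sup>2 \<le> (1 + rho) * ((cmod alpha)\<^sup>2 / x\<^sup>2 + (cmod beta)\<^sup>2 / y\<^sup>2)"
proof -
  have "(cmod (alpha / of_real x + beta / of_real y))\<^sup>2
      = (cmod (alpha / of_real x))\<^sup>2 + (cmod (beta / of_real y))\<^sup>2 + 2 * Re ((alpha / of_real x) * cnj (beta / of_real y))"
    by (rule cmod_add_square)
  also have "Re ((alpha / of_real x) * cnj (beta / of_real y)) = Re (alpha * cnj beta) / (x * y)"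
  proof -
    have "(alpha / of_real x) * cnj (beta / of_real y) = (alpha * cnj beta) / of_real (x * y)" by simp
    then show ?thesis by (simp only: Re_divide_of_real)
  qed
  also have "Re (alpha * cnj beta) / (x * y) \<le> rho * (cmod alpha * cmod beta) / (x * y)"
    using alpha_nz beta_nz assms by (intro divide_right_mono) (auto simp: rho_def)
  also have "rho * (cmod alpha * cmod beta) / (x * y) = rho * ((cmod alpha / x) * (cmod beta / y))" by simp
  also have "2 * (rho * ((cmod alpha / x) * (cmod beta / y))) \<le> rho * ((cmod alpha / x)\<^sup>2 + (cmod beta / y)\<^sup>2)"
  proof -
    have "2 * ((cmod alpha / x) * (cmod beta / y)) \<le> (cmod alpha / x)\<^sup>2 + (cmod beta / y)\<^sup>2"
      using sum_squares_bound[of "cmod alpha / x" "cmod beta / y"] by simp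
    from mult_left_mono[OF this rho_bounds(1)] show ?thesis by (simp only: mult_ac)
  qed
  finally show ?thesis using assms by (simp add: norm_divide power_divide distrib_left distrib_right add_divide_distrib)
qed

text \<open>The function e^c (xy)^(-a) |w|^(2b), in exponential form so that its jet comes from a
  sum of logarithms; \<open>barrier_log1\<close> is the derivative of its logarithm in the flow
  time.\<close>

definition barrier :: "real \<Rightarrow> real \<Rightarrow> complex ^ 'n \<Rightarrow> real" where
  "barrier c b p = exp (c - aexp * ln (xk p) - aexp * ln (yl p) + b * ln (wsq p))"

definition barrier_log1 :: "real \<Rightarrow> complex ^ 'n \<Rightarrow> complex" where
  "barrier_log1 b p = - of_real aexp * (alpha / of_real (xk p) + beta / of_real (yl p)) + of_real b * (cnj (wtime p) / of_real (wsq p))"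

lemma leaf_jet_barrier:
  "leaf_jet generic (barrier c b) (\<lambda>p. of_real (barrier c b p) * barrier_log1 b p)
    (\<lambda>p. barrier c b p * (aexp * ((cmod alpha)\<^sup>2 / (xk p)\<^sup>2 + (cmod beta)\<^sup>2 / (yl p)\<^sup>2) + (cmod (barrier_log1 b p))\<^sup>2))"
proof -
  note o = open_generic
  note jc = leaf_jet_const[OF o, of c]
  note jx = leaf_jet_cmult[OF leaf_jet_ln[OF leaf_jet_xk o xk_pos] o, of "- aexp"]
  note jy = leaf_jet_cmult[OF leaf_jet_ln[OF leaf_jet_yl o yl_pos] o, of "- aexp"]
  note jw = leaf_jet_cmult[OF leaf_jet_ln[OF leaf_jet_wsq o wsq_pos] o, of b]
  have "leaf_jet generic (\<lambda>p. c - aexp * ln (xk p) - aexp * ln (yl p) + b * ln (wsq p)) (barrier_log1 b)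
     (\<lambda>p. aexp * ((cmod alpha)\<^sup>2 / (xk p)\<^sup>2 + (cmod beta)\<^sup>2 / (yl p)\<^sup>2))"
  proof (rule leaf_jet_cong[OF leaf_jet_add[OF leaf_jet_add[OF leaf_jet_add[OF jc jx o] jy o] jw o] o])
    fix p assume p: "p \<in> generic"
    \<comment> \<open>ln |w|^2 is harmonic where w is nonzero, so the factor |w|^(2b) adds nothing
      to the Laplacian of the logarithm.\<close>
    have "1 / wsq p - (cmod (cnj (wtime p)))\<^sup>2 / (wsq p)\<^sup>2 = 0"
      using wsq_pos[OF p] unfolding complex_mod_cnj wsq_def[symmetric] by (simp add: power2_eq_square)
    then show "0 + - aexp * (0 / xk p - (cmod alpha)\<^sup>2 / (xk p)\<^sup>2) + - aexp * (0 / yl p - (cmod beta)\<^sup>2 / (yl p)\<^sup>2)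
        + b * (1 / wsq p - (cmod (cnj (wtime p)))\<^sup>2 / (wsq p)\<^sup>2)
      = aexp * ((cmod alpha)\<^sup>2 / (xk p)\<^sup>2 + (cmod beta)\<^sup>2 / (yl p)\<^sup>2)"
      by (simp add: algebra_simps)
  qed (auto simp: barrier_log1_def algebra_simps)
  from leaf_jet_exp[OF this o] show ?thesis unfolding barrier_def[abs_def] .
qed

text \<open>
  For \<open>b = 2 * aexp\<close> the reciprocal barrier is the Kelvin transform of the one for \<open>b = 0\<close>, with
  a logarithmic gradient of the same length.
\<close>

lemma barrier_log1_norm:
  assumes p: "p \<in> generic" and b: "b = 0 \<or> b = 2 * aexp"
  shows "cmod (barrier_log1 b p) = aexp * cmod (alpha / of_real (xk p) + beta / of_real (yl p))"
proof -
  let ?A = "alpha / of_real (xk p) + beta / of_real (yl p)" and ?w = "wtime p"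
  have w0: "wsq p > 0" by (rule wsq_pos[OF p])
  have "cmod (barrier_log1 b p) ^ 2 = (aexp * cmod ?A)\<^sup>2"
  proof (cases "b = 0")
    case True
    then show ?thesis using aexp_bounds by (simp add: barrier_log1_def norm_mult power_mult_distrib)
  next
    case False
    then have b: "b = 2 * aexp" using b by simp
    have ra: "Re (alpha * ?w) = xk p / 2" using Re_alpha_wtime[of p] by linarith
    have rb: "Re (beta * ?w) = yl p / 2" using Re_beta_wtime[of p] by linarith
    \<comment> \<open>Euler's identity: in w, the product of \<open>xk\<close> and \<open>yl\<close>
      is homogeneous of degree 2. It makes the cross term below cancel the square of the added
      vector, so the length is that of \<open>?A\<close> alone.\<close>
    have Re1: "Re (?A * ?w) = 1"
    proof -
      have "?A * ?w = alpha * ?w / of_real (xk p) + beta * ?w / of_real (yl p)" by (simp add: distrib_right)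
      then have "Re (?A * ?w) = Re (alpha * ?w) / xk p + Re (beta * ?w) / yl p"
        by (simp only: plus_complex.sel Re_divide_of_real)
      also have "\<dots> = (xk p / 2) / xk p + (yl p / 2) / yl p" by (simp only: ra rb)
      also have "\<dots> = 1" using xk_pos[OF p] yl_pos[OF p] by simp
      finally show ?thesis .
    qed
    have "barrier_log1 b p = - of_real aexp * (?A - 2 * cnj ?w / of_real (wsq p))"
      by (simp add: barrier_log1_def b algebra_simps)
    then have "(cmod (barrier_log1 b p))\<^sup>2 = aexp\<^sup>2 * (cmod (?A - 2 * cnj ?w / of_real (wsq p)))\<^sup>2"
      using aexp_bounds by (simp add: norm_mult power_mult_distrib)
    also have "(cmod (?A - 2 * cnj ?w / of_real (wsq p)))\<^sup>2
       = (cmod ?A)\<^sup>2 + (cmod (2 * cnj ?w / of_real (wsq p)))\<^sup>2 - 2 * Re (?A * cnj (2 * cnj ?w / of_real (wsq p)))"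
      by (rule cmod_diff_square)
    also have "?A * cnj (2 * cnj ?w / of_real (wsq p)) = of_real (2 / wsq p) * (?A * ?w)" by simp
    also have "Re (of_real (2 / wsq p) * (?A * ?w)) = 2 / wsq p" using Re1 by (simp only: Re_complex_of_real times_complex.sel Im_complex_of_real)
    also have "(cmod (2 * cnj ?w / of_real (wsq p)))\<^sup>2 = 4 / wsq p"
      using w0 unfolding norm_mult norm_divide complex_mod_cnj power_divide power_mult_distrib wsq_def[symmetric]
      by (simp add: power2_eq_square)
    finally show ?thesis by (simp add: power_mult_distrib)
  qed
  then show ?thesis by (rule power2_eq_imp_eq) (use aexp_bounds in auto)
qed

text \<open>Let g be the derivative of the logarithm and S the sum of |alpha|^2/x^2 and
  |beta|^2/y^2. After division by the barrier the claim is a S + |g|^2 >= 2 |g|^2. The gradient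
  bound gives |g|^2 <= a^2 (1+rho) S, which is a S by the choice of a.\<close>

lemma barrier_superharmonic:
  assumes p: "p \<in> generic" and b: "b = 0 \<or> b = 2 * aexp"
  shows "barrier c b p * (aexp * ((cmod alpha)\<^sup>2 / (xk p)\<^sup>2 + (cmod beta)\<^sup>2 / (yl p)\<^sup>2) + (cmod (barrier_log1 b p))\<^sup>2)
    \<ge> 2 * (cmod (of_real (barrier c b p) * barrier_log1 b p))\<^sup>2 / barrier c b p"
proof -
  let ?S = "(cmod alpha)\<^sup>2 / (xk p)\<^sup>2 + (cmod beta)\<^sup>2 / (yl p)\<^sup>2"
  have e: "barrier c b p > 0" by (simp add: barrier_def)
  have "(cmod (barrier_log1 b p))\<^sup>2 = aexp\<^sup>2 * (cmod (alpha / of_real (xk p) + beta / of_real (yl p)))\<^sup>2"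
    by (simp add: barrier_log1_norm[OF p b] power_mult_distrib)
  also have "\<dots> \<le> aexp\<^sup>2 * ((1 + rho) * ?S)"
    by (intro mult_left_mono log_gradient_le xk_pos yl_pos p) simp
  also have "\<dots> = (aexp * (1 + rho)) * (aexp * ?S)" by (simp only: power2_eq_square mult_ac)
  finally have "(cmod (barrier_log1 b p))\<^sup>2 \<le> aexp * ?S" by (simp add: aexp_bounds(3))
  then have "barrier c b p * (2 * (cmod (barrier_log1 b p))\<^sup>2) \<le> barrier c b p * (aexp * ?S + (cmod (barrier_log1 b p))\<^sup>2)"
    using e by (intro mult_left_mono) auto
  then show ?thesis using e by (simp add: norm_mult power_mult_distrib power2_eq_square)
qed

end

section \<open>Cut-off functions\<close>

lemma flat_deriv_1: "flat_deriv 1 x = (if x \<le> 0 then 0 else exp (- 1 / x) / x\<^sup>2)"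
  by (simp add: flat_deriv_def power2_eq_square)

lemma flat_deriv_2: "flat_deriv 2 x = (if x \<le> 0 then 0 else exp (- 1 / x) * (1 - 2 * x) / x ^ 4)"
  by (simp add: flat_deriv_def numeral_2_eq_2 pderiv_mult pderiv_pCons field_simps power_Suc eval_nat_numeral)

lemma flat_deriv_0: "flat_deriv 0 = flat_fun" by (simp add: flat_fun_eq_flat_deriv)

lemma smooth_real_on_flat_deriv: "smooth_real_on UNIV (flat_deriv n)"
  unfolding smooth_real_on_def
  by (rule exI[of _ "\<lambda>m. flat_deriv (n + m)"]) (auto intro: flat_deriv_has_derivative)

text \<open>The bound 3 is the largest argument that occurs in the cut-offs: 4 |z_j|^2 - 1 on the
  polydisc. The arguments x/S - 1 with x <= 2S and \<open>flat_fun 1\<close> - V with V >= 0 are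
  smaller.\<close>

lemma flat_deriv_bounds: "\<exists>B\<ge>1. \<forall>x\<le>3. \<bar>flat_deriv 1 x\<bar> \<le> B \<and> \<bar>flat_deriv 2 x\<bar> \<le> B"
proof -
  have b: "\<exists>B. \<forall>x\<le>3. \<bar>flat_deriv n x\<bar> \<le> B" for n
  proof -
    have "continuous_on {0..3} (flat_deriv n)"
      using flat_deriv_has_derivative by (meson DERIV_continuous continuous_at_imp_continuous_on)
    then have "bounded (flat_deriv n ` {0..3})"
      by (intro compact_imp_bounded compact_continuous_image) auto
    then obtain B where B: "\<forall>x\<in>{0..3}. \<bar>flat_deriv n x\<bar> \<le> B" unfolding bounded_iff by auto
    have "\<bar>flat_deriv n x\<bar> \<le> max B 0" if "x \<le> 3" for x
    proof (cases "x \<le> 0")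
      case True
      then show ?thesis by (simp add: flat_deriv_def)
    next
      case False
      then show ?thesis using bspec[OF B, of x] that by auto
    qed
    then show ?thesis by blast
  qed
  obtain B1 where B1: "\<forall>x\<le>3. \<bar>flat_deriv 1 x\<bar> \<le> B1" using b by blast
  obtain B2 where B2: "\<forall>x\<le>3. \<bar>flat_deriv 2 x\<bar> \<le> B2" using b by blast
  show ?thesis
    by (rule exI[of _ "max 1 (max B1 B2)"]) (use B1 B2 in \<open>fastforce simp: le_max_iff_disj\<close>)
qed

definition flat_B :: real where
  "flat_B = (SOME B. B \<ge> 1 \<and> (\<forall>x\<le>3. \<bar>flat_deriv 1 x\<bar> \<le> B \<and> \<bar>flat_deriv 2 x\<bar> \<le> B))"

lemma flat_B: "flat_B \<ge> 1" "x \<le> 3 \<Longrightarrow> \<bar>flat_deriv 1 x\<bar> \<le> flat_B" "x \<le> 3 \<Longrightarrow> \<bar>flat_deriv 2 x\<bar> \<le> flat_B"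
  using someI_ex[OF flat_deriv_bounds] unfolding flat_B_def by blast+

lemma flat_deriv_nonpos: "x \<le> 0 \<Longrightarrow> flat_deriv n x = 0" by (simp add: flat_deriv_def)

lemma flat_deriv_1_nonneg: "0 \<le> flat_deriv 1 x" unfolding flat_deriv_1 by simp

lemma flat_deriv_2_nonneg: "x \<le> 1 / 2 \<Longrightarrow> 0 \<le> flat_deriv 2 x" by (simp add: flat_deriv_2)

text \<open>Up to 1/2 the flat function is convex; on this window its first two derivatives are
  moreover bounded below. The growth estimate of the flow measure places its argument there.\<close>

lemma flat_deriv_lower:
  assumes "1 / 8 \<le> x" "x \<le> 1 / 4"
  shows "exp (- 8) \<le> flat_deriv 1 x" "exp (- 8) \<le> flat_deriv 2 x"
proof -
  have x: "x > 0" using assms by simp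
  have e: "exp (- 8) \<le> exp (- 1 / x)" using assms by (simp add: field_simps)
  have "x\<^sup>2 \<le> 1" using assms by (simp add: power_le_one)
  then have "exp (- 1 / x) * 1 \<le> exp (- 1 / x) * (1 / x\<^sup>2)" using x by (intro mult_left_mono) auto
  then have "exp (- 8) \<le> exp (- 1 / x) * (1 / x\<^sup>2)" using e by linarith
  then show "exp (- 8) \<le> flat_deriv 1 x" using x unfolding flat_deriv_1 by simp
  have "x ^ 4 \<le> (1 / 4) ^ 4" using assms x by (intro power_mono) auto
  also have "\<dots> \<le> 1 - 2 * x" using assms by (simp add: power4_eq_xxxx)
  finally have "exp (- 1 / x) * 1 \<le> exp (- 1 / x) * ((1 - 2 * x) / x ^ 4)"
    using x by (intro mult_left_mono) (simp_all add: le_divide_eq)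
  then have "exp (- 8) \<le> exp (- 1 / x) * ((1 - 2 * x) / x ^ 4)" using e by linarith
  then show "exp (- 8) \<le> flat_deriv 2 x" using x unfolding flat_deriv_2 by simp
qed

context linear_foliation
begin

lemma leaf_jet_flat:
  assumes "leaf_jet U a a1 a2" "open U"
  shows "leaf_jet U (\<lambda>p. flat_fun (a p)) (\<lambda>p. of_real (flat_deriv 1 (a p)) * a1 p)
     (\<lambda>p. flat_deriv 1 (a p) * a2 p + flat_deriv 2 (a p) * (cmod (a1 p))\<^sup>2)"
proof (rule leaf_jet_compose[OF smooth_real_on_flat_fun smooth_real_on_flat_deriv _ _ assms])
  show "(flat_fun has_real_derivative flat_deriv 1 x) (at x)" for x
    using flat_deriv_has_derivative[of 0 x] by (simp add: flat_deriv_0)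
  show "(flat_deriv 1 has_real_derivative flat_deriv 2 x) (at x)" for x
    using flat_deriv_has_derivative[of 1 x] by (simp add: numeral_2_eq_2)
qed simp

section \<open>Cut-off near the boundary of the polydisc\<close>

text \<open>A smooth indicator of the approach to the boundary: 0 while all |z_j|^2 <= 1/4, and at
  least \<open>flat_fun 1\<close> once some |z_j|^2 exceeds 1/2.\<close>

definition vbdry :: "complex ^ 'n \<Rightarrow> real" where
  "vbdry p = (\<Sum>j\<in>UNIV. flat_fun (4 * vsq j p + (- 1)))"
definition vbdry1 :: "complex ^ 'n \<Rightarrow> complex" where
  "vbdry1 p = (\<Sum>j\<in>UNIV. of_real (flat_deriv 1 (4 * vsq j p + (- 1))) * (of_real 4 * (lam $ j * of_real (vsq j p))))"
definition vbdry2 :: "complex ^ 'n \<Rightarrow> real" where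
  "vbdry2 p = (\<Sum>j\<in>UNIV. flat_deriv 1 (4 * vsq j p + (- 1)) * (4 * ((cmod (lam $ j))\<^sup>2 * vsq j p))
     + flat_deriv 2 (4 * vsq j p + (- 1)) * (cmod (of_real 4 * (lam $ j * of_real (vsq j p))))\<^sup>2)"

lemma leaf_jet_vbdry:
  assumes U: "open U"
  shows "leaf_jet U vbdry vbdry1 vbdry2"
  unfolding vbdry_def[abs_def] vbdry1_def[abs_def] vbdry2_def[abs_def]
proof (rule leaf_jet_sum[OF _ _ U])
  fix j
  have "leaf_jet U (\<lambda>p. 4 * vsq j p + (- 1)) (\<lambda>p. of_real 4 * (lam $ j * of_real (vsq j p)) + 0)
      (\<lambda>p. 4 * ((cmod (lam $ j))\<^sup>2 * vsq j p) + 0)"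
    by (rule leaf_jet_add[OF leaf_jet_cmult[OF leaf_jet_vsq[OF U] U] leaf_jet_const[OF U] U])
  from leaf_jet_flat[OF this U]
  show "leaf_jet U (\<lambda>p. flat_fun (4 * vsq j p + (- 1)))
      (\<lambda>p. of_real (flat_deriv 1 (4 * vsq j p + (- 1))) * (of_real 4 * (lam $ j * of_real (vsq j p))))
      (\<lambda>p. flat_deriv 1 (4 * vsq j p + (- 1)) * (4 * ((cmod (lam $ j))\<^sup>2 * vsq j p))
     + flat_deriv 2 (4 * vsq j p + (- 1)) * (cmod (of_real 4 * (lam $ j * of_real (vsq j p))))\<^sup>2)"
    by simp
qed simp

lemma vbdry_nonneg: "0 \<le> vbdry p" unfolding vbdry_def by (intro sum_nonneg) (simp add: flat_fun_nonneg)

lemma vbdry_zero: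
  assumes "\<And>j. vsq j p \<le> 1 / 4"
  shows "vbdry p = 0" "vbdry1 p = 0" "vbdry2 p = 0"
proof -
  have "4 * vsq j p + (- 1) \<le> 0" for j using assms[of j] by simp
  then show "vbdry p = 0" "vbdry1 p = 0" "vbdry2 p = 0"
    unfolding vbdry_def vbdry1_def vbdry2_def by (simp_all only: flat_fun_zero flat_deriv_nonpos) simp_all
qed

lemma vbdry_large: "1 / 2 < vsq j p \<Longrightarrow> flat_fun 1 \<le> vbdry p"
proof -
  assume "1 / 2 < vsq j p"
  then have "flat_fun 1 \<le> flat_fun (4 * vsq j p + (- 1))" by (intro flat_fun_mono) simp
  also have "\<dots> \<le> vbdry p" unfolding vbdry_def by (rule member_le_sum) (auto simp: flat_fun_nonneg)
  finally show ?thesis .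
qed

lemma vsq_less_1: "p \<in> polydisc \<Longrightarrow> vsq j p < 1"
  by (simp add: vsq_def polydisc_def abs_square_less_1)

lemma lam_le_max: "cmod (lam $ j) \<le> lam_max" by (simp add: lam_max_def)

lemma vbdry_bounds: "\<exists>C\<ge>1. \<forall>p\<in>polydisc. cmod (vbdry1 p) \<le> C \<and> \<bar>vbdry2 p\<bar> \<le> C"
proof -
  let ?N = "real CARD('n)"
  define c1 where "c1 = flat_B * (4 * lam_max)"
  define c2 where "c2 = flat_B * (4 * lam_max\<^sup>2) + flat_B * (4 * lam_max)\<^sup>2"
  let ?C = "1 + ?N * c1 + ?N * c2"
  have B0: "0 \<le> flat_B" using flat_B(1) by simp
  have L0: "0 \<le> lam_max" using lam_max_pos by simp
  have n1: "0 \<le> ?N * c1" using B0 L0 by (simp add: c1_def)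
  have n2: "0 \<le> ?N * c2"
    unfolding c2_def using B0 by (intro mult_nonneg_nonneg add_nonneg_nonneg) auto
  show ?thesis
  proof (intro exI[of _ ?C] conjI ballI)
    show "1 \<le> ?C" using n1 n2 by linarith
    fix p :: "complex ^ 'n" assume p: "p \<in> polydisc"
    have v: "0 \<le> vsq j p" "vsq j p \<le> 1" "4 * vsq j p + (- 1) \<le> 3" for j
      using vsq_less_1[OF p, of j] vsq_nonneg[of j p] by auto
    have g: "cmod (of_real 4 * (lam $ j * of_real (vsq j p))) \<le> 4 * lam_max" for j
    proof -
      have "cmod (lam $ j) * vsq j p \<le> lam_max * 1" using lam_le_max v L0 by (intro mult_mono) auto
      then show ?thesis using v by (simp add: norm_mult)
    qed
    have "cmod (vbdry1 p) \<le> (\<Sum>j\<in>(UNIV :: 'n set). c1)"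
      unfolding vbdry1_def c1_def
    proof (rule sum_norm_le)
      fix j
      have "\<bar>flat_deriv 1 (4 * vsq j p + (- 1))\<bar> * cmod (of_real 4 * (lam $ j * of_real (vsq j p))) \<le> flat_B * (4 * lam_max)"
        by (rule mult_mono[OF flat_B(2)[OF v(3)] g B0]) simp
      then show "cmod (of_real (flat_deriv 1 (4 * vsq j p + (- 1))) * (of_real 4 * (lam $ j * of_real (vsq j p)))) \<le> flat_B * (4 * lam_max)"
        unfolding norm_mult[of "of_real (flat_deriv 1 (4 * vsq j p + (- 1)))"] norm_of_real .
    qed
    also have "\<dots> \<le> ?C" unfolding sum_constant using n1 n2 by linarith
    finally show "cmod (vbdry1 p) \<le> ?C" .
    have "\<bar>vbdry2 p\<bar> \<le> (\<Sum>j\<in>(UNIV :: 'n set). c2)"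
      unfolding vbdry2_def c2_def
    proof (rule order_trans[OF sum_abs], rule sum_mono)
      fix j
      have "(cmod (lam $ j))\<^sup>2 * vsq j p \<le> lam_max\<^sup>2 * 1"
        using lam_le_max v L0 by (intro mult_mono power_mono) auto
      then have h1: "\<bar>flat_deriv 1 (4 * vsq j p + (- 1))\<bar> * (4 * ((cmod (lam $ j))\<^sup>2 * vsq j p)) \<le> flat_B * (4 * lam_max\<^sup>2)"
        using v by (intro mult_mono flat_B B0) auto
      have h2: "\<bar>flat_deriv 2 (4 * vsq j p + (- 1))\<bar> * (cmod (of_real 4 * (lam $ j * of_real (vsq j p))))\<^sup>2 \<le> flat_B * (4 * lam_max)\<^sup>2"
        by (rule mult_mono[OF flat_B(3)[OF v(3)] power_mono[OF g] B0]) auto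
      have ab: "\<bar>a * b + c * d\<bar> \<le> \<bar>a\<bar> * b + \<bar>c\<bar> * d" if "0 \<le> b" "0 \<le> d" for a b c d :: real
        using that abs_triangle_ineq[of "a * b" "c * d"] by (simp add: abs_mult)
      show "\<bar>flat_deriv 1 (4 * vsq j p + (- 1)) * (4 * ((cmod (lam $ j))\<^sup>2 * vsq j p))
         + flat_deriv 2 (4 * vsq j p + (- 1)) * (cmod (of_real 4 * (lam $ j * of_real (vsq j p))))\<^sup>2\<bar>
         \<le> flat_B * (4 * lam_max\<^sup>2) + flat_B * (4 * lam_max)\<^sup>2"
        by (rule order_trans[OF ab add_mono[OF h1 h2]]) (use v(1)[of j] in auto)
    qed
    also have "\<dots> = ?N * c2" by simp
    also have "\<dots> \<le> ?C" using n1 by simp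
    finally show "\<bar>vbdry2 p\<bar> \<le> ?C" .
  qed
qed

section \<open>Cut-off far out in the logarithmic coordinates\<close>

definition vfar :: "real \<Rightarrow> complex ^ 'n \<Rightarrow> real" where
  "vfar S p = flat_fun (inverse S * xk p + (- 1)) + flat_fun (inverse S * yl p + (- 1))"
definition vfar1 :: "real \<Rightarrow> complex ^ 'n \<Rightarrow> complex" where
  "vfar1 S p = of_real (flat_deriv 1 (inverse S * xk p + (- 1))) * (of_real (inverse S) * alpha)
     + of_real (flat_deriv 1 (inverse S * yl p + (- 1))) * (of_real (inverse S) * beta)"
definition vfar2 :: "real \<Rightarrow> complex ^ 'n \<Rightarrow> real" where
  "vfar2 S p = flat_deriv 2 (inverse S * xk p + (- 1)) * (cmod (of_real (inverse S) * alpha))\<^sup>2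
     + flat_deriv 2 (inverse S * yl p + (- 1)) * (cmod (of_real (inverse S) * beta))\<^sup>2"

lemma leaf_jet_vfar: "leaf_jet generic (vfar S) (vfar1 S) (vfar2 S)"
proof -
  note o = open_generic
  have x: "leaf_jet generic (\<lambda>p. inverse S * xk p + (- 1)) (\<lambda>p. of_real (inverse S) * alpha + 0) (\<lambda>p. inverse S * 0 + 0)"
    by (rule leaf_jet_add[OF leaf_jet_cmult[OF leaf_jet_xk o] leaf_jet_const[OF o] o])
  have y: "leaf_jet generic (\<lambda>p. inverse S * yl p + (- 1)) (\<lambda>p. of_real (inverse S) * beta + 0) (\<lambda>p. inverse S * 0 + 0)"
    by (rule leaf_jet_add[OF leaf_jet_cmult[OF leaf_jet_yl o] leaf_jet_const[OF o] o])
  show ?thesis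
    by (rule leaf_jet_cong[OF leaf_jet_add[OF leaf_jet_flat[OF x o] leaf_jet_flat[OF y o] o] o])
       (auto simp: vfar_def vfar1_def vfar2_def)
qed

lemma vfar_nonneg: "0 \<le> vfar S p" by (simp add: vfar_def flat_fun_nonneg)

lemma vfar_zero:
  assumes "S > 0" "xk p \<le> S" "yl p \<le> S"
  shows "vfar S p = 0" "vfar1 S p = 0" "vfar2 S p = 0"
proof -
  have "inverse S * xk p + (- 1) \<le> 0" "inverse S * yl p + (- 1) \<le> 0" using assms by (auto simp: field_simps)
  then show "vfar S p = 0" "vfar1 S p = 0" "vfar2 S p = 0"
    unfolding vfar_def vfar1_def vfar2_def by (simp_all only: flat_fun_zero flat_deriv_nonpos) simp_all
qed

lemma vfar_large:
  assumes "S > 0" "2 * S \<le> xk p \<or> 2 * S \<le> yl p"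
  shows "flat_fun 1 \<le> vfar S p"
proof -
  have "1 \<le> inverse S * xk p + (- 1) \<or> 1 \<le> inverse S * yl p + (- 1)" using assms by (auto simp: field_simps)
  then show ?thesis
    unfolding vfar_def
    by (meson add_increasing add_increasing2 flat_fun_mono flat_fun_nonneg)
qed

definition ab_max :: real where "ab_max = max 1 (max (cmod alpha) (cmod beta))"

lemma ab_max: "1 \<le> ab_max" "cmod alpha \<le> ab_max" "cmod beta \<le> ab_max" by (auto simp: ab_max_def)

text \<open>The logarithmic coordinates are real linear in the flow time, so k-th derivatives gain
  S^(-k). The common bound of order 1/S is enough, because the product with a measure O(S^2) and a
  potential O(S^(-2a)) still tends to 0.\<close>

lemma vfar_bounds:
  assumes S: "S \<ge> 1" and xy: "xk p \<le> 2 * S" "yl p \<le> 2 * S"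
  shows "cmod (vfar1 S p) \<le> 2 * flat_B * ab_max\<^sup>2 / S" "\<bar>vfar2 S p\<bar> \<le> 2 * flat_B * ab_max\<^sup>2 / S"
proof -
  have a: "inverse S * xk p + (- 1) \<le> 3" "inverse S * yl p + (- 1) \<le> 3" using S xy by (auto simp: field_simps)
  have B0: "0 \<le> flat_B" using flat_B(1) by simp
  have sq: "ab_max \<le> ab_max\<^sup>2" using ab_max(1) by (simp add: power2_eq_square)
  have n: "cmod (of_real (inverse S) * c) \<le> ab_max\<^sup>2 / S" "(cmod (of_real (inverse S) * c))\<^sup>2 \<le> ab_max\<^sup>2 / S"
    if c: "cmod c \<le> ab_max" for c
  proof -
    have e: "cmod (of_real (inverse S) * c) = cmod c / S" using S unfolding norm_mult norm_of_real by (simp add: divide_inverse)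
    have "cmod c / S \<le> ab_max / S" using c S by (intro divide_right_mono) auto
    also have "\<dots> \<le> ab_max\<^sup>2 / S" using sq S by (intro divide_right_mono) auto
    finally show "cmod (of_real (inverse S) * c) \<le> ab_max\<^sup>2 / S" using e by simp
    have "(cmod c / S)\<^sup>2 = (cmod c)\<^sup>2 / S\<^sup>2" by (simp add: power_divide)
    also have "\<dots> \<le> ab_max\<^sup>2 / S\<^sup>2" using c by (intro divide_right_mono power_mono) auto
    also have "\<dots> \<le> ab_max\<^sup>2 / S" using S by (intro divide_left_mono) (auto simp: power2_eq_square)
    finally show "(cmod (of_real (inverse S) * c))\<^sup>2 \<le> ab_max\<^sup>2 / S" using e by simp
  qed
  have "cmod (vfar1 S p) \<le> \<bar>flat_deriv 1 (inverse S * xk p + (- 1))\<bar> * cmod (of_real (inverse S) * alpha)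
      + \<bar>flat_deriv 1 (inverse S * yl p + (- 1))\<bar> * cmod (of_real (inverse S) * beta)"
    unfolding vfar1_def by (rule order_trans[OF norm_triangle_ineq]) (simp only: norm_mult norm_of_real order_refl)
  also have "\<dots> \<le> flat_B * (ab_max\<^sup>2 / S) + flat_B * (ab_max\<^sup>2 / S)"
    by (intro add_mono mult_mono flat_B n ab_max a B0 norm_ge_zero)
  finally show "cmod (vfar1 S p) \<le> 2 * flat_B * ab_max\<^sup>2 / S" by simp
  have "\<bar>vfar2 S p\<bar> \<le> \<bar>flat_deriv 2 (inverse S * xk p + (- 1))\<bar> * (cmod (of_real (inverse S) * alpha))\<^sup>2
      + \<bar>flat_deriv 2 (inverse S * yl p + (- 1))\<bar> * (cmod (of_real (inverse S) * beta))\<^sup>2"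
    unfolding vfar2_def by (rule order_trans[OF abs_triangle_ineq]) (simp only: abs_mult abs_power2 order_refl)
  also have "\<dots> \<le> flat_B * (ab_max\<^sup>2 / S) + flat_B * (ab_max\<^sup>2 / S)"
    by (intro add_mono mult_mono flat_B n ab_max a B0 zero_le_power2)
  finally show "\<bar>vfar2 S p\<bar> \<le> 2 * flat_B * ab_max\<^sup>2 / S" by simp
qed

section \<open>Cut-offs derived from the boundary and far functions\<close>

text \<open>The cut-off is obtained by applying \<open>flat_fun\<close> to \<open>flat_fun 1\<close>
  - V; it vanishes once V >= \<open>flat_fun 1\<close>. This constant, instead of 1, is its value
  where V = 0.\<close>

definition chi0 :: real where "chi0 = flat_fun (flat_fun 1)"

lemma chi0_pos: "chi0 > 0" by (simp add: chi0_def flat_fun_pos)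

lemma leaf_jet_cutoff:
  assumes "leaf_jet U V V1 V2" "open U"
  shows "leaf_jet U (\<lambda>p. flat_fun (flat_fun 1 + (- 1) * V p))
    (\<lambda>p. of_real (flat_deriv 1 (flat_fun 1 + (- 1) * V p)) * (- V1 p))
    (\<lambda>p. flat_deriv 1 (flat_fun 1 + (- 1) * V p) * (- V2 p) + flat_deriv 2 (flat_fun 1 + (- 1) * V p) * (cmod (- V1 p))\<^sup>2)"
  by (rule leaf_jet_cong[OF leaf_jet_flat[OF leaf_jet_add[OF leaf_jet_const[OF assms(2)]
        leaf_jet_cmult[OF assms(1,2), of "- 1"] assms(2)] assms(2)] assms(2)]) auto

lemma cutoff_bounds:
  assumes "0 \<le> V"
  shows "cmod (of_real (flat_deriv 1 (flat_fun 1 + (- 1) * V)) * (- V1)) \<le> flat_B * cmod V1"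
    "\<bar>flat_deriv 1 (flat_fun 1 + (- 1) * V) * (- V2) + flat_deriv 2 (flat_fun 1 + (- 1) * V) * (cmod (- V1))\<^sup>2\<bar>
      \<le> flat_B * (\<bar>V2\<bar> + (cmod V1)\<^sup>2)"
proof -
  have a: "flat_fun 1 + (- 1) * V \<le> 3" using assms flat_fun_less_1[of 1] by linarith
  show "cmod (of_real (flat_deriv 1 (flat_fun 1 + (- 1) * V)) * (- V1)) \<le> flat_B * cmod V1"
    unfolding norm_mult norm_of_real norm_minus_cancel by (intro mult_right_mono flat_B(2)[OF a]) simp
  have "\<bar>flat_deriv 1 (flat_fun 1 + (- 1) * V) * (- V2) + flat_deriv 2 (flat_fun 1 + (- 1) * V) * (cmod (- V1))\<^sup>2\<bar>
    \<le> \<bar>flat_deriv 1 (flat_fun 1 + (- 1) * V)\<bar> * \<bar>V2\<bar> + \<bar>flat_deriv 2 (flat_fun 1 + (- 1) * V)\<bar> * (cmod V1)\<^sup>2"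
    by (rule order_trans[OF abs_triangle_ineq]) (simp only: abs_mult abs_minus_cancel norm_minus_cancel abs_power2 order_refl)
  also have "\<dots> \<le> flat_B * \<bar>V2\<bar> + flat_B * (cmod V1)\<^sup>2"
    by (intro add_mono mult_right_mono flat_B(2,3)[OF a]) auto
  finally show "\<bar>flat_deriv 1 (flat_fun 1 + (- 1) * V) * (- V2) + flat_deriv 2 (flat_fun 1 + (- 1) * V) * (cmod (- V1))\<^sup>2\<bar>
      \<le> flat_B * (\<bar>V2\<bar> + (cmod V1)\<^sup>2)" by (simp add: distrib_left)
qed

lemma cutoff_zero:
  assumes "flat_fun 1 \<le> V"
  shows "flat_fun (flat_fun 1 + (- 1) * V) = 0" "flat_deriv n (flat_fun 1 + (- 1) * V) = 0"
  using assms by (auto intro: flat_fun_zero flat_deriv_nonpos)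

lemma nsq_le_card: "p \<in> polydisc \<Longrightarrow> nsq p \<le> real CARD('n)"
proof -
  assume "p \<in> polydisc"
  then have "nsq p \<le> (\<Sum>j\<in>(UNIV :: 'n set). 1)"
    unfolding nsq_def by (intro sum_mono less_imp_le vsq_less_1)
  then show ?thesis by simp
qed

end

section \<open>Growth of the flow measure\<close>

lemma cutoff_cost_nonneg:
  fixes r s t a b :: real
  assumes "\<bar>r\<bar> \<le> a" "\<bar>s\<bar> \<le> b" "0 \<le> t"
  shows "0 \<le> 2 * a + b - (- 1) * (t + s + 2 * r)"
  using assms by (simp add: abs_le_iff)

context linear_current
begin

definition core_set :: "real \<Rightarrow> (complex ^ 'n) set" where
  "core_set e = {p. (\<forall>j. vsq j p \<le> 1 / 2) \<and> e \<le> nsq p}"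

lemma continuous_vsq: "continuous_on A (vsq j :: complex ^ 'n \<Rightarrow> real)"
  unfolding vsq_def[abs_def] by (intro continuous_intros)

lemma continuous_nsq: "continuous_on A nsq"
  unfolding nsq_def[abs_def] by (intro continuous_intros continuous_vsq)

lemma measurable_vsq [measurable]: "vsq j \<in> borel_measurable borel" for j :: 'n
  by (rule borel_measurable_continuous_onI[OF continuous_vsq])

lemma measurable_nsq [measurable]: "nsq \<in> borel_measurable borel"
  by (rule borel_measurable_continuous_onI[OF continuous_nsq])

lemma compact_core_set:
  assumes "e > 0"
  shows "compact (core_set e)" "core_set e \<subseteq> Y"
proof -
  have eq: "core_set e = (\<Inter>j. {p. vsq j p \<le> 1 / 2}) \<inter> {p. e \<le> nsq p}" by (auto simp: core_set_def)
  have "closed (core_set e)"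
    unfolding eq by (intro closed_Int closed_INT ballI closed_Collect_le continuous_vsq continuous_nsq continuous_on_const)
  moreover have "bounded (core_set e)"
  proof -
    have "norm p \<le> real CARD('n)" if "p \<in> core_set e" for p
    proof -
      have "nsq p \<le> (\<Sum>j\<in>(UNIV :: 'n set). 1)"
        unfolding nsq_def
      proof (rule sum_mono)
        fix j
        have "vsq j p \<le> 1 / 2" using that by (simp add: core_set_def)
        then show "vsq j p \<le> 1" by simp
      qed
      then have "(norm p)\<^sup>2 \<le> real CARD('n)" by (simp add: nsq_eq_norm)
      also have "\<dots> \<le> (real CARD('n))\<^sup>2" by (simp add: power2_eq_square)
      finally show ?thesis by (rule power2_le_imp_le) simp
    qed
    then show ?thesis unfolding bounded_iff by blast
  qed
  ultimately show "compact (core_set e)" by (simp add: compact_eq_bounded_closed)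
  show "core_set e \<subseteq> Y"
  proof
    fix p assume p: "p \<in> core_set e"
    have "cmod (p $ j) < 1" for j
    proof -
      have "vsq j p \<le> 1 / 2" using p by (simp add: core_set_def)
      then have "vsq j p < 1" by simp
      then show ?thesis by (simp add: vsq_def abs_square_less_1)
    qed
    moreover have "p \<noteq> 0" using p assms by (auto simp: core_set_def nsq_eq_norm)
    ultimately show "p \<in> Y" by (simp add: polydisc_def)
  qed
qed

lemma flow_measure_finite:
  assumes "e > 0"
  shows "emeasure flow_measure (core_set e) < \<infinity>"
proof -
  have [measurable]: "core_set e \<in> sets borel" using compact_core_set[OF assms] by (simp add: compact_imp_closed)
  let ?c = "1 / (lam_min\<^sup>2 * e)"
  have c: "?c > 0" using lam_min_pos assms by simp
  have "emeasure flow_measure (core_set e) = (\<integral>\<^sup>+p. ennreal (1 / speed2 p) * indicator (core_set e) p \<partial>pf.rep_measure)"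
    unfolding flow_measure_def by (rule emeasure_density) auto
  also have "\<dots> \<le> (\<integral>\<^sup>+p. ennreal ?c * indicator (core_set e) p \<partial>pf.rep_measure)"
  proof (rule nn_integral_mono)
    fix p
    have "ennreal (1 / speed2 p) \<le> ennreal ?c" if "p \<in> core_set e"
    proof (intro ennreal_leI divide_left_mono)
      have "lam_min\<^sup>2 * e \<le> lam_min\<^sup>2 * nsq p" using that by (intro mult_left_mono) (auto simp: core_set_def)
      also have "\<dots> \<le> speed2 p" by (rule speed2_ge)
      finally show *: "lam_min\<^sup>2 * e \<le> speed2 p" .
      have "0 < lam_min\<^sup>2 * e" using lam_min_pos assms by simp
      then show "0 < speed2 p * (lam_min\<^sup>2 * e)" using * by simp
    qed simp
    then show "ennreal (1 / speed2 p) * indicator (core_set e) p \<le> ennreal ?c * indicator (core_set e) p"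
      by (auto split: split_indicator)
  qed
  also have "\<dots> = ennreal ?c * emeasure pf.rep_measure (core_set e)"
    by (simp add: nn_integral_cmult_indicator)
  also have "\<dots> < \<infinity>"
    using pf.rep_measure_compact[OF compact_core_set[OF assms]] by (simp add: ennreal_mult_less_top)
  finally show ?thesis .
qed

text \<open>The part of the polydisc where the boundary cut-off can vary. It does not depend on R, X
  or S and has finite flow measure.\<close>

definition shell :: "(complex ^ 'n) set" where
  "shell = {p. (\<forall>j. vsq j p \<le> 1 / 2) \<and> (\<exists>j. 1 / 4 < vsq j p)}"

lemma measurable_shell [measurable]: "shell \<in> sets borel"
proof -
  have eq: "shell = (\<Inter>j. {p. vsq j p \<le> 1 / 2}) \<inter> (\<Union>j. {p. 1 / 4 < vsq j p})" by (auto simp: shell_def)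
  show ?thesis unfolding eq by measurable
qed

lemma shell_subset: "shell \<subseteq> core_set (1 / 4)"
proof
  fix p assume "p \<in> shell"
  then obtain j where j: "1 / 4 < vsq j p" and p: "\<forall>j. vsq j p \<le> 1 / 2" unfolding shell_def by blast
  have "1 / 4 \<le> nsq p" using j vsq_le_nsq[of j p] by linarith
  then show "p \<in> core_set (1 / 4)" using p by (simp add: core_set_def)
qed

lemma shell_finite: "emeasure flow_measure shell < \<infinity>"
proof -
  have "core_set (1 / 4) \<in> sets flow_measure" using compact_core_set[of "1/4"] by (simp add: compact_imp_closed)
  then have "emeasure flow_measure shell \<le> emeasure flow_measure (core_set (1 / 4))"
    by (rule emeasure_mono[OF shell_subset])
  also have "\<dots> < \<infinity>" by (rule flow_measure_finite) simp
  finally show ?thesis .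
qed

lemma vsq_cases:
  obtains "\<And>j. vsq j p \<le> 1 / 4" | "p \<in> shell" | j where "1 / 2 < vsq j p"
proof -
  consider "\<forall>j. vsq j p \<le> 1 / 4" | "\<forall>j. vsq j p \<le> 1 / 2" "\<exists>j. 1 / 4 < vsq j p" | "\<exists>j. 1 / 2 < vsq j p"
    by (meson not_le)
  then show thesis
    by cases (use that in \<open>auto simp: shell_def\<close>)
qed

text \<open>The potential is the subharmonic function \<open>flat_fun\<close> of \<tau>, with \<tau>
  affine in ln |z|^2 of slope 1/(8T), times the boundary cut-off. The Laplacian of ln |z|^2 itself
  may vanish, so only a gain of order 1/T^2 is guaranteed, whence the quadratic growth. The cost is
  confined to the shell and independent of T.\<close>

lemma flow_measure_growth:
  "\<exists>C\<ge>0. \<forall>T\<ge>1. emeasure flow_measure {p. (\<forall>j. vsq j p \<le> 1 / 4) \<and> real CARD('n) * exp (- T) \<le> nsq p} \<le> ennreal (C * T\<^sup>2)"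
proof -
  let ?n = "real CARD('n)"
  have n0: "?n > 0" by simp
  obtain CV where CV: "CV \<ge> 1" "\<And>p. p \<in> polydisc \<Longrightarrow> cmod (vbdry1 p) \<le> CV" "\<And>p. p \<in> polydisc \<Longrightarrow> \<bar>vbdry2 p\<bar> \<le> CV"
    using vbdry_bounds by blast
  have B1: "flat_B \<ge> 1" by (rule flat_B(1))
  define H where "H = 2 * ((flat_B * lam_max) * (flat_B * CV)) + flat_B * (CV + CV\<^sup>2)"
  have H0: "H \<ge> 0" using B1 CV(1) lam_max_pos by (simp add: H_def)
  define c where "c = exp (- 8) * lam_min\<^sup>2 / 64 * chi0"
  have c0: "c > 0" using lam_min_pos chi0_pos by (simp add: c_def)
  define ms where "ms = measure flow_measure shell"
  have ms: "emeasure flow_measure shell = ennreal ms"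
    unfolding ms_def using shell_finite by (intro emeasure_eq_ennreal_measure) simp
  have ms0: "ms \<ge> 0" by (simp add: ms_def)
  show ?thesis
  proof (intro exI[of _ "H * ms / c"] conjI allI impI)
    show "0 \<le> H * ms / c" using H0 ms0 c0 by simp
    fix T :: real assume T: "T \<ge> 1"
    let ?A = "{p :: complex ^ 'n. (\<forall>j. vsq j p \<le> 1 / 4) \<and> ?n * exp (- T) \<le> nsq p}"
    have A_eq: "?A = (\<Inter>j. {p. vsq j p \<le> 1 / 4}) \<inter> {p. ?n * exp (- T) \<le> nsq p}" by auto
    have [measurable]: "?A \<in> sets borel" unfolding A_eq by measurable
    \<comment> \<open>With n the dimension, so that |z|^2 <= n: \<tau> is at most 1/4 on the
      polydisc, at least 1/8 where |z|^2 >= n exp(-T), and at most 0 where |z|^2 <= n exp(-2T). The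
      last region is cut out of the support.\<close>
    define \<tau> where "\<tau> p = (1 / (8 * T)) * ln (nsq p) + (1 / 4 - ln ?n / (8 * T))" for p
    define \<tau>1 where "\<tau>1 p = of_real (1 / (8 * T)) * (nsq1 p / of_real (nsq p))" for p
    define \<tau>2 where "\<tau>2 p = (1 / (8 * T)) * (speed2 p / nsq p - (cmod (nsq1 p))\<^sup>2 / (nsq p)\<^sup>2)" for p
    have posY: "0 < nsq p" if "p \<in> Y" for p using that nsq_pos by simp
    have j\<tau>: "leaf_jet Y \<tau> \<tau>1 \<tau>2"
      by (rule leaf_jet_cong[OF leaf_jet_add[OF leaf_jet_cmult[OF leaf_jet_ln[OF leaf_jet_nsq[OF open_Y] open_Y posY] open_Y, of "1 / (8 * T)"]
          leaf_jet_const[OF open_Y, of "1 / 4 - ln ?n / (8 * T)"] open_Y] open_Y])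
         (auto simp: \<tau>_def \<tau>1_def \<tau>2_def)
    note jF = leaf_jet_flat[OF j\<tau> open_Y]
    note jX = leaf_jet_cutoff[OF leaf_jet_vbdry[OF open_Y] open_Y]
    define F where "F p = flat_fun (\<tau> p)" for p
    define F1 where "F1 p = of_real (flat_deriv 1 (\<tau> p)) * \<tau>1 p" for p
    define F2 where "F2 p = flat_deriv 1 (\<tau> p) * \<tau>2 p + flat_deriv 2 (\<tau> p) * (cmod (\<tau>1 p))\<^sup>2" for p
    define X where "X p = flat_fun (flat_fun 1 + (- 1) * vbdry p)" for p
    define X1 where "X1 p = of_real (flat_deriv 1 (flat_fun 1 + (- 1) * vbdry p)) * (- vbdry1 p)" for p
    define X2 where "X2 p = flat_deriv 1 (flat_fun 1 + (- 1) * vbdry p) * (- vbdry2 p)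
        + flat_deriv 2 (flat_fun 1 + (- 1) * vbdry p) * (cmod (- vbdry1 p))\<^sup>2" for p
    have jG: "leaf_jet Y (\<lambda>p. (- 1) * (F p * X p)) (\<lambda>p. of_real (- 1) * (F1 p * of_real (X p) + of_real (F p) * X1 p))
       (\<lambda>p. (- 1) * (F2 p * X p + F p * X2 p + 2 * Re (F1 p * cnj (X1 p))))"
      using leaf_jet_cmult[OF leaf_jet_mult[OF jF jX open_Y] open_Y, of "- 1"]
      unfolding F_def F1_def F2_def X_def X1_def X2_def .
    define e where "e = ?n * exp (- (2 * T))"
    have e0: "e > 0" using n0 by (simp add: e_def)
    define g where "g p = (c / T\<^sup>2) * indicat_real ?A p" for p
    define h where "h p = H * indicat_real shell p" for p
    have "(\<integral>\<^sup>+p. ennreal (g p) \<partial>flow_measure) \<le> (\<integral>\<^sup>+p. ennreal (h p) \<partial>flow_measure)"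
    proof (rule flow_measure_le[OF jG compact_core_set[OF e0]])
      show "g \<in> borel_measurable borel" "h \<in> borel_measurable borel"
        unfolding g_def h_def by measurable
      show "0 \<le> g p" "0 \<le> h p" for p using c0 H0 by (auto simp: g_def h_def)
      have Xz: "X p = 0" "X1 p = 0" "X2 p = 0" if "1 / 2 < vsq j p" for p j
        using cutoff_zero[OF vbdry_large[OF that]] by (simp_all only: X_def X1_def X2_def) simp_all
      show "(- 1) * (F p * X p) = 0" if p: "p \<in> Y - core_set e" for p
      proof (cases "\<forall>j. vsq j p \<le> 1 / 2")
        case True
        then have lt: "nsq p < e" using p by (auto simp: core_set_def)
        have pos: "0 < nsq p" using p posY by blast
        have "ln (nsq p) \<le> ln e" using lt pos by simp
        also have "ln e = ln ?n - 2 * T" by (simp add: e_def ln_mult)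
        finally have "(1 / (8 * T)) * ln (nsq p) \<le> (1 / (8 * T)) * (ln ?n - 2 * T)" using T by (intro mult_left_mono) auto
        also have "\<dots> = ln ?n / (8 * T) - 1 / 4" using T by (simp add: field_simps)
        finally have "\<tau> p \<le> 0" by (simp add: \<tau>_def)
        then show ?thesis by (simp add: F_def flat_fun_zero)
      next
        case False
        then obtain j where "1 / 2 < vsq j p" by (auto simp: not_le)
        then show ?thesis using Xz by simp
      qed
      fix p assume p: "p \<in> Y"
      have pp: "p \<in> polydisc" using p by simp
      have N: "0 < nsq p" by (rule posY[OF p])
      have T0: "0 < 1 / (8 * T)" "1 / (8 * T) \<le> 1" using T by auto
      have Tsq: "(1 / (8 * T))\<^sup>2 \<le> 1 / (8 * T)"
        using mult_left_mono[OF T0(2) less_imp_le[OF T0(1)]] by (simp only: power2_eq_square mult_1_right)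
      have \<tau>le: "\<tau> p \<le> 1 / 4"
      proof -
        have "ln (nsq p) \<le> ln ?n" using nsq_le_card[OF pp] N by simp
        then have "(1 / (8 * T)) * ln (nsq p) \<le> (1 / (8 * T)) * ln ?n" using T0 by (intro mult_left_mono) auto
        then show ?thesis by (simp add: \<tau>_def)
      qed
      have n1le: "(cmod (nsq1 p))\<^sup>2 / (nsq p)\<^sup>2 \<le> speed2 p / nsq p"
        using nsq1_le[of p] N by (simp add: divide_le_eq power2_eq_square mult.commute)
      then have \<tau>2: "0 \<le> \<tau>2 p" using T0 by (simp add: \<tau>2_def)
      have F2: "0 \<le> F2 p"
        unfolding F2_def using \<tau>2 \<tau>le by (intro add_nonneg_nonneg mult_nonneg_nonneg flat_deriv_1_nonneg flat_deriv_2_nonneg) auto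
      have F0: "0 \<le> F p" "F p \<le> 1" by (simp_all add: F_def flat_fun_nonneg less_imp_le[OF flat_fun_less_1])
      have X0: "0 \<le> X p" by (simp add: X_def flat_fun_nonneg)
      consider "\<And>j. vsq j p \<le> 1 / 4" | "p \<in> shell" | j where "1 / 2 < vsq j p" using vsq_cases[of p] by metis
      then show "g p \<le> h p - (- 1) * (F2 p * X p + F p * X2 p + 2 * Re (F1 p * cnj (X1 p)))"
      proof cases
        case 1
        have X: "X p = chi0" "X1 p = 0" "X2 p = 0"
          using vbdry_zero[of p] 1 by (simp_all add: X_def X1_def X2_def chi0_def)
        have hz: "h p \<ge> 0" using H0 by (simp add: h_def)
        have "g p \<le> F2 p * chi0"
        proof (cases "p \<in> ?A")
          case True
          then have ge: "?n * exp (- T) \<le> nsq p" by simp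
          have "ln (?n * exp (- T)) \<le> ln (nsq p)" using ge n0 N by simp
          then have "ln ?n - T \<le> ln (nsq p)" by (simp add: ln_mult)
          then have "(1 / (8 * T)) * (ln ?n - T) \<le> (1 / (8 * T)) * ln (nsq p)" using T0 by (intro mult_left_mono) auto
          moreover have "(1 / (8 * T)) * (ln ?n - T) = ln ?n / (8 * T) - 1 / 8" using T by (simp add: field_simps)
          ultimately have \<tau>ge: "1 / 8 \<le> \<tau> p" by (simp add: \<tau>_def)
          have a: "(cmod (\<tau>1 p))\<^sup>2 = (1 / (8 * T))\<^sup>2 * ((cmod (nsq1 p))\<^sup>2 / (nsq p)\<^sup>2)"
            using T N by (simp add: \<tau>1_def norm_mult norm_divide power_mult_distrib power_divide)
          have "(1 / (8 * T))\<^sup>2 * (speed2 p / nsq p - (cmod (nsq1 p))\<^sup>2 / (nsq p)\<^sup>2) \<le> \<tau>2 p"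
            unfolding \<tau>2_def using Tsq n1le by (intro mult_right_mono) auto
          \<comment> \<open>The second derivative of \<tau> is weighted by 1/(8T), which is at least
            its square. With equal weights the term |nsq1|^2/nsq^2 drops out against the squared
            gradient, and speed2/nsq, which is bounded below, remains.\<close>
          then have k1: "(1 / (8 * T))\<^sup>2 * (speed2 p / nsq p) \<le> \<tau>2 p + (cmod (\<tau>1 p))\<^sup>2"
            unfolding a by (simp add: right_diff_distrib)
          have "lam_min\<^sup>2 \<le> speed2 p / nsq p" using speed2_ge[of p] N by (simp add: le_divide_eq)
          from mult_left_mono[OF this zero_le_power2[of "1 / (8 * T)"]]
          have "(1 / (8 * T))\<^sup>2 * lam_min\<^sup>2 \<le> \<tau>2 p + (cmod (\<tau>1 p))\<^sup>2"
            using k1 by (rule order_trans)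
          then have "exp (- 8) * ((1 / (8 * T))\<^sup>2 * lam_min\<^sup>2) \<le> exp (- 8) * (\<tau>2 p + (cmod (\<tau>1 p))\<^sup>2)"
            by (intro mult_left_mono) auto
          also have "\<dots> = exp (- 8) * \<tau>2 p + exp (- 8) * (cmod (\<tau>1 p))\<^sup>2" by (simp add: distrib_left)
          also have "\<dots> \<le> F2 p"
            unfolding F2_def using \<tau>2 by (intro add_mono mult_right_mono flat_deriv_lower[OF \<tau>ge \<tau>le]) auto
          finally have "exp (- 8) * ((1 / (8 * T))\<^sup>2 * lam_min\<^sup>2) * chi0 \<le> F2 p * chi0"
            using chi0_pos by (intro mult_right_mono) auto
          moreover have "g p = exp (- 8) * ((1 / (8 * T))\<^sup>2 * lam_min\<^sup>2) * chi0"
            using True by (simp add: g_def c_def power_mult_distrib power_divide)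
          ultimately show ?thesis by simp
        next
          case False
          then show ?thesis using F2 chi0_pos by (simp add: g_def)
        qed
        then show ?thesis using X hz by simp
      next
        case 2
        then obtain i where "1 / 4 < vsq i p" by (auto simp: shell_def)
        then have nA: "p \<notin> ?A" by (metis (mono_tags, lifting) mem_Collect_eq not_le)
        have x1: "cmod (X1 p) \<le> flat_B * CV"
          unfolding X1_def
          by (rule order_trans[OF cutoff_bounds(1)[OF vbdry_nonneg] mult_left_mono[OF CV(2)[OF pp]]]) (use B1 in simp)
        have "(cmod (vbdry1 p))\<^sup>2 \<le> CV\<^sup>2" using CV(2)[OF pp] by (intro power_mono) auto
        then have "flat_B * (\<bar>vbdry2 p\<bar> + (cmod (vbdry1 p))\<^sup>2) \<le> flat_B * (CV + CV\<^sup>2)"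
          using CV(3)[OF pp] B1 by (intro mult_left_mono add_mono) auto
        then have x2: "\<bar>X2 p\<bar> \<le> flat_B * (CV + CV\<^sup>2)"
          unfolding X2_def by (rule order_trans[OF cutoff_bounds(2)[OF vbdry_nonneg]])
        have f1: "cmod (F1 p) \<le> flat_B * lam_max"
        proof -
          have "cmod (\<tau>1 p) = (1 / (8 * T)) * (cmod (nsq1 p) / nsq p)" using T N by (simp add: \<tau>1_def norm_mult norm_divide)
          also have "\<dots> \<le> 1 * lam_max"
            using T0 nsq1_le'[of p] N by (intro mult_mono) (auto simp: divide_le_eq)
          finally have "cmod (\<tau>1 p) \<le> lam_max" by simp
          moreover have "\<bar>flat_deriv 1 (\<tau> p)\<bar> \<le> flat_B" using \<tau>le by (intro flat_B(2)) simp
          ultimately show ?thesis unfolding F1_def norm_mult norm_of_real using B1 by (intro mult_mono) auto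
        qed
        have "\<bar>Re (F1 p * cnj (X1 p))\<bar> \<le> cmod (F1 p * cnj (X1 p))" by (rule abs_Re_le_cmod)
        also have "\<dots> = cmod (F1 p) * cmod (X1 p)" by (simp add: norm_mult)
        also have "\<dots> \<le> (flat_B * lam_max) * (flat_B * CV)" using f1 x1 B1 lam_max_pos by (intro mult_mono) auto
        finally have r: "\<bar>Re (F1 p * cnj (X1 p))\<bar> \<le> (flat_B * lam_max) * (flat_B * CV)" .
        have "\<bar>F p * X2 p\<bar> \<le> 1 * (flat_B * (CV + CV\<^sup>2))"
          unfolding abs_mult using F0 x2 by (intro mult_mono) auto
        then have s: "\<bar>F p * X2 p\<bar> \<le> flat_B * (CV + CV\<^sup>2)" by simp
        have t: "0 \<le> F2 p * X p" using F2 X0 by simp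
        have gz: "g p = 0" and hz: "h p = H" using nA 2 by (simp_all add: g_def h_def)
        show ?thesis unfolding gz hz H_def by (rule cutoff_cost_nonneg[OF r s t])
      next
        case 3
        then have "\<not> vsq j p \<le> 1 / 4" "\<not> vsq j p \<le> 1 / 2" by simp_all
        then have "p \<notin> ?A" and "p \<notin> shell" unfolding shell_def by blast+
        then show ?thesis using Xz[OF 3] by (simp add: g_def h_def)
      qed
    qed
    moreover have "(\<integral>\<^sup>+p. ennreal (g p) \<partial>flow_measure) = ennreal (c / T\<^sup>2) * emeasure flow_measure ?A"
    proof -
      have "(\<integral>\<^sup>+p. ennreal (g p) \<partial>flow_measure) = (\<integral>\<^sup>+p. ennreal (c / T\<^sup>2) * indicator ?A p \<partial>flow_measure)"
        by (intro nn_integral_cong) (auto simp: g_def split: split_indicator)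
      then show ?thesis by (simp add: nn_integral_cmult_indicator)
    qed
    moreover have "(\<integral>\<^sup>+p. ennreal (h p) \<partial>flow_measure) = ennreal H * emeasure flow_measure shell"
    proof -
      have "(\<integral>\<^sup>+p. ennreal (h p) \<partial>flow_measure) = (\<integral>\<^sup>+p. ennreal H * indicator shell p \<partial>flow_measure)"
        by (intro nn_integral_cong) (auto simp: h_def split: split_indicator)
      then show ?thesis by (simp add: nn_integral_cmult_indicator)
    qed
    ultimately have main: "ennreal (c / T\<^sup>2) * emeasure flow_measure ?A \<le> ennreal (H * ms)"
      using H0 ms0 by (simp add: ms ennreal_mult)
    have "emeasure flow_measure ?A = ennreal (T\<^sup>2 / c) * (ennreal (c / T\<^sup>2) * emeasure flow_measure ?A)"
    proof -
      have "ennreal (T\<^sup>2 / c) * ennreal (c / T\<^sup>2) = 1"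
        using c0 T by (subst ennreal_mult[symmetric]) auto
      then show ?thesis by (simp add: mult.assoc[symmetric])
    qed
    also have "\<dots> \<le> ennreal (T\<^sup>2 / c) * ennreal (H * ms)" by (rule mult_left_mono[OF main]) simp
    also have "\<dots> = ennreal (H * ms / c * T\<^sup>2)"
      using c0 H0 ms0 by (subst ennreal_mult[symmetric]) (auto simp: mult_ac)
    finally show "emeasure flow_measure ?A \<le> ennreal (H * ms / c * T\<^sup>2)" .
  qed
qed

end

section \<open>The potential\<close>

context linear_foliation
begin

text \<open>On the polydisc |z|^2 + exp(-2R) is at most n + 1, so this constant makes
  \<open>pot0\<close> at least 1 there.\<close>

definition pot_c :: real where "pot_c = 1 + ln (real CARD('n) + 1) / 2"

text \<open>The summand exp(-2R) truncates -ln |z| at height about R and makes it strictly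
  superharmonic along the leaves inside the ball of radius exp(-R).\<close>

definition pot0 :: "real \<Rightarrow> complex ^ 'n \<Rightarrow> real" where
  "pot0 R p = - (1 / 2) * ln (nsq p + exp (- 2 * R)) + pot_c"

lemma pot_c_ge: "1 \<le> pot_c" by (simp add: pot_c_def)

lemma pot0_ge:
  assumes "R \<ge> 1" "p \<in> polydisc"
  shows "1 \<le> pot0 R p"
proof -
  have "nsq p + exp (- 2 * R) \<le> real CARD('n) + 1"
    using nsq_le_card[OF assms(2)] assms(1) by (intro add_mono) auto
  moreover have "0 < nsq p + exp (- 2 * R)" using nsq_nonneg[of p] by (simp add: add_nonneg_pos)
  ultimately have "ln (nsq p + exp (- 2 * R)) \<le> ln (real CARD('n) + 1)" by simp
  then show ?thesis by (simp add: pot0_def pot_c_def)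
qed

lemma pot0_le: "pot0 R p \<le> R + pot_c"
proof -
  have "ln (exp (- 2 * R)) \<le> ln (nsq p + exp (- 2 * R))"
    using nsq_nonneg[of p] by (subst ln_le_cancel_iff) (auto simp: add_nonneg_pos)
  then show ?thesis by (simp add: pot0_def)
qed

definition pot0_1 :: "real \<Rightarrow> complex ^ 'n \<Rightarrow> complex" where
  "pot0_1 R p = of_real (- (1 / 2)) * (nsq1 p / of_real (nsq p + exp (- 2 * R)))"
definition pot0_2 :: "real \<Rightarrow> complex ^ 'n \<Rightarrow> real" where
  "pot0_2 R p = - (1 / 2) * (speed2 p / (nsq p + exp (- 2 * R)) - (cmod (nsq1 p))\<^sup>2 / (nsq p + exp (- 2 * R))\<^sup>2)"

lemma leaf_jet_pot0: "open U \<Longrightarrow> leaf_jet U (pot0 R) (pot0_1 R) (pot0_2 R)"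
proof -
  assume U: "open U"
  have pos: "0 < nsq p + exp (- 2 * R)" for p using nsq_nonneg[of p] by (simp add: add_nonneg_pos)
  show ?thesis
    by (rule leaf_jet_cong[OF leaf_jet_add[OF leaf_jet_cmult[OF leaf_jet_ln[OF
        leaf_jet_add[OF leaf_jet_nsq[OF U] leaf_jet_const[OF U, of "exp (- 2 * R)"] U] U pos] U, of "- (1 / 2)"]
        leaf_jet_const[OF U, of pot_c] U] U])
      (auto simp: pot0_def pot0_1_def pot0_2_def)
qed

text \<open>With M = |z|^2 + exp(-2R), Cauchy-Schwarz in \<open>nsq1_le\<close> leaves speed2 (M -
  |z|^2)/M^2. The regularizing summand is exactly what keeps this positive.\<close>

lemma pot0_2_lower:
  "speed2 p * exp (- 2 * R) / (2 * (nsq p + exp (- 2 * R))\<^sup>2) \<le> - pot0_2 R p"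
proof -
  let ?M = "nsq p + exp (- 2 * R)"
  have M: "0 < ?M" using nsq_nonneg[of p] by (simp add: add_nonneg_pos)
  have "(cmod (nsq1 p))\<^sup>2 / ?M\<^sup>2 \<le> nsq p * speed2 p / ?M\<^sup>2" using nsq1_le[of p] by (intro divide_right_mono) auto
  moreover have "speed2 p / ?M - nsq p * speed2 p / ?M\<^sup>2 = speed2 p * exp (- 2 * R) / ?M\<^sup>2"
  proof -
    have "speed2 p / ?M = speed2 p * ?M / ?M\<^sup>2" using M by (simp add: power2_eq_square)
    then show ?thesis by (simp add: diff_divide_distrib[symmetric] algebra_simps)
  qed
  ultimately have "speed2 p * exp (- 2 * R) / ?M\<^sup>2 \<le> speed2 p / ?M - (cmod (nsq1 p))\<^sup>2 / ?M\<^sup>2" by linarith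
  then show ?thesis by (simp add: pot0_2_def)
qed

lemma pot0_2_nonpos: "0 \<le> - pot0_2 R p"
proof -
  have "0 \<le> speed2 p * exp (- 2 * R) / (2 * (nsq p + exp (- 2 * R))\<^sup>2)" using speed2_nonneg[of p] by simp
  then show ?thesis using pot0_2_lower[of p R] by linarith
qed

lemma pot0_2_lower':
  assumes "nsq p \<le> exp (- 2 * R)"
  shows "speed2 p * exp (2 * R) / 8 \<le> - pot0_2 R p"
proof -
  let ?r = "exp (- 2 * R)" and ?M = "nsq p + exp (- 2 * R)"
  have M: "0 < ?M" using nsq_nonneg[of p] by (simp add: add_nonneg_pos)
  have "?M \<le> 2 * ?r" using assms by simp
  then have "?M\<^sup>2 \<le> (2 * ?r)\<^sup>2" using M by (intro power_mono) auto
  then have "speed2 p * ?r / (2 * (2 * ?r)\<^sup>2) \<le> speed2 p * ?r / (2 * ?M\<^sup>2)"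
    using M speed2_nonneg[of p] by (intro divide_left_mono) auto
  moreover have "speed2 p * ?r / (2 * (2 * ?r)\<^sup>2) = speed2 p * exp (2 * R) / 8"
    by (simp add: power2_eq_square exp_minus field_simps)
  ultimately show ?thesis using pot0_2_lower[of p R] by linarith
qed

lemma pot0_1_le: "cmod (pot0_1 R p) \<le> lam_max"
proof -
  let ?M = "nsq p + exp (- 2 * R)"
  have M: "0 < ?M" using nsq_nonneg[of p] by (simp add: add_nonneg_pos)
  have "cmod (nsq1 p) \<le> lam_max * ?M"
    using nsq1_le'[of p] lam_max_pos by (smt (verit, best) exp_gt_zero mult_left_mono)
  then have "cmod (nsq1 p) / ?M \<le> lam_max" using M by (simp add: divide_le_eq)
  moreover have "cmod (pot0_1 R p) = (1 / 2) * (cmod (nsq1 p) / ?M)"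
    unfolding pot0_1_def norm_mult norm_divide norm_of_real using M by simp
  moreover have "0 \<le> cmod (nsq1 p) / ?M" using M by simp
  ultimately show ?thesis by linarith
qed

text \<open>Bounds the logarithmic gradients of all three summands of the reciprocal potential:
  \<open>lam_max\<close> serves for \<open>pot0\<close>, and 8 \<open>ab_max\<close> for the
  barriers where x, y >= 1/4.\<close>

definition grad_C :: real where "grad_C = lam_max + 8 * ab_max"

lemma barrier_log1_le:
  assumes p: "p \<in> generic" "vsq k p \<le> 1 / 2" "vsq l p \<le> 1 / 2" and b: "b = 0 \<or> b = 2 * aexp"
  shows "cmod (barrier_log1 b p) \<le> grad_C"
proof -
  have ln2: "1 / 2 \<le> ln (2 :: real)" using ln2_ge_two_thirds by simp
  have "ln (vsq k p) \<le> ln (1 / 2)" "ln (vsq l p) \<le> ln (1 / 2)" using generic_vsq[OF p(1)] p by simp_all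
  then have xy: "1 / 4 \<le> xk p" "1 / 4 \<le> yl p" using ln2 by (auto simp: xk_def yl_def ln_div)
  have q: "cmod (c / of_real t) \<le> 4 * ab_max" if "cmod c \<le> ab_max" "1 / 4 \<le> t" for c t
  proof -
    have "cmod c / t \<le> ab_max / (1 / 4)" using that ab_max(1) by (intro frac_le) auto
    then show ?thesis using that by (simp add: norm_divide)
  qed
  have "cmod (alpha / of_real (xk p) + beta / of_real (yl p)) \<le> 4 * ab_max + 4 * ab_max"
    by (rule order_trans[OF norm_triangle_ineq add_mono[OF q[OF ab_max(2) xy(1)] q[OF ab_max(3) xy(2)]]])
  then have "aexp * cmod (alpha / of_real (xk p) + beta / of_real (yl p)) \<le> 1 * (4 * ab_max + 4 * ab_max)"
    using aexp_bounds by (intro mult_mono) auto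
  then show ?thesis using lam_max_pos by (simp add: barrier_log1_norm[OF p(1) b] grad_C_def)
qed

text \<open>The 1/8 comes from the Laplacian of \<open>pot0\<close> in the small ball, the square
  from the bound 3 + 2 \<open>pot_c\<close> for the ratio of \<open>pot0\<close> to the
  potential.\<close>

definition pot_q :: real where "pot_q = 1 / (8 * (3 + 2 * pot_c)\<^sup>2)"

lemma pot_q_pos: "pot_q > 0"
proof -
  have "3 + 2 * pot_c \<noteq> 0" using pot_c_ge by linarith
  then show ?thesis by (simp add: pot_q_def)
qed

text \<open>Each upper bound for F = 1/E comes from a single summand of E, and the gradient bound
  from the bounded logarithmic gradient of every summand. For the last estimate, -F2 is at least
  -pot0_2/(pot0 E)^2, and pot0 E is bounded in the inner region: there each barrier is at most 1/R,
  while pot0 = O(R).\<close>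

lemma potential_exists:
  assumes R: "R \<ge> 1" and X: "X \<ge> 1"
  obtains F F1 F2 where "leaf_jet generic F F1 F2"
    "\<And>p. p \<in> generic \<Longrightarrow> 0 < F p" "\<And>p. p \<in> generic \<Longrightarrow> F2 p \<le> 0"
    "\<And>p. p \<in> generic \<Longrightarrow> F p \<le> pot0 R p"
    "\<And>p. p \<in> generic \<Longrightarrow> F p \<le> exp (- (2 * aexp - 1) * ln R + aexp * ln (xk p) + aexp * ln (yl p))"
    "\<And>p. p \<in> generic \<Longrightarrow> F p \<le> exp (- ((2 * aexp - 1) * ln R - 4 * aexp * ln X) + aexp * ln (xk p) + aexp * ln (yl p)
        - 2 * aexp * ln (wsq p))"
    "\<And>p. p \<in> generic \<Longrightarrow> vsq k p \<le> 1 / 2 \<Longrightarrow> vsq l p \<le> 1 / 2 \<Longrightarrow> cmod (F1 p) \<le> grad_C * F p"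
    "\<And>p. p \<in> generic \<Longrightarrow> nsq p \<le> exp (- 2 * R) \<Longrightarrow> wsq p \<le> X\<^sup>2 \<Longrightarrow> pot_q * (speed2 p * exp (2 * R)) \<le> - F2 p"
proof -
  note o = open_generic
  \<comment> \<open>e^c1 = R^(2a-1) and e^c2 = R^(2a-1) X^(-4a), so the second barrier does not
    exceed the first where |w| <= X.\<close>
  define c1 where "c1 = (2 * aexp - 1) * ln R"
  define c2 where "c2 = (2 * aexp - 1) * ln R - 4 * aexp * ln X"
  let ?b = "2 * aexp"
  define e0 where "e0 p = inverse (pot0 R p)" for p
  define e01 where "e01 p = - pot0_1 R p / of_real ((pot0 R p)\<^sup>2)" for p
  define e02 where "e02 p = - (pot0_2 R p / (pot0 R p)\<^sup>2 - 2 * (cmod (pot0_1 R p))\<^sup>2 / pot0 R p ^ 3)" for p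
  define b11 where "b11 p = of_real (barrier c1 0 p) * barrier_log1 0 p" for p
  define b21 where "b21 p = of_real (barrier c2 ?b p) * barrier_log1 ?b p" for p
  define b12 where "b12 p = barrier c1 0 p * (aexp * ((cmod alpha)\<^sup>2 / (xk p)\<^sup>2 + (cmod beta)\<^sup>2 / (yl p)\<^sup>2) + (cmod (barrier_log1 0 p))\<^sup>2)" for p
  define b22 where "b22 p = barrier c2 ?b p * (aexp * ((cmod alpha)\<^sup>2 / (xk p)\<^sup>2 + (cmod beta)\<^sup>2 / (yl p)\<^sup>2) + (cmod (barrier_log1 ?b p))\<^sup>2)" for p
  define E where "E p = e0 p + barrier c1 0 p + barrier c2 ?b p" for p
  define E1 where "E1 p = e01 p + b11 p + b21 p" for p
  define E2 where "E2 p = e02 p + b12 p + b22 p" for p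
  have pg: "p \<in> polydisc" if "p \<in> generic" for p using that by (simp add: generic_def)
  have P1: "1 \<le> pot0 R p" if "p \<in> generic" for p by (rule pot0_ge[OF R pg[OF that]])
  have P0: "0 < pot0 R p" if "p \<in> generic" for p using P1[OF that] by simp
  have e0pos: "0 < e0 p" if "p \<in> generic" for p using P0[OF that] by (simp add: e0_def)
  have bpos: "0 < barrier c b p" for c b p by (simp add: barrier_def)
  have Epos: "0 < E p" if "p \<in> generic" for p
    unfolding E_def by (intro add_pos_pos e0pos[OF that] bpos)
  have je0: "leaf_jet generic e0 e01 e02"
    using leaf_jet_inverse[OF leaf_jet_pot0[OF o] o P0] unfolding e0_def e01_def e02_def .
  have jb1: "leaf_jet generic (barrier c1 0) b11 b12"
    unfolding b11_def b12_def by (rule leaf_jet_barrier)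
  have jb2: "leaf_jet generic (barrier c2 ?b) b21 b22"
    unfolding b21_def b22_def by (rule leaf_jet_barrier)
  have jE: "leaf_jet generic E E1 E2"
    using leaf_jet_add[OF leaf_jet_add[OF je0 jb1 o] jb2 o] unfolding E_def E1_def E2_def .
  define F where "F p = inverse (E p)" for p
  define F1 where "F1 p = - E1 p / of_real ((E p)\<^sup>2)" for p
  define F2 where "F2 p = - (E2 p / (E p)\<^sup>2 - 2 * (cmod (E1 p))\<^sup>2 / E p ^ 3)" for p
  have jF: "leaf_jet generic F F1 F2"
    using leaf_jet_inverse[OF jE o Epos] unfolding F_def F1_def F2_def .
  have Fle: "F p \<le> inverse t" if "p \<in> generic" "0 < t" "t \<le> E p" for p t
    unfolding F_def using that by (intro le_imp_inverse_le) auto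
  have F2up: "(- pot0_2 R p / (pot0 R p)\<^sup>2) / (E p)\<^sup>2 \<le> - F2 p" if p: "p \<in> generic" for p
  proof -
    have "e02 p \<ge> - pot0_2 R p / (pot0 R p)\<^sup>2 + 2 * (cmod (e01 p))\<^sup>2 / e0 p"
    proof -
      have "(cmod (e01 p))\<^sup>2 / e0 p = (cmod (pot0_1 R p))\<^sup>2 / pot0 R p ^ 3"
        unfolding e01_def e0_def norm_divide norm_minus_cancel norm_of_real
        using P0[OF p] by (simp add: power_divide power2_eq_square power3_eq_cube field_simps)
      then have "2 * (cmod (e01 p))\<^sup>2 / e0 p = 2 * (cmod (pot0_1 R p))\<^sup>2 / pot0 R p ^ 3"
        by (metis times_divide_eq_right)
      then show ?thesis by (simp add: e02_def)
    qed
    moreover have "b12 p \<ge> 2 * (cmod (b11 p))\<^sup>2 / barrier c1 0 p"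
      unfolding b12_def b11_def by (rule barrier_superharmonic[OF p]) simp
    moreover have "b22 p \<ge> 2 * (cmod (b21 p))\<^sup>2 / barrier c2 ?b p"
      unfolding b22_def b21_def by (rule barrier_superharmonic[OF p]) simp
    ultimately have "(- pot0_2 R p / (pot0 R p)\<^sup>2) / (E p)\<^sup>2 \<le> E2 p / (E p)\<^sup>2 - 2 * (cmod (E1 p))\<^sup>2 / E p ^ 3"
      unfolding E_def E1_def E2_def by (rule reciprocal_superharmonic_sum[OF e0pos[OF p] bpos bpos])
    then show ?thesis by (simp add: F2_def)
  qed
  show thesis
  proof (rule that[OF jF])
    fix p assume p: "p \<in> generic"
    show "0 < F p" using Epos[OF p] by (simp add: F_def)
    have "0 \<le> (- pot0_2 R p / (pot0 R p)\<^sup>2) / (E p)\<^sup>2"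
      by (intro divide_nonneg_nonneg pot0_2_nonpos zero_le_power2)
    then show "F2 p \<le> 0" using F2up[OF p] by linarith
    have "F p \<le> inverse (e0 p)"
      by (rule Fle[OF p e0pos[OF p]]) (use bpos[of c1 0 p] bpos[of c2 ?b p] in \<open>simp add: E_def\<close>)
    then show "F p \<le> pot0 R p" by (simp add: e0_def)
    have "F p \<le> inverse (barrier c1 0 p)"
      by (rule Fle[OF p bpos]) (use e0pos[OF p] bpos[of c2 ?b p] in \<open>simp add: E_def\<close>)
    also have "inverse (barrier c1 0 p) = exp (- (c1 - aexp * ln (xk p) - aexp * ln (yl p) + 0 * ln (wsq p)))"
      by (simp only: barrier_def exp_minus)
    also have "\<dots> = exp (- (2 * aexp - 1) * ln R + aexp * ln (xk p) + aexp * ln (yl p))"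
      by (simp add: c1_def algebra_simps)
    finally show "F p \<le> exp (- (2 * aexp - 1) * ln R + aexp * ln (xk p) + aexp * ln (yl p))" .
    have "F p \<le> inverse (barrier c2 ?b p)"
      by (rule Fle[OF p bpos]) (use e0pos[OF p] bpos[of c1 0 p] in \<open>simp add: E_def\<close>)
    also have "inverse (barrier c2 ?b p) = exp (- (c2 - aexp * ln (xk p) - aexp * ln (yl p) + ?b * ln (wsq p)))"
      by (simp only: barrier_def exp_minus)
    also have "\<dots> = exp (- ((2 * aexp - 1) * ln R - 4 * aexp * ln X) + aexp * ln (xk p) + aexp * ln (yl p)
        - 2 * aexp * ln (wsq p))"
      by (simp add: c2_def algebra_simps)
    finally show "F p \<le> exp (- ((2 * aexp - 1) * ln R - 4 * aexp * ln X) + aexp * ln (xk p) + aexp * ln (yl p)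
        - 2 * aexp * ln (wsq p))" .
    show "cmod (F1 p) \<le> grad_C * F p" if v: "vsq k p \<le> 1 / 2" "vsq l p \<le> 1 / 2"
    proof -
      have g0: "0 \<le> grad_C" using lam_max_pos ab_max(1) by (simp add: grad_C_def)
      have "cmod (e01 p) \<le> grad_C * e0 p"
      proof -
        have "cmod (e01 p) = cmod (pot0_1 R p) * e0 p * e0 p"
          unfolding e01_def e0_def norm_divide norm_minus_cancel norm_of_real
          using P0[OF p] by (simp add: power2_eq_square field_simps)
        also have "\<dots> \<le> lam_max * e0 p * 1"
          using pot0_1_le[of R p] e0pos[OF p] P1[OF p] lam_max_pos
          by (intro mult_mono) (auto simp: e0_def inverse_le_1_iff)
        also have "\<dots> \<le> grad_C * e0 p"
          using e0pos[OF p] ab_max(1) by (simp add: grad_C_def)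
        finally show ?thesis .
      qed
      moreover have "cmod (b11 p) \<le> grad_C * barrier c1 0 p"
        using mult_left_mono[OF barrier_log1_le[OF p v, of 0] less_imp_le[OF bpos[of c1 0 p]]] bpos[of c1 0 p]
        by (simp add: b11_def norm_mult mult.commute)
      moreover have "cmod (b21 p) \<le> grad_C * barrier c2 ?b p"
        using mult_left_mono[OF barrier_log1_le[OF p v, of ?b] less_imp_le[OF bpos[of c2 ?b p]]] bpos[of c2 ?b p]
        by (simp add: b21_def norm_mult mult.commute)
      moreover have "cmod (E1 p) \<le> cmod (e01 p) + cmod (b11 p) + cmod (b21 p)"
        unfolding E1_def by (rule norm_triangle_mono[OF norm_triangle_ineq order_refl])
      ultimately have "cmod (E1 p) \<le> grad_C * e0 p + grad_C * barrier c1 0 p + grad_C * barrier c2 ?b p"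
        by linarith
      also have "\<dots> = grad_C * E p" by (simp add: E_def distrib_left)
      finally have "cmod (E1 p) / (E p)\<^sup>2 \<le> grad_C * E p / (E p)\<^sup>2" by (rule divide_right_mono) simp
      then show ?thesis
        unfolding F1_def F_def norm_divide norm_minus_cancel norm_of_real
        using Epos[OF p] by (simp add: power2_eq_square divide_inverse)
    qed
    show "pot_q * (speed2 p * exp (2 * R)) \<le> - F2 p" if n: "nsq p \<le> exp (- 2 * R)" and w: "wsq p \<le> X\<^sup>2"
    proof -
      have lnR: "0 \<le> ln R" using R by simp
      have "ln (vsq k p) \<le> ln (exp (- 2 * R))" "ln (vsq l p) \<le> ln (exp (- 2 * R))"
        using generic_vsq[OF p] vsq_le_nsq[of k p] vsq_le_nsq[of l p] n by (subst ln_le_cancel_iff; simp)+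
      then have "R \<le> xk p" "R \<le> yl p" by (simp_all add: xk_def yl_def)
      then have "ln R \<le> ln (xk p)" "ln R \<le> ln (yl p)" using R by simp_all
      then have lx: "aexp * ln R \<le> aexp * ln (xk p)" "aexp * ln R \<le> aexp * ln (yl p)"
        using aexp_bounds by (auto intro!: mult_left_mono)
      have "ln (wsq p) \<le> ln (X\<^sup>2)" using wsq_pos[OF p] w X by simp
      then have "ln (wsq p) \<le> 2 * ln X" using X by (simp add: ln_realpow)
      then have lw: "2 * aexp * ln (wsq p) \<le> 2 * aexp * (2 * ln X)" using aexp_bounds by (intro mult_left_mono) auto
      have b1: "barrier c1 0 p \<le> inverse R"
      proof -
        have "c1 - aexp * ln (xk p) - aexp * ln (yl p) + 0 * ln (wsq p) \<le> - ln R"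
          using lx by (simp add: c1_def algebra_simps)
        then have "barrier c1 0 p \<le> exp (- ln R)" unfolding barrier_def by (simp only: exp_le_cancel_iff)
        then show ?thesis using R by (simp add: exp_minus)
      qed
      have b2: "barrier c2 ?b p \<le> inverse R"
      proof -
        have "c2 - aexp * ln (xk p) - aexp * ln (yl p) + ?b * ln (wsq p) \<le> - ln R"
          using lx lw by (simp add: c2_def algebra_simps)
        then have "barrier c2 ?b p \<le> exp (- ln R)" unfolding barrier_def by (simp only: exp_le_cancel_iff)
        then show ?thesis using R by (simp add: exp_minus)
      qed
      have "pot0 R p \<le> R + pot_c" by (rule pot0_le)
      also have "\<dots> \<le> (1 + pot_c) * R" using R pot_c_ge by (simp add: algebra_simps)
      finally have pR: "pot0 R p * inverse R \<le> 1 + pot_c" using R by (simp add: field_simps)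
      have "pot0 R p * E p \<le> pot0 R p * (e0 p + inverse R + inverse R)"
        unfolding E_def using b1 b2 P0[OF p] by (intro mult_left_mono add_mono) auto
      also have "\<dots> = 1 + 2 * (pot0 R p * inverse R)" using P0[OF p] by (simp add: e0_def algebra_simps)
      also have "\<dots> \<le> 3 + 2 * pot_c" using pR by simp
      finally have "(pot0 R p * E p)\<^sup>2 \<le> (3 + 2 * pot_c)\<^sup>2"
        using P0[OF p] Epos[OF p] by (intro power_mono) auto
      moreover have "0 < (pot0 R p * E p)\<^sup>2" using P0[OF p] Epos[OF p] by simp
      ultimately have "(speed2 p * exp (2 * R) / 8) / (3 + 2 * pot_c)\<^sup>2 \<le> (- pot0_2 R p) / (pot0 R p * E p)\<^sup>2"
        using pot0_2_lower'[OF n] pot0_2_nonpos[of R p] by (intro frac_le) auto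
      also have "\<dots> = (- pot0_2 R p / (pot0 R p)\<^sup>2) / (E p)\<^sup>2" by (simp add: power_mult_distrib)
      also have "\<dots> \<le> - F2 p" by (rule F2up[OF p])
      finally show ?thesis by (simp add: pot_q_def)
    qed
  qed
qed

end

section \<open>The Lelong number\<close>

context linear_current
begin

lemma measurable_xk [measurable]: "xk \<in> borel_measurable borel"
  and measurable_yl [measurable]: "yl \<in> borel_measurable borel"
  unfolding xk_def[abs_def] yl_def[abs_def] by measurable

lemma measurable_wsq [measurable]: "wsq \<in> borel_measurable borel"
  unfolding wsq_def[abs_def] wtime_def[abs_def] by measurable

lemma measurable_generic [measurable]: "generic \<in> sets borel"
  using open_generic by simp

section \<open>Mass of a small ball against an integral over the shell\<close>

text \<open>A ball of radius exp(-R) off two hyperplanes, truncated to |w| <= X. The mass bound will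
  be uniform in X.\<close>

definition inner_set :: "real \<Rightarrow> real \<Rightarrow> (complex ^ 'n) set" where
  "inner_set R X = generic \<inter> {p. nsq p \<le> exp (- 2 * R)} \<inter> {p. wsq p \<le> X\<^sup>2}"

lemma measurable_inner_set [measurable]: "inner_set R X \<in> sets borel"
  unfolding inner_set_def by measurable

text \<open>A majorant of the potential on the shell that is free of X: there |z|^2 >= 1/4 bounds
  \<open>pot0\<close> by \<open>pot_c\<close> + ln 2, and the other term is R^(1-2a) (xy)^a.\<close>

definition shell_fun :: "real \<Rightarrow> complex ^ 'n \<Rightarrow> real" where
  "shell_fun R p = min (pot_c + ln 2) (exp (- (2 * aexp - 1) * ln R + aexp * ln (xk p) + aexp * ln (yl p)))"

lemma measurable_shell_fun [measurable]: "shell_fun R \<in> borel_measurable borel"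
  unfolding shell_fun_def[abs_def] by measurable

lemma shell_fun_nonneg: "0 \<le> shell_fun R p"
  using pot_c_ge by (simp add: shell_fun_def add_nonneg_nonneg)

lemma measurable_core_set [measurable]: "core_set e \<in> sets borel"
proof -
  have eq: "core_set e = (\<Inter>j. {p. vsq j p \<le> 1 / 2}) \<inter> {p. e \<le> nsq p}" by (auto simp: core_set_def)
  show ?thesis unfolding eq by measurable
qed

text \<open>With T = 4S + ln n the set measured here is contained in the union of the set of
  \<open>flow_measure_growth\<close> and the shell. The level exp(-4S) fits the far cut-off, since x
  < 2S forces |z_k|^2 > exp(-4S).\<close>

lemma core_set_growth: "\<exists>C\<ge>0. \<forall>S\<ge>1. emeasure flow_measure (core_set (exp (- 4 * S))) \<le> ennreal (C * S\<^sup>2)"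
proof -
  let ?n = "real CARD('n)"
  have n1: "?n \<ge> 1" using card_gt_0_iff[of "UNIV :: 'n set"] by simp
  have ln0: "0 \<le> ln ?n" using n1 by simp
  obtain C where C: "C \<ge> 0" "\<And>T. T \<ge> 1 \<Longrightarrow> emeasure flow_measure {p. (\<forall>j. vsq j p \<le> 1 / 4) \<and> ?n * exp (- T) \<le> nsq p} \<le> ennreal (C * T\<^sup>2)"
    using flow_measure_growth by blast
  define ms where "ms = measure flow_measure shell"
  have ms: "emeasure flow_measure shell = ennreal ms"
    unfolding ms_def using shell_finite by (intro emeasure_eq_ennreal_measure) simp
  have ms0: "ms \<ge> 0" by (simp add: ms_def)
  show ?thesis
  proof (intro exI[of _ "C * (4 + ln ?n)\<^sup>2 + ms"] conjI allI impI)
    show "0 \<le> C * (4 + ln ?n)\<^sup>2 + ms" using C(1) ms0 by simp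
    fix S :: real assume S: "S \<ge> 1"
    define T where "T = 4 * S + ln ?n"
    have T: "1 \<le> T" unfolding T_def using S ln0 by linarith
    let ?A = "{p :: complex ^ 'n. (\<forall>j. vsq j p \<le> 1 / 4) \<and> ?n * exp (- T) \<le> nsq p}"
    have A_eq: "?A = (\<Inter>j. {p. vsq j p \<le> 1 / 4}) \<inter> {p. ?n * exp (- T) \<le> nsq p}" by auto
    have Am: "?A \<in> sets borel" unfolding A_eq by measurable
    have eT: "?n * exp (- T) = exp (- 4 * S)"
      using n1 by (simp add: T_def exp_diff exp_minus exp_add)
    have sub: "core_set (exp (- 4 * S)) \<subseteq> ?A \<union> shell"
    proof
      fix p assume p: "p \<in> core_set (exp (- 4 * S))"
      then have h: "\<forall>j. vsq j p \<le> 1 / 2" and n: "exp (- 4 * S) \<le> nsq p" by (simp_all add: core_set_def)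
      show "p \<in> ?A \<union> shell"
      proof (cases "\<forall>j. vsq j p \<le> 1 / 4")
        case True
        then show ?thesis using n eT by simp
      next
        case False
        then have "\<exists>j. 1 / 4 < vsq j p" by (meson not_le)
        then show ?thesis using h by (simp add: shell_def)
      qed
    qed
    have "emeasure flow_measure (core_set (exp (- 4 * S))) \<le> emeasure flow_measure (?A \<union> shell)"
      using Am by (intro emeasure_mono[OF sub]) simp
    also have "\<dots> \<le> emeasure flow_measure ?A + emeasure flow_measure shell"
      using Am by (intro emeasure_subadditive) simp_all
    also have "\<dots> \<le> ennreal (C * T\<^sup>2) + ennreal ms" using C(2)[OF T] ms by (simp add: add_right_mono)
    also have "\<dots> = ennreal (C * T\<^sup>2 + ms)" using C(1) ms0 by (simp add: ennreal_plus)
    also have "\<dots> \<le> ennreal ((C * (4 + ln ?n)\<^sup>2 + ms) * S\<^sup>2)"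
    proof (rule ennreal_leI)
      have "ln ?n \<le> ln ?n * S" using ln0 S mult_left_mono[of 1 S "ln ?n"] by simp
      then have "T \<le> (4 + ln ?n) * S" by (simp add: T_def distrib_right)
      then have "T\<^sup>2 \<le> ((4 + ln ?n) * S)\<^sup>2" using T by (intro power_mono) auto
      then have "C * T\<^sup>2 \<le> C * (4 + ln ?n)\<^sup>2 * S\<^sup>2" using C(1) mult_left_mono by (fastforce simp: power_mult_distrib mult.assoc)
      moreover have "ms \<le> ms * S\<^sup>2" using ms0 S mult_left_mono[of 1 "S\<^sup>2" ms] by (simp add: one_le_power)
      ultimately show "C * T\<^sup>2 + ms \<le> (C * (4 + ln ?n)\<^sup>2 + ms) * S\<^sup>2" by (simp add: distrib_right)
    qed
    finally show "emeasure flow_measure (core_set (exp (- 4 * S))) \<le> ennreal ((C * (4 + ln ?n)\<^sup>2 + ms) * S\<^sup>2)" .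
  qed
qed

lemma vsq_k_exp: "p \<in> generic \<Longrightarrow> vsq k p = exp (- 2 * xk p)"
  and vsq_l_exp: "p \<in> generic \<Longrightarrow> vsq l p = exp (- 2 * yl p)"
  using generic_vsq[of p] by (simp_all add: xk_def yl_def)

lemma exp_minus_two_le: "R \<ge> 1 \<Longrightarrow> exp (- 2 * R) \<le> (1 / 4 :: real)"
proof -
  assume R: "R \<ge> 1"
  have "2 \<le> exp (1 :: real)" using exp_ge_add_one_self[of 1] by simp
  then have "2 * 2 \<le> exp (1 :: real) * exp 1" by (intro mult_mono) auto
  then have "4 \<le> exp (2 :: real)" by (simp add: exp_add[symmetric])
  also have "\<dots> \<le> exp (2 * R)" using R by simp
  finally have "inverse (exp (2 * R)) \<le> inverse 4" by (intro le_imp_inverse_le) auto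
  then show ?thesis by (simp add: exp_minus)
qed

lemma wsq_far:
  assumes S: "S > 0" and far: "S < xk p \<or> S < yl p"
  shows "S\<^sup>2 / (4 * ab_max\<^sup>2) \<le> wsq p"
proof -
  have a: "0 < ab_max" using ab_max(1) by simp
  have w0: "0 \<le> wsq p" by (simp add: wsq_def)
  have ab: "(cmod alpha)\<^sup>2 \<le> ab_max\<^sup>2" "(cmod beta)\<^sup>2 \<le> ab_max\<^sup>2"
    using ab_max by (auto intro!: power_mono)
  have "S\<^sup>2 \<le> 4 * ab_max\<^sup>2 * wsq p"
    using far
  proof
    assume "S < xk p"
    then have "S\<^sup>2 \<le> (xk p)\<^sup>2" using S by (intro power_mono) auto
    also have "\<dots> \<le> 4 * (cmod alpha)\<^sup>2 * wsq p" by (rule xk_sq_le)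
    also have "\<dots> \<le> 4 * ab_max\<^sup>2 * wsq p" using ab w0 by (intro mult_right_mono) auto
    finally show ?thesis .
  next
    assume "S < yl p"
    then have "S\<^sup>2 \<le> (yl p)\<^sup>2" using S by (intro power_mono) auto
    also have "\<dots> \<le> 4 * (cmod beta)\<^sup>2 * wsq p" by (rule yl_sq_le)
    also have "\<dots> \<le> 4 * ab_max\<^sup>2 * wsq p" using ab w0 by (intro mult_right_mono) auto
    finally show ?thesis .
  qed
  then show ?thesis using a by (simp add: divide_le_eq mult.commute)
qed

text \<open>The numbers s and f stand for the two zones where the cut-off varies. As s + f <= 2, the
  squared gradient is again linear in s + f, so one factor s + f bounds all derivatives.\<close>

lemma cutoff_pair_bounds:
  fixes s f Cv :: real
  assumes "0 \<le> V" "cmod V1 \<le> Cv * (s + f)" "\<bar>V2\<bar> \<le> Cv * (s + f)" "0 \<le> s + f" "s + f \<le> 2" "0 \<le> Cv"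
  shows "cmod (of_real (flat_deriv 1 (flat_fun 1 + (- 1) * V)) * (- V1)) \<le> (flat_B * Cv) * (s + f)"
    "\<bar>flat_deriv 1 (flat_fun 1 + (- 1) * V) * (- V2) + flat_deriv 2 (flat_fun 1 + (- 1) * V) * (cmod (- V1))\<^sup>2\<bar>
      \<le> (flat_B * (Cv + 2 * Cv\<^sup>2)) * (s + f)"
proof -
  have B: "0 \<le> flat_B" using flat_B(1) by simp
  show "cmod (of_real (flat_deriv 1 (flat_fun 1 + (- 1) * V)) * (- V1)) \<le> (flat_B * Cv) * (s + f)"
    using order_trans[OF cutoff_bounds(1)[OF assms(1), of V1] mult_left_mono[OF assms(2) B]] by (simp only: mult.assoc)
  have "(cmod V1)\<^sup>2 \<le> (Cv * (s + f))\<^sup>2" using assms(2) by (intro power_mono) auto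
  also have "\<dots> = Cv\<^sup>2 * ((s + f) * (s + f))" by (simp add: power2_eq_square mult_ac)
  also have "\<dots> \<le> Cv\<^sup>2 * (2 * (s + f))" using assms by (intro mult_left_mono mult_right_mono) auto
  finally have "\<bar>V2\<bar> + (cmod V1)\<^sup>2 \<le> (Cv + 2 * Cv\<^sup>2) * (s + f)" using assms(3) by (simp add: algebra_simps)
  from order_trans[OF cutoff_bounds(2)[OF assms(1), of V2 V1] mult_left_mono[OF this B]]
  show "\<bar>flat_deriv 1 (flat_fun 1 + (- 1) * V) * (- V2) + flat_deriv 2 (flat_fun 1 + (- 1) * V) * (cmod (- V1))\<^sup>2\<bar>
      \<le> (flat_B * (Cv + 2 * Cv\<^sup>2)) * (s + f)" by (simp only: mult.assoc)
qed

text \<open>The test function G is the potential F times the cut-off, 0 off the generic points. On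
  the inner set the cut-off is constant and -F2 provides the gain. Elsewhere F2 <= 0 does no harm,
  and the derivatives of the cut-off cost at most \<open>CH\<close> F (s + f), with s living on the
  shell and f beyond S. The factor \<open>K\<close> bounds F S^(2a) in that far zone.\<close>

lemma inner_bound_finite:
  assumes CV: "CV \<ge> 1" "\<And>p. p \<in> polydisc \<Longrightarrow> cmod (vbdry1 p) \<le> CV" "\<And>p. p \<in> polydisc \<Longrightarrow> \<bar>vbdry2 p\<bar> \<le> CV"
    and R: "R \<ge> 1" and X: "X \<ge> 1" and S: "S \<ge> 2 * ab_max * X"
  defines "Cv \<equiv> CV + 2 * flat_B * ab_max\<^sup>2"
  defines "CH \<equiv> 2 * grad_C * (flat_B * Cv) + flat_B * (Cv + 2 * Cv\<^sup>2)"
  defines "K \<equiv> exp (- ((2 * aexp - 1) * ln R - 4 * aexp * ln X) + 2 * aexp * ln 2 + 2 * aexp * ln (4 * ab_max\<^sup>2))"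
  shows "(\<integral>\<^sup>+p. ennreal (pot_q * chi0 * (speed2 p * exp (2 * R)) * indicat_real (inner_set R X) p) \<partial>flow_measure)
    \<le> (\<integral>\<^sup>+p. ennreal (CH * (shell_fun R p * indicat_real shell p
         + K * S powr (- 2 * aexp) / S * indicat_real (core_set (exp (- 4 * S))) p)) \<partial>flow_measure)"
proof -
  have abX: "2 \<le> 2 * ab_max * X" using ab_max(1) X mult_mono[of 1 ab_max 1 X] by simp
  then have S1: "S \<ge> 1" using S by linarith
  have S0: "S > 0" using S1 by simp
  have B: "flat_B \<ge> 1" by (rule flat_B(1))
  have Cv0: "0 \<le> Cv" unfolding Cv_def using CV(1) B by simp
  have gC: "0 \<le> grad_C" using lam_max_pos ab_max(1) by (simp add: grad_C_def)
  have CH0: "0 \<le> CH" unfolding CH_def using Cv0 gC B by simp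
  have K0: "0 < K" by (simp add: K_def)
  obtain F F1 F2 where F: "leaf_jet generic F F1 F2"
    and Fpos: "\<And>p. p \<in> generic \<Longrightarrow> 0 < F p" and F2neg: "\<And>p. p \<in> generic \<Longrightarrow> F2 p \<le> 0"
    and Fpot: "\<And>p. p \<in> generic \<Longrightarrow> F p \<le> pot0 R p"
    and FR: "\<And>p. p \<in> generic \<Longrightarrow> F p \<le> exp (- (2 * aexp - 1) * ln R + aexp * ln (xk p) + aexp * ln (yl p))"
    and FX: "\<And>p. p \<in> generic \<Longrightarrow> F p \<le> exp (- ((2 * aexp - 1) * ln R - 4 * aexp * ln X) + aexp * ln (xk p) + aexp * ln (yl p)
        - 2 * aexp * ln (wsq p))"
    and Fgrad: "\<And>p. p \<in> generic \<Longrightarrow> vsq k p \<le> 1 / 2 \<Longrightarrow> vsq l p \<le> 1 / 2 \<Longrightarrow> cmod (F1 p) \<le> grad_C * F p"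
    and Flow: "\<And>p. p \<in> generic \<Longrightarrow> nsq p \<le> exp (- 2 * R) \<Longrightarrow> wsq p \<le> X\<^sup>2 \<Longrightarrow> pot_q * (speed2 p * exp (2 * R)) \<le> - F2 p"
  proof (rule potential_exists[OF R X], goal_cases)
    case (1 F F1 F2)
    show ?case
    proof (rule 1(1))
      show "leaf_jet generic F F1 F2" by (rule 1(2))
    qed (rule 1(3-9), assumption+)+
  qed
  define V where "V p = vbdry p + vfar S p" for p
  define V1 where "V1 p = vbdry1 p + vfar1 S p" for p
  define V2 where "V2 p = vbdry2 p + vfar2 S p" for p
  have jV: "leaf_jet generic V V1 V2"
    using leaf_jet_add[OF leaf_jet_vbdry[OF open_generic] leaf_jet_vfar open_generic] unfolding V_def V1_def V2_def .
  define C where "C p = flat_fun (flat_fun 1 + (- 1) * V p)" for p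
  define C1 where "C1 p = of_real (flat_deriv 1 (flat_fun 1 + (- 1) * V p)) * (- V1 p)" for p
  define C2 where "C2 p = flat_deriv 1 (flat_fun 1 + (- 1) * V p) * (- V2 p)
      + flat_deriv 2 (flat_fun 1 + (- 1) * V p) * (cmod (- V1 p))\<^sup>2" for p
  have jC: "leaf_jet generic C C1 C2"
    using leaf_jet_cutoff[OF jV open_generic] unfolding C_def C1_def C2_def .
  have V0: "0 \<le> V p" for p using vbdry_nonneg[of p] vfar_nonneg[of S p] by (simp add: V_def)
  have Cz: "C p = 0" "C1 p = 0" "C2 p = 0" if "flat_fun 1 \<le> V p" for p
    using cutoff_zero[OF that] by (simp_all only: C_def C1_def C2_def) simp_all
  have Vlarge: "flat_fun 1 \<le> V p" if "(\<exists>j. 1 / 2 < vsq j p) \<or> 2 * S \<le> xk p \<or> 2 * S \<le> yl p" for p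
    using that vbdry_large[of _ p] vfar_large[OF S0, of p] vbdry_nonneg[of p] vfar_nonneg[of S p]
    unfolding V_def by (metis add_increasing add_increasing2)
  define G where "G p = (if p \<in> generic then F p * C p else 0)" for p
  define G1 where "G1 p = (if p \<in> generic then F1 p * of_real (C p) + of_real (F p) * C1 p else 0)" for p
  define G2 where "G2 p = (if p \<in> generic then F2 p * C p + F p * C2 p + 2 * Re (F1 p * cnj (C1 p)) else 0)" for p
  have jG1: "leaf_jet generic G G1 G2"
    by (rule leaf_jet_cong[OF leaf_jet_mult[OF F jC open_generic] open_generic]) (simp_all add: G_def G1_def G2_def)
  \<comment> \<open>A neighbourhood of the two hyperplanes where x > 2S or y > 2S wherever these
    coordinates are defined. The cut-off vanishes at its generic points, so G extends by 0 with a
    jet on all of Y.\<close>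
  let ?U = "{p. vsq k p < exp (- 4 * S)} \<union> {p :: complex ^ 'n. vsq l p < exp (- 4 * S)}"
  have oU: "open ?U"
    by (intro open_Un open_Collect_less continuous_vsq continuous_on_const)
  have Uz: "flat_fun 1 \<le> V p" if p: "p \<in> ?U" "p \<in> generic" for p
  proof -
    have "exp (- 2 * xk p) < exp (- 4 * S) \<or> exp (- 2 * yl p) < exp (- 4 * S)"
      using p(1) vsq_k_exp[OF p(2)] vsq_l_exp[OF p(2)] by auto
    then have "2 * S \<le> xk p \<or> 2 * S \<le> yl p" by auto
    then show ?thesis using Vlarge by blast
  qed
  have jG2: "leaf_jet ?U G G1 G2"
    by (rule leaf_jet_cong[OF leaf_jet_const[OF oU, of 0] oU]) (use Cz[OF Uz] in \<open>auto simp: G_def G1_def G2_def\<close>)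
  have "Y \<subseteq> generic \<union> ?U"
  proof
    fix p assume "p \<in> Y"
    moreover have "vsq j p < exp (- 4 * S)" if "p $ j = 0" for j using that by (simp add: vsq_def)
    ultimately show "p \<in> generic \<union> ?U" unfolding generic_def by blast
  qed
  then have jG: "leaf_jet Y G G1 G2"
    by (rule leaf_jet_subset[OF leaf_jet_Un[OF jG1 jG2 open_generic oU]])
  define g where "g p = pot_q * chi0 * (speed2 p * exp (2 * R)) * indicat_real (inner_set R X) p" for p
  define Kf where "Kf = K * S powr (- 2 * aexp) / S"
  have Kf0: "0 \<le> Kf" using K0 S0 by (simp add: Kf_def)
  define h where "h p = CH * (shell_fun R p * indicat_real shell p + Kf * indicat_real (core_set (exp (- 4 * S))) p)" for p
  have hn: "0 \<le> h p" for p
    unfolding h_def using CH0 Kf0 shell_fun_nonneg by (intro mult_nonneg_nonneg add_nonneg_nonneg) auto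
  have core: "p \<in> core_set (exp (- 4 * S))"
    if p: "p \<in> generic" "\<And>j. vsq j p \<le> 1 / 2" "xk p < 2 * S" for p
  proof -
    have "exp (- 4 * S) \<le> vsq k p" using vsq_k_exp[OF p(1)] p(3) by simp
    then have "exp (- 4 * S) \<le> nsq p" using vsq_le_nsq[of k p] by linarith
    then show ?thesis using p(2) by (simp add: core_set_def)
  qed
  have "(\<integral>\<^sup>+p. ennreal (g p) \<partial>flow_measure) \<le> (\<integral>\<^sup>+p. ennreal (h p) \<partial>flow_measure)"
  proof (rule flow_measure_le[OF jG compact_core_set])
    show "0 < exp (- 4 * S)" by simp
    show "g \<in> borel_measurable borel" "h \<in> borel_measurable borel"
      unfolding g_def[abs_def] h_def[abs_def] by measurable
    show "0 \<le> g p" for p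
      unfolding g_def using pot_q_pos chi0_pos speed2_nonneg[of p] by simp
    show "0 \<le> h p" for p by (rule hn)
    show "G p = 0" if p: "p \<in> Y - core_set (exp (- 4 * S))" for p
    proof (cases "p \<in> generic")
      case True
      then have "\<not> ((\<forall>j. vsq j p \<le> 1 / 2) \<and> xk p < 2 * S)" using core p by blast
      then have "flat_fun 1 \<le> V p" by (intro Vlarge) (auto simp: not_le not_less)
      then show ?thesis using Cz by (simp add: G_def)
    qed (simp add: G_def)
    fix p assume pY: "p \<in> Y"
    show "g p \<le> h p - G2 p"
    proof (cases "p \<in> generic")
      case False
      then have "p \<notin> inner_set R X" by (simp add: inner_set_def)
      then show ?thesis using False hn[of p] by (simp add: g_def G2_def)
    next
      case True
      note p = True
      have pp: "p \<in> polydisc" using pY by simp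
      \<comment> \<open>Since x and y are at most 2 \<open>ab_max\<close> |w|, the assumption on S
        places the inner set where both cut-off functions are 0.\<close>
      have innerD: "vsq j p \<le> 1 / 4" "xk p \<le> S" "yl p \<le> S" if "p \<in> inner_set R X" for j
      proof -
        have n: "nsq p \<le> exp (- 2 * R)" and w: "wsq p \<le> X\<^sup>2" using that by (simp_all add: inner_set_def)
        show "vsq j p \<le> 1 / 4" using vsq_le_nsq[of j p] n exp_minus_two_le[OF R] by linarith
        have m: "4 * c\<^sup>2 * wsq p \<le> (2 * ab_max * X)\<^sup>2" if "0 \<le> c" "c \<le> ab_max" for c
        proof -
          have "4 * c\<^sup>2 * wsq p \<le> 4 * ab_max\<^sup>2 * X\<^sup>2"
            using that w by (intro mult_mono power_mono) (auto simp: wsq_def)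
          then show ?thesis by (simp add: power_mult_distrib)
        qed
        have "(xk p)\<^sup>2 \<le> (2 * ab_max * X)\<^sup>2"
          by (rule order_trans[OF xk_sq_le m]) (simp_all add: ab_max)
        then have "xk p \<le> 2 * ab_max * X" by (rule power2_le_imp_le) (use abX in linarith)
        then show "xk p \<le> S" using S by simp
        have "(yl p)\<^sup>2 \<le> (2 * ab_max * X)\<^sup>2"
          by (rule order_trans[OF yl_sq_le m]) (simp_all add: ab_max)
        then have "yl p \<le> 2 * ab_max * X" by (rule power2_le_imp_le) (use abX in linarith)
        then show "yl p \<le> S" using S by simp
      qed
      show ?thesis
      proof (cases "(\<exists>j. 1 / 2 < vsq j p) \<or> 2 * S \<le> xk p \<or> 2 * S \<le> yl p")
        case True
        have "p \<notin> inner_set R X"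
        proof
          assume "p \<in> inner_set R X"
          note i = innerD[OF this]
          have "\<not> 1 / 2 < vsq j p" for j using i(1)[of j] by linarith
          moreover have "\<not> 2 * S \<le> xk p" "\<not> 2 * S \<le> yl p" using i(2,3) S0 by linarith+
          ultimately show False using True by blast
        qed
        then show ?thesis using Cz[OF Vlarge[OF True]] hn[of p] by (simp add: g_def G2_def)
      next
        case False
        then have vh: "vsq j p \<le> 1 / 2" and x2: "xk p < 2 * S" and y2: "yl p < 2 * S" for j by (auto simp: not_less)
        have pc: "p \<in> core_set (exp (- 4 * S))" by (rule core[OF p vh x2])
        \<comment> \<open>Weights of the two transition zones; f already contains the factor 1/S
          from \<open>vfar_bounds\<close>.\<close>
        define s where "s = indicat_real shell p"
        define f where "f = (if xk p \<le> S \<and> yl p \<le> S then 0 else 1 / S)"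
        have s01: "0 \<le> s" "s \<le> 1" by (auto simp: s_def split: split_indicator)
        have f01: "0 \<le> f" "f \<le> 1" using S1 by (auto simp: f_def)
        have bd: "cmod (vbdry1 p) \<le> CV * s" "\<bar>vbdry2 p\<bar> \<le> CV * s"
        proof -
          have "cmod (vbdry1 p) \<le> CV * s \<and> \<bar>vbdry2 p\<bar> \<le> CV * s"
          proof (cases "p \<in> shell")
            case True
            then show ?thesis using CV(2,3)[OF pp] by (simp add: s_def)
          next
            case False
            then have "vsq j p \<le> 1 / 4" for j using vh by (auto simp: shell_def not_less)
            then show ?thesis using vbdry_zero[of p] CV(1) s01 by simp
          qed
          then show "cmod (vbdry1 p) \<le> CV * s" "\<bar>vbdry2 p\<bar> \<le> CV * s" by auto
        qed
        let ?b = "2 * flat_B * ab_max\<^sup>2"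
        have fb: "cmod (vfar1 S p) \<le> ?b * f \<and> \<bar>vfar2 S p\<bar> \<le> ?b * f"
        proof (cases "xk p \<le> S \<and> yl p \<le> S")
          case True
          then show ?thesis using vfar_zero[OF S0, of p] by (simp add: f_def)
        next
          case False
          then have "f = 1 / S" unfolding f_def by (rule if_not_P)
          then have "?b * f = ?b / S" by simp
          then show ?thesis using vfar_bounds[OF S1, of p] x2 y2 by simp
        qed
        have b0: "0 \<le> ?b" using B by simp
        have CVs: "0 \<le> CV * f" "0 \<le> ?b * s" using CV(1) f01 s01 b0 by (auto intro!: mult_nonneg_nonneg)
        have Cv_eq: "Cv * (s + f) = CV * s + ?b * f + (CV * f + ?b * s)" unfolding Cv_def by (simp add: algebra_simps)
        have v1: "cmod (V1 p) \<le> Cv * (s + f)"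
          unfolding Cv_eq V1_def using bd(1) fb CVs norm_triangle_ineq[of "vbdry1 p" "vfar1 S p"] by linarith
        have v2: "\<bar>V2 p\<bar> \<le> Cv * (s + f)"
          unfolding Cv_eq V2_def using bd(2) fb CVs abs_triangle_ineq[of "vbdry2 p" "vfar2 S p"] by linarith
        have sf: "0 \<le> s + f" "s + f \<le> 2" using s01 f01 by auto
        have c1: "cmod (C1 p) \<le> (flat_B * Cv) * (s + f)"
          unfolding C1_def by (rule cutoff_pair_bounds(1)[OF V0 v1 v2 sf Cv0])
        have c2: "\<bar>C2 p\<bar> \<le> (flat_B * (Cv + 2 * Cv\<^sup>2)) * (s + f)"
          unfolding C2_def by (rule cutoff_pair_bounds(2)[OF V0 v1 v2 sf Cv0])
        have Fp: "0 < F p" by (rule Fpos[OF p])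
        have cost: "\<bar>2 * Re (F1 p * cnj (C1 p)) + F p * C2 p\<bar> \<le> CH * (F p * (s + f))"
        proof -
          have "\<bar>Re (F1 p * cnj (C1 p))\<bar> \<le> cmod (F1 p * cnj (C1 p))" by (rule abs_Re_le_cmod)
          also have "\<dots> = cmod (F1 p) * cmod (C1 p)" by (simp add: norm_mult)
          also have "\<dots> \<le> (grad_C * F p) * ((flat_B * Cv) * (s + f))"
            using Fgrad[OF p vh vh] c1 gC Fp by (intro mult_mono) auto
          finally have a: "\<bar>Re (F1 p * cnj (C1 p))\<bar> \<le> (grad_C * F p) * ((flat_B * Cv) * (s + f))" .
          have b: "\<bar>F p * C2 p\<bar> \<le> F p * ((flat_B * (Cv + 2 * Cv\<^sup>2)) * (s + f))"
            using c2 Fp by (simp add: abs_mult)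
          have "\<bar>2 * Re (F1 p * cnj (C1 p)) + F p * C2 p\<bar>
              \<le> 2 * ((grad_C * F p) * ((flat_B * Cv) * (s + f))) + F p * ((flat_B * (Cv + 2 * Cv\<^sup>2)) * (s + f))"
            using a b by (simp only: abs_le_iff) linarith
          also have "\<dots> = CH * (F p * (s + f))" unfolding CH_def by (simp add: algebra_simps)
          finally show ?thesis .
        qed
        have hs: "F p * (s + f) \<le> shell_fun R p * indicat_real shell p + Kf * indicat_real (core_set (exp (- 4 * S))) p"
        proof -
          have "F p * s \<le> shell_fun R p * s"
          proof (cases "p \<in> shell")
            case True
            then obtain j where "1 / 4 < vsq j p" by (auto simp: shell_def)
            then have "1 / 4 \<le> nsq p + exp (- 2 * R)" using vsq_le_nsq[of j p] by (smt (verit) exp_gt_zero)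
            then have "ln (1 / 4) \<le> ln (nsq p + exp (- 2 * R))" by (subst ln_le_cancel_iff) auto
            moreover have "ln (1 / 4) = - 2 * ln (2 :: real)" using ln_realpow[of 2 2] by (simp add: ln_div)
            ultimately have "pot0 R p \<le> pot_c + ln 2" by (simp add: pot0_def)
            then have "F p \<le> shell_fun R p" unfolding shell_fun_def using Fpot[OF p] FR[OF p] by (intro min.boundedI) auto
            then show ?thesis using s01 by (intro mult_right_mono)
          qed (simp add: s_def)
          moreover have "F p * f \<le> Kf"
          proof (cases "xk p \<le> S \<and> yl p \<le> S")
            case True
            then show ?thesis using Kf0 by (simp add: f_def)
          next
            case False
            then have far: "S < xk p \<or> S < yl p" by auto
            have a0: "0 \<le> aexp" using aexp_bounds by simp
            have ab0: "0 < 4 * ab_max\<^sup>2" using ab_max(1) by simp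
            have q0: "0 < S\<^sup>2 / (4 * ab_max\<^sup>2)" using S0 ab0 by simp
            have "ln (S\<^sup>2 / (4 * ab_max\<^sup>2)) \<le> ln (wsq p)"
              using wsq_far[OF S0 far] q0 by (subst ln_le_cancel_iff) auto
            then have "2 * ln S - ln (4 * ab_max\<^sup>2) \<le> ln (wsq p)"
              using S0 ab0 by (simp add: ln_div ln_realpow)
            then have w: "2 * aexp * (2 * ln S - ln (4 * ab_max\<^sup>2)) \<le> 2 * aexp * ln (wsq p)"
              using a0 by (intro mult_left_mono) auto
            have "ln (xk p) \<le> ln (2 * S)" "ln (yl p) \<le> ln (2 * S)"
              using xk_pos[OF p] yl_pos[OF p] x2 y2 by simp_all
            then have "aexp * ln (xk p) \<le> aexp * (ln 2 + ln S)" "aexp * ln (yl p) \<le> aexp * (ln 2 + ln S)"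
              using a0 S0 by (auto intro!: mult_left_mono simp: ln_mult)
            \<comment> \<open>The factor (xy)^a is at most (2S)^(2a), while |w|^(-4a) is at most
              (S^2/(4 ab_max^2))^(-2a); together they give the power S^(-2a).\<close>
            then have "- ((2 * aexp - 1) * ln R - 4 * aexp * ln X) + aexp * ln (xk p) + aexp * ln (yl p) - 2 * aexp * ln (wsq p)
               \<le> (- ((2 * aexp - 1) * ln R - 4 * aexp * ln X) + 2 * aexp * ln 2 + 2 * aexp * ln (4 * ab_max\<^sup>2)) + (- 2 * aexp) * ln S"
              using w by (simp add: algebra_simps)
            then have "exp (- ((2 * aexp - 1) * ln R - 4 * aexp * ln X) + aexp * ln (xk p) + aexp * ln (yl p) - 2 * aexp * ln (wsq p))
               \<le> K * exp ((- 2 * aexp) * ln S)"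
              unfolding K_def exp_add[symmetric] by (simp only: exp_le_cancel_iff)
            also have "exp ((- 2 * aexp) * ln S) = S powr (- 2 * aexp)" using S0 by (simp add: powr_def)
            finally have "F p \<le> K * S powr (- 2 * aexp)" using FX[OF p] by linarith
            then have "F p / S \<le> Kf" unfolding Kf_def using S0 by (intro divide_right_mono) auto
            moreover have "f = 1 / S" unfolding f_def by (rule if_not_P[OF False])
            ultimately show ?thesis by simp
          qed
          ultimately show ?thesis using pc by (simp add: s_def distrib_left)
        qed
        have hcost: "\<bar>2 * Re (F1 p * cnj (C1 p)) + F p * C2 p\<bar> \<le> h p"
          using order_trans[OF cost mult_left_mono[OF hs CH0]] unfolding h_def .
        show ?thesis
        proof (cases "p \<in> inner_set R X")
          case False
          have "F2 p * C p \<le> 0" using F2neg[OF p] flat_fun_nonneg by (simp add: C_def mult_nonpos_nonneg)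
          then have "G2 p \<le> h p" using hcost p by (simp add: G2_def abs_le_iff)
          then show ?thesis using False by (simp add: g_def)
        next
          case True
          have Vz: "V p = 0" "V1 p = 0" "V2 p = 0"
            using vbdry_zero[OF innerD(1)[OF True]] vfar_zero[OF S0 innerD(2,3)[OF True]]
            by (simp_all add: V_def V1_def V2_def)
          then have Cp: "C p = chi0" "C1 p = 0" "C2 p = 0" by (simp_all add: C_def C1_def C2_def chi0_def)
          have "pot_q * (speed2 p * exp (2 * R)) \<le> - F2 p"
            using Flow[OF p] True by (simp add: inner_set_def)
          then have "pot_q * (speed2 p * exp (2 * R)) * chi0 \<le> - F2 p * chi0"
            using chi0_pos by (intro mult_right_mono) auto
          then have "g p \<le> - G2 p" using True p Cp by (simp add: g_def G2_def mult_ac)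
          then show ?thesis using hn[of p] by simp
        qed
      qed
    qed
  qed (simp_all)
  then show ?thesis unfolding g_def h_def Kf_def .
qed

text \<open>For fixed R and X the far error is K S^(-2a)/S times a measure O(S^2), that is
  O(S^(1-2a)), and disappears as S tends to infinity. The only dependence on X was in
  \<open>K\<close>, so the constant left over is independent of both R and X.\<close>

lemma inner_bound:
  "\<exists>D\<ge>0. \<forall>R\<ge>1. \<forall>X\<ge>1.
     (\<integral>\<^sup>+p. ennreal (speed2 p * exp (2 * R) * indicat_real (inner_set R X) p) \<partial>flow_measure)
      \<le> ennreal D * (\<integral>\<^sup>+p. ennreal (shell_fun R p * indicat_real shell p) \<partial>flow_measure)"
proof -
  obtain CV where CV: "CV \<ge> 1" "\<And>p. p \<in> polydisc \<Longrightarrow> cmod (vbdry1 p) \<le> CV" "\<And>p. p \<in> polydisc \<Longrightarrow> \<bar>vbdry2 p\<bar> \<le> CV"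
    using vbdry_bounds by blast
  obtain Cg where Cg: "Cg \<ge> 0" "\<And>S. S \<ge> 1 \<Longrightarrow> emeasure flow_measure (core_set (exp (- 4 * S))) \<le> ennreal (Cg * S\<^sup>2)"
    using core_set_growth by blast
  define Cv where "Cv = CV + 2 * flat_B * ab_max\<^sup>2"
  define CH where "CH = 2 * grad_C * (flat_B * Cv) + flat_B * (Cv + 2 * Cv\<^sup>2)"
  have CH0: "0 \<le> CH"
    unfolding CH_def Cv_def grad_C_def using CV(1) flat_B(1) lam_max_pos ab_max(1) by simp
  define c0 where "c0 = pot_q * chi0"
  have c0: "c0 > 0" using pot_q_pos chi0_pos by (simp add: c0_def)
  show ?thesis
  proof (intro exI[of _ "CH / c0"] conjI allI impI)
    show "0 \<le> CH / c0" using CH0 c0 by simp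
    fix R X :: real assume R: "R \<ge> 1" and X: "X \<ge> 1"
    let ?A = "\<integral>\<^sup>+p. ennreal (speed2 p * exp (2 * R) * indicat_real (inner_set R X) p) \<partial>flow_measure"
    let ?B = "\<integral>\<^sup>+p. ennreal (shell_fun R p * indicat_real shell p) \<partial>flow_measure"
    define K where "K = exp (- ((2 * aexp - 1) * ln R - 4 * aexp * ln X) + 2 * aexp * ln 2 + 2 * aexp * ln (4 * ab_max\<^sup>2))"
    have K0: "K > 0" by (simp add: K_def)
    have A: "ennreal c0 * ?A \<le> ennreal CH * (?B + ennreal (K * Cg * S powr (1 - 2 * aexp)))"
      if S: "S \<ge> 2 * ab_max * X" for S
    proof -
      have "2 \<le> 2 * ab_max * X" using ab_max(1) X mult_mono[of 1 ab_max 1 X] by simp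
      then have S1: "S \<ge> 1" using S by linarith
      define Kf where "Kf = K * S powr (- 2 * aexp) / S"
      have Kf0: "0 \<le> Kf" using K0 S1 by (simp add: Kf_def)
      let ?core = "core_set (exp (- 4 * S))"
      have "ennreal c0 * ?A = (\<integral>\<^sup>+p. ennreal c0 * ennreal (speed2 p * exp (2 * R) * indicat_real (inner_set R X) p) \<partial>flow_measure)"
        by (rule nn_integral_cmult[symmetric]) measurable
      also have "\<dots> = (\<integral>\<^sup>+p. ennreal (pot_q * chi0 * (speed2 p * exp (2 * R)) * indicat_real (inner_set R X) p) \<partial>flow_measure)"
        using c0 speed2_nonneg by (intro nn_integral_cong) (simp add: ennreal_mult[symmetric] c0_def[symmetric] mult.assoc)
      also have "\<dots> \<le> (\<integral>\<^sup>+p. ennreal (CH * (shell_fun R p * indicat_real shell p + Kf * indicat_real ?core p)) \<partial>flow_measure)"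
        using inner_bound_finite[OF CV R X S] unfolding CH_def Cv_def Kf_def K_def .
      also have "\<dots> = (\<integral>\<^sup>+p. ennreal CH * (ennreal (shell_fun R p * indicat_real shell p) + ennreal Kf * indicator ?core p) \<partial>flow_measure)"
      proof (rule nn_integral_cong)
        fix p
        have 1: "0 \<le> shell_fun R p * indicat_real shell p" using shell_fun_nonneg by simp
        have 2: "0 \<le> Kf * indicat_real ?core p" using Kf0 by simp
        have 3: "ennreal (Kf * indicat_real ?core p) = ennreal Kf * indicator ?core p" by (auto split: split_indicator)
        show "ennreal (CH * (shell_fun R p * indicat_real shell p + Kf * indicat_real ?core p))
          = ennreal CH * (ennreal (shell_fun R p * indicat_real shell p) + ennreal Kf * indicator ?core p)"
          using CH0 1 2 by (simp only: ennreal_mult add_nonneg_nonneg ennreal_plus 3)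
      qed
      also have "\<dots> = ennreal CH * (?B + ennreal Kf * emeasure flow_measure ?core)"
        by (subst nn_integral_cmult, measurable, subst nn_integral_add) (simp_all add: nn_integral_cmult_indicator)
      also have "\<dots> \<le> ennreal CH * (?B + ennreal (K * Cg * S powr (1 - 2 * aexp)))"
      proof (intro mult_left_mono add_left_mono)
        have "ennreal Kf * emeasure flow_measure ?core \<le> ennreal Kf * ennreal (Cg * S\<^sup>2)"
          by (intro mult_left_mono Cg(2)[OF S1]) simp
        also have "\<dots> = ennreal (Kf * (Cg * S\<^sup>2))" using Kf0 Cg(1) by (simp add: ennreal_mult)
        also have "Kf * (Cg * S\<^sup>2) = K * Cg * (S powr (- 2 * aexp) * S)"
          using S1 by (simp add: Kf_def power2_eq_square)
        also have "S powr (- 2 * aexp) * S = S powr (1 - 2 * aexp)"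
          using S1 powr_add[of S "- 2 * aexp" 1] by simp
        finally show "ennreal Kf * emeasure flow_measure ?core \<le> ennreal (K * Cg * S powr (1 - 2 * aexp))" .
      qed simp_all
      finally show ?thesis .
    qed
    have "ennreal c0 * ?A \<le> ennreal CH * ?B"
    proof (rule ennreal_le_epsilon)
      fix e :: real assume e: "e > 0"
      define d where "d = e / (CH + 1)"
      have d: "d > 0" using e CH0 by (simp add: d_def)
      have "((\<lambda>S. S powr (1 - 2 * aexp)) \<longlongrightarrow> 0) at_top"
        by (rule tendsto_neg_powr) (use aexp_bounds in \<open>simp_all add: filterlim_ident\<close>)
      then have "((\<lambda>S. K * Cg * S powr (1 - 2 * aexp)) \<longlongrightarrow> K * Cg * 0) at_top" by (intro tendsto_intros)
      then have "eventually (\<lambda>S. K * Cg * S powr (1 - 2 * aexp) < d) at_top"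
        using d by (intro order_tendstoD(2)) auto
      then have "eventually (\<lambda>S. K * Cg * S powr (1 - 2 * aexp) < d \<and> 2 * ab_max * X \<le> S) at_top"
        using eventually_ge_at_top by (rule eventually_conj)
      then obtain S where S: "K * Cg * S powr (1 - 2 * aexp) < d" "2 * ab_max * X \<le> S"
        using eventually_happens'[OF trivial_limit_at_top_linorder] by blast
      have "ennreal c0 * ?A \<le> ennreal CH * (?B + ennreal (K * Cg * S powr (1 - 2 * aexp)))" by (rule A[OF S(2)])
      also have "\<dots> \<le> ennreal CH * (?B + ennreal d)"
        using S(1) by (intro mult_left_mono add_left_mono ennreal_leI) auto
      also have "\<dots> = ennreal CH * ?B + ennreal (CH * d)" using CH0 d by (simp add: distrib_left ennreal_mult)
      also have "\<dots> \<le> ennreal CH * ?B + ennreal e"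
        using CH0 e by (intro add_left_mono ennreal_leI) (simp add: d_def field_simps)
      finally show "ennreal c0 * ?A \<le> ennreal CH * ?B + ennreal e" .
    qed
    then have "ennreal (inverse c0) * (ennreal c0 * ?A) \<le> ennreal (inverse c0) * (ennreal CH * ?B)"
      by (rule mult_left_mono) simp
    moreover have "ennreal (inverse c0) * ennreal c0 = 1" using c0 by (simp add: ennreal_mult[symmetric])
    moreover have "ennreal (inverse c0) * ennreal CH = ennreal (CH / c0)"
      using c0 CH0 by (simp add: ennreal_mult[symmetric] divide_inverse mult.commute)
    ultimately show "?A \<le> ennreal (CH / c0) * ?B" by (simp add: mult.assoc[symmetric])
  qed
qed

section \<open>Passage to the limit\<close>

lemma inner_set_measure:
  "(\<integral>\<^sup>+p. ennreal (speed2 p * exp (2 * R) * indicat_real (inner_set R X) p) \<partial>flow_measure)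
    = ennreal (exp (2 * R)) * emeasure pf.rep_measure (inner_set R X)"
proof -
  have "(\<integral>\<^sup>+p. ennreal (speed2 p * exp (2 * R) * indicat_real (inner_set R X) p) \<partial>flow_measure)
     = (\<integral>\<^sup>+p. ennreal (1 / speed2 p) * ennreal (speed2 p * exp (2 * R) * indicat_real (inner_set R X) p) \<partial>pf.rep_measure)"
    unfolding flow_measure_def by (rule nn_integral_density; measurable)
  also have "\<dots> = (\<integral>\<^sup>+p. ennreal (exp (2 * R)) * indicator (inner_set R X) p \<partial>pf.rep_measure)"
  proof (rule nn_integral_cong)
    fix p
    show "ennreal (1 / speed2 p) * ennreal (speed2 p * exp (2 * R) * indicat_real (inner_set R X) p)
      = ennreal (exp (2 * R)) * indicator (inner_set R X) p"
    proof (cases "p \<in> inner_set R X")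
      case True
      then have "p \<noteq> 0" by (simp add: inner_set_def generic_def)
      then have "0 < speed2 p" by (rule speed2_pos)
      then show ?thesis using True by (simp add: ennreal_mult[symmetric])
    qed simp
  qed
  also have "\<dots> = ennreal (exp (2 * R)) * emeasure pf.rep_measure (inner_set R X)"
    by (simp add: nn_integral_cmult_indicator)
  finally show ?thesis .
qed

text \<open>Monotonicity in R allows dominated convergence to be applied along integers only and
  carried over to all small radii.\<close>

lemma shell_fun_antimono:
  assumes "1 \<le> R" "R \<le> R'"
  shows "shell_fun R' p \<le> shell_fun R p"
proof -
  have "ln R \<le> ln R'" using assms by simp
  then have "(2 * aexp - 1) * ln R \<le> (2 * aexp - 1) * ln R'" using aexp_bounds by (intro mult_left_mono) auto
  then have "- (2 * aexp - 1) * ln R' + aexp * ln (xk p) + aexp * ln (yl p)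
     \<le> - (2 * aexp - 1) * ln R + aexp * ln (xk p) + aexp * ln (yl p)" by (simp only: mult_minus_left)
  then show ?thesis unfolding shell_fun_def by (intro min.mono) auto
qed

lemma shell_fun_tendsto_0: "(\<lambda>m. shell_fun (real m) p) \<longlonglongrightarrow> 0"
proof (rule tendsto_sandwich[OF _ _ tendsto_const])
  let ?c = "exp (aexp * ln (xk p) + aexp * ln (yl p))"
  show "eventually (\<lambda>m. 0 \<le> shell_fun (real m) p) sequentially" by (simp add: shell_fun_nonneg)
  show "eventually (\<lambda>m. shell_fun (real m) p \<le> real m powr (- (2 * aexp - 1)) * ?c) sequentially"
    using eventually_gt_at_top[of "0::nat"]
  proof eventually_elim
    case (elim m)
    have "shell_fun (real m) p \<le> exp (- (2 * aexp - 1) * ln (real m) + aexp * ln (xk p) + aexp * ln (yl p))"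
      unfolding shell_fun_def by simp
    also have "\<dots> = exp (- (2 * aexp - 1) * ln (real m)) * ?c" by (simp only: exp_add mult.assoc)
    also have "exp (- (2 * aexp - 1) * ln (real m)) = real m powr (- (2 * aexp - 1))"
      using elim by (simp add: powr_def)
    finally show ?case .
  qed
  have "(\<lambda>m. real m powr (- (2 * aexp - 1))) \<longlonglongrightarrow> 0"
    by (rule tendsto_neg_powr[OF _ filterlim_real_sequentially]) (use aexp_bounds in simp)
  from tendsto_mult_right[OF this, of ?c]
  show "(\<lambda>m. real m powr (- (2 * aexp - 1)) * ?c) \<longlonglongrightarrow> 0" by simp
qed

lemma shell_integral_tendsto_0:
  "(\<lambda>m. \<integral>\<^sup>+p. ennreal (shell_fun (real m) p * indicat_real shell p) \<partial>flow_measure) \<longlonglongrightarrow> 0"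
proof -
  have "(\<lambda>m. \<integral>\<^sup>+p. ennreal (shell_fun (real m) p * indicat_real shell p) \<partial>flow_measure)
      \<longlonglongrightarrow> (\<integral>\<^sup>+p. 0 \<partial>flow_measure)"
  proof (rule nn_integral_dominated_convergence[where w = "\<lambda>p. ennreal (pot_c + ln 2) * indicator shell p"])
    show "AE p in flow_measure. ennreal (shell_fun (real m) p * indicat_real shell p) \<le> ennreal (pot_c + ln 2) * indicator shell p" for m
      by (auto simp: shell_fun_def split: split_indicator intro!: ennreal_leI)
    show "(\<integral>\<^sup>+p. ennreal (pot_c + ln 2) * indicator shell p \<partial>flow_measure) < \<infinity>"
      using shell_finite by (simp add: nn_integral_cmult_indicator ennreal_mult_less_top)
    show "AE p in flow_measure. (\<lambda>m. ennreal (shell_fun (real m) p * indicat_real shell p)) \<longlonglongrightarrow> 0"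
    proof (rule AE_I2)
      fix p
      have "(\<lambda>m. shell_fun (real m) p * indicat_real shell p) \<longlonglongrightarrow> 0 * indicat_real shell p"
        by (intro tendsto_mult shell_fun_tendsto_0 tendsto_const)
      then show "(\<lambda>m. ennreal (shell_fun (real m) p * indicat_real shell p)) \<longlonglongrightarrow> 0"
        using tendsto_ennrealI by fastforce
    qed
  qed measurable
  then show ?thesis by simp
qed

lemma lelong_number_zero:
  assumes mass: "\<And>j. current_mass polydisc L {0} T {z. z $ j = 0} = 0"
  shows "lelong_number polydisc L {0} T 0 = 0"
proof -
  let ?\<sigma> = pf.rep_measure
  let ?B = "\<lambda>R. \<integral>\<^sup>+p. ennreal (shell_fun R p * indicat_real shell p) \<partial>flow_measure"
  obtain D where D: "D \<ge> 0" "\<And>R X. R \<ge> 1 \<Longrightarrow> X \<ge> 1 \<Longrightarrow>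
     ennreal (exp (2 * R)) * emeasure ?\<sigma> (inner_set R X) \<le> ennreal D * ?B R"
    using inner_bound unfolding inner_set_measure by blast
  \<comment> \<open>The mass hypothesis enters here: almost every point is generic.\<close>
  have null: "AE p in ?\<sigma>. p \<in> generic"
  proof -
    have "AE p in ?\<sigma>. p \<notin> {z. z $ j = 0} - {0}" for j
    proof (rule AE_not_in)
      have "closed {z :: complex ^ 'n. z $ j = 0}" by (intro closed_Collect_eq continuous_intros)
      then have "{z :: complex ^ 'n. z $ j = 0} - {0} \<in> sets borel" by simp
      then show "{z. z $ j = 0} - {0} \<in> null_sets ?\<sigma>"
        using mass[of j] by (simp add: null_sets_def current_mass_def wedge_measure_eq)
    qed
    from AE_Y this[of k] this[of l] show ?thesis
      by eventually_elim (auto simp: generic_def)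
  qed
  have bound: "ennreal (exp (2 * R)) * emeasure ?\<sigma> (ball 0 (exp (- R)) - {0}) \<le> ennreal D * ?B R"
    if R: "R \<ge> 1" for R
  proof -
    have [measurable]: "ball (0 :: complex ^ 'n) (exp (- R)) - {0} \<in> sets borel" by simp
    define U where "U = generic \<inter> {p. nsq p \<le> exp (- 2 * R)}"
    have [measurable]: "U \<in> sets borel" unfolding U_def by measurable
    \<comment> \<open>The bound for inner sets is uniform in X, so letting X run through the
      integers yields the whole ball by continuity of the measure from below.\<close>
    have U: "U = (\<Union>m. inner_set R (real m + 1))"
    proof -
      have "\<exists>m. wsq p \<le> (real m + 1)\<^sup>2" for p
      proof -
        obtain m :: nat where m: "sqrt (wsq p) \<le> real m" using real_arch_simple by blast
        have w0: "0 \<le> wsq p" by (simp add: wsq_def)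
        have "(sqrt (wsq p))\<^sup>2 \<le> (real m + 1)\<^sup>2" using m w0 by (intro power_mono) auto
        then show ?thesis using w0 by auto
      qed
      then show ?thesis by (auto simp: U_def inner_set_def)
    qed
    have "emeasure ?\<sigma> (ball 0 (exp (- R)) - {0}) \<le> emeasure ?\<sigma> U"
    proof (rule emeasure_mono_AE)
      show "AE p in ?\<sigma>. p \<in> ball 0 (exp (- R)) - {0} \<longrightarrow> p \<in> U"
        using null
      proof eventually_elim
        case (elim p)
        have "nsq p \<le> exp (- 2 * R)" if "p \<in> ball 0 (exp (- R))"
        proof -
          have "(norm p)\<^sup>2 \<le> (exp (- R))\<^sup>2" using that by (intro power_mono) auto
          then show ?thesis by (simp add: nsq_eq_norm power2_eq_square exp_add[symmetric])
        qed
        then show ?case using elim by (simp add: U_def)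
      qed
    qed simp
    then have "ennreal (exp (2 * R)) * emeasure ?\<sigma> (ball 0 (exp (- R)) - {0}) \<le> ennreal (exp (2 * R)) * emeasure ?\<sigma> U"
      by (rule mult_left_mono) simp
    also have "emeasure ?\<sigma> U = (SUP m. emeasure ?\<sigma> (inner_set R (real m + 1)))"
      unfolding U
    proof (rule SUP_emeasure_incseq[symmetric])
      show "incseq (\<lambda>m. inner_set R (real m + 1))"
      proof (rule incseq_SucI)
        fix m
        have "(real m + 1)\<^sup>2 \<le> (real (Suc m) + 1)\<^sup>2" by (intro power_mono) auto
        then show "inner_set R (real m + 1) \<subseteq> inner_set R (real (Suc m) + 1)"
          unfolding inner_set_def using order_trans by blast
      qed
    qed auto
    also have "ennreal (exp (2 * R)) * \<dots> = (SUP m. ennreal (exp (2 * R)) * emeasure ?\<sigma> (inner_set R (real m + 1)))"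
      by (rule SUP_mult_left_ennreal)
    also have "\<dots> \<le> ennreal D * ?B R" by (intro SUP_least D(2) R) simp
    finally show ?thesis .
  qed
  \<comment> \<open>With R = - ln r the factor exp(2R) is 1/r^2, the normalization of the Lelong
    number; the remaining factor 1/pi is estimated by 1.\<close>
  have ratio: "emeasure ?\<sigma> (ball 0 r - {0}) / ennreal (pi * r\<^sup>2) \<le> ennreal D * ?B (- ln r)"
    if r: "0 < r" "r \<le> exp (- 1)" for r
  proof (rule divide_le_posI_ennreal)
    show "0 < ennreal (pi * r\<^sup>2)" using r by simp
    have "ln r \<le> ln (exp (- 1))" using r by (subst ln_le_cancel_iff) auto
    then have R: "1 \<le> - ln r" by simp
    have e: "exp (- (- ln r)) = r" "exp (2 * - ln r) = 1 / r\<^sup>2"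
      using r by (simp_all add: exp_minus exp_double inverse_eq_divide power_one_over)
    let ?m = "emeasure ?\<sigma> (ball 0 r - {0})"
    have b: "ennreal (1 / r\<^sup>2) * ?m \<le> ennreal D * ?B (- ln r)" using bound[OF R] unfolding e .
    have "ennreal (r\<^sup>2) * ennreal (1 / r\<^sup>2) = 1" using r by (simp add: ennreal_mult[symmetric])
    then have "?m = ennreal (r\<^sup>2) * (ennreal (1 / r\<^sup>2) * ?m)" by (simp add: mult.assoc[symmetric])
    also have "\<dots> \<le> ennreal (r\<^sup>2) * (ennreal D * ?B (- ln r))" by (rule mult_left_mono[OF b]) simp
    also have "\<dots> \<le> ennreal (pi * r\<^sup>2) * (ennreal D * ?B (- ln r))"
      using pi_gt3 mult_right_mono[of 1 pi "r\<^sup>2"] by (intro mult_right_mono ennreal_leI) auto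
    finally show "?m \<le> ennreal (pi * r\<^sup>2) * (ennreal D * ?B (- ln r))" .
  qed
  have "lelong_number polydisc L {0} T 0 = Limsup (at_right 0) (\<lambda>r. emeasure ?\<sigma> (ball 0 r - {0}) / ennreal (pi * r\<^sup>2))"
    unfolding lelong_number_def ddc_norm_square wedge_measure_eq ..
  also have "\<dots> \<le> 0"
  proof (rule ennreal_le_epsilon)
    fix e :: real assume e: "e > 0"
    have "(\<lambda>m. ennreal D * ?B (real m)) \<longlonglongrightarrow> ennreal D * 0"
      by (rule ennreal_tendsto_cmult[OF _ shell_integral_tendsto_0]) simp
    then have "eventually (\<lambda>m. ennreal D * ?B (real m) < ennreal e) sequentially"
      using e by (intro order_tendstoD(2)) auto
    then have "eventually (\<lambda>m. ennreal D * ?B (real m) < ennreal e \<and> 1 \<le> m) sequentially"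
      using eventually_ge_at_top by (rule eventually_conj)
    then obtain m where m: "ennreal D * ?B (real m) < ennreal e" "1 \<le> m"
      using eventually_happens'[OF trivial_limit_sequentially] by blast
    have "eventually (\<lambda>r. emeasure ?\<sigma> (ball 0 r - {0}) / ennreal (pi * r\<^sup>2) \<le> ennreal e) (at_right 0)"
      unfolding eventually_at_right_field
    proof (intro exI conjI allI impI)
      show "0 < exp (- real m)" by simp
      fix r :: real assume r: "0 < r" "r < exp (- real m)"
      have "exp (- real m) \<le> exp (- 1)" using m(2) by simp
      then have "r \<le> exp (- 1)" using r(2) by linarith
      then have "emeasure ?\<sigma> (ball 0 r - {0}) / ennreal (pi * r\<^sup>2) \<le> ennreal D * ?B (- ln r)"
        by (rule ratio[OF r(1)])
      also have "\<dots> \<le> ennreal D * ?B (real m)"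
      proof (intro mult_left_mono nn_integral_mono ennreal_leI mult_right_mono shell_fun_antimono)
        have "ln r < ln (exp (- real m))" using r by (subst ln_less_cancel_iff) auto
        then show "real m \<le> - ln r" by simp
      qed (use m(2) in auto)
      also have "\<dots> \<le> ennreal e" using m(1) by simp
      finally show "emeasure ?\<sigma> (ball 0 r - {0}) / ennreal (pi * r\<^sup>2) \<le> ennreal e" .
    qed
    then show "Limsup (at_right 0) (\<lambda>r. emeasure ?\<sigma> (ball 0 r - {0}) / ennreal (pi * r\<^sup>2)) \<le> 0 + ennreal e"
      by (simp add: Limsup_bounded)
  qed
  finally show ?thesis by simp
qed

end

theorem theorem1p1:
  fixes lam :: "complex ^ 'n"
    and L :: "('n::finite, 'm::finite) chart set"
    and T :: "('n, 'm) leaf_form \<Rightarrow> complex"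
  assumes "CARD('n) \<ge> 2"
    and "CARD('m) = CARD('n) - 1"
    and "\<forall>j. lam $ j \<noteq> 0"
    and "\<exists>k l. k \<noteq> l \<and> lam $ k / lam $ l \<notin> \<real>"
    and "singular_foliation polydisc L {0}"
    and "leaves polydisc L {0} = integral_curves (linear_field lam) (polydisc - {0})"
    and "positive_harmonic_directed_current polydisc L {0} T"
    and "\<forall>j. current_mass polydisc L {0} T {z. z $ j = 0} = 0"
  shows "lelong_number polydisc L {0} T 0 = 0"
proof -
  obtain k l where kl: "lam $ k / lam $ l \<notin> \<real>" using assms(4) by blast
  interpret linear_current lam L k l T
    by unfold_locales (use assms(3,5,6,7) kl in auto)
  show ?thesis by (rule lelong_number_zero) (use assms(8) in blast)
qed

end
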